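(* Let $n\ge 1$. The group $SO(n-1)$ acts naturally on $\mathcal{K}_{n,1}$ (rotations that fix the long axis), and there are morphisms of bundles for which each vertical map is a homotopy equivalence: $$\begin{array}{ccccc} SO(n)\times_{SO(n-1)}\mathcal{K}_{n,1} & \xrightarrow{i} & SO(n+1)\times_{SO(n-1)}\mathcal{K}_{n,1} & \xrightarrow{p} & SO(n+1)/SO(n)\\ \downarrow{\scriptstyle\theta_n} & & \downarrow{\scriptstyle\theta_n} & & \downarrow{\scriptstyle 1}\\ \mathrm{Emb}_*(S^1,S^n) & \xrightarrow{j} & \mathrm{Emb}(S^1,S^n) & \to & S^n \end{array}$$ Thus, there is a bundle $$SO(n+1)\times_{SO(n-1)}\mathcal{K}_{n,1}\to SO(n+1)/SO(n-1)$$ with fibre $\mathcal{K}_{n,1}$. Furthermore, there is a homeomorphism $$\mathrm{Emb}(S^1,S^3)\to S^3\times\mathrm{Emb}_*(S^1,S^3),$$ and the bundle $$\mathcal{K}_{3,1}\to\mathrm{Emb}_*(S^1,S^3)\to S^2$$ is the induced bundle with fibre $\mathcal{K}_{3,1}$ from the bundle $SO(2)\to SO(3)\to S^2$.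
   Context: $\mathcal{K}_{n,1}$ is the space of smooth embeddings $f:\mathbb{R}\to\mathbb{R}^n$ with $f(x)=(x,0,\dots,0)$ for $|x|\ge1$. $\mathrm{Emb}(S^1,S^n)$ is the space of smooth embeddings and $\mathrm{Emb}_*(S^1,S^n)$ the subspace of smooth pointed embeddings (sending a fixed base-point of $S^1$ to a fixed base-point of $S^n$). $SO(n-1)$ is regarded as the group of rotations of $\mathbb{R}^n$ fixing the long axis $\mathbb{R}\times\{0\}$ pointwise; it acts on $\mathcal{K}_{n,1}$ by rotating knots about that axis. For $G=SO(n)$ or $SO(n+1)$, $G\times_{SO(n-1)}\mathcal{K}_{n,1}$ is the quotient of $G\times\mathcal{K}_{n,1}$ by $(AB,f)\sim(A,B\cdot f)$ for $B\in SO(n-1)$. Regarding $S^n$ as the one-point compactification of $\mathbb{R}^n$ with base-point $\infty$, a long knot $f$ has a one-point compactification $\dot f\in\mathrm{Emb}_*(S^1,S^n)$. $SO(n)\subset SO(n+1)$ is the stabilizer of the base-point of $S^n$. The maps $\theta_n$ are $[A,f]\mapsto A\circ\dot f$, induced by the natural action of $SO(n+1)$ on $S^n$. $SO(n+1)/SO(n)$ is identified with $S^n$. The maps $i$ and $j$ are inclusions, $p$ is the projection $[A,f]\mapsto A\,SO(n)$, and $\mathrm{Emb}(S^1,S^n)\to S^n$ is evaluation at the base-point of $S^1$. The map $\mathrm{Emb}_*(S^1,S^3)\to S^2$ is given by the derivative (direction) at the base-point. The bundle with fibre $\mathcal{K}_{3,1}$ induced from $SO(2)\to SO(3)\to S^2$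 is $SO(3)\times_{SO(2)}\mathcal{K}_{3,1}\to SO(3)/SO(2)=S^2$, where $SO(2)$ acts on $\mathcal{K}_{3,1}$ by rotation about the long axis.
   Formalization: That the maps θ_n are homotopy equivalences is stated for n ≥ 2 only (false for n = 1: sources connected, Emb spaces not); the "induced bundle" for n = 3 is read as a fibre homotopy equivalence over S^2 via θ_3, K_{3,1} being the strict fibre up to homotopy equivalence. *)

theory Defs
  imports "HOL-Analysis.Analysis" "HOL-Algebra.Group_Action"
begin

section \<open>Bundles and homotopy equivalences\<close>

definition quotient_topology :: "'a topology \<Rightarrow> ('a \<Rightarrow> 'b) \<Rightarrow> 'b topology" where
  "quotient_topology X q = topology
     (\<lambda>U. U \<subseteq> q ` topspace X \<and> openin X {x \<in> topspace X. q x \<in> U})"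

lemma openin_quotient_topology:
  "openin (quotient_topology X q) U \<longleftrightarrow>
     U \<subseteq> q ` topspace X \<and> openin X {x \<in> topspace X. q x \<in> U}"
proof -
  have "istopology (\<lambda>U. U \<subseteq> q ` topspace X \<and> openin X {x \<in> topspace X. q x \<in> U})"
    unfolding istopology_def
  proof (intro conjI allI impI)
    fix S T
    assume S: "S \<subseteq> q ` topspace X \<and> openin X {x \<in> topspace X. q x \<in> S}"
      and T: "T \<subseteq> q ` topspace X \<and> openin X {x \<in> topspace X. q x \<in> T}"
    show "S \<inter> T \<subseteq> q ` topspace X" using S by blast
    have "{x \<in> topspace X. q x \<in> S \<inter> T} =
        {x \<in> topspace X. q x \<in> S} \<inter> {x \<in> topspace X. q x \<in> T}" by blast
    then show "openin X {x \<in> topspace X. q x \<in> S \<inter> T}"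
      using S T by (simp add: openin_Int)
  next
    fix \<K>
    assume K: "\<forall>S\<in>\<K>. S \<subseteq> q ` topspace X \<and> openin X {x \<in> topspace X. q x \<in> S}"
    then show "\<Union>\<K> \<subseteq> q ` topspace X" by blast
    have "{x \<in> topspace X. q x \<in> \<Union>\<K>} = (\<Union>S\<in>\<K>. {x \<in> topspace X. q x \<in> S})" by blast
    then show "openin X {x \<in> topspace X. q x \<in> \<Union>\<K>}"
      using K by (auto intro!: openin_Union)
  qed
  then show ?thesis by (simp add: quotient_topology_def topology_inverse')
qed

definition fibre_bundle ::
  "'e topology \<Rightarrow> ('e \<Rightarrow> 'b) \<Rightarrow> 'b topology \<Rightarrow> 'f topology \<Rightarrow> bool" where
  "fibre_bundle E p B F \<longleftrightarrow>
     continuous_map E B p \<and>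
     (\<forall>b \<in> topspace B. \<exists>U h. openin B U \<and> b \<in> U \<and>
        homeomorphic_map (prod_topology (subtopology B U) F)
                         (subtopology E {e \<in> topspace E. p e \<in> U}) h \<and>
        (\<forall>u \<in> U. \<forall>y \<in> topspace F. p (h (u, y)) = u))"

text \<open>A bundle written as a sequence \<open>F \<rightarrow> E \<rightarrow> B\<close>: the first map identifies \<open>F\<close> with the
  fibre over the base-point \<open>b\<^sub>0\<close>.\<close>
definition bundle_sequence ::
  "'f topology \<Rightarrow> ('f \<Rightarrow> 'e) \<Rightarrow> 'e topology \<Rightarrow> ('e \<Rightarrow> 'b) \<Rightarrow> 'b topology \<Rightarrow> 'b \<Rightarrow> bool" where
  "bundle_sequence F i E p B b\<^sub>0 \<longleftrightarrow>
     fibre_bundle E p B F \<and> b\<^sub>0 \<in> topspace B \<and>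
     homeomorphic_map F (subtopology E {e \<in> topspace E. p e = b\<^sub>0}) i"

definition homotopy_equivalence :: "'a topology \<Rightarrow> 'b topology \<Rightarrow> ('a \<Rightarrow> 'b) \<Rightarrow> bool" where
  "homotopy_equivalence X Y f \<longleftrightarrow>
     continuous_map X Y f \<and>
     (\<exists>g. continuous_map Y X g \<and>
          homotopic_with (\<lambda>_. True) X X (g \<circ> f) id \<and>
          homotopic_with (\<lambda>_. True) Y Y (f \<circ> g) id)"

text \<open>Homotopy equivalence over a common base: all maps, including every stage of the
  homotopies, commute with the projections \<open>p\<close> and \<open>q\<close>.\<close>
definition fibre_homotopy_equivalence ::
  "'a topology \<Rightarrow> ('a \<Rightarrow> 'c) \<Rightarrow> 'b topology \<Rightarrow> ('b \<Rightarrow> 'c) \<Rightarrow> ('a \<Rightarrow> 'b) \<Rightarrow> bool" where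
  "fibre_homotopy_equivalence X p Y q f \<longleftrightarrow>
     continuous_map X Y f \<and> (\<forall>x \<in> topspace X. q (f x) = p x) \<and>
     (\<exists>g. continuous_map Y X g \<and> (\<forall>y \<in> topspace Y. p (g y) = q y) \<and>
          homotopic_with (\<lambda>h. \<forall>x \<in> topspace X. p (h x) = p x) X X (g \<circ> f) id \<and>
          homotopic_with (\<lambda>h. \<forall>y \<in> topspace Y. q (h y) = q y) Y Y (f \<circ> g) id)"


definition bundle_morphism ::
  "'f topology \<Rightarrow> ('f \<Rightarrow> 'e) \<Rightarrow> 'e topology \<Rightarrow> ('e \<Rightarrow> 'b) \<Rightarrow> 'b topology \<Rightarrow>
   'g topology \<Rightarrow> ('g \<Rightarrow> 'd) \<Rightarrow> 'd topology \<Rightarrow> ('d \<Rightarrow> 'c) \<Rightarrow> 'c topology \<Rightarrow>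
   ('f \<Rightarrow> 'g) \<Rightarrow> ('e \<Rightarrow> 'd) \<Rightarrow> ('b \<Rightarrow> 'c) \<Rightarrow> bool" where
  "bundle_morphism F i E p B F' i' E' p' B' \<phi> \<Phi> \<beta> \<longleftrightarrow>
     continuous_map F F' \<phi> \<and> continuous_map E E' \<Phi> \<and> continuous_map B B' \<beta> \<and>
     (\<forall>x \<in> topspace F. \<Phi> (i x) = i' (\<phi> x)) \<and>
     (\<forall>e \<in> topspace E. p' (\<Phi> e) = \<beta> (p e))"


section \<open>Smooth curves and the \<open>C\<^sup>\<infinity>\<close>-topology\<close>

definition nth_vderiv :: "nat \<Rightarrow> (real \<Rightarrow> 'a::real_normed_vector) \<Rightarrow> real \<Rightarrow> 'a" where
  "nth_vderiv k f = ((\<lambda>g t. vector_derivative g (at t)) ^^ k) f"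

definition smooth_curve :: "(real \<Rightarrow> 'a::real_normed_vector) \<Rightarrow> bool" where
  "smooth_curve f \<longleftrightarrow> (\<forall>k t. nth_vderiv k f differentiable (at t))"

text \<open>The compact-open \<open>C\<^sup>\<infinity>\<close>-topology: uniform convergence of every derivative on compact
  sets.  It is only used on subsets of the smooth curves.\<close>
definition Cinf_topology :: "(real \<Rightarrow> 'a::real_normed_vector) topology" where
  "Cinf_topology = topology_generated_by
     {{f. \<forall>t\<in>C. nth_vderiv k f t \<in> U} | k C U. compact C \<and> open U}"


section \<open>Long knots\<close>

text \<open>\<open>\<real>\<^sup>n\<close> is \<^typ>\<open>real^'n\<close> with \<open>n = CARD('n)\<close>; the index \<open>a\<close> names the
  coordinate of the long axis (the first coordinate in the usual notation).\<close>
definition long_knots :: "'n::finite \<Rightarrow> (real \<Rightarrow> real^'n) set" where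
  "long_knots a =
     {f. smooth_curve f \<and> (\<forall>t. vector_derivative f (at t) \<noteq> 0) \<and>
         embedding_map euclidean euclidean f \<and>
         (\<forall>x. \<bar>x\<bar> \<ge> 1 \<longrightarrow> f x = axis a x)}"

definition long_knot_space :: "'n::finite \<Rightarrow> (real \<Rightarrow> real^'n) topology" where
  "long_knot_space a = subtopology Cinf_topology (long_knots a)"


section \<open>Spheres as one-point compactifications\<close>

text \<open>\<open>S\<^sup>d\<close> is the unit sphere of \<open>\<real>\<^sup>d \<times> \<real> =\<close> \<^typ>\<open>real^('d option)\<close>, the last factor
  being the coordinate \<^const>\<open>None\<close>.  Stereographic projection from \<open>pt_inf\<close> makes it
  \<open>\<real>\<^sup>d \<union> {\<infinity>}\<close>.  In particular \<open>S\<^sup>1\<close> lies in \<^typ>\<open>real^(1 option)\<close>.\<close>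
abbreviation unit_sphere :: "(real^'d::finite) set" where
  "unit_sphere \<equiv> sphere 0 1"

definition pt_inf :: "real^('d::finite option)" where
  "pt_inf = axis None 1"

definition proj_finite :: "real^('d::finite option) \<Rightarrow> real^'d" where
  "proj_finite v = (\<chi> i. v $ Some i)"

definition stereo :: "real^('d::finite option) \<Rightarrow> real^'d" where
  "stereo v = proj_finite v /\<^sub>R (1 - v $ None)"

definition inv_stereo :: "real^'d::finite \<Rightarrow> real^('d option)" where
  "inv_stereo x = (\<chi> k. case k of
       None \<Rightarrow> ((norm x)\<^sup>2 - 1) / ((norm x)\<^sup>2 + 1)
     | Some i \<Rightarrow> 2 * x $ i / ((norm x)\<^sup>2 + 1))"

lemma stereo_inv_stereo: "stereo (inv_stereo x) = x"
proof -
  have pos: "(norm x)\<^sup>2 + 1 > 0" by (simp add: add_nonneg_pos)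
  have d: "1 - ((norm x)\<^sup>2 - 1) / ((norm x)\<^sup>2 + 1) = 2 / ((norm x)\<^sup>2 + 1)"
    using pos by (simp add: field_simps)
  show ?thesis
    unfolding stereo_def inv_stereo_def proj_finite_def using pos
    by (simp add: vec_eq_iff d divide_simps)
qed

text \<open>The parametrization of \<open>S\<^sup>1\<close> with \<open>circle_point 0 = \<infinity>\<close> whose velocity at \<open>\<infinity>\<close> is the
  positive unit vector of \<open>\<real> = T\<^sub>\<infinity>S\<^sup>1\<close>.\<close>
definition circle_point :: "real \<Rightarrow> real^(1 option)" where
  "circle_point t = (\<chi> k. case k of None \<Rightarrow> cos t | Some _ \<Rightarrow> sin t)"

text \<open>\<open>circle_point\<close> is a local diffeomorphism onto \<open>S\<^sup>1\<close> and \<open>S\<^sup>n\<close> is a submanifold of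
  Euclidean space, so smoothness and immersivity of \<open>g : S\<^sup>1 \<rightarrow> S\<^sup>n\<close> are those of the curve
  \<open>g \<circ> circle_point\<close>.  Values outside \<open>S\<^sup>1\<close> are fixed by \<^const>\<open>extensional\<close>.\<close>
definition circle_embeddings :: "(real^(1 option) \<Rightarrow> real^('n::finite option)) set" where
  "circle_embeddings =
     {g \<in> extensional unit_sphere.
        smooth_curve (g \<circ> circle_point) \<and>
        (\<forall>t. vector_derivative (g \<circ> circle_point) (at t) \<noteq> 0) \<and>
        g ` unit_sphere \<subseteq> unit_sphere \<and>
        embedding_map (top_of_set unit_sphere) (top_of_set unit_sphere) g}"

definition pointed_embeddings :: "(real^(1 option) \<Rightarrow> real^('n::finite option)) set" where
  "pointed_embeddings = {g \<in> circle_embeddings. g pt_inf = pt_inf}"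

definition Emb :: "(real^(1 option) \<Rightarrow> real^('n::finite option)) topology" where
  "Emb = pullback_topology circle_embeddings (\<lambda>g. g \<circ> circle_point) Cinf_topology"

definition Emb_pt :: "(real^(1 option) \<Rightarrow> real^('n::finite option)) topology" where
  "Emb_pt = subtopology Emb pointed_embeddings"

text \<open>The one-point compactification of a long knot; \<open>\<real>\<close> is \<^typ>\<open>real^1\<close> here.\<close>
definition compactify :: "(real \<Rightarrow> real^'n::finite) \<Rightarrow> real^(1 option) \<Rightarrow> real^('n option)" where
  "compactify f =
     (\<lambda>z \<in> unit_sphere. if z = pt_inf then pt_inf else inv_stereo (f (stereo z $ 1)))"

text \<open>The direction at \<open>\<infinity>\<close> of a pointed embedding, in the unit sphere of \<open>\<real>\<^sup>n = T\<^sub>\<infinity>S\<^sup>n\<close>.\<close>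
definition direction :: "(real^(1 option) \<Rightarrow> real^('n::finite option)) \<Rightarrow> real^'n" where
  "direction g = sgn (proj_finite (vector_derivative (g \<circ> circle_point) (at 0)))"


section \<open>Rotation groups\<close>

text \<open>All groups are subgroups of \<open>SO(n+1)\<close>, acting on \<open>\<real>\<^sup>n \<times> \<real>\<close>: \<open>SO(n)\<close> is the stabilizer
  of the base-point of \<open>S\<^sup>n\<close>, acting on \<open>\<real>\<^sup>n\<close> through the block \<open>fin_block\<close>, and \<open>SO(n-1)\<close>
  consists of the elements of \<open>SO(n)\<close> fixing the long axis pointwise.\<close>
type_synonym 'n succ_matrix = "(real^('n option))^('n option)"

definition SO_succ :: "'n::finite succ_matrix set" where
  "SO_succ = {A. rotation_matrix A}"

definition SO_mid :: "'n::finite succ_matrix set" where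
  "SO_mid = {A \<in> SO_succ. A *v pt_inf = pt_inf}"

definition fin_block :: "'n::finite succ_matrix \<Rightarrow> (real^'n)^'n" where
  "fin_block A = (\<chi> i j. A $ Some i $ Some j)"

definition SO_axis :: "'n::finite \<Rightarrow> 'n succ_matrix set" where
  "SO_axis a = {A \<in> SO_mid. \<forall>x. fin_block A *v axis a x = axis a x}"

definition SO_axis_group :: "'n::finite \<Rightarrow> 'n succ_matrix monoid" where
  "SO_axis_group a = \<lparr>carrier = SO_axis a, mult = (**), one = mat 1\<rparr>"

definition rotate_knot :: "'n::finite succ_matrix \<Rightarrow> (real \<Rightarrow> real^'n) \<Rightarrow> real \<Rightarrow> real^'n" where
  "rotate_knot B f = (\<lambda>x. fin_block B *v f x)"

definition rotate_embedding ::
  "'n::finite succ_matrix \<Rightarrow> (real^(1 option) \<Rightarrow> real^('n option))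
     \<Rightarrow> real^(1 option) \<Rightarrow> real^('n option)" where
  "rotate_embedding A g = (\<lambda>z \<in> unit_sphere. A *v g z)"

definition coset :: "(real^'m::finite^'m) set \<Rightarrow> real^'m^'m \<Rightarrow> (real^'m^'m) set" where
  "coset H A = (\<lambda>B. A ** B) ` H"

definition coset_space ::
  "(real^'m::finite^'m) set \<Rightarrow> (real^'m^'m) set \<Rightarrow> (real^'m^'m) set topology" where
  "coset_space G H = quotient_topology (top_of_set G) (coset H)"


section \<open>The spaces \<open>G \<times>\<^bsub>SO(n-1)\<^esub> K\<^bsub>n,1\<^esub>\<close>\<close>

type_synonym 'n framed = "'n succ_matrix \<times> (real \<Rightarrow> real^'n)"

text \<open>The relation \<open>(AB, f) \<sim> (A, B\<cdot>f)\<close>.  It is already an equivalence relation on \<open>G \<times> K\<^bsub>n,1\<^esub>\<close>.\<close>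
definition balanced_rel :: "'n::finite \<Rightarrow> 'n succ_matrix set \<Rightarrow> ('n framed \<times> 'n framed) set" where
  "balanced_rel a G =
     {((A ** B, f), (A, rotate_knot B f)) | A B f.
        A \<in> G \<and> B \<in> SO_axis a \<and> f \<in> long_knots a}"

definition balanced_class ::
  "'n::finite \<Rightarrow> 'n succ_matrix set \<Rightarrow> 'n framed \<Rightarrow> 'n framed set" where
  "balanced_class a G x = balanced_rel a G `` {x}"

text \<open>A point of \<open>SO(n) \<times>\<^bsub>SO(n-1)\<^esub> K\<^bsub>n,1\<^esub>\<close> is the same set of pairs as its image in
  \<open>SO(n+1) \<times>\<^bsub>SO(n-1)\<^esub> K\<^bsub>n,1\<^esub>\<close>, so the inclusion between these spaces is \<^const>\<open>id\<close>.\<close>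
definition balanced_product ::
  "'n::finite \<Rightarrow> 'n succ_matrix set \<Rightarrow> 'n framed set topology" where
  "balanced_product a G =
     quotient_topology (prod_topology (top_of_set G) (long_knot_space a)) (balanced_class a G)"

text \<open>The map on equivalence classes, or on cosets, induced by a map constant on each of them.\<close>
definition induced :: "('a \<Rightarrow> 'b) \<Rightarrow> 'a set \<Rightarrow> 'b" where
  "induced f C = the_elem (f ` C)"

definition theta :: "'n::finite framed set \<Rightarrow> real^(1 option) \<Rightarrow> real^('n option)" where
  "theta = induced (\<lambda>(A, f). rotate_embedding A (compactify f))"


subsection \<open>The map \<open>[A, f] \<mapsto> A \<circ> compactify f\<close> is well defined\<close>

lemma SO_mid_entries:
  assumes "A \<in> SO_mid"
  shows "A $ k $ None = (if k = None then 1 else 0)" "A $ None $ k = (if k = None then 1 else 0)"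
proof -
  have A: "A *v pt_inf = pt_inf" and o: "orthogonal_matrix A"
    using assms by (auto simp: SO_mid_def SO_succ_def rotation_matrix_def)
  have "transpose A *v pt_inf = transpose A *v (A *v pt_inf)" using A by simp
  also have "\<dots> = pt_inf"
    using o by (simp add: matrix_vector_mul_assoc orthogonal_matrix_def)
  finally have T: "transpose A *v pt_inf = pt_inf" .
  have e: "(B *v pt_inf) $ k = B $ k $ None" for B :: "'a succ_matrix" and k
    by (simp add: pt_inf_def matrix_vector_mult_basis column_def)
  show "A $ k $ None = (if k = None then 1 else 0)"
    using e[of A k] A by (simp add: pt_inf_def axis_def)
  show "A $ None $ k = (if k = None then 1 else 0)"
    using e[of "transpose A" k] T by (simp add: pt_inf_def axis_def transpose_def)
qed

lemma sum_option: "(\<Sum>k\<in>(UNIV :: 'n::finite option set). f k) = f None + (\<Sum>i\<in>UNIV. f (Some i) :: real)"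
proof -
  have "(\<Sum>k\<in>range Some. f k) = (\<Sum>i\<in>(UNIV::'n set). f (Some i))"
    by (simp add: sum.reindex)
  then show ?thesis by (simp add: UNIV_option_conv)
qed

lemma SO_mid_mult_nth:
  assumes "A \<in> SO_mid"
  shows "(A *v v) $ None = v $ None" "(A *v v) $ Some i = (fin_block A *v proj_finite v) $ i"
  by (simp_all add: matrix_vector_mult_def sum_option SO_mid_entries[OF assms]
      fin_block_def proj_finite_def)

lemma norm_option: "(norm v)\<^sup>2 = (v $ None)\<^sup>2 + (norm (proj_finite v))\<^sup>2"
  by (simp add: norm_vec_def L2_set_def sum_option proj_finite_def sum_nonneg)

lemma norm_fin_block:
  assumes "A \<in> SO_mid" shows "norm (fin_block A *v x) = norm x"
proof -
  define v :: "real^('a option)" where "v = (\<chi> k. case k of None \<Rightarrow> 0 | Some i \<Rightarrow> x $ i)"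
  have v: "proj_finite v = x" "v $ None = 0" by (simp_all add: v_def proj_finite_def vec_eq_iff)
  have w: "proj_finite (A *v v) = fin_block A *v x"
    using SO_mid_mult_nth(2)[OF assms, of v] v by (simp add: proj_finite_def vec_eq_iff)
  have "norm (A *v v) = norm v"
    using assms by (simp add: SO_mid_def SO_succ_def rotation_matrix_def
        orthogonal_transformation_matrix orthogonal_transformation_norm)
  then have "(norm (A *v v))\<^sup>2 = (norm v)\<^sup>2" by simp
  then show ?thesis
    using v w SO_mid_mult_nth(1)[OF assms, of v] by (simp add: norm_option)
qed

lemma inv_stereo_fin_block:
  assumes "A \<in> SO_mid" shows "inv_stereo (fin_block A *v x) = A *v inv_stereo x"
proof -
  have p: "proj_finite (inv_stereo x) = (2 / ((norm x)\<^sup>2 + 1)) *\<^sub>R x"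
    by (simp add: vec_eq_iff proj_finite_def inv_stereo_def)
  have "inv_stereo (fin_block A *v x) $ k = (A *v inv_stereo x) $ k" for k
    by (cases k) (simp_all add: SO_mid_mult_nth[OF assms] p,
      simp_all add: inv_stereo_def norm_fin_block[OF assms] matrix_vector_mult_scaleR)
  then show ?thesis by (simp add: vec_eq_iff)
qed

lemma compactify_rotate_knot:
  assumes "B \<in> SO_mid"
  shows "compactify (rotate_knot B f) = rotate_embedding B (compactify f)"
  using assms inv_stereo_fin_block[OF assms]
  by (auto simp: compactify_def rotate_knot_def rotate_embedding_def SO_mid_def fun_eq_iff)

lemma rotate_embedding_mult: "rotate_embedding (A ** B) g = rotate_embedding A (rotate_embedding B g)"
  by (auto simp: rotate_embedding_def fun_eq_iff matrix_vector_mul_assoc)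

lemma fin_block_mat1: "fin_block (mat 1) = mat 1"
  by (simp add: fin_block_def mat_def vec_eq_iff)

lemma mat1_SO_axis: "mat 1 \<in> SO_axis a"
  by (simp add: SO_axis_def SO_mid_def SO_succ_def rotation_matrix_def orthogonal_matrix_id
      fin_block_mat1)

lemma induced_eq:
  assumes "x \<in> C" "\<And>y. y \<in> C \<Longrightarrow> h y = c"
  shows "induced h C = c"
proof -
  have "h ` C = {c}" using assms by blast
  then show ?thesis by (simp add: induced_def)
qed

lemma theta_balanced_class:
  assumes "A \<in> G" "f \<in> long_knots a"
  shows "theta (balanced_class a G (A, f)) = rotate_embedding A (compactify f)"
  unfolding theta_def
proof (rule induced_eq)
  have f1: "rotate_knot (mat 1) f = f"
    by (simp add: rotate_knot_def fin_block_mat1)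
  have "((A ** mat 1, f), (A, rotate_knot (mat 1) f)) \<in> balanced_rel a G"
    unfolding balanced_rel_def using assms mat1_SO_axis[of a] by blast
  then show "(A, f) \<in> balanced_class a G (A, f)"
    by (simp add: balanced_class_def f1)
next
  fix y assume "y \<in> balanced_class a G (A, f)"
  then obtain A' B where "A = A' ** B" "y = (A', rotate_knot B f)" "B \<in> SO_axis a"
    unfolding balanced_class_def balanced_rel_def by blast
  then show "(case y of (A, f) \<Rightarrow> rotate_embedding A (compactify f)) =
      rotate_embedding A (compactify f)"
    by (simp add: SO_axis_def compactify_rotate_knot rotate_embedding_mult)
qed

end

theory Submission
  imports Defs
begin

text \<open>Everything rests on one deformation.  Let \<open>P\<close> be the space of pointed embeddings of the circle
  whose direction at the base-point is the long axis, and \<open>C \<subseteq> P\<close> the embeddings that agree with the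
  great circle through the long axis on the hemisphere around the base-point.  Compactification is a
  homeomorphism from the long knots onto \<open>C\<close>.  The lemma \<open>regularize\<close> deforms \<open>P\<close> into \<open>C\<close>, keeping \<open>C\<close>
  inside \<open>C\<close> at all times and commuting at all times with the rotations that fix the long axis.  The
  deformation is a concatenation of three.  A dilation of the target sphere gives \<open>g\<close> unit speed at the
  base-point.  Then \<open>g\<close> is blended with the great circle on a short arc around the base-point; the
  length of the arc, \<open>scale a g\<close>, is an explicit continuous function of \<open>g\<close>, invariant under rotations and
  small enough for every intermediate curve to be an embedding.  Finally, dilations of the source and
  the target sphere expand this arc to the whole hemisphere.

  An embedding \<open>g\<close> determines the orthonormal pair \<open>frame_at g\<close>: its value and its direction at the
  base-point.  A rotation \<open>A\<close> carrying the standard pair to this pair moves \<open>g\<close> into \<open>P\<close>, and two such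
  \<open>A\<close> differ by a rotation about the long axis.  By equivariance, \<open>g \<mapsto> [A, knot_of a (A\<inverse> g)]\<close> is therefore
  well defined, and it is a homotopy inverse of \<open>theta\<close> over the space of orthonormal pairs
  (\<open>theta_fibre_homotopy_equivalence\<close>).  Restricting to pairs that start at the base-point gives the
  pointed version, and forgetting parts of the pair gives the other equivalences.  Since \<open>A\<close> exists for
  every orthonormal pair only in dimension \<open>n \<ge> 2\<close>, this part has \<open>n \<ge> 2\<close> as a hypothesis.

  All the bundles arise from \<open>equivariant_bundle\<close>: if a group acts compatibly on the total space and on the base
  and orbit maps to the base have local sections, then the translates of one fibre give local trivializations.
  The sections come from products of two reflections, which depend continuously on the vectors
  that they carry into each other (\<open>point_section\<close>, \<open>frame_section\<close>).  For \<open>n = 3\<close>, left translation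
  by unit quaternions is a global section of \<open>SO(4) \<rightarrow> S\<^sup>3\<close>, which splits the bundle
  \<open>Emb \<rightarrow> S\<^sup>3\<close> as a product.

  Continuity in the \<open>C\<^sup>\<infinity>\<close>-topology is handled through \<open>joint_smooth\<close>.  A map from a space \<open>X\<close> to
  smooth curves is continuous exactly when all \<open>t\<close>-derivatives of the family \<open>u x t\<close> are jointly continuous.
  The latter condition is local in \<open>(x, t)\<close> and stable under arithmetic and
  composition, so that each continuity proof reduces to reading off a formula.\<close>

section \<open>Smooth families of curves\<close>

lemma continuous_map_euclidean_binop:
  fixes h :: "'a::topological_space \<Rightarrow> 'b::topological_space \<Rightarrow> 'c::topological_space"
  assumes f: "continuous_map T euclidean f" and g: "continuous_map T euclidean g"
    and h: "continuous_on UNIV (\<lambda>p. h (fst p) (snd p))"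
  shows "continuous_map T euclidean (\<lambda>p. h (f p) (g p))"
proof -
  have "continuous_map T euclidean (\<lambda>p. (f p, g p))"
    using continuous_map_pairedI[OF f g] by (simp only: prod_topology_euclidean)
  moreover have "continuous_map (euclidean :: ('a\<times>'b) topology) euclidean (\<lambda>p. h (fst p) (snd p))"
    using h by simp
  ultimately have "continuous_map T euclidean ((\<lambda>p. h (fst p) (snd p)) \<circ> (\<lambda>p. (f p, g p)))"
    by (rule continuous_map_compose)
  then show ?thesis by (simp add: o_def)
qed

lemma continuous_map_euclidean_unop:
  fixes h :: "'a::topological_space \<Rightarrow> 'c::topological_space"
  assumes f: "continuous_map T euclidean f" and h: "continuous_on S h" and S: "f ` topspace T \<subseteq> S"
  shows "continuous_map T euclidean (\<lambda>p. h (f p))"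
proof -
  have "continuous_map T (top_of_set S) f" using f S
    by (simp add: continuous_map_in_subtopology image_subset_iff_funcset)
  moreover have "continuous_map (top_of_set S) euclidean h" using h by simp
  ultimately have "continuous_map T euclidean (h \<circ> f)" by (rule continuous_map_compose)
  then show ?thesis by (simp add: o_def)
qed

text \<open>A family \<open>u\<close> of curves, parametrized by \<open>X\<close> and defined on a
  subset \<open>W\<close> of \<open>X \<times> \<real>\<close>, is of class \<open>C\<^sup>k\<close>
  in \<open>t\<close> with all derivatives jointly continuous. The derivative is bound by an
  existential quantifier, so that closure properties follow from differentiation rules by induction on
  \<open>k\<close>.\<close>
primrec joint_C :: "nat \<Rightarrow> 'x topology \<Rightarrow> ('x \<times> real) set \<Rightarrow> ('x \<Rightarrow> real \<Rightarrow> 'a::real_normed_vector) \<Rightarrow> bool"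
where
  "joint_C 0 X W u \<longleftrightarrow>
     continuous_map (subtopology (prod_topology X euclidean) W) euclidean (\<lambda>p. u (fst p) (snd p))"
| "joint_C (Suc k) X W u \<longleftrightarrow>
     continuous_map (subtopology (prod_topology X euclidean) W) euclidean (\<lambda>p. u (fst p) (snd p)) \<and>
     (\<exists>u'. (\<forall>x t. (x, t) \<in> W \<longrightarrow> (u x has_vector_derivative u' x t) (at t)) \<and> joint_C k X W u')"

lemma joint_C_imp_continuous:
  "joint_C k X W u \<Longrightarrow>
     continuous_map (subtopology (prod_topology X euclidean) W) euclidean (\<lambda>p. u (fst p) (snd p))"
  by (cases k) auto

lemma joint_C_SucI:
  assumes "joint_C 0 X W u" "\<And>x t. (x, t) \<in> W \<Longrightarrow> (u x has_vector_derivative u' x t) (at t)"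
    "joint_C k X W u'"
  shows "joint_C (Suc k) X W u"
  using assms by auto

lemma joint_C_SucD: "joint_C (Suc k) X W u \<Longrightarrow> joint_C k X W u"
  by (induction k arbitrary: u) (simp, force)

lemma joint_C_subset:
  assumes "joint_C k X W u" "W' \<subseteq> W"
  shows "joint_C k X W' u"
  using assms
proof (induction k arbitrary: u)
  case 0
  then show ?case
    using continuous_map_from_subtopology_mono by auto
next
  case (Suc k)
  from Suc.prems obtain u' where "\<forall>x t. (x, t) \<in> W \<longrightarrow> (u x has_vector_derivative u' x t) (at t)"
    "joint_C k X W u'" by auto
  moreover have "continuous_map (subtopology (prod_topology X euclidean) W') euclidean (\<lambda>p. u (fst p) (snd p))"
    using Suc.prems continuous_map_from_subtopology_mono by auto
  ultimately show ?case using Suc.IH[of u'] Suc.prems(2) by auto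
qed

lemma open_slice:
  assumes "openin (prod_topology X euclidean) W" "(x, t) \<in> W"
  shows "open {s. (x, s) \<in> W}"
proof -
  have x: "x \<in> topspace X" using assms openin_subset by fastforce
  have "continuous_map euclidean (prod_topology X euclidean) (\<lambda>s. (x, s))"
    using x by (simp add: continuous_map_pairedI)
  from openin_continuous_map_preimage[OF this assms(1)] show ?thesis by simp
qed

lemma joint_C_cong:
  assumes W: "openin (prod_topology X euclidean) W"
    and eq: "\<And>x t. (x, t) \<in> W \<Longrightarrow> u x t = v x t" and u: "joint_C k X W u"
  shows "joint_C k X W v"
  using u
proof (cases k)
  case 0
  show ?thesis using u unfolding 0 joint_C.simps
    by (rule continuous_map_eq) (use eq in auto)
next
  case (Suc j)
  then obtain u' where u': "\<And>x t. (x, t) \<in> W \<Longrightarrow> (u x has_vector_derivative u' x t) (at t)"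
    "joint_C j X W u'" using u by auto
  have c: "joint_C 0 X W v" using joint_C_imp_continuous[OF u] unfolding joint_C.simps
    by (rule continuous_map_eq) (use eq in auto)
  have "(v x has_vector_derivative u' x t) (at t)" if "(x, t) \<in> W" for x t
    by (rule has_vector_derivative_transform_within_open[OF u'(1)[OF that] open_slice[OF W that]])
      (use that eq in auto)
  then show ?thesis unfolding Suc using c u'(2) joint_C_SucI by blast
qed

lemma joint_C_vector_derivative:
  assumes W: "openin (prod_topology X euclidean) W" and u: "joint_C (Suc k) X W u"
  shows "\<And>x t. (x, t) \<in> W \<Longrightarrow> (u x has_vector_derivative vector_derivative (u x) (at t)) (at t)"
    and "joint_C k X W (\<lambda>x t. vector_derivative (u x) (at t))"
proof -
  obtain u' where u': "\<And>x t. (x, t) \<in> W \<Longrightarrow> (u x has_vector_derivative u' x t) (at t)"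
    "joint_C k X W u'" using u by auto
  have e: "u' x t = vector_derivative (u x) (at t)" if "(x, t) \<in> W" for x t
    using u'(1)[OF that] by (simp add: vector_derivative_at)
  show "(u x has_vector_derivative vector_derivative (u x) (at t)) (at t)" if "(x, t) \<in> W" for x t
    using u'(1)[OF that] e[OF that] by simp
  show "joint_C k X W (\<lambda>x t. vector_derivative (u x) (at t))"
    using joint_C_cong[OF W e u'(2)] .
qed

text \<open>The domains \<open>V\<close> form an open cover, so that joint continuity can be
  pasted.\<close>
lemma joint_C_local_continuous:
  assumes loc: "\<forall>p\<in>W. \<exists>V. openin (prod_topology X euclidean) V \<and> p \<in> V \<and> joint_C k X V u"
  shows "continuous_map (subtopology (prod_topology X euclidean) W) euclidean (\<lambda>p. u (fst p) (snd p))"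
proof -
  let ?T = "subtopology (prod_topology X euclidean) W"
  from loc obtain V where
    V: "\<And>p. p \<in> W \<Longrightarrow> openin (prod_topology X euclidean) (V p) \<and> p \<in> V p \<and> joint_C k X (V p) u"
    by metis
  show ?thesis
  proof (rule pasting_lemma[where I = W and T = "\<lambda>p. V p \<inter> W" and f = "\<lambda>_ p. u (fst p) (snd p)"])
    fix i assume i: "i \<in> W"
    show "openin ?T (V i \<inter> W)" using V[OF i] by (simp add: openin_subtopology_Int)
    show "continuous_map (subtopology ?T (V i \<inter> W)) euclidean (\<lambda>p. u (fst p) (snd p))"
      unfolding subtopology_subtopology
      by (rule continuous_map_from_subtopology_mono[OF joint_C_imp_continuous[of k X "V i" u]])
        (use V[OF i] in auto)
  next
    fix p assume "p \<in> topspace ?T"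
    then have "p \<in> W" by simp
    then show "\<exists>j. j \<in> W \<and> p \<in> V j \<inter> W \<and> u (fst p) (snd p) = u (fst p) (snd p)" using V[of p] by blast
  qed auto
qed

text \<open>Being of class \<open>C\<^sup>k\<close> is local because the derivative is unique: the
  local derivatives agree with the global function \<open>vector_derivative\<close>. Formulas by cases
  can therefore be treated one region at a time.\<close>
lemma joint_C_local:
  assumes W: "openin (prod_topology X euclidean) W"
    and loc: "\<forall>p\<in>W. \<exists>V. openin (prod_topology X euclidean) V \<and> p \<in> V \<and> joint_C k X V u"
  shows "joint_C k X W u"
  using loc
proof (induction k arbitrary: u)
  case 0
  show ?case unfolding joint_C.simps(1) by (rule joint_C_local_continuous[OF 0])
next
  case (Suc k)
  have d: "(u x has_vector_derivative vector_derivative (u x) (at t)) (at t)" if xt: "(x, t) \<in> W" for x t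
  proof -
    obtain V where "openin (prod_topology X euclidean) V" "(x, t) \<in> V" "joint_C (Suc k) X V u"
      using bspec[OF Suc.prems xt] by (elim exE conjE)
    then show ?thesis by (intro joint_C_vector_derivative(1))
  qed
  have k: "joint_C k X W (\<lambda>x t. vector_derivative (u x) (at t))"
  proof (rule Suc.IH, intro ballI)
    fix p assume p: "p \<in> W"
    obtain V where "openin (prod_topology X euclidean) V" "p \<in> V" "joint_C (Suc k) X V u"
      using bspec[OF Suc.prems p] by (elim exE conjE)
    then show "\<exists>V. openin (prod_topology X euclidean) V \<and> p \<in> V \<and>
        joint_C k X V (\<lambda>x t. vector_derivative (u x) (at t))"
      by (intro exI[of _ V] conjI joint_C_vector_derivative(2))
  qed
  show ?case
    by (rule joint_C_SucI[OF _ d k]) (simp_all add: joint_C_local_continuous[OF Suc.prems])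
qed

definition joint_smooth :: "'x topology \<Rightarrow> ('x \<times> real) set \<Rightarrow> ('x \<Rightarrow> real \<Rightarrow> 'a::real_normed_vector) \<Rightarrow> bool"
  where "joint_smooth X W u \<longleftrightarrow> (\<forall>k. joint_C k X W u)"

subsection \<open>Closure properties\<close>

lemma joint_C_const: "joint_C k X W (\<lambda>_ _. c)"
proof (induction k arbitrary: c)
  case (Suc k)
  show ?case by (rule joint_C_SucI[where u' = "\<lambda>_ _. 0"]) (use Suc in auto)
qed auto

lemma joint_C_param:
  assumes "continuous_map X euclidean c"
  shows "joint_C k X W (\<lambda>x _. c x)"
proof -
  have "joint_C 0 X W (\<lambda>x _. c x)"
    using assms continuous_map_compose[OF continuous_map_fst assms]
    by (auto simp: o_def intro: continuous_map_from_subtopology)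
  then show ?thesis
    by (cases k) (auto intro!: joint_C_SucI[where u' = "\<lambda>_ _. 0"] simp: joint_C_const simp del: joint_C.simps)
qed

lemma joint_C_id: "joint_C k X W (\<lambda>_ t. t)"
proof -
  have "joint_C 0 X W (\<lambda>_ t. t)"
    by (auto intro!: continuous_map_from_subtopology continuous_map_snd)
  then show ?thesis
    by (cases k) (auto intro!: joint_C_SucI[where u' = "\<lambda>_ _. 1"] simp: joint_C_const simp del: joint_C.simps)
qed

lemma joint_C_add:
  assumes "joint_C k X W u" "joint_C k X W v"
  shows "joint_C k X W (\<lambda>x t. u x t + v x t)"
  using assms
proof (induction k arbitrary: u v)
  case 0
  then show ?case
    by (auto intro!: continuous_map_euclidean_binop[where h = "(+)"] continuous_intros)
next
  case (Suc k)
  then obtain u' v' where d: "\<And>x t. (x, t) \<in> W \<Longrightarrow> (u x has_vector_derivative u' x t) (at t)" "joint_C k X W u'"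
    "\<And>x t. (x, t) \<in> W \<Longrightarrow> (v x has_vector_derivative v' x t) (at t)" "joint_C k X W v'" by auto
  show ?case
    by (rule joint_C_SucI[where u' = "\<lambda>x t. u' x t + v' x t"])
      (use d Suc in \<open>auto intro!: has_vector_derivative_add continuous_map_euclidean_binop[where h = "(+)"] continuous_intros\<close>)
qed

lemma joint_C_bilinear:
  assumes b: "bounded_bilinear h" and "joint_C k X W u" "joint_C k X W v"
  shows "joint_C k X W (\<lambda>x t. h (u x t) (v x t))"
  using assms(2-)
proof (induction k arbitrary: u v)
  have c: "continuous_on UNIV (\<lambda>p. h (fst p) (snd p))"
    by (intro bounded_bilinear.continuous_on[OF b] continuous_intros)
  {
    case 0
    then show ?case using c by (auto intro!: continuous_map_euclidean_binop[where h = h])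
  next
    case (Suc k)
    then obtain u' v' where d: "\<And>x t. (x, t) \<in> W \<Longrightarrow> (u x has_vector_derivative u' x t) (at t)" "joint_C k X W u'"
      "\<And>x t. (x, t) \<in> W \<Longrightarrow> (v x has_vector_derivative v' x t) (at t)" "joint_C k X W v'" by auto
    have uv: "joint_C k X W u" "joint_C k X W v" using Suc.prems joint_C_SucD by blast+
    show ?case
    proof (rule joint_C_SucI[where u' = "\<lambda>x t. h (u x t) (v' x t) + h (u' x t) (v x t)"])
      show "joint_C 0 X W (\<lambda>x t. h (u x t) (v x t))"
        using Suc.prems c by (auto intro!: continuous_map_euclidean_binop[where h = h])
      show "((\<lambda>t. h (u x t) (v x t)) has_vector_derivative h (u x t) (v' x t) + h (u' x t) (v x t)) (at t)"
        if "(x, t) \<in> W" for x t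
        using bounded_bilinear.has_vector_derivative[OF b d(1)[OF that] d(3)[OF that]] by simp
      show "joint_C k X W (\<lambda>x t. h (u x t) (v' x t) + h (u' x t) (v x t))"
        by (intro joint_C_add Suc.IH uv d)
    qed
  }
qed

lemma joint_C_linear:
  assumes b: "bounded_linear h" and "joint_C k X W u"
  shows "joint_C k X W (\<lambda>x t. h (u x t))"
proof -
  have "bounded_bilinear (\<lambda>(r::real) y. r *\<^sub>R h y)"
    by (rule bounded_bilinear.comp[OF bounded_bilinear_scaleR bounded_linear_ident b])
  from joint_C_bilinear[OF this joint_C_const[of k X W 1] assms(2)] show ?thesis by simp
qed

text \<open>The chain rule reduces the claim for \<open>Suc k\<close> to the one for
  \<open>k\<close> and to products.\<close>
lemma joint_C_compose:
  assumes \<phi>: "continuous_map X Y \<phi>" and v: "joint_C k X W v" and u: "joint_C k Y W' u"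
    and sub: "\<And>x t. (x, t) \<in> W \<Longrightarrow> (\<phi> x, v x t) \<in> W'"
  shows "joint_C k X W (\<lambda>x t. u (\<phi> x) (v x t))"
  using v u
proof (induction k arbitrary: u)
  have cont: "joint_C 0 X W (\<lambda>x t. u (\<phi> x) (v x t))" if "joint_C 0 X W v" "joint_C 0 Y W' u" for u :: "'b \<Rightarrow> real \<Rightarrow> 'c"
  proof -
    let ?T = "subtopology (prod_topology X euclidean) W"
    have "continuous_map ?T (prod_topology Y euclidean) (\<lambda>p. (\<phi> (fst p), v (fst p) (snd p)))"
      using that(1) continuous_map_compose[OF continuous_map_fst \<phi>, of euclidean]
      by (auto intro!: continuous_map_pairedI simp: o_def intro: continuous_map_from_subtopology)
    then have "continuous_map ?T (subtopology (prod_topology Y euclidean) W') (\<lambda>p. (\<phi> (fst p), v (fst p) (snd p)))"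
      using sub by (auto simp: continuous_map_in_subtopology)
    from continuous_map_compose[OF this that(2)[simplified]] show ?thesis by (simp add: o_def)
  qed
  {
    case 0
    then show ?case using cont by simp
  next
    case (Suc k)
    obtain v' where v': "\<And>x t. (x, t) \<in> W \<Longrightarrow> (v x has_vector_derivative v' x t) (at t)" "joint_C k X W v'"
      using Suc.prems(1) by auto
    obtain u' where u': "\<And>x t. (x, t) \<in> W' \<Longrightarrow> (u x has_vector_derivative u' x t) (at t)" "joint_C k Y W' u'"
      using Suc.prems(2) by auto
    have vk: "joint_C k X W v" using Suc.prems(1) joint_C_SucD by blast
    show ?case
    proof (rule joint_C_SucI[where u' = "\<lambda>x t. v' x t *\<^sub>R u' (\<phi> x) (v x t)"])
      show "joint_C 0 X W (\<lambda>x t. u (\<phi> x) (v x t))" using Suc.prems by (intro cont) auto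
      show "((\<lambda>t. u (\<phi> x) (v x t)) has_vector_derivative v' x t *\<^sub>R u' (\<phi> x) (v x t)) (at t)"
        if "(x, t) \<in> W" for x t
        using vector_diff_chain_at[OF v'(1)[OF that] u'(1)[OF sub[OF that]]] by (simp add: o_def)
      show "joint_C k X W (\<lambda>x t. v' x t *\<^sub>R u' (\<phi> x) (v x t))"
        by (rule joint_C_bilinear[OF bounded_bilinear_scaleR v'(2) Suc.IH[OF vk u'(2)]])
    qed
  }
qed

text \<open>The derivative of \<open>1/u\<close> is \<open>- u' (1/u)\<^sup>2\<close>, which
  involves \<open>1/u\<close> itself only to lower order; hence induction on \<open>k\<close>.\<close>
lemma joint_C_inverse:
  fixes u :: "'x \<Rightarrow> real \<Rightarrow> real"
  assumes "joint_C k X W u" "\<And>x t. (x, t) \<in> W \<Longrightarrow> u x t \<noteq> 0"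
  shows "joint_C k X W (\<lambda>x t. inverse (u x t))"
  using assms(1)
proof (induction k)
  have c: "joint_C 0 X W (\<lambda>x t. inverse (u x t))" if "joint_C 0 X W u"
    using that assms(2) by (auto intro!: continuous_map_euclidean_unop[where h = inverse and S = "-{0}"] continuous_intros)
  {
    case 0 then show ?case using c by simp
  next
    case (Suc k)
    obtain u' where u': "\<And>x t. (x, t) \<in> W \<Longrightarrow> (u x has_vector_derivative u' x t) (at t)" "joint_C k X W u'"
      using Suc.prems(1) by auto
    have i: "joint_C k X W (\<lambda>x t. inverse (u x t))" using Suc.IH Suc.prems joint_C_SucD by blast
    show ?case
    proof (rule joint_C_SucI[where u' = "\<lambda>x t. (-1) * ((inverse (u x t) * u' x t) * inverse (u x t))"])
      show "joint_C 0 X W (\<lambda>x t. inverse (u x t))" using Suc.prems by (intro c) auto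
      show "((\<lambda>t. inverse (u x t)) has_vector_derivative (-1) * ((inverse (u x t) * u' x t) * inverse (u x t))) (at t)"
        if "(x, t) \<in> W" for x t
        using u'(1)[OF that] assms(2)[OF that] DERIV_inverse'[of "u x" "u' x t" t UNIV]
        by (simp add: has_real_derivative_iff_has_vector_derivative)
      show "joint_C k X W (\<lambda>x t. (-1) * ((inverse (u x t) * u' x t) * inverse (u x t)))"
        by (intro joint_C_bilinear[OF bounded_bilinear_mult] joint_C_const i u')
    qed
  }
qed

lemma joint_C_real_function:
  fixes F :: "real \<Rightarrow> 'a::real_normed_vector"
  assumes "\<And>k. joint_C k X (topspace X \<times> S) (\<lambda>_. F)" "openin (prod_topology X euclidean) W" "joint_C k X W v"
    "\<And>x t. (x, t) \<in> W \<Longrightarrow> v x t \<in> S"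
  shows "joint_C k X W (\<lambda>x t. F (v x t))"
proof -
  have "\<And>x t. (x, t) \<in> W \<Longrightarrow> (id x, v x t) \<in> topspace X \<times> S" using assms(2,4) openin_subset by fastforce
  from joint_C_compose[OF continuous_map_id assms(3) assms(1) this] show ?thesis by simp
qed

lemma joint_C_0_real_function:
  fixes F :: "real \<Rightarrow> 'a::real_normed_vector"
  assumes "continuous_on S F" "W \<subseteq> UNIV \<times> S"
  shows "joint_C 0 X W (\<lambda>_ t. F t)"
proof -
  have "continuous_map (subtopology (prod_topology X euclidean) W) euclidean snd"
    by (rule continuous_map_from_subtopology[OF continuous_map_snd])
  moreover have "snd ` topspace (subtopology (prod_topology X euclidean) W) \<subseteq> S" using assms(2) by auto
  ultimately show ?thesis unfolding joint_C.simps by (intro continuous_map_euclidean_unop[OF _ assms(1)])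
qed

lemma joint_C_sin_cos: "joint_C k X W (\<lambda>_ t. sin t) \<and> joint_C k X W (\<lambda>_ t. cos t)"
proof (induction k)
  have c: "joint_C 0 X W (\<lambda>_ t. sin t)" "joint_C 0 X W (\<lambda>_ t. cos t)"
    by (rule joint_C_0_real_function[where S = UNIV]; auto intro: continuous_intros)+
  {
    case 0 show ?case using c by simp
  next
    case (Suc k)
    have "joint_C k X W (\<lambda>_ t. (-1) * sin t)"
      by (intro joint_C_bilinear[OF bounded_bilinear_mult] joint_C_const conjunct1[OF Suc])
    then have "joint_C (Suc k) X W (\<lambda>_ t. cos t)"
      by (intro joint_C_SucI[OF c(2), where u' = "\<lambda>_ t. (-1) * sin t"])
        (auto simp flip: has_real_derivative_iff_has_vector_derivative intro!: derivative_eq_intros)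
    moreover have "joint_C (Suc k) X W (\<lambda>_ t. sin t)"
      by (intro joint_C_SucI[OF c(1), where u' = "\<lambda>_ t. cos t"] conjunct2[OF Suc])
        (auto simp flip: has_real_derivative_iff_has_vector_derivative intro!: derivative_eq_intros)
    ultimately show ?case by blast
  }
qed

lemma joint_C_sqrt_function: "joint_C k X (A \<times> {0<..}) (\<lambda>_ t. sqrt t)"
proof (induction k)
  have c: "joint_C 0 X (A \<times> {0<..}) (\<lambda>_ t. sqrt t)"
    by (rule joint_C_0_real_function[where S = UNIV]) (auto intro: continuous_intros)
  {
    case 0 show ?case using c by simp
  next
    case (Suc k)
    show ?case
    proof (rule joint_C_SucI[OF c, where u' = "\<lambda>_ t. inverse (2 * sqrt t)"])
      show "joint_C k X (A \<times> {0<..}) (\<lambda>_ t. inverse (2 * sqrt t))"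
        by (intro joint_C_inverse joint_C_bilinear[OF bounded_bilinear_mult] joint_C_const Suc) auto
      show "(sqrt has_vector_derivative inverse (2 * sqrt t)) (at t)" if "(x, t) \<in> A \<times> {0<..}" for x t
        using that by (auto simp flip: has_real_derivative_iff_has_vector_derivative intro!: derivative_eq_intros simp: field_simps)
    qed
  }
qed

lemma joint_C_arctan_function: "joint_C k X W (\<lambda>_ t. arctan t)"
proof -
  have c: "joint_C 0 X W (\<lambda>_ t. arctan t)"
    by (rule joint_C_0_real_function[where S = UNIV]) (auto intro: continuous_intros)
  have p: "1 + t * t \<noteq> (0::real)" for t
    by (smt (verit) zero_le_square)
  show ?thesis
  proof (cases k)
    case 0 then show ?thesis using c by simp
  next
    case (Suc j)
    have "joint_C j X W (\<lambda>_ t. inverse (1 + t * t))"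
      by (intro joint_C_inverse joint_C_add joint_C_bilinear[OF bounded_bilinear_mult] joint_C_const joint_C_id p)
    then show ?thesis unfolding Suc
      by (intro joint_C_SucI[OF c, where u' = "\<lambda>_ t. inverse (1 + t * t)"])
        (auto simp flip: has_real_derivative_iff_has_vector_derivative intro!: derivative_eq_intros simp: field_simps power2_eq_square)
  qed
qed

subsection \<open>Families with derivatives of all orders\<close>

lemma joint_smooth_subset: "joint_smooth X W u \<Longrightarrow> W' \<subseteq> W \<Longrightarrow> joint_smooth X W' u"
  by (auto simp: joint_smooth_def intro: joint_C_subset)

lemma joint_smooth_cong:
  "openin (prod_topology X euclidean) W \<Longrightarrow> (\<And>x t. (x, t) \<in> W \<Longrightarrow> u x t = v x t) \<Longrightarrow>
   joint_smooth X W u \<Longrightarrow> joint_smooth X W v"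
  unfolding joint_smooth_def using joint_C_cong by blast

lemma joint_smooth_Un:
  assumes "openin (prod_topology X euclidean) V1" "openin (prod_topology X euclidean) V2"
    "joint_smooth X V1 u" "joint_smooth X V2 u" "W \<subseteq> V1 \<union> V2"
  shows "joint_smooth X W u"
proof -
  have "joint_smooth X (V1 \<union> V2) u"
    unfolding joint_smooth_def
    by (intro allI joint_C_local openin_Un assms) (use assms in \<open>auto simp: joint_smooth_def\<close>)
  then show ?thesis using assms(5) joint_smooth_subset by blast
qed

lemma joint_smooth_const [simp]: "joint_smooth X W (\<lambda>_ _. c)"
  and joint_smooth_param: "continuous_map X euclidean p \<Longrightarrow> joint_smooth X W (\<lambda>x _. p x)"
  and joint_smooth_id [simp]: "joint_smooth X W (\<lambda>_ t. t)"
  and joint_smooth_add: "joint_smooth X W u \<Longrightarrow> joint_smooth X W v \<Longrightarrow> joint_smooth X W (\<lambda>x t. u x t + v x t)"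
  and joint_smooth_bilinear: "bounded_bilinear h \<Longrightarrow> joint_smooth X W u1 \<Longrightarrow> joint_smooth X W v1 \<Longrightarrow>
     joint_smooth X W (\<lambda>x t. h (u1 x t) (v1 x t))"
  and joint_smooth_linear: "bounded_linear l \<Longrightarrow> joint_smooth X W u1 \<Longrightarrow> joint_smooth X W (\<lambda>x t. l (u1 x t))"
  and joint_smooth_compose: "continuous_map X Y \<phi> \<Longrightarrow> joint_smooth X W r \<Longrightarrow> joint_smooth Y W' w \<Longrightarrow>
     (\<And>x t. (x, t) \<in> W \<Longrightarrow> (\<phi> x, r x t) \<in> W') \<Longrightarrow> joint_smooth X W (\<lambda>x t. w (\<phi> x) (r x t))"
  and joint_smooth_inverse: "joint_smooth X W r \<Longrightarrow> (\<And>x t. (x, t) \<in> W \<Longrightarrow> r x t \<noteq> 0) \<Longrightarrow>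
     joint_smooth X W (\<lambda>x t. inverse (r x t))"
  unfolding joint_smooth_def
  by (blast intro: joint_C_const joint_C_param joint_C_id joint_C_add joint_C_bilinear joint_C_linear
      joint_C_compose joint_C_inverse)+

lemma joint_smooth_scaleR:
  "joint_smooth X W r \<Longrightarrow> joint_smooth X W u \<Longrightarrow> joint_smooth X W (\<lambda>x t. r x t *\<^sub>R u x t)"
  by (rule joint_smooth_bilinear[OF bounded_bilinear_scaleR])

lemma joint_smooth_mult:
  fixes r :: "'x \<Rightarrow> real \<Rightarrow> real"
  shows "joint_smooth X W r \<Longrightarrow> joint_smooth X W s \<Longrightarrow> joint_smooth X W (\<lambda>x t. r x t * s x t)"
  by (rule joint_smooth_bilinear[OF bounded_bilinear_mult])

lemma joint_smooth_inner:
  "joint_smooth X W u \<Longrightarrow> joint_smooth X W v \<Longrightarrow> joint_smooth X W (\<lambda>x t. u x t \<bullet> v x t)"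
  by (rule joint_smooth_bilinear[OF bounded_bilinear_inner])

lemma joint_smooth_minus: "joint_smooth X W u \<Longrightarrow> joint_smooth X W (\<lambda>x t. - u x t)"
  using joint_smooth_linear[OF bounded_linear_minus[OF bounded_linear_ident], of X W u] by simp

lemma joint_smooth_diff:
  "joint_smooth X W u \<Longrightarrow> joint_smooth X W v \<Longrightarrow> joint_smooth X W (\<lambda>x t. u x t - v x t)"
  using joint_smooth_add[OF _ joint_smooth_minus, of X W u v] by simp

lemma joint_smooth_divide:
  fixes r :: "'x \<Rightarrow> real \<Rightarrow> real"
  shows "joint_smooth X W r \<Longrightarrow> joint_smooth X W s \<Longrightarrow> (\<And>x t. (x, t) \<in> W \<Longrightarrow> s x t \<noteq> 0) \<Longrightarrow>
    joint_smooth X W (\<lambda>x t. r x t / s x t)"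
  unfolding divide_inverse by (intro joint_smooth_mult joint_smooth_inverse)

lemma joint_smooth_real_function:
  fixes F :: "real \<Rightarrow> 'a::real_normed_vector"
  assumes "openin (prod_topology X euclidean) W" "joint_smooth X W v"
    "\<And>k. joint_C k X (topspace X \<times> S) (\<lambda>_. F)" "\<And>x t. (x, t) \<in> W \<Longrightarrow> v x t \<in> S"
  shows "joint_smooth X W (\<lambda>x t. F (v x t))"
  using assms joint_C_real_function[of X S F W _ v] unfolding joint_smooth_def by blast

lemma joint_smooth_sin:
  fixes v :: "'x \<Rightarrow> real \<Rightarrow> real"
  assumes "openin (prod_topology X euclidean) W" "joint_smooth X W v"
  shows "joint_smooth X W (\<lambda>x t. sin (v x t))"
  by (rule joint_smooth_real_function[OF assms, where S = UNIV]) (use joint_C_sin_cos in auto)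

lemma joint_smooth_cos:
  fixes v :: "'x \<Rightarrow> real \<Rightarrow> real"
  assumes "openin (prod_topology X euclidean) W" "joint_smooth X W v"
  shows "joint_smooth X W (\<lambda>x t. cos (v x t))"
  by (rule joint_smooth_real_function[OF assms, where S = UNIV]) (use joint_C_sin_cos in auto)

lemma joint_smooth_arctan:
  assumes "openin (prod_topology X euclidean) W" "joint_smooth X W v"
  shows "joint_smooth X W (\<lambda>x t. arctan (v x t))"
  by (rule joint_smooth_real_function[OF assms, where S = UNIV]) (use joint_C_arctan_function in auto)

lemma joint_smooth_sqrt:
  assumes "openin (prod_topology X euclidean) W" "joint_smooth X W v"
    "\<And>x t. (x, t) \<in> W \<Longrightarrow> v x t > 0"
  shows "joint_smooth X W (\<lambda>x t. sqrt (v x t))"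
  by (rule joint_smooth_real_function[OF assms(1,2) joint_C_sqrt_function]) (use assms(3) in auto)

section \<open>Smooth families and the \<open>C\<^sup>\<infinity>\<close>-topology\<close>

lemma openin_whole [simp]: "openin (prod_topology X euclidean) (topspace X \<times> UNIV)"
  by (simp add: openin_prod_Times_iff)

lemma nth_vderiv_0 [simp]: "nth_vderiv 0 f = f"
  by (simp add: nth_vderiv_def)

lemma nth_vderiv_Suc: "nth_vderiv (Suc k) f = (\<lambda>t. vector_derivative (nth_vderiv k f) (at t))"
  by (simp add: nth_vderiv_def)

lemma joint_smooth_vector_derivative:
  assumes "openin (prod_topology X euclidean) W" "joint_smooth X W u"
  shows "joint_smooth X W (\<lambda>x t. vector_derivative (u x) (at t))"
    and "(x, t) \<in> W \<Longrightarrow> (u x has_vector_derivative vector_derivative (u x) (at t)) (at t)"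
  using assms joint_C_vector_derivative[OF assms(1)] unfolding joint_smooth_def by blast+

lemma joint_smooth_nth_vderiv:
  assumes "openin (prod_topology X euclidean) W" "joint_smooth X W u"
  shows "joint_smooth X W (\<lambda>x. nth_vderiv k (u x))"
proof (induction k)
  case (Suc k)
  show ?case unfolding nth_vderiv_Suc by (rule joint_smooth_vector_derivative(1)[OF assms(1) Suc])
qed (simp add: assms)

lemma joint_smooth_imp_continuous:
  "joint_smooth X W u \<Longrightarrow>
     continuous_map (subtopology (prod_topology X euclidean) W) euclidean (\<lambda>p. u (fst p) (snd p))"
  unfolding joint_smooth_def using joint_C_imp_continuous by blast

lemma joint_smooth_imp_continuous_whole:
  assumes "joint_smooth X (topspace X \<times> UNIV) u"
  shows "continuous_map (prod_topology X euclidean) euclidean (\<lambda>p. u (fst p) (snd p))"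
proof -
  have "subtopology (prod_topology X euclidean) (topspace X \<times> (UNIV :: real set)) = prod_topology X euclidean"
    by (metis subtopology_topspace topspace_euclidean topspace_prod_topology)
  then show ?thesis using joint_smooth_imp_continuous[OF assms] by simp
qed

text \<open>A subbasic open set prescribes the values of one derivative over a compact set of times,
  so its preimage is open by the tube lemma.\<close>
lemma joint_smooth_imp_Cinf:
  assumes u: "joint_smooth X (topspace X \<times> UNIV) u"
  shows "\<And>x. x \<in> topspace X \<Longrightarrow> smooth_curve (u x)" "continuous_map X Cinf_topology u"
proof -
  note n = joint_smooth_nth_vderiv[OF openin_whole u]
  show "smooth_curve (u x)" if "x \<in> topspace X" for x
    unfolding smooth_curve_def
    using joint_smooth_vector_derivative(2)[OF openin_whole n] that
    by (blast intro: differentiableI_vector)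
  have o: "openin X {x \<in> topspace X. \<forall>t\<in>C. nth_vderiv k (u x) t \<in> U}"
    if C: "compact C" and U: "open U" for k C U
  proof (subst openin_subopen, intro ballI)
    let ?W = "{p \<in> topspace (prod_topology X euclidean). nth_vderiv k (u (fst p)) (snd p) \<in> U}"
    have W: "openin (prod_topology X euclidean) ?W"
      using openin_continuous_map_preimage[OF joint_smooth_imp_continuous_whole[OF n[of k]], of U] U by simp
    fix x assume x: "x \<in> {x \<in> topspace X. \<forall>t\<in>C. nth_vderiv k (u x) t \<in> U}"
    then have "x \<in> topspace X" "{x} \<times> C \<subseteq> ?W" "compactin euclidean C" using C by auto
    from tube_lemma_right[OF W this(3,1,2)]
    obtain A B where AB: "openin X A" "x \<in> A" "C \<subseteq> B" "A \<times> B \<subseteq> ?W" by blast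
    moreover have "nth_vderiv k (u y) t \<in> U" if "y \<in> A" "t \<in> C" for y t
      using AB(3,4) that by (auto dest!: subsetD[of "A \<times> B" _ "(y, t)"])
    then have "A \<subseteq> {x \<in> topspace X. \<forall>t\<in>C. nth_vderiv k (u x) t \<in> U}"
      using openin_subset[OF AB(1)] by auto
    ultimately show "\<exists>T. openin X T \<and> x \<in> T \<and> T \<subseteq> {x \<in> topspace X. \<forall>t\<in>C. nth_vderiv k (u x) t \<in> U}"
      by blast
  qed
  show "continuous_map X Cinf_topology u"
    unfolding Cinf_topology_def
  proof (rule continuous_on_generated_topo)
    fix V assume "V \<in> {{f. \<forall>t\<in>C. nth_vderiv k f t \<in> (U :: 'b set)} | k C U. compact C \<and> open U}"
    then obtain k C U where V: "V = {f. \<forall>t\<in>C. nth_vderiv k f t \<in> U}" "compact C" "open U" by auto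
    have "u -` V \<inter> topspace X = {x \<in> topspace X. \<forall>t\<in>C. nth_vderiv k (u x) t \<in> U}" using V by auto
    then show "openin X (u -` V \<inter> topspace X)" using o V by simp
  next
    have "{f. \<forall>t\<in>{}. nth_vderiv 0 f t \<in> (UNIV :: 'b set)} \<in> {{f. \<forall>t\<in>C. nth_vderiv k f t \<in> (U :: 'b set)} | k C U. compact C \<and> open U}"
      using compact_empty open_UNIV by blast
    then show "u ` topspace X \<subseteq> \<Union> {{f. \<forall>t\<in>C. nth_vderiv k f t \<in> (U :: 'b set)} | k C U. compact C \<and> open U}"
      by auto
  qed
qed

text \<open>Conversely, if a derivative of \<open>u x\<close> maps \<open>t\<close> into an open
  set, it does so on a compact neighbourhood of \<open>t\<close>. This is an open condition on the
  curve, so it persists for parameters near \<open>x\<close>.\<close>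
lemma Cinf_imp_joint_smooth:
  assumes c: "continuous_map X Cinf_topology u" and sm: "\<And>x. x \<in> topspace X \<Longrightarrow> smooth_curve (u x)"
  shows "joint_smooth X (topspace X \<times> UNIV) u"
proof -
  let ?T = "subtopology (prod_topology X euclidean) (topspace X \<times> (UNIV :: real set))"
  have d: "(nth_vderiv j (u x) has_vector_derivative nth_vderiv (Suc j) (u x) t) (at t)"
    if "x \<in> topspace X" for j x t
    using sm[OF that] by (simp add: smooth_curve_def nth_vderiv_Suc vector_derivative_works[symmetric])
  have cont: "continuous_map ?T euclidean (\<lambda>p. nth_vderiv j (u (fst p)) (snd p))" for j
  proof -
    have "openin (prod_topology X euclidean) {p \<in> topspace X \<times> UNIV. nth_vderiv j (u (fst p)) (snd p) \<in> V}"
      (is "openin _ ?P") if V: "open V" for V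
    proof (subst openin_subopen, intro ballI)
      fix p assume p: "p \<in> ?P"
      obtain x t where xt: "p = (x, t)" by (cases p)
      have x: "x \<in> topspace X" and v: "nth_vderiv j (u x) t \<in> V" using p xt by auto
      have "isCont (nth_vderiv j (u x)) t" using has_vector_derivative_continuous[OF d[OF x]] .
      then have "(nth_vderiv j (u x) \<longlongrightarrow> nth_vderiv j (u x) t) (nhds t)"
        by (simp add: isCont_def tendsto_at_iff_tendsto_nhds)
      then have "\<forall>\<^sub>F s in nhds t. nth_vderiv j (u x) s \<in> V"
        using V v by (rule topological_tendstoD)
      then obtain e where e: "e > 0" "\<And>s. dist s t < e \<Longrightarrow> nth_vderiv j (u x) s \<in> V"
        unfolding eventually_nhds_metric by blast
      let ?F = "{f. \<forall>s\<in>cball t (e/2). nth_vderiv j f s \<in> V}"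
      have "openin Cinf_topology ?F"
        unfolding Cinf_topology_def 
        by (rule topology_generated_by_Basis, rule CollectI, rule exI[of _ j],
            rule exI[of _ "cball t (e/2)"], rule exI[of _ V]) (simp add: V)
      from openin_continuous_map_preimage[OF c this]
      have "openin (prod_topology X euclidean) ({y \<in> topspace X. u y \<in> ?F} \<times> ball t (e/2))"
        by (simp add: openin_prod_Times_iff)
      moreover have "p \<in> {y \<in> topspace X. u y \<in> ?F} \<times> ball t (e/2)"
        using x xt e by (auto simp: dist_commute)
      moreover have "{y \<in> topspace X. u y \<in> ?F} \<times> ball t (e/2) \<subseteq> ?P" by auto
      ultimately show "\<exists>T. openin (prod_topology X euclidean) T \<and> p \<in> T \<and> T \<subseteq> ?P" by blast
    qed
    then have "continuous_map (prod_topology X euclidean) euclidean (\<lambda>p. nth_vderiv j (u (fst p)) (snd p))"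
      by (auto simp: continuous_map_def)
    then show ?thesis by (rule continuous_map_from_subtopology)
  qed
  have "joint_C k X (topspace X \<times> UNIV) (\<lambda>x. nth_vderiv j (u x))" for k j
  proof (induction k arbitrary: j)
    case 0
    then show ?case using cont by simp
  next
    case (Suc k)
    show ?case
      by (rule joint_C_SucI[where u' = "\<lambda>x. nth_vderiv (Suc j) (u x)"]) (use cont d Suc in auto)
  qed
  from this[of _ 0] show ?thesis by (simp add: joint_smooth_def)
qed

text \<open>The supremum is attained. Upper semicontinuity follows from the tube lemma, lower
  semicontinuity from the continuity at a single time where it is attained.\<close>
lemma continuous_map_SUP_interval:
  fixes u :: "'x \<Rightarrow> real \<Rightarrow> real"
  assumes u: "continuous_map (prod_topology X euclidean) euclidean (\<lambda>p. u (fst p) (snd p))" and ab: "a \<le> b"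
  shows "continuous_map X euclidean (\<lambda>x. SUP t\<in>{a..b}. u x t)"
proof -
  have slice: "continuous_on {a..b} (u x)" if "x \<in> topspace X" for x
  proof -
    have "continuous_map euclidean (prod_topology X euclidean) (\<lambda>s::real. (x, s))"
      using that by (simp add: continuous_map_pairedI)
    from continuous_map_compose[OF this u] have "continuous_on UNIV (u x)" by (simp add: o_def)
    then show ?thesis using continuous_on_subset by blast
  qed
  define m where "m = (\<lambda>x. SUP t\<in>{a..b}. u x t)"
  have att: "\<exists>t\<in>{a..b}. u x t = m x \<and> (\<forall>s\<in>{a..b}. u x s \<le> m x)" if xX: "x \<in> topspace X" for x
  proof -
    obtain t where t: "t \<in> {a..b}" "\<And>s. s \<in> {a..b} \<Longrightarrow> u x s \<le> u x t"
      using continuous_attains_sup[OF _ _ slice[OF xX]] ab by auto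
    then have "m x = u x t" unfolding m_def by (intro cSup_eq_maximum) auto
    then show ?thesis using t by auto
  qed
  have le: "openin X {x \<in> topspace X. m x < r}" for r
  proof (subst openin_subopen, intro ballI)
    fix x assume x: "x \<in> {x \<in> topspace X. m x < r}"
    let ?W = "{p \<in> topspace (prod_topology X euclidean). u (fst p) (snd p) \<in> {..<r}}"
    have W: "openin (prod_topology X euclidean) ?W"
      using openin_continuous_map_preimage[OF u, of "{..<r}"] by simp
    have "\<forall>t\<in>{a..b}. u x t < r" using att[of x] x by fastforce
    then have "x \<in> topspace X" "{x} \<times> {a..b} \<subseteq> ?W" "compactin euclidean {a..b}" using x by auto
    from tube_lemma_right[OF W this(3,1,2)]
    obtain A B where AB: "openin X A" "x \<in> A" "{a..b} \<subseteq> B" "A \<times> B \<subseteq> ?W" by blast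
    have "m y < r" if y: "y \<in> A" for y
    proof -
      obtain t where "t \<in> {a..b}" "u y t = m y" using att[of y] y openin_subset[OF AB(1)] by blast
      moreover have "(y, t) \<in> ?W" using AB y calculation by blast
      ultimately show ?thesis by simp
    qed
    then have "A \<subseteq> {x \<in> topspace X. m x < r}" using openin_subset[OF AB(1)] by auto
    then show "\<exists>T. openin X T \<and> x \<in> T \<and> T \<subseteq> {x \<in> topspace X. m x < r}" using AB by blast
  qed
  have ge: "openin X {x \<in> topspace X. r < m x}" for r
  proof (subst openin_subopen, intro ballI)
    fix x assume x: "x \<in> {x \<in> topspace X. r < m x}"
    then obtain t where t: "t \<in> {a..b}" "u x t = m x" using att by blast
    have "continuous_map X (prod_topology X euclidean) (\<lambda>x. (x, t))"
      by (simp add: continuous_map_pairedI)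
    from continuous_map_compose[OF this u] have "continuous_map X euclidean (\<lambda>x. u x t)" by (simp add: o_def)
    from openin_continuous_map_preimage[OF this, of "{r<..}"]
    have "openin X {y \<in> topspace X. u y t > r}" by simp
    moreover have "{y \<in> topspace X. u y t > r} \<subseteq> {x \<in> topspace X. r < m x}"
      using att t(1) by fastforce
    ultimately show "\<exists>T. openin X T \<and> x \<in> T \<and> T \<subseteq> {x \<in> topspace X. r < m x}" using x t by force
  qed
  show ?thesis
    unfolding m_def[symmetric] continuous_map_upper_lower_semicontinuous_lt
    using le ge by auto
qed

subsection \<open>A smooth bump function\<close>

text \<open>The functions \<open>exp (-1/t) t\<^sup>-\<^sup>n\<close> on the positive half-line,
  extended by zero. The family is closed under differentiation up to linear combinations, which makes
  smoothness a single induction over all \<open>n\<close>.\<close>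
definition flat_exp :: "nat \<Rightarrow> real \<Rightarrow> real" where
  "flat_exp n t = (if t > 0 then exp (- inverse t) * inverse t ^ n else 0)"

lemma flat_exp_tendsto_0: "(flat_exp n \<longlongrightarrow> 0) (at 0)"
proof -
  have "((\<lambda>s::real. s ^ n / exp s) \<longlongrightarrow> 0) at_top" by (rule tendsto_power_div_exp_0)
  then have "((\<lambda>t::real. inverse t ^ n / exp (inverse t)) \<longlongrightarrow> 0) (at_right 0)"
    by (rule filterlim_compose[OF _ filterlim_inverse_at_top_right])
  then have "(flat_exp n \<longlongrightarrow> 0) (at_right 0)"
    by (rule Lim_transform_eventually)
      (auto simp: flat_exp_def eventually_at_filter exp_minus field_simps)
  moreover have "(flat_exp n \<longlongrightarrow> 0) (at_left 0)"
    by (rule tendsto_eventually) (auto simp: flat_exp_def eventually_at_filter)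
  ultimately show ?thesis by (simp add: filterlim_split_at)
qed

lemma flat_exp_derivative:
  "(flat_exp n has_real_derivative flat_exp (n + 2) t - n * flat_exp (n + 1) t) (at t)"
proof -
  consider "t > 0" | "t < 0" | "t = 0" by linarith
  then show ?thesis
  proof cases
    case 1
    have "((\<lambda>t. exp (- inverse t) * inverse t ^ n) has_real_derivative
        exp (- inverse t) * inverse t ^ (n + 2) - n * (exp (- inverse t) * inverse t ^ (n + 1))) (at t)"
    proof -
      have p: "((\<lambda>t. inverse t ^ n) has_real_derivative
          n * (inverse t ^ (n - Suc 0) * - (inverse t ^ Suc (Suc 0)))) (at t)"
        using DERIV_power[OF DERIV_inverse[of t UNIV], of n] 1 by (simp add: mult_ac)
      have e: "((\<lambda>t. exp (- inverse t)) has_real_derivative exp (- inverse t) * inverse t ^ 2) (at t)"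
        using 1 by (auto intro!: derivative_eq_intros simp: power2_eq_square)
      show ?thesis using DERIV_mult[OF e p]
        by (rule DERIV_cong) (cases n; simp add: algebra_simps power2_eq_square)
    qed
    then have "((\<lambda>t. exp (- inverse t) * inverse t ^ n) has_real_derivative
        flat_exp (n + 2) t - n * flat_exp (n + 1) t) (at t)" using 1 by (simp add: flat_exp_def)
    then show ?thesis
      by (rule DERIV_cong_ev[THEN iffD1, rotated -1, OF _ refl _ refl])
        (use 1 eventually_nhds_in_open[of "{0<..}" t] in \<open>auto elim!: eventually_mono simp: flat_exp_def\<close>)
  next
    case 2
    have "((\<lambda>_. 0) has_real_derivative flat_exp (n + 2) t - n * flat_exp (n + 1) t) (at t)"
      using 2 by (simp add: flat_exp_def)
    then show ?thesis
      by (rule DERIV_cong_ev[THEN iffD1, rotated -1, OF _ refl _ refl])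
        (use 2 eventually_nhds_in_open[of "{..<0}" t] in \<open>auto elim!: eventually_mono simp: flat_exp_def\<close>)
  next
    case 3
    have "(\<lambda>h. (flat_exp n (0 + h) - flat_exp n 0) / h) = flat_exp (Suc n)"
      by (auto simp: flat_exp_def fun_eq_iff field_simps)
    then have "(flat_exp n has_real_derivative 0) (at 0)"
      unfolding DERIV_def using flat_exp_tendsto_0[of "Suc n"] by simp
    then show ?thesis using 3 by (simp add: flat_exp_def)
  qed
qed

lemma joint_C_flat_exp: "joint_C k X W (\<lambda>_. flat_exp n)"
proof (induction k arbitrary: n)
  have c: "joint_C 0 X W (\<lambda>_. flat_exp n)" for n
    by (rule joint_C_0_real_function[where S = UNIV])
      (use flat_exp_derivative[THEN DERIV_isCont] in \<open>auto simp: continuous_on_eq_continuous_at\<close>)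
  {
    case 0 show ?case by (rule c)
  next
    case (Suc k)
    have "joint_C k X W (\<lambda>_ t. flat_exp (n + 2) t + (- real n) * flat_exp (n + 1) t)"
      by (intro joint_C_add joint_C_bilinear[OF bounded_bilinear_mult] joint_C_const Suc)
    then show ?case
      by (rule joint_C_SucI[OF c, rotated])
       (use flat_exp_derivative in \<open>auto simp flip: has_real_derivative_iff_has_vector_derivative\<close>)
  }
qed

text \<open>With \<open>y = 4/3 (1 - x\<^sup>2)\<close> the quotient is \<open>1\<close> for
  \<open>y \<ge> 1\<close>, that is for \<open>\<bar>x\<bar> \<le> 1/2\<close>, and \<open>0\<close>
  for \<open>y \<le> 0\<close>, that is for \<open>\<bar>x\<bar> \<ge> 1\<close>.\<close>
definition bump :: "real \<Rightarrow> real" where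
  "bump x = (let y = 4/3 * (1 - x * x) in flat_exp 0 y / (flat_exp 0 y + flat_exp 0 (1 - y)))"

lemma flat_exp_nonneg: "flat_exp n t \<ge> 0" and flat_exp_pos: "t > 0 \<Longrightarrow> flat_exp n t > 0"
  and flat_exp_0: "t \<le> 0 \<Longrightarrow> flat_exp n t = 0"
  by (auto simp: flat_exp_def)

lemma flat_exp_sum_pos: "flat_exp 0 y + flat_exp 0 (1 - y) > 0"
proof (cases "y > 0")
  case True
  then show ?thesis using flat_exp_pos flat_exp_nonneg by (simp add: add_pos_nonneg)
next
  case False
  then show ?thesis using flat_exp_pos[of "1 - y" 0] flat_exp_nonneg by (simp add: add_nonneg_pos)
qed

lemma bump_range: "0 \<le> bump x" "bump x \<le> 1"
  using flat_exp_sum_pos flat_exp_nonneg by (auto simp: bump_def Let_def)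

lemma bump_1: "\<bar>x\<bar> \<le> 1/2 \<Longrightarrow> bump x = 1"
proof -
  assume "\<bar>x\<bar> \<le> 1/2"
  then have "x * x \<le> 1/2 * (1/2)" using mult_mono[of "\<bar>x\<bar>" "1/2" "\<bar>x\<bar>" "1/2"] by (simp add: abs_mult_self_eq)
  then have "1 - 4/3 * (1 - x * x) \<le> 0" by simp
  then show ?thesis
    using flat_exp_sum_pos[of "4/3 * (1 - x * x)"] by (simp only: bump_def Let_def flat_exp_0) simp
qed

lemma bump_0: "\<bar>x\<bar> \<ge> 1 \<Longrightarrow> bump x = 0"
proof -
  assume "\<bar>x\<bar> \<ge> 1"
  then have "x * x \<ge> 1" using mult_mono[of 1 "\<bar>x\<bar>" 1 "\<bar>x\<bar>"] by (simp add: abs_mult_self_eq)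
  then show ?thesis by (simp add: bump_def Let_def flat_exp_0)
qed

lemma joint_smooth_bump:
  assumes W: "openin (prod_topology X euclidean) W" and v: "joint_smooth X W v"
  shows "joint_smooth X W (\<lambda>x t. bump (v x t))"
proof -
  have e: "joint_smooth X W (\<lambda>x t. flat_exp 0 (w x t))" if "joint_smooth X W w" for w
    by (rule joint_smooth_real_function[OF W that, where S = UNIV]) (auto intro: joint_C_flat_exp)
  show ?thesis unfolding bump_def Let_def
    by (intro joint_smooth_divide joint_smooth_add e joint_smooth_mult joint_smooth_const
         joint_smooth_diff v less_imp_neq[OF flat_exp_sum_pos, symmetric])
qed

text \<open>The derivative is continuous and vanishes for \<open>\<bar>x\<bar> > 1\<close>, so
  compactness of an interval gives the bound.\<close>
lemma bump_derivative: "\<exists>B\<ge>1. \<forall>x. \<exists>d. (bump has_real_derivative d) (at x) \<and> \<bar>d\<bar> \<le> B"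
proof -
  let ?X = "euclidean :: real topology"
  let ?W = "topspace ?X \<times> (UNIV :: real set)"
  have s: "joint_smooth ?X ?W (\<lambda>_. bump)"
    by (rule joint_smooth_bump[OF openin_whole joint_smooth_id])
  define b where "b t = vector_derivative bump (at t)" for t
  have d: "(bump has_real_derivative b t) (at t)" for t
    using joint_smooth_vector_derivative(2)[OF openin_whole s, of 0 t]
    by (simp add: b_def has_real_derivative_iff_has_vector_derivative)
  have "continuous_map (prod_topology ?X euclidean) euclidean (\<lambda>p. b (snd p))"
    using joint_smooth_imp_continuous_whole[OF joint_smooth_vector_derivative(1)[OF openin_whole s]]
    by (simp add: b_def)
  moreover have "continuous_map euclidean (prod_topology ?X euclidean) (\<lambda>s::real. (0, s))"
    by (rule continuous_map_pairedI) auto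
  ultimately have "continuous_map euclidean euclidean ((\<lambda>p. b (snd p)) \<circ> (\<lambda>s::real. (0::real, s)))"
    by (rule continuous_map_compose[rotated])
  then have "continuous_on UNIV b" by (simp add: o_def)
  then have "compact (b ` {-2..2})" by (intro compact_continuous_image) (auto intro: continuous_on_subset)
  then obtain B where B: "\<And>t. t \<in> {-2..2} \<Longrightarrow> \<bar>b t\<bar> \<le> B"
    by (metis bounded_iff compact_imp_bounded image_eqI real_norm_def)
  have "b t = 0" if "t \<notin> {-2..2}" for t
  proof -
    have "open (- {-1..1::real})" "t \<in> - {-1..1}" using that by auto
    moreover have "bump y = 0" if "y \<in> - {-1..1}" for y using that by (intro bump_0) auto
    moreover have "((\<lambda>_. 0) has_vector_derivative (0::real)) (at t)" by simp
    ultimately have "(bump has_vector_derivative 0) (at t)"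
      by (metis has_vector_derivative_transform_within_open)
    then show ?thesis unfolding b_def by (rule vector_derivative_at)
  qed
  then have "\<bar>b t\<bar> \<le> max 1 B" for t using B[of t] by (cases "t \<in> {-2..2}") auto
  then show ?thesis using d by (intro exI[of _ "max 1 B"]) auto
qed

section \<open>Embedded circles in the sphere\<close>

definition axis_vec :: "'n::finite \<Rightarrow> real^('n option)" where
  "axis_vec a = axis (Some a) 1"

text \<open>The great circle through \<open>pt_inf\<close> in the direction of the long axis, which
  is the compactification of the unknotted long knot \<open>x \<mapsto> axis a x\<close>.\<close>
definition great_circle :: "'n::finite \<Rightarrow> real^(1 option) \<Rightarrow> real^('n option)" where
  "great_circle a z = (z $ Some 1) *\<^sub>R axis_vec a + (z $ None) *\<^sub>R pt_inf"

lemma frame_nth [simp]: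
  "pt_inf $ None = 1" "pt_inf $ Some i = 0" "axis_vec a $ None = 0" "axis_vec a $ Some a = 1"
  by (simp_all add: pt_inf_def axis_vec_def axis_def)

lemma axis_vec_nth: "axis_vec a $ Some i = (if i = a then 1 else 0)"
  by (simp add: axis_vec_def axis_def)

lemma frame_norm [simp]: "norm pt_inf = 1" "norm (axis_vec a) = 1"
  by (simp_all add: pt_inf_def axis_vec_def norm_axis_1)

lemma great_circle_nth [simp]:
  "great_circle a z $ None = z $ None" "great_circle a z $ Some a = z $ Some 1"
  by (simp_all add: great_circle_def)

lemma circle_point_nth [simp]: "circle_point t $ None = cos t" "circle_point t $ Some i = sin t"
  by (simp_all add: circle_point_def)

lemma circle_eq_iff: "(z :: real^(1 option)) = w \<longleftrightarrow> z $ None = w $ None \<and> z $ Some 1 = w $ Some 1"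
  by (auto simp: vec_eq_iff split_option_all)

lemma circle_norm: "(norm (z :: real^(1 option)))\<^sup>2 = (z $ None)\<^sup>2 + (z $ Some 1)\<^sup>2"
  by (simp add: norm_vec_def L2_set_def sum_option sum_nonneg)

lemma circle_point_sphere [simp]: "norm (circle_point t) = 1"
proof -
  have "(norm (circle_point t))\<^sup>2 = 1" by (simp add: circle_norm)
  then show ?thesis by (metis norm_ge_zero one_power2 power2_eq_iff_nonneg zero_le_one)
qed

lemma circle_point_0 [simp]: "circle_point 0 = pt_inf"
  by (simp add: circle_eq_iff)

lemma circle_point_as_sum: "circle_point t = sin t *\<^sub>R axis_vec 1 + cos t *\<^sub>R pt_inf"
  by (simp add: circle_eq_iff)

lemma circle_point_periodic [simp]: "circle_point (t + 2 * pi) = circle_point t"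
  "circle_point (t - 2 * pi) = circle_point t"
  by (simp_all add: circle_eq_iff cos_diff sin_diff)

lemma circle_point_surj:
  assumes "norm z = 1"
  obtains t where "- pi < t" "t \<le> pi" "z = circle_point t"
proof -
  have "(z $ None)\<^sup>2 + (z $ Some 1)\<^sup>2 = 1" using assms circle_norm[of z] by simp
  then obtain t where t: "0 \<le> t" "t < 2 * pi" "z $ None = cos t" "z $ Some 1 = sin t"
    using sincos_total_2pi by blast
  show ?thesis
  proof (cases "t \<le> pi")
    case True
    then show ?thesis using t that[of t] pi_gt_zero by (auto simp: circle_eq_iff)
  next
    case False
    then show ?thesis using t that[of "t - 2 * pi"]
      by (auto simp: circle_eq_iff cos_diff sin_diff)
  qed
qed

lemma circle_point_inj:
  assumes "circle_point s = circle_point t" "- pi < s" "s \<le> pi" "- pi < t" "t \<le> pi"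
  shows "s = t"
proof -
  have "sin s = sin t" "cos s = cos t" using assms(1) by (auto simp: circle_eq_iff)
  then obtain n :: int where n: "s = t + 2 * pi * n" using sin_cos_eq_iff[of s t] by (auto simp: algebra_simps)
  have "\<bar>2 * pi * n\<bar> < 2 * pi" using n assms by linarith
  then have "\<bar>real_of_int n\<bar> < 1" by (simp add: abs_mult)
  then show ?thesis using n by auto
qed

lemma circle_point_eq_pt_inf_iff: "- pi < t \<Longrightarrow> t \<le> pi \<Longrightarrow> circle_point t = pt_inf \<longleftrightarrow> t = 0"
  using circle_point_inj[of t 0] pi_gt_zero by auto

lemma circle_point_derivative:
  "(circle_point has_vector_derivative (cos t *\<^sub>R axis_vec 1 - sin t *\<^sub>R pt_inf)) (at t)"
proof -
  have "((\<lambda>t. sin t *\<^sub>R axis_vec 1 + cos t *\<^sub>R pt_inf) has_vector_derivative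
      cos t *\<^sub>R axis_vec 1 + (- sin t) *\<^sub>R (pt_inf :: real^(1 option))) (at t)"
    by (intro has_vector_derivative_add; rule has_vector_derivative_scaleR[THEN has_vector_derivative_eq_rhs])
      (auto intro!: derivative_eq_intros)
  then show ?thesis by (simp add: circle_point_as_sum[abs_def])
qed

lemma great_circle_linear: "bounded_linear (great_circle a)"
  unfolding great_circle_def[abs_def]
  by (intro bounded_linear_add bounded_linear_scaleR_const bounded_linear_vec_nth)

lemma great_circle_norm [simp]: "norm (great_circle a z) = norm z"
proof -
  have "proj_finite (great_circle a z) = (z $ Some 1) *\<^sub>R axis a 1"
    by (simp add: vec_eq_iff proj_finite_def great_circle_def axis_vec_nth axis_def)
  then have "(norm (great_circle a z))\<^sup>2 = (norm z)\<^sup>2"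
    by (simp add: norm_option[of "great_circle a z"] circle_norm norm_axis_1 power_mult_distrib)
  then show ?thesis by simp
qed

lemma great_circle_inj: "great_circle a z = great_circle a w \<longleftrightarrow> z = w"
  by (metis circle_eq_iff great_circle_nth)

lemma joint_smooth_circle_point:
  assumes W: "openin (prod_topology X euclidean) W" and v: "joint_smooth X W v"
  shows "joint_smooth X W (\<lambda>x t. circle_point (v x t))"
  unfolding circle_point_as_sum
  by (intro joint_smooth_add joint_smooth_scaleR joint_smooth_sin joint_smooth_cos joint_smooth_const W v)

text \<open>\<open>circle_point\<close> maps a compact interval onto the circle, so it is a quotient
  map there.\<close>
lemma loop_continuous:
  assumes "continuous_on UNIV (g \<circ> circle_point)"
  shows "continuous_map (top_of_set (unit_sphere :: (real^(1 option)) set)) euclidean g"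
proof -
  let ?I = "top_of_set {-pi..pi}" and ?S = "top_of_set (unit_sphere :: (real^(1 option)) set)"
  have c: "continuous_map ?I ?S circle_point"
    using has_vector_derivative_continuous[OF circle_point_derivative]
    by (auto simp: continuous_map_in_subtopology intro!: continuous_at_imp_continuous_on)
  have "closed_map ?I ?S circle_point"
    by (rule continuous_imp_closed_map[OF c])
      (auto simp: compact_space_subtopology intro: Hausdorff_space_subtopology)
  moreover have "circle_point ` {-pi..pi} = unit_sphere"
  proof (intro equalityI subsetI)
    fix z :: "real^(1 option)" assume "z \<in> unit_sphere"
    then obtain t where "- pi < t" "t \<le> pi" "z = circle_point t" using circle_point_surj[of z] by auto
    then show "z \<in> circle_point ` {-pi..pi}" by auto
  qed auto
  ultimately have q: "quotient_map ?I ?S circle_point"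
    using c by (intro continuous_closed_imp_quotient_map) auto
  show ?thesis
    by (rule continuous_compose_quotient_map[OF q])
      (use assms in \<open>auto intro: continuous_on_subset\<close>)
qed

lemma smooth_curve_continuous: "smooth_curve f \<Longrightarrow> continuous_on UNIV f"
  unfolding smooth_curve_def
  by (metis continuous_at_imp_continuous_on differentiable_imp_continuous_within nth_vderiv_0)

text \<open>The circle is compact and the sphere is Hausdorff, so an injective continuous map is
  automatically an embedding.\<close>
lemma circle_embeddingI:
  fixes g :: "real^(1 option) \<Rightarrow> real^('n::finite option)"
  assumes "g \<in> extensional unit_sphere" "smooth_curve (g \<circ> circle_point)"
    "\<And>t. vector_derivative (g \<circ> circle_point) (at t) \<noteq> 0"
    "\<And>z. norm z = 1 \<Longrightarrow> norm (g z) = 1" "\<And>z w. norm z = 1 \<Longrightarrow> norm w = 1 \<Longrightarrow> g z = g w \<Longrightarrow> z = w"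
  shows "g \<in> circle_embeddings"
proof -
  have m: "g ` unit_sphere \<subseteq> unit_sphere" using assms(4) by auto
  then have c: "continuous_map (top_of_set unit_sphere) (top_of_set unit_sphere) g"
    using loop_continuous[OF smooth_curve_continuous[OF assms(2)]]
    by (auto simp: continuous_map_in_subtopology)
  have "closed_map (top_of_set unit_sphere) (top_of_set unit_sphere) g"
    by (rule continuous_imp_closed_map[OF c])
      (auto simp: compact_space_subtopology intro: Hausdorff_space_subtopology)
  moreover have "inj_on g unit_sphere" using assms(5) by (auto intro!: inj_onI)
  ultimately have "embedding_map (top_of_set unit_sphere) (top_of_set unit_sphere) g"
    using c by (intro injective_closed_imp_embedding_map) auto
  then show ?thesis using assms m by (simp add: circle_embeddings_def)
qed

lemma circle_embeddingD:
  fixes g :: "real^(1 option) \<Rightarrow> real^('n::finite option)"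
  assumes "g \<in> circle_embeddings"
  shows "g \<in> extensional unit_sphere" "smooth_curve (g \<circ> circle_point)"
    "vector_derivative (g \<circ> circle_point) (at t) \<noteq> 0"
    "norm z = 1 \<Longrightarrow> norm (g z) = 1" "norm z = 1 \<Longrightarrow> norm w = 1 \<Longrightarrow> g z = g w \<Longrightarrow> z = w"
proof -
  have *: "embedding_map (top_of_set unit_sphere) (top_of_set unit_sphere) g" "g ` unit_sphere \<subseteq> unit_sphere"
    using assms by (auto simp: circle_embeddings_def)
  show "g \<in> extensional unit_sphere" "smooth_curve (g \<circ> circle_point)"
    "vector_derivative (g \<circ> circle_point) (at t) \<noteq> 0"
    using assms by (auto simp: circle_embeddings_def)
  show "norm z = 1 \<Longrightarrow> norm (g z) = 1" using *(2) by (simp add: image_subset_iff)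
  show "norm z = 1 \<Longrightarrow> norm w = 1 \<Longrightarrow> g z = g w \<Longrightarrow> z = w"
    using *(1) inj_onD[of g unit_sphere z w]
    by (auto simp: embedding_map_def homeomorphic_eq_everything_map)
qed

lemma topspace_Cinf [simp]: "topspace (Cinf_topology :: (real \<Rightarrow> 'a::real_normed_vector) topology) = UNIV"
proof -
  have "{f. \<forall>t\<in>{}. nth_vderiv 0 f t \<in> (UNIV :: 'a set)} \<in>
      {{f. \<forall>t\<in>C. nth_vderiv k f t \<in> U} | k C U. compact C \<and> open U}"
    by (rule CollectI, rule exI[of _ 0], rule exI[of _ "{}"], rule exI[of _ UNIV]) simp
  then show ?thesis unfolding Cinf_topology_def topology_generated_by_topspace by auto
qed

lemma topspace_Emb [simp]: "topspace Emb = circle_embeddings"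
  by (simp add: Emb_def topspace_pullback_topology)

text \<open>The interface between the topology of \<open>Emb\<close> and families of curves: from
  here on, continuity of maps into and out of \<open>Emb\<close> is a statement about
  \<open>joint_smooth\<close>.\<close>
lemma continuous_map_EmbI:
  assumes "\<And>x. x \<in> topspace X \<Longrightarrow> F x \<in> circle_embeddings"
    and "joint_smooth X (topspace X \<times> UNIV) (\<lambda>x t. F x (circle_point t))"
  shows "continuous_map X Emb F"
  unfolding Emb_def
proof (rule continuous_map_pullback')
  show "continuous_map X Cinf_topology ((\<lambda>g. g \<circ> circle_point) \<circ> F)"
    using joint_smooth_imp_Cinf(2)[OF assms(2)] by (simp add: o_def)
qed (use assms(1) in auto)

lemma continuous_map_EmbD:
  assumes "continuous_map X Emb F"
  shows "joint_smooth X (topspace X \<times> UNIV) (\<lambda>x t. F x (circle_point t))"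
proof (rule Cinf_imp_joint_smooth)
  have "continuous_map Emb Cinf_topology (id \<circ> (\<lambda>g. g \<circ> circle_point))"
    unfolding Emb_def by (rule continuous_map_pullback[OF continuous_map_id])
  from continuous_map_compose[OF assms this]
  show "continuous_map X Cinf_topology (\<lambda>x t. F x (circle_point t))" by (simp add: o_def)
  fix x assume "x \<in> topspace X"
  then have "F x \<in> circle_embeddings" using continuous_map_image_subset_topspace[OF assms] by auto
  then show "smooth_curve (\<lambda>t. F x (circle_point t))"
    using circle_embeddingD(2) by (simp add: o_def)
qed

section \<open>Rotating embedded circles\<close>

lemma bounded_bilinear_matrix_vector: "bounded_bilinear ((*v) :: real^'n::finite^'m::finite \<Rightarrow> real^'n \<Rightarrow> real^'m)"
  unfolding bilinear_conv_bounded_bilinear[symmetric] bilinear_def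
  by (auto intro!: linearI simp: matrix_vector_mult_add_rdistrib matrix_vector_right_distrib
      matrix_vector_mult_scaleR scaleR_matrix_vector_assoc)

lemma SO_succ_norm: "A \<in> SO_succ \<Longrightarrow> norm (A *v v) = norm v"
  by (simp add: SO_succ_def rotation_matrix_def orthogonal_transformation_matrix orthogonal_transformation_norm)

lemma SO_succ_transpose: "A \<in> SO_succ \<Longrightarrow> transpose A \<in> SO_succ"
  and SO_succ_mult: "A \<in> SO_succ \<Longrightarrow> B \<in> SO_succ \<Longrightarrow> A ** B \<in> SO_succ"
  and SO_succ_one [simp]: "mat 1 \<in> SO_succ"
  and SO_succ_inverse: "A \<in> SO_succ \<Longrightarrow> transpose A ** A = mat 1" "A \<in> SO_succ \<Longrightarrow> A ** transpose A = mat 1"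
  using orthogonal_matrix_mul[of A B]
  by (auto simp: SO_succ_def rotation_matrix_def det_mul orthogonal_matrix_id)
    (simp_all add: orthogonal_matrix_def)

lemma SO_succ_cancel: "A \<in> SO_succ \<Longrightarrow> transpose A *v (A *v v) = v" "A \<in> SO_succ \<Longrightarrow> A *v (transpose A *v v) = v"
  by (simp_all only: matrix_vector_mul_assoc SO_succ_inverse matrix_vector_mul_lid)

lemma loop_derivative:
  assumes "g \<in> circle_embeddings"
  shows "((\<lambda>t. g (circle_point t)) has_vector_derivative vector_derivative (\<lambda>t. g (circle_point t)) (at t)) (at t)"
proof -
  have "nth_vderiv 0 (g \<circ> circle_point) differentiable (at t)"
    using circle_embeddingD(2)[OF assms] unfolding smooth_curve_def by blast
  then show ?thesis by (simp add: vector_derivative_works o_def)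
qed

lemma loop_immersed: "g \<in> circle_embeddings \<Longrightarrow> vector_derivative (\<lambda>t. g (circle_point t)) (at t) \<noteq> 0"
  using circle_embeddingD(3)[of g t] by (simp add: o_def)

lemma rotate_embedding_loop: "rotate_embedding A g (circle_point t) = A *v g (circle_point t)"
  by (simp add: rotate_embedding_def)

lemma rotate_embedding_derivative:
  assumes "g \<in> circle_embeddings"
  shows "vector_derivative (\<lambda>t. rotate_embedding A g (circle_point t)) (at t) =
     A *v vector_derivative (\<lambda>t. g (circle_point t)) (at t)"
  unfolding rotate_embedding_loop
  by (intro vector_derivative_at bounded_linear.has_vector_derivative[OF _ loop_derivative[OF assms]]) auto

lemma rotate_embedding_continuous:
  shows "continuous_map (prod_topology (top_of_set (SO_succ :: 'a::finite succ_matrix set)) Emb) Emb (\<lambda>(A, g). rotate_embedding A g)"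
    and "\<And>(A :: 'a succ_matrix) g. A \<in> SO_succ \<Longrightarrow> g \<in> circle_embeddings \<Longrightarrow> rotate_embedding A g \<in> circle_embeddings"
proof -
  let ?X = "prod_topology (top_of_set (SO_succ :: 'a succ_matrix set)) (Emb :: (_ \<Rightarrow> real^('a option)) topology)"
  have c: "continuous_map ?X euclidean fst"
    by (rule continuous_map_into_fulltopology[OF continuous_map_fst])
  have s: "joint_smooth ?X (topspace ?X \<times> UNIV) (\<lambda>x t. fst x *v snd x (circle_point t))"
    by (intro joint_smooth_bilinear[OF bounded_bilinear_matrix_vector] joint_smooth_param[OF c]
        continuous_map_EmbD[OF continuous_map_snd])
  have e: "(\<lambda>(A, g). rotate_embedding A g) = (\<lambda>x. rotate_embedding (fst x) (snd x))"
    by auto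
  have inj: "v = w" if "A \<in> SO_succ" "A *v v = A *v w" for A :: "'a succ_matrix" and v w
  proof -
    have "transpose A *v (A *v v) = transpose A *v (A *v w)" by (simp only: that(2))
    then show ?thesis by (simp only: SO_succ_cancel(1)[OF that(1)])
  qed
  have nz: "vector_derivative (\<lambda>t. rotate_embedding A g (circle_point t)) (at t) \<noteq> 0"
    if "A \<in> SO_succ" "g \<in> circle_embeddings" for A :: "'a succ_matrix" and g t
  proof -
    have "norm (A *v vector_derivative (\<lambda>t. g (circle_point t)) (at t)) \<noteq> 0"
      unfolding SO_succ_norm[OF that(1)] using loop_immersed[OF that(2), of t] by simp
    then show ?thesis unfolding rotate_embedding_derivative[OF that(2)] by force
  qed
  have mem: "rotate_embedding A g \<in> circle_embeddings" if A: "A \<in> SO_succ" and g: "g \<in> circle_embeddings" for A :: "'a succ_matrix" and g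
  proof (rule circle_embeddingI)
    show "smooth_curve (rotate_embedding A g \<circ> circle_point)"
      using joint_smooth_imp_Cinf(1)[OF s, of "(A, g)"] A g by (simp add: o_def rotate_embedding_loop)
    show "vector_derivative (rotate_embedding A g \<circ> circle_point) (at t) \<noteq> 0" for t
      using nz[OF A g, of t] by (simp add: o_def)
    show "z = w" if "norm z = 1" "norm w = 1" "rotate_embedding A g z = rotate_embedding A g w" for z w
      using that inj[OF A, of "g z" "g w"] circle_embeddingD(5)[OF g, of z w]
      by (simp add: rotate_embedding_def)
  qed (simp_all add: rotate_embedding_def SO_succ_norm[OF A] circle_embeddingD(4)[OF g])
  show "rotate_embedding A g \<in> circle_embeddings" if "A \<in> SO_succ" "g \<in> circle_embeddings" for A :: "'a succ_matrix" and g
    by (rule mem[OF that])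
  show "continuous_map ?X Emb (\<lambda>(A, g). rotate_embedding A g)" unfolding e
    by (rule continuous_map_EmbI) (use mem s in \<open>simp_all add: rotate_embedding_loop mem_Times_iff\<close>)
qed

section \<open>Dilations of the sphere\<close>

text \<open>The denominator of \<open>dilate\<close>; it is positive on the unit sphere when
  \<open>k > 0\<close>.\<close>
definition dil_den :: "real \<Rightarrow> real^('d::finite option) \<Rightarrow> real" where
  "dil_den k v = (1 + v $ None) + k\<^sup>2 * (1 - v $ None)"

text \<open>In the stereographic chart centred at \<open>pt_inf\<close>, where \<open>pt_inf\<close>
  is the origin, this is multiplication by \<open>k\<close>. Equivalently it divides the coordinate
  \<open>stereo\<close> by \<open>k\<close>. The formula involves no chart and is visibly smooth in
  \<open>k\<close> and \<open>v\<close>.\<close>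
definition dilate :: "real \<Rightarrow> real^('d::finite option) \<Rightarrow> real^('d option)" where
  "dilate k v = (1 / dil_den k v) *\<^sub>R
     ((2 * k) *\<^sub>R (v - (v $ None) *\<^sub>R pt_inf) + ((1 + v $ None) - k\<^sup>2 * (1 - v $ None)) *\<^sub>R pt_inf)"

lemma sphere_None_bound:
  fixes v :: "real^('n::finite option)"
  shows "norm v = 1 \<Longrightarrow> \<bar>v $ None\<bar> \<le> 1"
  using component_le_norm_cart[of v None] by simp

lemma dil_den_pos:
  assumes "k > 0" "norm v = 1" shows "dil_den k v > 0"
proof -
  have b: "-1 \<le> v $ None" "v $ None \<le> 1" using sphere_None_bound[OF assms(2)] by auto
  show ?thesis
  proof (cases "v $ None = 1")
    case False
    then have "k\<^sup>2 * (1 - v $ None) > 0" using assms b by (intro mult_pos_pos) auto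
    then show ?thesis using b unfolding dil_den_def by linarith
  qed (simp add: dil_den_def)
qed

lemma dilate_nth:
  "dilate k v $ None = ((1 + v $ None) - k\<^sup>2 * (1 - v $ None)) / dil_den k v"
  "dilate k v $ Some i = 2 * k * v $ Some i / dil_den k v"
  by (simp_all add: dilate_def)

lemma dilate_norm [simp]:
  assumes "k > 0" "norm v = 1" shows "norm (dilate k v) = 1"
proof -
  let ?D = "dil_den k v"
  have D: "?D > 0" by (rule dil_den_pos[OF assms])
  have p: "proj_finite (dilate k v) = (2 * k / ?D) *\<^sub>R proj_finite v"
    by (simp add: vec_eq_iff proj_finite_def dilate_nth)
  have f: "(norm (proj_finite v))\<^sup>2 = 1 - (v $ None)\<^sup>2" using norm_option[of v] assms by simp
  have "(norm (dilate k v))\<^sup>2 =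
      (((1 + v $ None) - k\<^sup>2 * (1 - v $ None)) / ?D)\<^sup>2 + (2 * k / ?D)\<^sup>2 * (1 - (v $ None)\<^sup>2)"
    by (simp add: norm_option[of "dilate k v"] p power_mult_distrib power_divide f dilate_nth)
  also have "\<dots> = (((1 + v $ None) - k\<^sup>2 * (1 - v $ None))\<^sup>2 + (2 * k)\<^sup>2 * (1 - (v $ None)\<^sup>2)) / ?D\<^sup>2"
    by (simp add: power_divide add_divide_distrib)
  also have "((1 + v $ None) - k\<^sup>2 * (1 - v $ None))\<^sup>2 + (2 * k)\<^sup>2 * (1 - (v $ None)\<^sup>2) = ?D\<^sup>2"
    by (simp add: dil_den_def power2_eq_square algebra_simps)
  finally have "(norm (dilate k v))\<^sup>2 = 1" using D by simp
  then show ?thesis by (metis norm_ge_zero one_power2 power2_eq_iff_nonneg zero_le_one)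
qed

text \<open>The dilations form a one-parameter group, as they multiply one stereographic coordinate;
  in particular \<open>dilate (1 / k)\<close> is inverse to \<open>dilate k\<close>.\<close>
lemma dilate_dilate:
  assumes "j > 0" "k > 0" "norm v = 1"
  shows "dilate j (dilate k v) = dilate (j * k) v"
proof -
  let ?D = "dil_den k v" and ?v = "v $ None"
  have D: "?D \<noteq> 0" "dil_den (j * k) v \<noteq> 0" using dil_den_pos[of k v] dil_den_pos[of "j * k" v] assms by auto
  have e1: "1 + dilate k v $ None = 2 * (1 + ?v) / ?D" "1 - dilate k v $ None = 2 * k\<^sup>2 * (1 - ?v) / ?D"
    unfolding dilate_nth using D by (simp_all add: field_simps) (simp_all add: dil_den_def algebra_simps)
  have e: "dil_den j (dilate k v) = 2 * dil_den (j * k) v / ?D"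
    unfolding dil_den_def[of j] e1 using D
    by (simp add: dil_den_def[of "j * k"] field_simps power_mult_distrib)
  have "dilate j (dilate k v) $ i = dilate (j * k) v $ i" for i
  proof (cases i)
    case None
    have "dilate j (dilate k v) $ None = (2 * (1 + ?v) / ?D - j\<^sup>2 * (2 * k\<^sup>2 * (1 - ?v) / ?D)) / (2 * dil_den (j * k) v / ?D)"
      unfolding dilate_nth(1)[of j] e e1 ..
    also have "\<dots> = ((1 + ?v) - (j * k)\<^sup>2 * (1 - ?v)) / dil_den (j * k) v"
      using D by (simp add: field_simps power_mult_distrib)
    finally show ?thesis unfolding None dilate_nth(1)[of "j * k"] .
  next
    case (Some l)
    show ?thesis unfolding Some dilate_nth(2) e using D by (simp add: field_simps)
  qed
  then show ?thesis by (simp add: vec_eq_iff)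
qed

lemma dilate_1 [simp]: "dilate 1 v = v"
  by (simp add: dilate_def dil_den_def algebra_simps)

lemma dilate_inverse: "k > 0 \<Longrightarrow> norm v = 1 \<Longrightarrow> dilate (1 / k) (dilate k v) = v"
  by (simp add: dilate_dilate)

lemma dilate_pt_inf [simp]: "dilate k pt_inf = pt_inf"
  by (simp add: dilate_def dil_den_def)

lemma dilate_great_circle: "dilate k (great_circle a z) = great_circle a (dilate k z)"
proof -
  have e: "dil_den k (great_circle a z) = dil_den k z" by (simp add: dil_den_def)
  have "dilate k (great_circle a z) $ i = great_circle a (dilate k z) $ i" for i
  proof (cases i)
    case None then show ?thesis by (simp add: dilate_nth e)
  next
    case (Some l)
    have "great_circle a w $ Some l = (if l = a then w $ Some 1 else 0)" for w
      by (simp add: great_circle_def axis_vec_nth)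
    then show ?thesis unfolding Some dilate_nth(2) e by (simp add: dilate_nth)
  qed
  then show ?thesis by (simp add: vec_eq_iff)
qed

lemma SO_mid_None: "A \<in> SO_mid \<Longrightarrow> (A *v v) $ None = v $ None"
  and SO_mid_pt_inf: "A \<in> SO_mid \<Longrightarrow> A *v pt_inf = pt_inf"
  and SO_mid_SO_succ: "A \<in> SO_mid \<Longrightarrow> A \<in> SO_succ"
  using SO_mid_mult_nth(1) by (auto simp: SO_mid_def)

lemma dilate_rotate: "A \<in> SO_mid \<Longrightarrow> dilate k (A *v v) = A *v dilate k v"
  by (simp add: dilate_def dil_den_def SO_mid_None SO_mid_pt_inf matrix_vector_mult_scaleR
      matrix_vector_right_distrib matrix_vector_mult_diff_distrib)

lemma joint_smooth_dilate:
  assumes "joint_smooth X W k" "joint_smooth X W v"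
    "\<And>x t. (x, t) \<in> W \<Longrightarrow> k x t > 0" "\<And>x t. (x, t) \<in> W \<Longrightarrow> norm (v x t) = 1"
  shows "joint_smooth X W (\<lambda>x t. dilate (k x t) (v x t))"
proof -
  have n: "joint_smooth X W (\<lambda>x t. v x t $ None)"
    by (rule joint_smooth_linear[OF bounded_linear_vec_nth assms(2)])
  have d: "joint_smooth X W (\<lambda>x t. dil_den (k x t) (v x t))"
    unfolding dil_den_def power2_eq_square
    by (intro joint_smooth_add joint_smooth_mult joint_smooth_diff joint_smooth_const n assms(1))
  have nz: "dil_den (k x t) (v x t) \<noteq> 0" if "(x, t) \<in> W" for x t
    using dil_den_pos[OF assms(3)[OF that] assms(4)[OF that]] by simp
  show ?thesis unfolding dilate_def power2_eq_square
    by (intro nz joint_smooth_scaleR joint_smooth_divide joint_smooth_add joint_smooth_mult joint_smooth_diff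
        joint_smooth_const n d assms(1,2))
qed

lemma dilate_differentiable:
  assumes "dil_den k v \<noteq> 0"
  shows "\<exists>L. (dilate k has_derivative L) (at v)"
proof -
  have n: "((\<lambda>v. v $ None) has_derivative (\<lambda>v. v $ None)) (at v)" for v :: "real^('a option)"
    by (rule bounded_linear_imp_has_derivative[OF bounded_linear_vec_nth])
  have d: "(dil_den k has_derivative (\<lambda>w. w $ None + k\<^sup>2 * (- (w $ None)))) (at v)"
    unfolding dil_den_def[abs_def] by (auto intro!: derivative_eq_intros n)
  show ?thesis unfolding dilate_def[abs_def]
    by (rule exI) (rule has_derivative_scaleR has_derivative_divide has_derivative_const has_derivative_add
      has_derivative_diff has_derivative_ident has_derivative_mult n d assms)+
qed

text \<open>If a velocity \<open>w\<close> were mapped to \<open>0\<close>, then applying the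
  inverse dilation would make \<open>w\<close> itself zero.\<close>
lemma dilate_immersed:
  assumes k: "k > 0" and s: "\<And>s. norm (u s) = 1" and u: "(u has_vector_derivative w) (at t)" and w: "w \<noteq> 0"
  obtains w' where "((\<lambda>s. dilate k (u s)) has_vector_derivative w') (at t)" "w' \<noteq> 0"
proof -
  have "dil_den k (u t) \<noteq> 0" "dil_den (1 / k) (dilate k (u t)) \<noteq> 0"
    using dil_den_pos[OF k s[of t]] dil_den_pos[of "1 / k" "dilate k (u t)"] k s[of t] by auto
  then obtain L L' where L: "(dilate k has_derivative L) (at (u t))"
    and L': "(dilate (1 / k) has_derivative L') (at (dilate k (u t)))"
    using dilate_differentiable by blast
  have 1: "((\<lambda>s. dilate k (u s)) has_vector_derivative L w) (at t)"
    using vector_derivative_diff_chain_within[of u w t UNIV "dilate k" L] u has_derivative_at_withinI[OF L]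
    by (simp add: o_def)
  have "L w \<noteq> 0"
  proof
    assume 0: "L w = 0"
    have "((\<lambda>s. dilate (1 / k) (dilate k (u s))) has_vector_derivative L' (L w)) (at t)"
      using vector_derivative_diff_chain_within[of "\<lambda>s. dilate k (u s)" "L w" t UNIV "dilate (1 / k)" L'] 1
        has_derivative_at_withinI[OF L'] by (simp add: o_def)
    then have "(u has_vector_derivative L' (L w)) (at t)" using dilate_inverse[OF k s] by simp
    then have "w = L' 0" using vector_derivative_unique_at[OF u] 0 by simp
    then show False using w linear_0[OF has_derivative_linear[OF L']] by simp
  qed
  then show ?thesis using 1 that by blast
qed

lemma dilate_velocity:
  assumes u: "(u has_vector_derivative w) (at t)" and N: "u t = pt_inf" and w: "w $ None = 0"
  shows "((\<lambda>s. dilate k (u s)) has_vector_derivative k *\<^sub>R w) (at t)"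
proof -
  have n: "((\<lambda>s. u s $ None) has_real_derivative 0) (at t)"
    using bounded_linear.has_vector_derivative[OF bounded_linear_vec_nth u, of None] w
    by (simp add: has_real_derivative_iff_has_vector_derivative)
  have d: "((\<lambda>s. 1 / dil_den k (u s)) has_real_derivative 0) (at t)"
    unfolding dil_den_def using n N by (auto intro!: derivative_eq_intros)
  have v: "((\<lambda>s. (2 * k) *\<^sub>R (u s - (u s $ None) *\<^sub>R pt_inf) + ((1 + u s $ None) - k\<^sup>2 * (1 - u s $ None)) *\<^sub>R pt_inf)
     has_vector_derivative (2 * k) *\<^sub>R w) (at t)"
  proof -
    have a: "((\<lambda>s. (u s $ None) *\<^sub>R pt_inf) has_vector_derivative 0) (at t)"
      using has_vector_derivative_scaleR[OF n has_vector_derivative_const[of pt_inf]] by simp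
    have b: "((\<lambda>s. (1 + u s $ None) - k\<^sup>2 * (1 - u s $ None)) has_real_derivative 0) (at t)"
      using n by (auto intro!: derivative_eq_intros)
    have c: "((\<lambda>s. ((1 + u s $ None) - k\<^sup>2 * (1 - u s $ None)) *\<^sub>R pt_inf) has_vector_derivative 0) (at t)"
      using has_vector_derivative_scaleR[OF b has_vector_derivative_const[of pt_inf]] by simp
    have "((\<lambda>s. (2 * k) *\<^sub>R (u s - (u s $ None) *\<^sub>R pt_inf)) has_vector_derivative (2 * k) *\<^sub>R (w - 0)) (at t)"
      by (intro bounded_linear.has_vector_derivative[OF bounded_linear_scaleR_right] has_vector_derivative_diff u a)
    from has_vector_derivative_add[OF this c] show ?thesis by simp
  qed
  show ?thesis
    using has_vector_derivative_scaleR[OF d v] N unfolding dilate_def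
    by (simp add: dil_den_def)
qed

text \<open>A lift of \<open>dilate k\<close> on the circle through \<open>circle_point\<close>.
  Since \<open>dilate k\<close> multiplies \<open>tan (t/2)\<close> by \<open>k\<close>, the new angle
  differs from \<open>t\<close> by twice the difference of two arctangents; the addition theorem for
  the tangent turns this difference into one \<open>arctan\<close> of a quotient with positive
  denominator, which is smooth for all \<open>t\<close>.\<close>
definition circle_lift :: "real \<Rightarrow> real \<Rightarrow> real" where
  "circle_lift k t = t + 2 * arctan ((k - 1) * sin t / ((1 + cos t) + k * (1 - cos t)))"

lemma circle_lift_den_pos:
  assumes "k > 0" shows "(1 + cos t) + k * (1 - cos t) > (0::real)"
proof (cases "cos t = 1")
  case False
  then have "k * (1 - cos t) > 0" using assms cos_le_one[of t] by (intro mult_pos_pos) (auto simp: less_le)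
  then show ?thesis using cos_ge_minus_one[of t] by linarith
qed simp

text \<open>The tangent of half the increment is the rational expression \<open>x\<close> below; the
  double-angle formulas then reduce both coordinates to polynomial identities in \<open>sin t\<close>
  and \<open>cos t\<close>.\<close>
lemma circle_point_lift:
  assumes k: "k > 0"
  shows "circle_point (circle_lift k t) = dilate k (circle_point t)"
proof -
  define S C E where "S = sin t" and "C = cos t" and "E = (1 + cos t) + k * (1 - cos t)"
  define x where "x = (k - 1) * S / E"
  define D where "D = (1 + C) + k\<^sup>2 * (1 - C)"
  have E: "E > 0" unfolding E_def by (rule circle_lift_den_pos[OF k])
  have SC: "S\<^sup>2 = 1 - C\<^sup>2" unfolding S_def C_def by (simp add: sin_squared_eq)
  have D: "D > 0" using dil_den_pos[OF k circle_point_sphere[of t]] by (simp add: D_def dil_den_def C_def)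
  have p: "1 + x\<^sup>2 > 0" by (simp add: add_pos_nonneg)
  have EE: "E\<^sup>2 + ((k - 1) * S)\<^sup>2 = 2 * D"
    unfolding power_mult_distrib SC by (simp add: E_def D_def C_def[symmetric] power2_eq_square algebra_simps)
  have x1: "1 + x\<^sup>2 = 2 * D / E\<^sup>2"
    unfolding x_def EE[symmetric] using E by (simp add: power_divide field_simps)
  have c2: "cos (2 * arctan x) = (1 - x\<^sup>2) / (1 + x\<^sup>2)" and s2: "sin (2 * arctan x) = 2 * x / (1 + x\<^sup>2)"
    using p by (simp_all add: cos_double sin_double cos_arctan sin_arctan power_divide diff_divide_distrib)
  have c3: "(1 - x\<^sup>2) / (1 + x\<^sup>2) = (E\<^sup>2 - ((k - 1) * S)\<^sup>2) / (2 * D)"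
    unfolding x1 using E D by (simp add: x_def power_divide field_simps)
  have s3: "2 * x / (1 + x\<^sup>2) = (2 * (k - 1) * S * E) / (2 * D)"
    unfolding x1 using E D by (simp add: x_def power2_eq_square field_simps)
  have l: "circle_lift k t = t + 2 * arctan x" by (simp add: circle_lift_def x_def S_def E_def)
  have "sin (circle_lift k t) = (S * (E\<^sup>2 - (k - 1)\<^sup>2 * S\<^sup>2) + C * (2 * (k - 1) * S * E)) / (2 * D)"
    unfolding l sin_add c2 s2 c3 s3 S_def[symmetric] C_def[symmetric]
    by (simp add: add_divide_distrib power_mult_distrib)
  also have "S * (E\<^sup>2 - (k - 1)\<^sup>2 * S\<^sup>2) + C * (2 * (k - 1) * S * E) = S * (4 * k)"
    unfolding SC by (simp add: E_def C_def[symmetric] power2_eq_square algebra_simps)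
  finally have 1: "sin (circle_lift k t) = 2 * k * S / D" using D by (simp add: field_simps)
  have "cos (circle_lift k t) = (C * (E\<^sup>2 - ((k - 1) * S)\<^sup>2) - S * (2 * (k - 1) * S * E)) / (2 * D)"
    unfolding l cos_add c2 s2 c3 s3 S_def[symmetric] C_def[symmetric]
    by (simp only: times_divide_eq_right diff_divide_distrib[symmetric])
  also have "\<dots> = (C * (E\<^sup>2 - (k - 1)\<^sup>2 * S\<^sup>2) - S\<^sup>2 * (2 * (k - 1) * E)) / (2 * D)"
    by (simp add: power2_eq_square algebra_simps)
  also have "C * (E\<^sup>2 - (k - 1)\<^sup>2 * S\<^sup>2) - S\<^sup>2 * (2 * (k - 1) * E) = 2 * ((1 + C) - k\<^sup>2 * (1 - C))"
    unfolding SC by (simp add: E_def C_def[symmetric] power2_eq_square algebra_simps)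
  finally have 2: "cos (circle_lift k t) = ((1 + C) - k\<^sup>2 * (1 - C)) / D" using D by (simp add: field_simps)
  show ?thesis using 1 2
    by (simp add: circle_eq_iff dilate_nth dil_den_def D_def C_def S_def)
qed

lemma joint_smooth_circle_lift:
  assumes W: "openin (prod_topology X euclidean) W" and k: "joint_smooth X W k" and pos: "\<And>x t. (x, t) \<in> W \<Longrightarrow> k x t > 0"
  shows "joint_smooth X W (\<lambda>x t. circle_lift (k x t) t)"
  unfolding circle_lift_def
  by (intro joint_smooth_add joint_smooth_mult joint_smooth_arctan joint_smooth_divide joint_smooth_diff
      joint_smooth_sin joint_smooth_cos joint_smooth_const joint_smooth_id W k)
    (use circle_lift_den_pos pos in \<open>simp add: less_imp_neq[symmetric]\<close>)

lemma circle_lift_0 [simp]: "circle_lift k 0 = 0"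
  by (simp add: circle_lift_def)

lemma circle_lift_derivative_0: "(circle_lift k has_real_derivative k) (at 0)"
  unfolding circle_lift_def[abs_def] by (auto intro!: derivative_eq_intros simp: field_simps)

lemma circle_lift_derivative:
  assumes k: "k > 0"
  obtains d where "(circle_lift k has_real_derivative d) (at t)" "d \<noteq> 0"
proof -
  have "(circle_lift k has_real_derivative 1 + 2 * (inverse (1 + ((k - 1) * sin t / ((1 + cos t) + k * (1 - cos t)))\<^sup>2) *
     (((k - 1) * cos t * ((1 + cos t) + k * (1 - cos t)) - (k - 1) * sin t * (- sin t + k * sin t)) /
       (((1 + cos t) + k * (1 - cos t)) * ((1 + cos t) + k * (1 - cos t)))))) (at t)" (is "(_ has_real_derivative ?d) _")
    unfolding circle_lift_def[abs_def] using circle_lift_den_pos[OF k, of t]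
    by (auto intro!: derivative_eq_intros)
  then have d: "(circle_lift k has_vector_derivative ?d) (at t)"
    by (simp only: has_real_derivative_iff_has_vector_derivative)
  have "((\<lambda>s. circle_point (circle_lift k s)) has_vector_derivative
      ?d *\<^sub>R (cos (circle_lift k t) *\<^sub>R axis_vec 1 - sin (circle_lift k t) *\<^sub>R pt_inf)) (at t)"
    using vector_diff_chain_at[OF d circle_point_derivative] by (simp only: o_def)
  then have e: "((\<lambda>s. dilate k (circle_point s)) has_vector_derivative
      ?d *\<^sub>R (cos (circle_lift k t) *\<^sub>R axis_vec 1 - sin (circle_lift k t) *\<^sub>R pt_inf)) (at t)"
    by (simp only: circle_point_lift[OF k])
  have "cos t *\<^sub>R axis_vec 1 - sin t *\<^sub>R pt_inf \<noteq> (0 :: real^(1 option))"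
  proof
    assume "cos t *\<^sub>R axis_vec 1 - sin t *\<^sub>R pt_inf = (0 :: real^(1 option))"
    then have "cos t = 0" "sin t = 0" by (simp_all add: circle_eq_iff)
    then show False using sin_cos_squared_add[of t] by simp
  qed
  then obtain w' where "((\<lambda>s. dilate k (circle_point s)) has_vector_derivative w') (at t)" "w' \<noteq> 0"
    using dilate_immersed[OF k _ circle_point_derivative] circle_point_sphere by blast
  then have "?d \<noteq> 0" using vector_derivative_unique_at[OF e] by auto
  then show ?thesis using that d by (simp only: has_real_derivative_iff_has_vector_derivative)
qed

section \<open>Velocity at the base-point\<close>

definition velocity :: "(real^(1 option) \<Rightarrow> real^('n::finite option)) \<Rightarrow> real^('n option)" where
  "velocity g = vector_derivative (\<lambda>t. g (circle_point t)) (at 0)"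

lemma velocity_nonzero: "g \<in> circle_embeddings \<Longrightarrow> velocity g \<noteq> 0"
  unfolding velocity_def by (rule loop_immersed)

lemma velocity_derivative:
  "g \<in> circle_embeddings \<Longrightarrow> ((\<lambda>t. g (circle_point t)) has_vector_derivative velocity g) (at 0)"
  unfolding velocity_def by (rule loop_derivative)

lemma velocity_rotate: "g \<in> circle_embeddings \<Longrightarrow> velocity (rotate_embedding A g) = A *v velocity g"
  unfolding velocity_def by (rule rotate_embedding_derivative)

lemma velocity_tangent:
  assumes g: "g \<in> circle_embeddings" shows "g pt_inf \<bullet> velocity g = 0"
proof -
  have 1: "((\<lambda>t. g (circle_point t) \<bullet> g (circle_point t)) has_vector_derivative
      g (circle_point 0) \<bullet> velocity g + velocity g \<bullet> g (circle_point 0)) (at 0)"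
    by (rule bounded_bilinear.has_vector_derivative[OF bounded_bilinear_inner velocity_derivative[OF g] velocity_derivative[OF g]])
  have "g (circle_point t) \<bullet> g (circle_point t) = 1" for t
    using circle_embeddingD(4)[OF g, of "circle_point t"] by (simp add: dot_square_norm)
  then have "((\<lambda>t. 1 :: real) has_vector_derivative
      g (circle_point 0) \<bullet> velocity g + velocity g \<bullet> g (circle_point 0)) (at 0)"
    using 1 by (simp only: )
  then have "g (circle_point 0) \<bullet> velocity g + velocity g \<bullet> g (circle_point 0) = 0"
    using vector_derivative_unique_at[OF has_vector_derivative_const, of 1] by simp
  then show ?thesis by (simp add: inner_commute)
qed

lemma inner_pt_inf: "pt_inf \<bullet> v = v $ None"
  by (simp add: pt_inf_def inner_axis')

lemma velocity_None: "g \<in> pointed_embeddings \<Longrightarrow> velocity g $ None = 0"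
  using velocity_tangent[of g] by (simp add: pointed_embeddings_def inner_pt_inf)

text \<open>Conjugating with \<open>k = 1/c\<close> zooms into the curve around the base-point and
  keeps the velocity there.\<close>
definition dilate_embedding ::
  "real \<Rightarrow> real \<Rightarrow> (real^(1 option) \<Rightarrow> real^('n::finite option)) \<Rightarrow> real^(1 option) \<Rightarrow> real^('n option)" where
  "dilate_embedding k c g = (\<lambda>z\<in>unit_sphere. dilate k (g (dilate c z)))"

lemma dilate_embedding_loop:
  "c > 0 \<Longrightarrow> dilate_embedding k c g (circle_point t) = dilate k (g (circle_point (circle_lift c t)))"
  by (simp add: dilate_embedding_def circle_point_lift)

text \<open>Dilations are diffeomorphisms of the circle and of the sphere, so only smoothness is
  left as a hypothesis; it is derived together with continuity in families.\<close>
lemma dilate_embedding_mem: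
  fixes g :: "real^(1 option) \<Rightarrow> real^('n::finite option)"
  assumes g: "g \<in> circle_embeddings" and k: "k > 0" and c: "c > 0"
    and sm: "smooth_curve (dilate_embedding k c g \<circ> circle_point)"
  shows "dilate_embedding k c g \<in> circle_embeddings"
proof (rule circle_embeddingI[OF _ sm])
  fix t
  obtain d where d: "(circle_lift c has_real_derivative d) (at t)" "d \<noteq> 0"
    using circle_lift_derivative[OF c] .
  have "((\<lambda>s. g (circle_point (circle_lift c s))) has_vector_derivative
     d *\<^sub>R vector_derivative (\<lambda>t. g (circle_point t)) (at (circle_lift c t))) (at t)"
    using vector_diff_chain_at[OF d(1)[unfolded has_real_derivative_iff_has_vector_derivative] loop_derivative[OF g]]
    by (simp only: o_def)
  moreover have "d *\<^sub>R vector_derivative (\<lambda>t. g (circle_point t)) (at (circle_lift c t)) \<noteq> 0"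
    using d(2) loop_immersed[OF g] by simp
  ultimately obtain w where w: "((\<lambda>s. dilate k (g (circle_point (circle_lift c s)))) has_vector_derivative w) (at t)" "w \<noteq> 0"
    using dilate_immersed[OF k, of "\<lambda>s. g (circle_point (circle_lift c s))"] circle_embeddingD(4)[OF g circle_point_sphere]
    by blast
  have "dilate_embedding k c g \<circ> circle_point = (\<lambda>s. dilate k (g (circle_point (circle_lift c s))))"
    by (simp add: o_def dilate_embedding_loop[OF c])
  then show "vector_derivative (dilate_embedding k c g \<circ> circle_point) (at t) \<noteq> 0"
    using vector_derivative_at[OF w(1)] w(2) by simp
next
  fix z w :: "real^(1 option)" assume zw: "norm z = 1" "norm w = 1" "dilate_embedding k c g z = dilate_embedding k c g w"
  have n: "norm (dilate c z) = 1" "norm (dilate c w) = 1" "norm (g (dilate c z)) = 1" "norm (g (dilate c w)) = 1"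
    using zw c circle_embeddingD(4)[OF g] by auto
  have "dilate (1 / k) (dilate k (g (dilate c z))) = dilate (1 / k) (dilate k (g (dilate c w)))"
    using zw by (simp add: dilate_embedding_def)
  then have "g (dilate c z) = g (dilate c w)" by (simp only: dilate_inverse[OF k] n)
  then have "dilate c z = dilate c w" using circle_embeddingD(5)[OF g] n by blast
  then have "dilate (1 / c) (dilate c z) = dilate (1 / c) (dilate c w)" by simp
  then show "z = w" by (simp only: dilate_inverse[OF c] zw)
qed (use assms circle_embeddingD(4)[OF g] in \<open>auto simp: dilate_embedding_def\<close>)

lemma dilate_embedding_continuous:
  fixes F :: "'x \<Rightarrow> real^(1 option) \<Rightarrow> real^('n::finite option)"
  assumes F: "continuous_map X Emb F" and k: "continuous_map X euclideanreal k" and c: "continuous_map X euclideanreal c"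
    and pos: "\<And>x. x \<in> topspace X \<Longrightarrow> k x > 0" "\<And>x. x \<in> topspace X \<Longrightarrow> c x > 0"
  shows "continuous_map X Emb (\<lambda>x. dilate_embedding (k x) (c x) (F x))"
    and "\<And>x. x \<in> topspace X \<Longrightarrow> dilate_embedding (k x) (c x) (F x) \<in> circle_embeddings"
proof -
  let ?W = "topspace X \<times> (UNIV :: real set)"
  have Fm: "F x \<in> circle_embeddings" if "x \<in> topspace X" for x
    using continuous_map_image_subset_topspace[OF F] that by auto
  have l: "joint_smooth X ?W (\<lambda>x t. circle_lift (c x) t)"
    by (rule joint_smooth_circle_lift[OF openin_whole joint_smooth_param[OF c]]) (use pos in auto)
  have "joint_smooth X ?W (\<lambda>x t. F (id x) (circle_point (circle_lift (c x) t)))"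
    by (rule joint_smooth_compose[OF continuous_map_id l continuous_map_EmbD[OF F]]) auto
  then have "joint_smooth X ?W (\<lambda>x t. dilate (k x) (F x (circle_point (circle_lift (c x) t))))"
    by (intro joint_smooth_dilate joint_smooth_param[OF k]) (use pos circle_embeddingD(4)[OF Fm] in auto)
  then have s: "joint_smooth X ?W (\<lambda>x t. dilate_embedding (k x) (c x) (F x) (circle_point t))"
    by (rule joint_smooth_cong[OF openin_whole, rotated]) (use pos in \<open>simp add: dilate_embedding_loop\<close>)
  show m: "dilate_embedding (k x) (c x) (F x) \<in> circle_embeddings" if x: "x \<in> topspace X" for x
    using joint_smooth_imp_Cinf(1)[OF s x]
    by (intro dilate_embedding_mem Fm pos x) (simp add: o_def)
  show "continuous_map X Emb (\<lambda>x. dilate_embedding (k x) (c x) (F x))"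
    by (rule continuous_map_EmbI[OF m s])
qed

lemma dilate_embedding_1 [simp]: "g \<in> extensional unit_sphere \<Longrightarrow> dilate_embedding 1 1 g = g"
  by (auto simp: dilate_embedding_def fun_eq_iff extensional_def)

lemma dilate_embedding_pointed:
  assumes "g \<in> pointed_embeddings" "k > 0" "c > 0"
  shows "dilate_embedding k c g \<in> pointed_embeddings"
    and "velocity (dilate_embedding k c g) = (k * c) *\<^sub>R velocity g"
proof -
  have g: "g \<in> circle_embeddings" "g pt_inf = pt_inf" using assms by (auto simp: pointed_embeddings_def)
  let ?X = "top_of_set {0 :: real}"
  have "continuous_map ?X Emb (\<lambda>_. g)" using g by simp
  then have "dilate_embedding k c g \<in> circle_embeddings"
    using dilate_embedding_continuous(2)[of ?X "\<lambda>_. g" "\<lambda>_. k" "\<lambda>_. c" 0] assms by simp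
  then show "dilate_embedding k c g \<in> pointed_embeddings"
    using g by (simp add: pointed_embeddings_def dilate_embedding_def)
  have "((\<lambda>s. g (circle_point (circle_lift c s))) has_vector_derivative c *\<^sub>R velocity g) (at 0)"
    using vector_diff_chain_at[OF circle_lift_derivative_0[unfolded has_real_derivative_iff_has_vector_derivative], of "\<lambda>t. g (circle_point t)" "velocity g" c]
      velocity_derivative[OF g(1)] by (simp add: o_def)
  from dilate_velocity[OF this, of k]
  have "((\<lambda>s. dilate k (g (circle_point (circle_lift c s)))) has_vector_derivative k *\<^sub>R c *\<^sub>R velocity g) (at 0)"
    using g velocity_None[OF assms(1)] by simp
  then show "velocity (dilate_embedding k c g) = (k * c) *\<^sub>R velocity g"
    unfolding velocity_def using assms(3) by (simp add: dilate_embedding_loop vector_derivative_at)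
qed

lemma dilate_embedding_rotate:
  assumes "B \<in> SO_mid" "c > 0"
  shows "dilate_embedding k c (rotate_embedding B g) = rotate_embedding B (dilate_embedding k c g)"
  using assms by (auto simp: dilate_embedding_def rotate_embedding_def fun_eq_iff dilate_rotate)

section \<open>Embeddings along the long axis\<close>

text \<open>The space \<open>P\<close> of the introduction. Parallel to its own multiple by the norm
  means positively proportional to the long axis.\<close>
definition axis_embeddings :: "'n::finite \<Rightarrow> (real^(1 option) \<Rightarrow> real^('n option)) set" where
  "axis_embeddings a = {g \<in> pointed_embeddings. velocity g = norm (velocity g) *\<^sub>R axis_vec a}"

text \<open>The space \<open>C\<close> of the introduction. The hemisphere \<open>z $ None \<ge>
  0\<close> corresponds to \<open>\<bar>x\<bar> \<ge> 1\<close> under stereographic projection, which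
  is where a long knot is prescribed.\<close>
definition standard_embeddings :: "'n::finite \<Rightarrow> (real^(1 option) \<Rightarrow> real^('n option)) set" where
  "standard_embeddings a = {g \<in> axis_embeddings a. \<forall>z. norm z = 1 \<longrightarrow> z $ None \<ge> 0 \<longrightarrow> g z = great_circle a z}"

abbreviation Emb_axis :: "'n::finite \<Rightarrow> (real^(1 option) \<Rightarrow> real^('n option)) topology" where
  "Emb_axis a \<equiv> subtopology Emb (axis_embeddings a)"

lemma axis_embeddings_circle: "g \<in> axis_embeddings a \<Longrightarrow> g \<in> circle_embeddings"
  and axis_embeddings_pointed: "g \<in> axis_embeddings a \<Longrightarrow> g \<in> pointed_embeddings"
  and axis_embeddings_pt_inf: "g \<in> axis_embeddings a \<Longrightarrow> g pt_inf = pt_inf"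
  and standard_axis: "g \<in> standard_embeddings a \<Longrightarrow> g \<in> axis_embeddings a"
  by (auto simp: axis_embeddings_def pointed_embeddings_def standard_embeddings_def)

lemma topspace_Emb_axis [simp]: "topspace (Emb_axis a) = axis_embeddings a"
  using axis_embeddings_circle by auto

lemma SO_axis_mid: "B \<in> SO_axis a \<Longrightarrow> B \<in> SO_mid"
  and SO_axis_axis_vec: "B \<in> SO_axis a \<Longrightarrow> B *v axis_vec a = axis_vec a"
proof -
  assume B: "B \<in> SO_axis a"
  then show m: "B \<in> SO_mid" by (simp add: SO_axis_def)
  have e: "fin_block B *v axis a 1 = axis a 1" using B by (simp add: SO_axis_def)
  have p: "proj_finite (axis_vec a) = axis a 1"
    by (simp add: vec_eq_iff proj_finite_def axis_vec_nth axis_def)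
  have "(B *v axis_vec a) $ i = axis_vec a $ i" for i
  proof (cases i)
    case (Some l)
    have "(B *v axis_vec a) $ Some l = axis a 1 $ l" by (simp add: SO_mid_mult_nth(2)[OF m] p e)
    then show ?thesis unfolding Some by (simp add: axis_vec_nth axis_def)
  qed (simp add: SO_mid_mult_nth(1)[OF m])
  then show "B *v axis_vec a = axis_vec a" by (simp add: vec_eq_iff)
qed

lemma SO_axis_iff: "B \<in> SO_axis a \<longleftrightarrow> B \<in> SO_succ \<and> B *v pt_inf = pt_inf \<and> B *v axis_vec a = axis_vec a"
proof
  assume B: "B \<in> SO_succ \<and> B *v pt_inf = pt_inf \<and> B *v axis_vec a = axis_vec a"
  then have m: "B \<in> SO_mid" by (simp add: SO_mid_def)
  have p: "proj_finite (axis_vec a) = axis a 1"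
    by (simp add: vec_eq_iff proj_finite_def axis_vec_nth axis_def)
  have "(fin_block B *v axis a 1) $ i = axis a 1 $ i" for i
    using SO_mid_mult_nth(2)[OF m, of "axis_vec a" i] B by (simp add: p axis_vec_nth axis_def)
  then have 1: "fin_block B *v axis a 1 = axis a 1" by (simp add: vec_eq_iff)
  have "axis a x = x *\<^sub>R axis a 1" for x :: real by (simp add: vec_eq_iff axis_def)
  then have "fin_block B *v axis a x = axis a x" for x :: real
    by (metis 1 matrix_vector_mult_scaleR)
  then show "B \<in> SO_axis a" using m by (simp add: SO_axis_def)
next
  assume "B \<in> SO_axis a"
  then show "B \<in> SO_succ \<and> B *v pt_inf = pt_inf \<and> B *v axis_vec a = axis_vec a"
    using SO_axis_mid[of B a] SO_axis_axis_vec[of B a] by (simp add: SO_mid_def)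
qed

lemma rotate_axis_embeddings:
  assumes B: "B \<in> SO_axis a" and g: "g \<in> axis_embeddings a"
  shows "rotate_embedding B g \<in> axis_embeddings a"
proof -
  have Bs: "B \<in> SO_succ" "B *v pt_inf = pt_inf" "B *v axis_vec a = axis_vec a" using B SO_axis_iff[of B a] by auto
  have c: "g \<in> circle_embeddings" by (rule axis_embeddings_circle[OF g])
  have v: "velocity g = norm (velocity g) *\<^sub>R axis_vec a" using g by (simp add: axis_embeddings_def)
  have "B *v velocity g = velocity g"
    by (subst (1 2) v) (simp add: matrix_vector_mult_scaleR Bs)
  then show ?thesis using rotate_embedding_continuous(2)[OF Bs(1) c] v
    by (simp add: axis_embeddings_def pointed_embeddings_def velocity_rotate[OF c])
      (simp add: rotate_embedding_def axis_embeddings_pt_inf[OF g] Bs)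
qed

lemma velocity_great_circle:
  assumes "\<And>z. norm z = 1 \<Longrightarrow> z $ None \<ge> 0 \<Longrightarrow> g z = great_circle a z"
  shows "velocity g = axis_vec a"
proof -
  have "((\<lambda>t. great_circle a (circle_point t)) has_vector_derivative great_circle a (axis_vec 1)) (at 0)"
    using bounded_linear.has_vector_derivative[OF great_circle_linear circle_point_derivative[of 0], of a]
    by simp
  then have "((\<lambda>t. g (circle_point t)) has_vector_derivative great_circle a (axis_vec 1)) (at 0)"
    by (rule has_vector_derivative_transform_within_open[of _ _ _ "{- (pi/2)<..<pi/2}"])
      (use cos_ge_zero in \<open>auto intro!: assms[symmetric]\<close>)
  then show ?thesis
    unfolding velocity_def by (simp add: vector_derivative_at great_circle_def)
qed

lemma standard_velocity: "g \<in> standard_embeddings a \<Longrightarrow> velocity g = axis_vec a"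
  by (rule velocity_great_circle) (simp add: standard_embeddings_def)

text \<open>The property that every stage of the deformation has to have: it makes the deformation
  restrict to long knots and descend to the quotients by rotations about the long axis.\<close>
definition axis_compatible ::
  "'n::finite \<Rightarrow> ((real^(1 option) \<Rightarrow> real^('n option)) \<Rightarrow> real^(1 option) \<Rightarrow> real^('n option)) \<Rightarrow> bool" where
  "axis_compatible a h \<longleftrightarrow> (\<forall>g\<in>standard_embeddings a. h g \<in> standard_embeddings a) \<and>
     (\<forall>B\<in>SO_axis a. \<forall>g\<in>axis_embeddings a. h (rotate_embedding B g) = rotate_embedding B (h g))"

lemma axis_compatible_cong:
  "(\<And>g. g \<in> topspace (Emb_axis a) \<Longrightarrow> h g = k g) \<Longrightarrow> axis_compatible a h = axis_compatible a k"
  unfolding axis_compatible_def topspace_Emb_axis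
  by (intro conj_cong ball_cong refl) (simp_all add: standard_axis rotate_axis_embeddings)

lemma homotopic_with_axisI:
  assumes "continuous_map (prod_topology (top_of_set {0..1::real}) (Emb_axis a)) (Emb_axis a) h"
    "\<And>g. g \<in> axis_embeddings a \<Longrightarrow> h (0, g) = p g" "\<And>g. g \<in> axis_embeddings a \<Longrightarrow> h (1, g) = q g"
    "\<And>s. 0 \<le> s \<Longrightarrow> s \<le> 1 \<Longrightarrow> axis_compatible a (\<lambda>g. h (s, g))"
  shows "homotopic_with (axis_compatible a) (Emb_axis a) (Emb_axis a) p q"
  by (subst homotopic_with[OF axis_compatible_cong]) (use assms in auto)

lemma continuous_map_velocity: "continuous_map Emb euclidean velocity"
proof -
  have s: "joint_smooth Emb (topspace Emb \<times> UNIV) (\<lambda>g t. g (circle_point t))"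
    using continuous_map_EmbD[OF continuous_map_id[of Emb]] by simp
  have 1: "continuous_map Emb (prod_topology Emb euclidean) (\<lambda>g. (g, 0::real))"
    by (intro continuous_map_pairedI continuous_map_id[unfolded id_def]) auto
  show ?thesis
    using continuous_map_compose[OF 1 joint_smooth_imp_continuous_whole[OF
      joint_smooth_vector_derivative(1)[OF openin_whole s]]]
    by (simp add: o_def velocity_def[abs_def])
qed

definition unit_speed :: "(real^(1 option) \<Rightarrow> real^('n::finite option)) \<Rightarrow> real^(1 option) \<Rightarrow> real^('n option)" where
  "unit_speed g = dilate_embedding (1 / norm (velocity g)) 1 g"

text \<open>The dilation by \<open>k\<close> multiplies the velocity at the base-point by
  \<open>k\<close>, so the linear path from \<open>1\<close> to the inverse of the speed works. A
  standard embedding already has unit speed and stays fixed.\<close>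
lemma homotopic_unit_speed:
  "homotopic_with (axis_compatible a) (Emb_axis a) (Emb_axis a) id unit_speed"
  "g \<in> axis_embeddings a \<Longrightarrow> velocity (unit_speed g) = axis_vec a"
proof -
  let ?X = "prod_topology (top_of_set {0..1::real}) (Emb_axis a)"
  define k where "k = (\<lambda>x :: real \<times> (real^(1 option) \<Rightarrow> real^('a option)). (1 - fst x) + fst x * inverse (norm (velocity (snd x))))"
  have v: "velocity g = norm (velocity g) *\<^sub>R axis_vec a" "norm (velocity g) > 0" if "g \<in> axis_embeddings a" for g
    using that velocity_nonzero[OF axis_embeddings_circle[OF that]] by (auto simp: axis_embeddings_def)
  have pos: "k (s, g) > 0" if "0 \<le> s" "s \<le> 1" "g \<in> axis_embeddings a" for s g
  proof (cases "s = 0")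
    case False
    then have "s * inverse (norm (velocity g)) > 0" using that v(2)[OF that(3)] by simp
    then show ?thesis using that by (simp add: k_def)
  qed (simp add: k_def)
  have snd: "continuous_map ?X Emb snd"
    by (rule continuous_map_into_fulltopology[OF continuous_map_snd])
  have f: "continuous_map ?X euclideanreal fst"
    by (rule continuous_map_into_fulltopology[OF continuous_map_fst])
  have n: "continuous_map ?X euclideanreal (\<lambda>x. norm (velocity (snd x)))"
    using continuous_map_euclidean_unop[OF continuous_map_compose[OF snd continuous_map_velocity], of UNIV norm]
    by (simp add: o_def continuous_on_norm_id)
  have kc: "continuous_map ?X euclideanreal k"
    unfolding k_def
    by (intro continuous_map_add continuous_map_real_mult continuous_map_diff f continuous_map_real_inverse n)
      (use v(2) in force)+
  have c1: "continuous_map ?X euclideanreal (\<lambda>_. 1)" by simp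
  have C: "continuous_map ?X Emb (\<lambda>x. dilate_embedding (k x) 1 (snd x))"
    by (rule dilate_embedding_continuous(1)[OF snd kc c1]) (use pos in auto)
  have mem: "dilate_embedding (k (s, g)) 1 g \<in> axis_embeddings a" if "0 \<le> s" "s \<le> 1" "g \<in> axis_embeddings a" for s g
    using dilate_embedding_pointed[OF axis_embeddings_pointed[OF that(3)] pos[OF that], of 1] v[OF that(3)] pos[OF that]
    by (simp add: axis_embeddings_def) (metis scaleR_scaleR)
  show "homotopic_with (axis_compatible a) (Emb_axis a) (Emb_axis a) id unit_speed"
  proof (rule homotopic_with_axisI[where h = "\<lambda>x. dilate_embedding (k x) 1 (snd x)"])
    show "continuous_map ?X (Emb_axis a) (\<lambda>x. dilate_embedding (k x) 1 (snd x))"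
      using C mem by (auto simp: continuous_map_in_subtopology)
    show "dilate_embedding (k (0, g)) 1 (snd (0 :: real, g)) = id g" if "g \<in> axis_embeddings a" for g
      using circle_embeddingD(1)[OF axis_embeddings_circle[OF that]] by (simp add: k_def)
    show "dilate_embedding (k (1, g)) 1 (snd (1 :: real, g)) = unit_speed g" if "g \<in> axis_embeddings a" for g
      by (simp add: k_def unit_speed_def inverse_eq_divide)
    show "axis_compatible a (\<lambda>g. dilate_embedding (k (s, g)) 1 (snd (s, g)))" if s: "0 \<le> s" "s \<le> 1" for s
      unfolding axis_compatible_def snd_conv
    proof (intro conjI ballI)
      fix g assume g: "g \<in> standard_embeddings a"
      have "k (s, g) = 1" using standard_velocity[OF g] by (simp add: k_def)
      then show "dilate_embedding (k (s, g)) 1 g \<in> standard_embeddings a"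
        using g circle_embeddingD(1)[OF axis_embeddings_circle[OF standard_axis[OF g]]] by simp
    next
      fix B g assume B: "B \<in> SO_axis a" and g: "g \<in> axis_embeddings a"
      have "k (s, rotate_embedding B g) = k (s, g)"
        using SO_succ_norm[OF SO_mid_SO_succ[OF SO_axis_mid[OF B]]]
        by (simp add: k_def velocity_rotate[OF axis_embeddings_circle[OF g]])
      then show "dilate_embedding (k (s, rotate_embedding B g)) 1 (rotate_embedding B g) =
          rotate_embedding B (dilate_embedding (k (s, g)) 1 g)"
        by (simp add: dilate_embedding_rotate[OF SO_axis_mid[OF B]])
    qed
  qed
  show "velocity (unit_speed g) = axis_vec a" if g: "g \<in> axis_embeddings a"
  proof -
    have "velocity (unit_speed g) = (1 / norm (velocity g)) *\<^sub>R velocity g"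
      unfolding unit_speed_def using dilate_embedding_pointed(2)[OF axis_embeddings_pointed[OF g], of "1 / norm (velocity g)" 1] v(2)[OF g]
      by simp
    also have "\<dots> = (1 / norm (velocity g)) *\<^sub>R norm (velocity g) *\<^sub>R axis_vec a" using v(1)[OF g] by simp
    also have "\<dots> = axis_vec a" using v(2)[OF g] by simp
    finally show ?thesis .
  qed
qed

section \<open>Elementary estimates\<close>

lemma vector_derivative_bound:
  fixes f :: "real \<Rightarrow> 'a::real_normed_vector"
  assumes "\<And>x. x \<in> closed_segment 0 t \<Longrightarrow> (f has_vector_derivative f' x) (at x)"
    "\<And>x. x \<in> closed_segment 0 t \<Longrightarrow> norm (f' x) \<le> B"
  shows "norm (f t - f 0) \<le> B * \<bar>t\<bar>"
proof -
  have B: "B \<ge> 0" using order_trans[OF norm_ge_zero assms(2)[of 0]] by simp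
  have "norm (f t - f 0) \<le> B * norm (t - 0)"
  proof (rule differentiable_bound[of "closed_segment 0 t" f "\<lambda>x h. h *\<^sub>R f' x"])
    fix x assume x: "x \<in> closed_segment 0 t"
    show "(f has_derivative (\<lambda>h. h *\<^sub>R f' x)) (at x within closed_segment 0 t)"
      using assms(1)[OF x] has_derivative_at_withinI unfolding has_vector_derivative_def by blast
    show "onorm (\<lambda>h. h *\<^sub>R f' x) \<le> B"
    proof (rule onorm_bound[OF B])
      fix h :: real
      have "norm (f' x) * \<bar>h\<bar> \<le> B * \<bar>h\<bar>" by (rule mult_right_mono) (use assms(2)[OF x] in auto)
      then show "norm (h *\<^sub>R f' x) \<le> B * norm h" by (simp add: mult.commute)
    qed
  qed simp_all
  then show ?thesis by simp
qed

text \<open>Two applications of the mean value inequality.\<close>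
lemma second_order_bound:
  fixes w :: "real \<Rightarrow> 'a::real_normed_vector"
  assumes "\<And>t. (w has_vector_derivative w1 t) (at t)" "\<And>t. (w1 has_vector_derivative w2 t) (at t)"
    "w 0 = 0" "w1 0 = 0" "\<And>t. \<bar>t\<bar> \<le> 1 \<Longrightarrow> norm (w2 t) \<le> M" "\<bar>t\<bar> \<le> 1"
  shows "norm (w1 t) \<le> M * \<bar>t\<bar>" "norm (w t) \<le> M * t\<^sup>2"
proof -
  have M: "M \<ge> 0" using order_trans[OF norm_ge_zero assms(5)[of 0]] by simp
  have seg: "\<bar>x\<bar> \<le> \<bar>t\<bar>" if "x \<in> closed_segment 0 t" for x t :: real
    using that by (auto simp: closed_segment_eq_real_ivl split: if_splits)
  have 1: "norm (w1 t) \<le> M * \<bar>t\<bar>" if "\<bar>t\<bar> \<le> 1" for t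
    using vector_derivative_bound[of t w1 w2 M] assms(2,4,5) that seg[of _ t] by force
  then show "norm (w1 t) \<le> M * \<bar>t\<bar>" using assms(6) by blast
  have "norm (w t - w 0) \<le> (M * \<bar>t\<bar>) * \<bar>t\<bar>"
  proof (rule vector_derivative_bound[of t w w1])
    fix x assume "x \<in> closed_segment 0 t"
    then have x: "\<bar>x\<bar> \<le> \<bar>t\<bar>" by (rule seg)
    then have "norm (w1 x) \<le> M * \<bar>x\<bar>" using 1 assms(6) by simp
    also have "\<dots> \<le> M * \<bar>t\<bar>" using x M by (simp add: mult_left_mono)
    finally show "norm (w1 x) \<le> M * \<bar>t\<bar>" .
  qed (rule assms(1))
  then show "norm (w t) \<le> M * t\<^sup>2" using assms(3) by (simp add: power2_eq_square mult.assoc abs_mult_self_eq)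
qed

lemma cos_lower_bound: "cos t \<ge> 1 - t\<^sup>2 / (2::real)"
proof -
  have "\<bar>sin (t / 2)\<bar> \<le> \<bar>t / 2\<bar>" by (rule abs_sin_x_le_abs_x)
  then have "(sin (t / 2))\<^sup>2 \<le> (t / 2)\<^sup>2" by (simp only: abs_le_square_iff)
  moreover have "cos t = 1 - 2 * (sin (t / 2))\<^sup>2" using cos_double_sin[of "t / 2"] by simp
  ultimately show ?thesis by (simp add: power_divide)
qed

lemma small_angle:
  assumes "- pi < t" "t \<le> pi" "cos t > 0" "\<bar>sin t\<bar> \<le> 1/2"
  shows "\<bar>t\<bar> \<le> 2 * \<bar>sin t\<bar>"
proof -
  define x where "x = \<bar>t\<bar>"
  have x: "0 \<le> x" "x \<le> pi" "cos x > 0" "\<bar>sin x\<bar> = \<bar>sin t\<bar>" using assms by (auto simp: x_def abs_if)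
  have "x < pi / 2"
  proof (rule ccontr)
    assume "\<not> x < pi / 2"
    then have "cos x \<le> cos (pi / 2)" using x by (intro cos_monotone_0_pi_le) auto
    then show False using x by simp
  qed
  moreover have s: "sin x \<ge> 0" using x by (simp add: sin_ge_zero)
  ultimately have x6: "x \<le> pi / 6"
  proof -
    assume h: "x < pi / 2"
    show ?thesis
    proof (rule ccontr)
      assume "\<not> x \<le> pi / 6"
      then have "sin (pi / 6) < sin x" using h x pi_gt_zero by (intro sin_monotone_2pi) auto
      then show False using assms(4) x(4) s by (simp add: sin_30)
    qed
  qed
  have "sin 0 - 0 / 2 \<le> sin x - x / 2"
  proof (rule DERIV_nonneg_imp_nondecreasing[of 0 x "\<lambda>x. sin x - x / 2"])
    fix y assume y: "0 \<le> y" "y \<le> x"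
    have "cos (pi / 3) \<le> cos y" using y x6 pi_gt_zero by (intro cos_monotone_0_pi_le) auto
    then have "cos y - 1/2 \<ge> 0" by (simp add: cos_60)
    moreover have "((\<lambda>x. sin x - x / 2) has_real_derivative cos y - 1/2) (at y)"
      by (auto intro!: derivative_eq_intros)
    ultimately show "\<exists>z. ((\<lambda>x. sin x - x / 2) has_real_derivative z) (at y) \<and> 0 \<le> z" by blast
  qed (use x in auto)
  then show ?thesis using x(4) s by (simp add: x_def)
qed

section \<open>Deviation from the great circle\<close>

definition deviation :: "'n::finite \<Rightarrow> (real^(1 option) \<Rightarrow> real^('n option)) \<Rightarrow> real \<Rightarrow> real^('n option)" where
  "deviation a g t = g (circle_point t) - great_circle a (circle_point t)"

text \<open>The supremum bounds the second derivative of the deviation near the base-point. Adding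
  \<open>1\<close> keeps the value away from zero, so that one may divide by it.\<close>
definition accel_bound :: "'n::finite \<Rightarrow> (real^(1 option) \<Rightarrow> real^('n option)) \<Rightarrow> real" where
  "accel_bound a g = 1 + (SUP t\<in>{-1..1}. norm (nth_vderiv 2 (deviation a g) t))"

text \<open>For \<open>\<bar>t\<bar>\<close> up to this radius the derivative of the deviation has
  norm at most \<open>1/4\<close>, so the coordinate of the curve along the long axis is increasing
  there.\<close>
definition core_radius :: "'n::finite \<Rightarrow> (real^(1 option) \<Rightarrow> real^('n option)) \<Rightarrow> real" where
  "core_radius a g = 1 / (4 * accel_bound a g)"

text \<open>The distance from the base-point to the part of the curve outside the core
  \<open>\<bar>t\<bar> < core_radius a g\<close>. The parameter \<open>u\<close> rescales the
  complementary arc to a fixed interval, so that continuity in \<open>g\<close> is an instance of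
  continuity of a supremum over a fixed interval.\<close>
definition far_distance :: "'n::finite \<Rightarrow> (real^(1 option) \<Rightarrow> real^('n option)) \<Rightarrow> real" where
  "far_distance a g = - (SUP u\<in>{0..1}.
     - norm (g (circle_point (core_radius a g + u * (2 * pi - 2 * core_radius a g))) - pt_inf))"

definition bump_bound :: real where
  "bump_bound = (SOME B. B \<ge> 1 \<and> (\<forall>x. \<exists>d. (bump has_real_derivative d) (at x) \<and> \<bar>d\<bar> \<le> B))"

lemma bump_bound: "bump_bound \<ge> 1" "\<exists>d. (bump has_real_derivative d) (at x) \<and> \<bar>d\<bar> \<le> bump_bound"
proof -
  have "bump_bound \<ge> 1 \<and> (\<forall>x. \<exists>d. (bump has_real_derivative d) (at x) \<and> \<bar>d\<bar> \<le> bump_bound)"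
    unfolding bump_bound_def by (rule someI_ex) (use bump_derivative in blast)
  then show "bump_bound \<ge> 1" "\<exists>d. (bump has_real_derivative d) (at x) \<and> \<bar>d\<bar> \<le> bump_bound" by auto
qed

text \<open>The width of the arc that is straightened. The factor \<open>far_distance\<close> keeps
  the straightened arc away from the rest of the curve; the other factors keep the derivative of the
  cut-off, which grows like the inverse of the width, from destroying monotonicity along the axis. The
  constant \<open>64\<close> leaves room in both estimates.\<close>
definition scale :: "'n::finite \<Rightarrow> (real^(1 option) \<Rightarrow> real^('n option)) \<Rightarrow> real" where
  "scale a g = far_distance a g / (64 * bump_bound * accel_bound a g)"

lemma joint_smooth_deviation: "joint_smooth Emb (topspace Emb \<times> UNIV) (deviation a)"
  unfolding deviation_def[abs_def]
  by (intro joint_smooth_diff joint_smooth_linear[OF great_circle_linear] joint_smooth_circle_point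
      openin_whole joint_smooth_id continuous_map_EmbD[OF continuous_map_id, unfolded id_def])

lemma deviation_derivatives:
  assumes "g \<in> circle_embeddings"
  shows "(nth_vderiv k (deviation a g) has_vector_derivative nth_vderiv (Suc k) (deviation a g) t) (at t)"
  using joint_smooth_vector_derivative(2)[OF openin_whole joint_smooth_nth_vderiv[OF openin_whole joint_smooth_deviation[of a]], of g t k]
    assms by (simp add: nth_vderiv_Suc)

lemma continuous_map_accel_bound: "continuous_map Emb euclideanreal (accel_bound a)"
proof -
  have "continuous_map (prod_topology Emb euclidean) euclidean (\<lambda>p. nth_vderiv 2 (deviation a (fst p)) (snd p))"
    by (rule joint_smooth_imp_continuous_whole[OF joint_smooth_nth_vderiv[OF openin_whole joint_smooth_deviation]])
  then have "continuous_map (prod_topology Emb euclidean) euclideanreal (\<lambda>p. norm (nth_vderiv 2 (deviation a (fst p)) (snd p)))"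
    by (rule continuous_map_euclidean_unop[where S = UNIV]) (auto intro: continuous_intros)
  then have "continuous_map Emb euclideanreal (\<lambda>g. SUP t\<in>{-1..1}. norm (nth_vderiv 2 (deviation a g) t))"
    by (rule continuous_map_SUP_interval) simp
  then show ?thesis unfolding accel_bound_def by (intro continuous_map_add) auto
qed

lemma accel_bound:
  assumes "g \<in> circle_embeddings"
  shows "\<bar>t\<bar> \<le> 1 \<Longrightarrow> norm (nth_vderiv 2 (deviation a g) t) \<le> accel_bound a g" "accel_bound a g \<ge> 1"
proof -
  have "continuous_on UNIV (nth_vderiv 2 (deviation a g))"
    using deviation_derivatives[OF assms] has_vector_derivative_continuous
    by (metis continuous_at_imp_continuous_on)
  then have "continuous_on {-1..1} (\<lambda>t. norm (nth_vderiv 2 (deviation a g) t))"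
    by (intro continuous_on_norm) (rule continuous_on_subset, auto)
  then have "compact ((\<lambda>t. norm (nth_vderiv 2 (deviation a g) t)) ` {-1..1})"
    by (intro compact_continuous_image) auto
  then have bdd: "bdd_above ((\<lambda>t. norm (nth_vderiv 2 (deviation a g) t)) ` {-1..1})"
    by (intro bounded_imp_bdd_above compact_imp_bounded)
  have le: "norm (nth_vderiv 2 (deviation a g) t) \<le> (SUP t\<in>{-1..1}. norm (nth_vderiv 2 (deviation a g) t))"
    if "\<bar>t\<bar> \<le> 1" for t
    by (rule cSUP_upper[OF _ bdd]) (use that in auto)
  then show "\<bar>t\<bar> \<le> 1 \<Longrightarrow> norm (nth_vderiv 2 (deviation a g) t) \<le> accel_bound a g"
    unfolding accel_bound_def by force
  have "0 \<le> (SUP t\<in>{-1..1}. norm (nth_vderiv 2 (deviation a g) t))"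
    using order_trans[OF norm_ge_zero le[of 0]] by simp
  then show "accel_bound a g \<ge> 1" unfolding accel_bound_def by simp
qed

lemma core_radius: "g \<in> circle_embeddings \<Longrightarrow> core_radius a g > 0 \<and> core_radius a g \<le> 1/4"
  using accel_bound(2)[of g a] unfolding core_radius_def by (auto simp: field_simps)

lemma continuous_map_core_radius: "continuous_map Emb euclideanreal (core_radius a)"
proof -
  have "continuous_map Emb euclideanreal (\<lambda>g. inverse (4 * accel_bound a g))"
    by (intro continuous_map_real_inverse continuous_map_real_mult continuous_map_accel_bound)
     (auto dest: accel_bound(2)[of _ a])
  then show ?thesis by (simp add: core_radius_def[abs_def] inverse_eq_divide)
qed

lemma continuous_map_far_distance: "continuous_map Emb euclideanreal (far_distance a)"
proof -
  have s: "joint_smooth Emb (topspace Emb \<times> UNIV) (\<lambda>g t. g (circle_point t))"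
    using continuous_map_EmbD[OF continuous_map_id[of Emb]] by simp
  have r: "joint_smooth Emb (topspace Emb \<times> UNIV) (\<lambda>g u. core_radius a g + u * (2 * pi - 2 * core_radius a g))"
    by (intro joint_smooth_add joint_smooth_mult joint_smooth_diff joint_smooth_const joint_smooth_id
        joint_smooth_param[OF continuous_map_core_radius])
  have "joint_smooth Emb (topspace Emb \<times> UNIV) (\<lambda>g u. (id g) (circle_point (core_radius a g + u * (2 * pi - 2 * core_radius a g))))"
    by (rule joint_smooth_compose[OF continuous_map_id r s]) auto
  then have "joint_smooth Emb (topspace Emb \<times> UNIV)
      (\<lambda>g u. g (circle_point (core_radius a g + u * (2 * pi - 2 * core_radius a g))) - pt_inf)"
    by (intro joint_smooth_diff joint_smooth_const) simp
  from joint_smooth_imp_continuous_whole[OF this]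
  have "continuous_map (prod_topology Emb euclidean) euclideanreal
     (\<lambda>p. - norm ((fst p) (circle_point (core_radius a (fst p) + snd p * (2 * pi - 2 * core_radius a (fst p)))) - pt_inf))"
    by (rule continuous_map_euclidean_unop[where S = UNIV and h = "\<lambda>v. - norm v"]) (auto intro!: continuous_intros)
  then have "continuous_map Emb euclideanreal (\<lambda>g. SUP u\<in>{0..1}.
     - norm (g (circle_point (core_radius a g + u * (2 * pi - 2 * core_radius a g))) - pt_inf))"
    by (rule continuous_map_SUP_interval[where u = "\<lambda>g u. - norm (g (circle_point (core_radius a g + u * (2 * pi - 2 * core_radius a g))) - pt_inf)"]) simp
  then show ?thesis unfolding far_distance_def by (intro continuous_map_minus)
qed

lemma loop_continuous_on: "g \<in> circle_embeddings \<Longrightarrow> continuous_on S (\<lambda>t. g (circle_point t))"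
  using loop_derivative[of g] has_vector_derivative_continuous
  by (metis continuous_at_imp_continuous_on)

lemma far_distance:
  assumes g: "g \<in> circle_embeddings" and p: "g pt_inf = pt_inf"
  shows "far_distance a g > 0" "far_distance a g \<le> 2"
    "\<And>t. - pi < t \<Longrightarrow> t \<le> pi \<Longrightarrow> core_radius a g \<le> \<bar>t\<bar> \<Longrightarrow> norm (g (circle_point t) - pt_inf) \<ge> far_distance a g"
proof -
  define r where "r = core_radius a g"
  define f where "f = (\<lambda>u. - norm (g (circle_point (r + u * (2 * pi - 2 * r))) - pt_inf))"
  have r: "0 < r" "r \<le> 1/4" using core_radius[OF g, of a] by (auto simp: r_def)
  have pi: "pi > 3" using pi_gt3 .
  have fd: "far_distance a g = - (SUP u\<in>{0..1}. f u)" by (simp add: far_distance_def r_def f_def)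
  have "continuous_on {0..1} f"
    unfolding f_def
    by (intro continuous_intros continuous_on_compose2[OF loop_continuous_on[OF g, of UNIV]]) auto
  then obtain u where u: "u \<in> {0..1}" "\<And>v. v \<in> {0..1} \<Longrightarrow> f v \<le> f u"
    using continuous_attains_sup[of "{0..1}" f] by auto
  have max: "(SUP u\<in>{0..1}. f u) = f u" by (rule cSup_eq_maximum) (use u in auto)
  have t: "r \<le> r + u * (2 * pi - 2 * r)" "r + u * (2 * pi - 2 * r) \<le> 2 * pi - r"
  proof -
    have "0 \<le> u * (2 * pi - 2 * r)" using u r pi by (intro mult_nonneg_nonneg) auto
    then show "r \<le> r + u * (2 * pi - 2 * r)" by simp
    have "u * (2 * pi - 2 * r) \<le> 1 * (2 * pi - 2 * r)" using u r pi by (intro mult_right_mono) auto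
    then show "r + u * (2 * pi - 2 * r) \<le> 2 * pi - r" by simp
  qed
  have ne: "g (circle_point t) \<noteq> pt_inf" if "0 < t" "t < 2 * pi" for t
  proof
    assume "g (circle_point t) = pt_inf"
    then have c: "circle_point t = pt_inf" using p circle_embeddingD(5)[OF g, of "circle_point t" pt_inf] by simp
    show False
    proof (cases "t \<le> pi")
      case True then show False using c circle_point_eq_pt_inf_iff[of t] that pi by simp
    next
      case False
      then show False using c circle_point_eq_pt_inf_iff[of "t - 2 * pi"] that by simp
    qed
  qed
  show "far_distance a g > 0" unfolding fd max using ne[of "r + u * (2 * pi - 2 * r)"] t r by (simp add: f_def)
  have n1: "norm (g (circle_point s)) = 1" for s using circle_embeddingD(4)[OF g] by simp
  show "far_distance a g \<le> 2" unfolding fd max unfolding f_def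
    using norm_triangle_ineq4[of "g (circle_point (r + u * (2 * pi - 2 * r)))" pt_inf] n1 by simp
  show "norm (g (circle_point t) - pt_inf) \<ge> far_distance a g" if "- pi < t" "t \<le> pi" "core_radius a g \<le> \<bar>t\<bar>" for t
  proof -
    define s where "s = (if t > 0 then t else t + 2 * pi)"
    have s: "r \<le> s" "s \<le> 2 * pi - r" "circle_point s = circle_point t"
      using that r pi unfolding s_def r_def by (auto simp: abs_if split: if_splits)
    define v where "v = (s - r) / (2 * pi - 2 * r)"
    have v: "v \<in> {0..1}" "r + v * (2 * pi - 2 * r) = s" using s r pi unfolding v_def by (auto simp: field_simps)
    have "f v \<le> f u" using u v by blast
    then show ?thesis unfolding fd max by (simp add: f_def v s)
  qed
qed

lemma scale:
  assumes "g \<in> circle_embeddings" "g pt_inf = pt_inf"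
  shows "scale a g > 0" "scale a g * (32 * bump_bound * accel_bound a g) \<le> 1" "scale a g \<le> far_distance a g / 64" "scale a g \<le> 1/32"
proof -
  note f = far_distance(1,2)[OF assms, of a] and A = accel_bound(2)[OF assms(1), of a] and B = bump_bound(1)
  have AB: "bump_bound * accel_bound a g \<ge> 1" using A B mult_mono[of 1 bump_bound 1 "accel_bound a g"] by simp
  show "scale a g > 0" unfolding scale_def using f A B by (intro divide_pos_pos mult_pos_pos) auto
  have e: "scale a g * (64 * (bump_bound * accel_bound a g)) = far_distance a g"
    unfolding scale_def using A B by (simp add: mult.assoc)
  then show "scale a g * (32 * bump_bound * accel_bound a g) \<le> 1" using f by (simp add: mult.assoc)
  show le: "scale a g \<le> far_distance a g / 64"
    unfolding scale_def using AB f by (intro divide_left_mono) (auto simp: mult.assoc)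
  show "scale a g \<le> 1/32" using le f by simp
qed

lemma continuous_map_scale: "continuous_map (subtopology Emb {g. g pt_inf = pt_inf}) euclideanreal (scale a)"
proof -
  have "continuous_map (subtopology Emb {g. g pt_inf = pt_inf}) euclideanreal
     (\<lambda>g. far_distance a g * inverse (64 * bump_bound * accel_bound a g))"
  proof (intro continuous_map_real_mult continuous_map_real_inverse continuous_map_from_subtopology
      continuous_map_far_distance continuous_map_accel_bound)
    fix g :: "real^(1 option) \<Rightarrow> real^('a option)"
    assume "g \<in> topspace (subtopology Emb {g. g pt_inf = pt_inf})"
    then have "accel_bound a g \<ge> 1" by (intro accel_bound(2)) simp
    then show "64 * bump_bound * accel_bound a g \<noteq> 0" using bump_bound(1) by simp
  qed simp_all
  then show ?thesis unfolding scale_def[abs_def] divide_inverse .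
qed

text \<open>For unit speed along the axis the deviation vanishes to first order at the
  base-point.\<close>
lemma deviation_bounds:
  assumes g: "g \<in> axis_embeddings a" and v: "velocity g = axis_vec a" and t: "\<bar>t\<bar> \<le> 1"
  shows "norm (nth_vderiv 1 (deviation a g) t) \<le> accel_bound a g * \<bar>t\<bar>"
    "norm (deviation a g t) \<le> accel_bound a g * t\<^sup>2"
    "deviation a g 0 = 0" "nth_vderiv 1 (deviation a g) 0 = 0"
proof -
  have c: "g \<in> circle_embeddings" by (rule axis_embeddings_circle[OF g])
  show 0: "deviation a g 0 = 0"
    using axis_embeddings_pt_inf[OF g] by (simp add: deviation_def great_circle_def)
  have "((\<lambda>t. great_circle a (circle_point t)) has_vector_derivative great_circle a (axis_vec 1)) (at 0)"
    using bounded_linear.has_vector_derivative[OF great_circle_linear circle_point_derivative[of 0], of a]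
    by simp
  from has_vector_derivative_diff[OF velocity_derivative[OF c] this]
  have "(deviation a g has_vector_derivative 0) (at 0)"
    by (simp add: deviation_def[abs_def] v great_circle_def)
  then show 1: "nth_vderiv 1 (deviation a g) 0 = 0"
    using nth_vderiv_Suc[of 0 "deviation a g"] by (simp add: vector_derivative_at)
  have d: "(deviation a g has_vector_derivative nth_vderiv 1 (deviation a g) t) (at t)"
     "(nth_vderiv 1 (deviation a g) has_vector_derivative nth_vderiv 2 (deviation a g) t) (at t)" for t
    using deviation_derivatives[OF c, of 0 a t] deviation_derivatives[OF c, of 1 a t]
    by (simp_all add: numeral_2_eq_2)
  show "norm (nth_vderiv 1 (deviation a g) t) \<le> accel_bound a g * \<bar>t\<bar>"
    "norm (deviation a g t) \<le> accel_bound a g * t\<^sup>2"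
    using second_order_bound[OF d 0 1 accel_bound(1)[OF c] t] by auto
qed

text \<open>The rotation fixes the great circle and is an isometry, hence all these quantities are
  unchanged.\<close>
lemma deviation_rotate:
  assumes B: "B \<in> SO_axis a" and g: "g \<in> axis_embeddings a"
  shows "accel_bound a (rotate_embedding B g) = accel_bound a g"
    "far_distance a (rotate_embedding B g) = far_distance a g"
    "scale a (rotate_embedding B g) = scale a g"
proof -
  have Bs: "B \<in> SO_succ" "B *v pt_inf = pt_inf" "B *v axis_vec a = axis_vec a" using B SO_axis_iff[of B a] by auto
  have c: "g \<in> circle_embeddings" by (rule axis_embeddings_circle[OF g])
  have gc: "B *v great_circle a z = great_circle a z" for z
    by (simp add: great_circle_def matrix_vector_mult_scaleR matrix_vector_right_distrib Bs)
  have 0: "deviation a (rotate_embedding B g) = (\<lambda>t. B *v deviation a g t)"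
    by (simp add: deviation_def fun_eq_iff rotate_embedding_loop matrix_vector_mult_diff_distrib gc)
  have k: "nth_vderiv k (\<lambda>t. B *v deviation a g t) = (\<lambda>t. B *v nth_vderiv k (deviation a g) t)" for k
  proof (induction k)
    case (Suc k)
    have "vector_derivative (\<lambda>t. B *v nth_vderiv k (deviation a g) t) (at t) = B *v nth_vderiv (Suc k) (deviation a g) t" for t
      by (intro vector_derivative_at bounded_linear.has_vector_derivative[OF matrix_vector_mul_bounded_linear]
         deviation_derivatives[OF c])
    then show ?case by (simp add: nth_vderiv_Suc[of k "\<lambda>t. B *v deviation a g t"] Suc)
  qed simp
  show 1: "accel_bound a (rotate_embedding B g) = accel_bound a g"
    unfolding accel_bound_def 0 k SO_succ_norm[OF Bs(1)] ..
  have d: "norm (B *v v - pt_inf) = norm (v - pt_inf)" for v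
    using SO_succ_norm[OF Bs(1), of "v - pt_inf"] by (simp add: matrix_vector_mult_diff_distrib Bs)
  show 2: "far_distance a (rotate_embedding B g) = far_distance a g"
    unfolding far_distance_def core_radius_def 1 rotate_embedding_loop d ..
  show "scale a (rotate_embedding B g) = scale a g" unfolding scale_def 1 2 ..
qed

section \<open>Straightening near the base-point\<close>

text \<open>Orthogonal projection of the ambient space along the base-point; on the hemisphere
  around \<open>pt_inf\<close> it is a chart with inverse given by \<open>hemi\<close>.\<close>
definition flat :: "real^('d::finite option) \<Rightarrow> real^('d option)" where
  "flat v = v - (v $ None) *\<^sub>R pt_inf"

text \<open>The point of the upper hemisphere above \<open>flat v\<close>, as long as this vector
  lies in the unit ball.\<close>
definition hemi :: "real^('d::finite option) \<Rightarrow> real^('d option)" where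
  "hemi v = flat v + sqrt (1 - (norm (flat v))\<^sup>2) *\<^sub>R pt_inf"

lemma flat_nth [simp]: "flat v $ None = 0" "flat v $ Some i = v $ Some i"
  by (simp_all add: flat_def)

lemma flat_linear: "bounded_linear flat"
  unfolding flat_def[abs_def]
  by (intro bounded_linear_sub bounded_linear_ident bounded_linear_scaleR_const bounded_linear_vec_nth)

lemma norm_flat: "(norm v)\<^sup>2 = (v $ None)\<^sup>2 + (norm (flat v))\<^sup>2"
proof -
  have "proj_finite (flat v) = proj_finite v" by (simp add: proj_finite_def vec_eq_iff)
  then show ?thesis using norm_option[of v] norm_option[of "flat v"] by simp
qed

lemma norm_flat_le: "norm (flat v) \<le> norm v"
proof (rule power2_le_imp_le)
  show "(norm (flat v))\<^sup>2 \<le> (norm v)\<^sup>2" unfolding norm_flat[of v] by simp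
qed simp

lemma hemi_nth [simp]: "hemi v $ None = sqrt (1 - (norm (flat v))\<^sup>2)" "hemi v $ Some i = v $ Some i"
  by (simp_all add: hemi_def)

lemma flat_hemi [simp]: "flat (hemi v) = flat v"
  by (simp add: vec_eq_iff split_option_all)

lemma hemi_norm: "norm (flat v) \<le> 1 \<Longrightarrow> norm (hemi v) = 1"
proof -
  assume "norm (flat v) \<le> 1"
  then have "(norm (flat v))\<^sup>2 \<le> 1" by (simp add: power_le_one)
  then have "(norm (hemi v))\<^sup>2 = 1" by (simp add: norm_flat[of "hemi v"])
  then show ?thesis by (metis norm_ge_zero one_power2 power2_eq_iff_nonneg zero_le_one)
qed

lemma hemi_eq: "norm v = 1 \<Longrightarrow> v $ None > 0 \<Longrightarrow> hemi v = v"
proof -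
  assume v: "norm v = 1" "v $ None > 0"
  then have "1 - (norm (flat v))\<^sup>2 = (v $ None)\<^sup>2" using norm_flat[of v] by simp
  then show "hemi v = v" using v by (simp add: vec_eq_iff split_option_all)
qed

lemma hemi_near: "norm (flat v) \<le> 1 \<Longrightarrow> norm (hemi v - pt_inf) \<le> 2 * norm (flat v)"
proof -
  assume 1: "norm (flat v) \<le> 1"
  let ?q = "(norm (flat v))\<^sup>2"
  have q: "0 \<le> ?q" "?q \<le> norm (flat v)" "?q \<le> 1"
    using 1 mult_left_mono[OF 1 norm_ge_zero[of "flat v"]] by (auto simp: power2_eq_square power_le_one)
  have "(1 - ?q)\<^sup>2 \<le> 1 - ?q"
    using q mult_left_mono[of "1 - ?q" 1 "1 - ?q"] by (simp add: power2_eq_square)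
  then have "1 - ?q \<le> sqrt (1 - ?q)" using q by (intro real_le_rsqrt)
  moreover have "sqrt (1 - ?q) \<le> 1" using q by simp
  ultimately have s: "\<bar>sqrt (1 - ?q) - 1\<bar> \<le> ?q" by simp
  have "hemi v - pt_inf = flat v + (sqrt (1 - ?q) - 1) *\<^sub>R pt_inf" by (simp add: hemi_def algebra_simps)
  then have "norm (hemi v - pt_inf) \<le> norm (flat v) + \<bar>sqrt (1 - ?q) - 1\<bar>"
    using norm_triangle_ineq[of "flat v" "(sqrt (1 - ?q) - 1) *\<^sub>R pt_inf"] by simp
  then show ?thesis using s q by simp
qed

lemma flat_rotate: "B \<in> SO_mid \<Longrightarrow> flat (B *v v) = B *v flat v"
  by (simp add: flat_def SO_mid_None SO_mid_pt_inf matrix_vector_mult_scaleR matrix_vector_mult_diff_distrib)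

lemma hemi_rotate: "B \<in> SO_mid \<Longrightarrow> hemi (B *v v) = B *v hemi v"
  by (simp add: hemi_def flat_rotate SO_succ_norm[OF SO_mid_SO_succ] SO_mid_pt_inf matrix_vector_mult_scaleR
      matrix_vector_right_distrib)

text \<open>Affine interpolation towards the great circle, cut off in the coordinate \<open>z $ Some
  1\<close> (the sine of the angle), with strength \<open>s\<close>. The values leave the sphere;
  \<open>hemi\<close> brings them back.\<close>
definition blend :: "'n::finite \<Rightarrow> real \<Rightarrow> real \<Rightarrow> (real^(1 option) \<Rightarrow> real^('n option)) \<Rightarrow> real^(1 option) \<Rightarrow> real^('n option)" where
  "blend a s e g z = g z + (s * bump (z $ Some 1 / e)) *\<^sub>R (great_circle a z - g z)"

definition straighten :: "'n::finite \<Rightarrow> real \<Rightarrow> real \<Rightarrow> (real^(1 option) \<Rightarrow> real^('n option)) \<Rightarrow> real^(1 option) \<Rightarrow> real^('n option)" where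
  "straighten a s e g = (\<lambda>z\<in>unit_sphere. if z $ None > 0 \<and> \<bar>z $ Some 1\<bar> < e then hemi (blend a s e g z) else g z)"

lemma square_less_iff: "b > 0 \<Longrightarrow> \<bar>x\<bar> < b \<longleftrightarrow> x * x < b * (b::real)"
proof -
  assume "b > 0"
  then have "\<not> \<bar>x\<bar> < b \<longleftrightarrow> \<not> x * x < b * b"
    unfolding not_less using abs_le_square_iff[of b x] by (simp add: power2_eq_square)
  then show ?thesis by blast
qed

lemma bump_derivative_0: "\<bar>x\<bar> > 1 \<Longrightarrow> (bump has_real_derivative 0) (at x)"
proof -
  assume x: "\<bar>x\<bar> > 1"
  have "((\<lambda>_. 0) has_vector_derivative (0::real)) (at x)" by simp
  then have "(bump has_vector_derivative 0) (at x)"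
    by (rule has_vector_derivative_transform_within_open[of _ _ _ "- {-1..1}"]) (use x bump_0 in auto)
  then show ?thesis by (simp add: has_real_derivative_iff_has_vector_derivative)
qed

text \<open>\<open>circle_point\<close> is periodic, so derivatives need to be examined only for
  \<open>-\<pi> < t \<le> \<pi>\<close>.\<close>
lemma loop_derivative_shift:
  assumes "((\<lambda>s. h (circle_point s)) has_vector_derivative D) (at t')" "circle_point t = circle_point t'"
  shows "((\<lambda>s. h (circle_point s)) has_vector_derivative D) (at t)"
proof -
  have "sin t = sin t'" "cos t = cos t'" using assms(2) by (auto simp: circle_eq_iff)
  then obtain n :: int where n: "t = t' + 2 * pi * n" using sin_cos_eq_iff[of t t'] by (auto simp: algebra_simps)
  have "((\<lambda>s. s - 2 * pi * n) has_vector_derivative 1) (at t)"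
    by (auto intro!: derivative_eq_intros simp flip: has_real_derivative_iff_has_vector_derivative)
  from vector_diff_chain_at[OF this, of "\<lambda>s. h (circle_point s)" D]
  have "((\<lambda>s. h (circle_point (s - 2 * pi * n))) has_vector_derivative D) (at t)"
    using assms(1) n by (simp add: o_def)
  moreover have "circle_point (s - 2 * pi * n) = circle_point s" for s
    using sin_cos_eq_iff[of "s - 2 * pi * n" s] by (auto simp: circle_eq_iff intro!: exI[of _ "-n"])
  ultimately show ?thesis by simp
qed

context
  fixes a :: "'n::finite" and g :: "real^(1 option) \<Rightarrow> real^('n option)" and s :: real
  assumes g: "g \<in> axis_embeddings a" and v: "velocity g = axis_vec a" and s: "0 \<le> s" "s \<le> 1"
begin

private lemma c: "g \<in> circle_embeddings" and p: "g pt_inf = pt_inf"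
  using axis_embeddings_circle[OF g] axis_embeddings_pt_inf[OF g] by auto

private lemma e: "scale a g > 0" "scale a g \<le> 1/32" "scale a g \<le> far_distance a g / 64"
    "scale a g * (bump_bound * accel_bound a g) \<le> 1/32" "scale a g * accel_bound a g \<le> 1/32"
proof -
  note sc = scale[OF c p, of a]
  show "scale a g > 0" "scale a g \<le> 1/32" "scale a g \<le> far_distance a g / 64" using sc by auto
  have "scale a g * (32 * bump_bound * accel_bound a g) = 32 * (scale a g * (bump_bound * accel_bound a g))"
    by algebra
  then show 1: "scale a g * (bump_bound * accel_bound a g) \<le> 1/32" using sc(2) by linarith
  have "scale a g * (1 * accel_bound a g) \<le> scale a g * (bump_bound * accel_bound a g)"
    using sc(1) bump_bound(1) accel_bound(2)[OF c, of a] by (intro mult_left_mono mult_right_mono) auto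
  then show "scale a g * accel_bound a g \<le> 1/32" using 1 by simp
qed

private lemma coeff: "0 \<le> s * bump x" "s * bump x \<le> 1"
  using bump_range[of x] s mult_mono[of s 1 "bump x" 1] by auto

private lemma blend_deviation:
  "blend a s e' g (circle_point t) = great_circle a (circle_point t) + (1 - s * bump (sin t / e')) *\<^sub>R deviation a g t"
  by (simp add: blend_def deviation_def algebra_simps)

text \<open>On twice the straightened arc the angle is at most \<open>4 * scale a g\<close>, where
  the deviation is much smaller than the angle; hence the blended curve projects into the interior of
  the unit ball, where \<open>hemi\<close> is smooth, and \<open>g\<close> itself lies in the upper
  hemisphere, where \<open>hemi\<close> is the identity.\<close>
private lemma core_bounds:
  assumes z: "norm z = 1" "z $ None > 0" "\<bar>z $ Some 1\<bar> < 2 * scale a g"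
  shows "norm (flat (blend a s (scale a g) g z)) \<le> 8 * scale a g" "g z $ None > 0"
proof -
  let ?e = "scale a g" and ?M = "accel_bound a g"
  obtain t where t: "- pi < t" "t \<le> pi" "z = circle_point t" using circle_point_surj[OF z(1)] .
  have "\<bar>t\<bar> \<le> 2 * \<bar>sin t\<bar>" using small_angle[of t] t z e(2) by simp
  then have t4: "\<bar>t\<bar> \<le> 4 * ?e" using t z by simp
  then have t1: "\<bar>t\<bar> \<le> 1/8" using e(2) by simp
  have M: "?M \<ge> 1" by (rule accel_bound(2)[OF c])
  have "?M * \<bar>t\<bar> \<le> ?M * (4 * ?e)" using t4 M by (intro mult_left_mono) auto
  then have Mt: "?M * \<bar>t\<bar> \<le> 1/8" using e(5) by (simp add: mult.commute)
  have "?M * t\<^sup>2 = (?M * \<bar>t\<bar>) * \<bar>t\<bar>" by (simp add: power2_eq_square abs_mult_self_eq)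
  also have "\<dots> \<le> 1/8 * \<bar>t\<bar>" using Mt by (intro mult_right_mono) auto
  finally have Mt2: "?M * t\<^sup>2 \<le> 1/8 * \<bar>t\<bar>" .
  have w: "norm (deviation a g t) \<le> 1/8 * \<bar>t\<bar>" using deviation_bounds(2)[OF g v, of t] t1 Mt2 by simp
  have f: "flat (blend a s ?e g z) = sin t *\<^sub>R axis_vec a + (1 - s * bump (sin t / ?e)) *\<^sub>R flat (deviation a g t)"
    unfolding t(3) blend_deviation
    by (simp add: vec_eq_iff split_option_all great_circle_def)
  have "norm (flat (blend a s ?e g z)) \<le> \<bar>sin t\<bar> + \<bar>1 - s * bump (sin t / ?e)\<bar> * norm (flat (deviation a g t))"
    unfolding f by (rule norm_triangle_le) simp
  also have "\<dots> \<le> \<bar>t\<bar> + 1 * (1/8 * \<bar>t\<bar>)"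
    using coeff[of "sin t / ?e"] w norm_flat_le[of "deviation a g t"]
    by (intro add_mono mult_mono abs_sin_x_le_abs_x) auto
  also have "\<dots> \<le> 8 * ?e" using t4 e(1) by simp
  finally show "norm (flat (blend a s ?e g z)) \<le> 8 * ?e" .
  have "t\<^sup>2 \<le> (1/8)\<^sup>2" using t1 by (simp only: abs_le_square_iff[symmetric])
  then have "cos t \<ge> 1/2" using cos_lower_bound[of t] by (simp add: power2_eq_square)
  moreover have "\<bar>deviation a g t $ None\<bar> \<le> 1/64"
    using component_le_norm_cart[of "deviation a g t" None] w t1 by simp
  moreover have "g z $ None = cos t + deviation a g t $ None" by (simp add: deviation_def t(3))
  ultimately show "g z $ None > 0" by linarith
qed

private lemma straighten_loop:
  "straighten a s (scale a g) g (circle_point t) =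
    (if cos t > 0 \<and> \<bar>sin t\<bar> < scale a g then hemi (blend a s (scale a g) g (circle_point t)) else g (circle_point t))"
  by (simp add: straighten_def)

text \<open>In the chart \<open>flat\<close> the straightened curve is given by one formula for all
  \<open>\<bar>t\<bar> \<le> 1/4\<close>, inside and outside the blending region, because the bump
  vanishes on the overlap.\<close>
private lemma straighten_component:
  assumes "\<bar>t\<bar> \<le> 1/4"
  shows "straighten a s (scale a g) g (circle_point t) $ Some i =
    great_circle a (circle_point t) $ Some i + (1 - s * bump (sin t / scale a g)) * deviation a g t $ Some i"
proof -
  have "t\<^sup>2 \<le> (1/4)\<^sup>2" using assms by (simp only: abs_le_square_iff[symmetric])
  then have "cos t > 0" using cos_lower_bound[of t] by (simp add: power2_eq_square)
  moreover have "bump (sin t / scale a g) = 0" if "\<not> \<bar>sin t\<bar> < scale a g"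
    using that e(1) by (intro bump_0) (simp add: abs_div_pos[symmetric])
  ultimately show ?thesis unfolding straighten_loop
    by (auto simp: blend_deviation) (simp add: deviation_def)
qed

private lemma component_derivative:
  "\<exists>d. \<bar>d\<bar> \<le> bump_bound \<and> (\<bar>sin t\<bar> > scale a g \<longrightarrow> d = 0) \<and>
    ((\<lambda>t. great_circle a (circle_point t) $ Some i + (1 - s * bump (sin t / scale a g)) * deviation a g t $ Some i)
     has_real_derivative cos t * axis_vec a $ Some i + ((1 - s * bump (sin t / scale a g)) * nth_vderiv 1 (deviation a g) t $ Some i
        - s * (d * (cos t / scale a g)) * deviation a g t $ Some i)) (at t)"
proof -
  obtain d where d: "(bump has_real_derivative d) (at (sin t / scale a g))" "\<bar>d\<bar> \<le> bump_bound"
    "\<bar>sin t\<bar> > scale a g \<longrightarrow> d = 0"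
  proof (cases "\<bar>sin t\<bar> > scale a g")
    case True
    then have "\<bar>sin t / scale a g\<bar> > 1" using e(1) by (simp add: abs_div_pos[symmetric])
    then show ?thesis using bump_derivative_0 bump_bound(1) by (intro that[of 0]) auto
  next
    case False
    then show ?thesis using bump_bound(2)[of "sin t / scale a g"] by (auto intro: that)
  qed
  have 1: "((\<lambda>t. bump (sin t / scale a g)) has_real_derivative d * (cos t / scale a g)) (at t)"
    by (rule DERIV_chain2[of bump d "\<lambda>t. sin t / scale a g" t, OF d(1)]) (use e(1) in \<open>auto intro!: derivative_eq_intros\<close>)
  have "((\<lambda>t. deviation a g t $ Some i) has_vector_derivative nth_vderiv 1 (deviation a g) t $ Some i) (at t)"
    using bounded_linear.has_vector_derivative[OF bounded_linear_vec_nth deviation_derivatives[OF c, of 0 a t]] by simp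
  then have 2: "((\<lambda>t. deviation a g t $ Some i) has_real_derivative nth_vderiv 1 (deviation a g) t $ Some i) (at t)"
    by (simp add: has_real_derivative_iff_has_vector_derivative)
  have gc: "(\<lambda>t. great_circle a (circle_point t) $ Some i) = (\<lambda>t. sin t * axis_vec a $ Some i)"
    by (simp add: great_circle_def fun_eq_iff)
  have 3: "((\<lambda>t. great_circle a (circle_point t) $ Some i) has_real_derivative cos t * axis_vec a $ Some i) (at t)"
    unfolding gc by (auto intro!: derivative_eq_intros)
  have 4: "((\<lambda>t. 1 - s * bump (sin t / scale a g)) has_real_derivative - (s * (d * (cos t / scale a g)))) (at t)"
    using DERIV_diff[OF DERIV_const[of 1] DERIV_cmult[OF 1, of s]] by simp
  have "((\<lambda>t. great_circle a (circle_point t) $ Some i + (1 - s * bump (sin t / scale a g)) * deviation a g t $ Some i)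
     has_real_derivative cos t * axis_vec a $ Some i + ((1 - s * bump (sin t / scale a g)) * nth_vderiv 1 (deviation a g) t $ Some i
        - s * (d * (cos t / scale a g)) * deviation a g t $ Some i)) (at t)"
    by (rule DERIV_cong[OF DERIV_add[OF 3 DERIV_mult[OF 4 2]]]) simp
  then show ?thesis using d by blast
qed

text \<open>The leading term \<open>cos t\<close> is at least \<open>31/32\<close>. The derivative
  of the deviation contributes at most \<open>1/4\<close> and the derivative of the cut-off, by the
  choice of \<open>scale\<close>, at most \<open>1/8\<close>.\<close>
private lemma component_increasing:
  assumes t: "\<bar>t\<bar> \<le> core_radius a g"
  shows "\<exists>y>0. ((\<lambda>t. great_circle a (circle_point t) $ Some a + (1 - s * bump (sin t / scale a g)) * deviation a g t $ Some a)
     has_real_derivative y) (at t)"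
proof -
  let ?e = "scale a g" and ?M = "accel_bound a g" and ?B = bump_bound
  obtain d where d: "\<bar>d\<bar> \<le> ?B" "\<bar>sin t\<bar> > ?e \<longrightarrow> d = 0"
    "((\<lambda>t. great_circle a (circle_point t) $ Some a + (1 - s * bump (sin t / scale a g)) * deviation a g t $ Some a)
     has_real_derivative cos t * axis_vec a $ Some a + ((1 - s * bump (sin t / scale a g)) * nth_vderiv 1 (deviation a g) t $ Some a
        - s * (d * (cos t / ?e)) * deviation a g t $ Some a)) (at t)"
    using component_derivative[of t a] by blast
  have M: "?M \<ge> 1" by (rule accel_bound(2)[OF c])
  have t4: "\<bar>t\<bar> \<le> 1/4" using t core_radius[OF c, of a] by simp
  have "t\<^sup>2 \<le> (1/4)\<^sup>2" using t4 by (simp only: abs_le_square_iff[symmetric])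
  then have cos: "cos t \<ge> 31/32" using cos_lower_bound[of t] by (simp add: power2_eq_square)
  have "?M * \<bar>t\<bar> \<le> ?M * core_radius a g" using t M by (intro mult_left_mono) auto
  also have "\<dots> = 1/4" using M by (simp add: core_radius_def)
  finally have Mt: "?M * \<bar>t\<bar> \<le> 1/4" .
  have "norm (nth_vderiv 1 (deviation a g) t) \<le> 1/4" using deviation_bounds(1)[OF g v, of t] t4 Mt by simp
  then have w1: "\<bar>nth_vderiv 1 (deviation a g) t $ Some a\<bar> \<le> 1/4"
    using component_le_norm_cart[of "nth_vderiv 1 (deviation a g) t" "Some a"] by simp
  have "\<bar>(1 - s * bump (sin t / ?e)) * nth_vderiv 1 (deviation a g) t $ Some a\<bar> \<le> 1 * (1/4)"
    unfolding abs_mult using w1 coeff[of "sin t / ?e"] by (intro mult_mono) auto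
  moreover have "\<bar>s * (d * (cos t / ?e)) * deviation a g t $ Some a\<bar> \<le> 1/8"
  proof (cases "\<bar>sin t\<bar> > ?e")
    case False
    have "\<bar>t\<bar> \<le> 2 * \<bar>sin t\<bar>" using small_angle[of t] t4 pi_gt3 cos False e(2) by simp
    then have "\<bar>t\<bar> \<le> \<bar>2 * ?e\<bar>" using False e(1) by simp
    then have t2: "t\<^sup>2 \<le> (2 * ?e)\<^sup>2" by (simp only: abs_le_square_iff)
    have "\<bar>deviation a g t $ Some a\<bar> \<le> ?M * t\<^sup>2"
      using component_le_norm_cart[of "deviation a g t" "Some a"] deviation_bounds(2)[OF g v, of t] t4 by simp
    also have "\<dots> \<le> ?M * (2 * ?e)\<^sup>2" using t2 M by (intro mult_left_mono) auto
    finally have dev: "\<bar>deviation a g t $ Some a\<bar> \<le> ?M * (2 * ?e)\<^sup>2" .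
    have "\<bar>s * (d * (cos t / ?e))\<bar> \<le> 1 * (?B * (1 / ?e))"
      unfolding abs_mult using s d(1) e(1) bump_bound(1)
      by (intro mult_mono) (auto simp: abs_div_pos[symmetric] divide_right_mono)
    then have "\<bar>s * (d * (cos t / ?e))\<bar> * \<bar>deviation a g t $ Some a\<bar> \<le> (1 * (?B * (1 / ?e))) * (?M * (2 * ?e)\<^sup>2)"
      using dev e(1) bump_bound(1) by (intro mult_mono) auto
    also have "\<dots> = 4 * (?e * (?B * ?M))" using e(1) by (simp add: power2_eq_square)
    finally show ?thesis using e(4) by (subst abs_mult) linarith
  qed (use d(2) in simp)
  moreover have pos: "x * axis_vec a $ Some a + (y - z) > 0" if "\<bar>y\<bar> \<le> 1 * (1/4)" "\<bar>z\<bar> \<le> 1/8" "x \<ge> 31/32" for x y z :: real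
    using that by (simp add: abs_le_iff)
  ultimately have "cos t * axis_vec a $ Some a + ((1 - s * bump (sin t / scale a g)) * nth_vderiv 1 (deviation a g) t $ Some a
        - s * (d * (cos t / ?e)) * deviation a g t $ Some a) > 0"
    using cos by blast
  then show ?thesis using d(3) by blast
qed

lemma straighten_sphere: "norm z = 1 \<Longrightarrow> norm (straighten a s (scale a g) g z) = 1"
proof (cases "z $ None > 0 \<and> \<bar>z $ Some 1\<bar> < scale a g")
  case True
  assume z: "norm z = 1"
  have "norm (flat (blend a s (scale a g) g z)) \<le> 8 * scale a g"
    by (rule core_bounds(1)[OF z]) (use True e(1) in auto)
  then show ?thesis using z True e(2) by (simp add: straighten_def hemi_norm)
next
  case False
  assume z: "norm z = 1"
  then have "straighten a s (scale a g) g z = g z" using False unfolding straighten_def by auto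
  then show ?thesis using circle_embeddingD(4)[OF c z] by simp
qed

lemma straighten_far:
  assumes "- pi < t" "t \<le> pi" "core_radius a g \<le> \<bar>t\<bar>"
  shows "\<not> (cos t > 0 \<and> \<bar>sin t\<bar> \<le> scale a g)"
proof
  assume h: "cos t > 0 \<and> \<bar>sin t\<bar> \<le> scale a g"
  then have "\<bar>t\<bar> \<le> 2 * scale a g" using small_angle[of t] assms e(2) by simp
  moreover have "scale a g * (4 * accel_bound a g) \<le> 1/8" using e(5) by simp
  then have "scale a g \<le> 1/8 * core_radius a g"
    using accel_bound(2)[OF c, of a] by (simp add: core_radius_def field_simps)
  ultimately show False using assms(3) core_radius[OF c, of a] by simp
qed

text \<open>Two parameters inside the core are separated by the coordinate along the axis. Outside
  the core the curve is unchanged and keeps the distance \<open>far_distance a g\<close> from the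
  base-point, whereas the modified arc stays within \<open>16 * scale a g\<close>; hence a point
  outside the core is never hit by the modified arc.\<close>
lemma straighten_inj:
  assumes "norm z = 1" "norm w = 1" "straighten a s (scale a g) g z = straighten a s (scale a g) g w"
  shows "z = w"
proof -
  let ?f = "straighten a s (scale a g) g" and ?r = "core_radius a g"
  have far: "t = u" if t: "- pi < t" "t \<le> pi" "- pi < u" "u \<le> pi" and eq: "?f (circle_point t) = ?f (circle_point u)"
    and r: "\<bar>t\<bar> > ?r" for t u
  proof (cases "cos u > 0 \<and> \<bar>sin u\<bar> < scale a g")
    case True
    have "?f (circle_point t) = g (circle_point t)" using straighten_far[of t] t r unfolding straighten_loop by auto
    moreover have "norm (?f (circle_point u) - pt_inf) \<le> 16 * scale a g"
      using True core_bounds(1)[of "circle_point u"] hemi_near[of "blend a s (scale a g) g (circle_point u)"] e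
      unfolding straighten_loop by simp
    ultimately have "far_distance a g \<le> 16 * scale a g"
      using far_distance(3)[OF c p, of t a] t r eq by simp
    then show ?thesis using e by simp
  next
    case False
    then have "g (circle_point t) = g (circle_point u)"
      using straighten_far[of t] t r eq unfolding straighten_loop by auto
    then have "circle_point t = circle_point u" using circle_embeddingD(5)[OF c] by simp
    then show ?thesis using circle_point_inj t by blast
  qed
  have near: "?f (circle_point t) $ Some a < ?f (circle_point u) $ Some a" if "\<bar>t\<bar> \<le> ?r" "\<bar>u\<bar> \<le> ?r" "t < u" for t u
  proof -
    have le: "\<bar>t\<bar> \<le> 1/4" "\<bar>u\<bar> \<le> 1/4" using that core_radius[OF c, of a] by auto
    show ?thesis
      unfolding straighten_component[OF le(1)] straighten_component[OF le(2)]
    proof (rule DERIV_pos_imp_increasing[OF that(3)])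
      fix x assume "t \<le> x" "x \<le> u"
      then have "\<bar>x\<bar> \<le> ?r" using that by linarith
      from component_increasing[OF this]
      show "\<exists>y. ((\<lambda>t. great_circle a (circle_point t) $ Some a + (1 - s * bump (sin t / scale a g)) * deviation a g t $ Some a)
        has_real_derivative y) (at x) \<and> y > 0" by blast
    qed
  qed
  obtain t where t: "- pi < t" "t \<le> pi" "z = circle_point t" using circle_point_surj[OF assms(1)] .
  obtain u where u: "- pi < u" "u \<le> pi" "w = circle_point u" using circle_point_surj[OF assms(2)] .
  have eq: "?f (circle_point t) = ?f (circle_point u)" using assms t u by simp
  consider "\<bar>t\<bar> > ?r" | "\<bar>u\<bar> > ?r" | "\<bar>t\<bar> \<le> ?r" "\<bar>u\<bar> \<le> ?r" by linarith
  then have "t = u"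
  proof cases
    case 1 then show ?thesis using far[of t u] t u eq by simp
  next
    case 2 then show ?thesis using far[of u t] t u eq by simp
  next
    case 3 then show ?thesis using near[of t u] near[of u t] eq by (cases t u rule: linorder_cases) auto
  qed
  then show ?thesis using t u by simp
qed

text \<open>The derivative is nonzero in the core because its component along the axis is positive,
  and elsewhere because the curve coincides with \<open>g\<close> locally. At the base-point the
  deviation and its derivative vanish, so blending does not change the velocity.\<close>
lemma straighten_mem:
  assumes sm: "smooth_curve (straighten a s (scale a g) g \<circ> circle_point)"
  shows "straighten a s (scale a g) g \<in> circle_embeddings"
    and "straighten a s (scale a g) g \<in> axis_embeddings a"
    and "velocity (straighten a s (scale a g) g) = axis_vec a"
proof -
  let ?f = "straighten a s (scale a g) g"
  have der: "((\<lambda>t. ?f (circle_point t)) has_vector_derivative vector_derivative (\<lambda>t. ?f (circle_point t)) (at t)) (at t)" for t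
  proof -
    have "nth_vderiv 0 (?f \<circ> circle_point) differentiable (at t)"
      using sm unfolding smooth_curve_def by blast
    then show ?thesis by (simp add: vector_derivative_works o_def)
  qed
  have comp: "((\<lambda>t. great_circle a (circle_point t) $ Some i + (1 - s * bump (sin t / scale a g)) * deviation a g t $ Some i)
     has_vector_derivative vector_derivative (\<lambda>t. ?f (circle_point t)) (at t) $ Some i) (at t)" if t: "\<bar>t\<bar> < core_radius a g" for t i
  proof -
    have "((\<lambda>t. ?f (circle_point t) $ Some i) has_vector_derivative vector_derivative (\<lambda>t. ?f (circle_point t)) (at t) $ Some i) (at t)"
      by (rule bounded_linear.has_vector_derivative[OF bounded_linear_vec_nth der])
    then show ?thesis
      by (rule has_vector_derivative_transform_within_open[of _ _ _ "{- core_radius a g<..<core_radius a g}"])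
        (use t core_radius[OF c, of a] in \<open>auto intro!: straighten_component\<close>)
  qed
  have nz: "vector_derivative (\<lambda>t. ?f (circle_point t)) (at t) \<noteq> 0" if t: "- pi < t" "t \<le> pi" for t
  proof (cases "\<bar>t\<bar> < core_radius a g")
    case True
    obtain y where "y > 0" "((\<lambda>t. great_circle a (circle_point t) $ Some a + (1 - s * bump (sin t / scale a g)) * deviation a g t $ Some a)
      has_real_derivative y) (at t)" using component_increasing[of t] True by auto
    then have "vector_derivative (\<lambda>t. ?f (circle_point t)) (at t) $ Some a > 0"
      using vector_derivative_unique_at[OF comp[OF True, of a]]
      by (simp add: has_real_derivative_iff_has_vector_derivative)
    then show ?thesis by force
  next
    case False
    \<comment> \<open>An open set on which the curve is not modified: for \<open>\<bar>sin u\<bar> < scale a g\<close> and \<open>cos u > 0\<close> the cosine exceeds \<open>1/2\<close>.\<close>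
    let ?V = "{u. cos u < 1/2} \<union> {u. sin u * sin u > scale a g * scale a g}"
    have V: "open ?V" by (intro open_Un open_Collect_less continuous_intros)
    have "t \<in> ?V"
    proof (cases "cos t < 1/2")
      case cos: False
      then have "\<not> \<bar>sin t\<bar> \<le> \<bar>scale a g\<bar>" using straighten_far[of t] t False e(1) by auto
      then have "\<not> sin t * sin t \<le> scale a g * scale a g" unfolding abs_le_square_iff power2_eq_square .
      then show ?thesis by simp
    qed simp
    moreover have "g (circle_point u) = ?f (circle_point u)" if u: "u \<in> ?V" for u
    proof -
      have "\<not> (cos u > 0 \<and> \<bar>sin u\<bar> < scale a g)"
      proof
        assume h: "cos u > 0 \<and> \<bar>sin u\<bar> < scale a g"
        then have s2: "sin u * sin u < scale a g * scale a g" using square_less_iff[OF e(1)] by blast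
        have "cos u < 1/2" using u s2 by auto
        then have "cos u * cos u < 1/2 * (1/2)" using h by (intro mult_strict_mono) auto
        moreover have "\<bar>sin u\<bar> < 1/2" using h e(2) by simp
        then have "sin u * sin u < 1/2 * (1/2)" by (simp only: square_less_iff)
        ultimately show False using sin_cos_squared_add[of u] by (simp add: power2_eq_square)
      qed
      then show ?thesis unfolding straighten_loop by auto
    qed
    ultimately have "((\<lambda>t. ?f (circle_point t)) has_vector_derivative vector_derivative (\<lambda>t. g (circle_point t)) (at t)) (at t)"
      by (intro has_vector_derivative_transform_within_open[OF loop_derivative[OF c] V])
    then show ?thesis using loop_immersed[OF c, of t] by (simp add: vector_derivative_at)
  qed
  show m: "?f \<in> circle_embeddings"
  proof (rule circle_embeddingI[OF _ sm])
    fix t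
    obtain t' where t': "- pi < t'" "t' \<le> pi" "circle_point t = circle_point t'"
      using circle_point_surj[OF circle_point_sphere[of t]] .
    show "vector_derivative (?f \<circ> circle_point) (at t) \<noteq> 0"
      using nz[OF t'(1,2)] vector_derivative_at[OF loop_derivative_shift[OF der t'(3)]] by (simp add: o_def)
  qed (use straighten_sphere straighten_inj in \<open>auto simp: straighten_def\<close>)
  have "?f pt_inf = pt_inf"
    using e(1) hemi_eq[of pt_inf] by (simp add: straighten_def blend_def p great_circle_def)
  then have pt: "?f \<in> pointed_embeddings" using m by (simp add: pointed_embeddings_def)
  have "velocity ?f $ Some i = axis_vec a $ Some i" for i
  proof -
    obtain d where "((\<lambda>t. great_circle a (circle_point t) $ Some i + (1 - s * bump (sin t / scale a g)) * deviation a g t $ Some i)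
     has_real_derivative axis_vec a $ Some i) (at 0)"
      using component_derivative[of 0 i] deviation_bounds(3,4)[OF g v, of 0] by auto
    then show ?thesis
      using vector_derivative_unique_at[OF comp[of 0 i]] core_radius[OF c, of a]
      by (simp add: has_real_derivative_iff_has_vector_derivative velocity_def)
  qed
  then show ve: "velocity ?f = axis_vec a"
    using velocity_None[OF pt] by (simp add: vec_eq_iff split_option_all)
  show "?f \<in> axis_embeddings a" using pt ve by (simp add: axis_embeddings_def)
qed

lemmas straighten_core_bounds = core_bounds
lemmas straighten_scale = e

end

text \<open>The two open regions \<open>R1\<close>, on which the blending formula holds, and
  \<open>R2\<close>, on which the curve is that of \<open>G x\<close>, cover everything. Taking twice
  the width in \<open>R1\<close> makes these open regions overlap.\<close>
lemma straighten_continuous: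
  fixes G :: "'x \<Rightarrow> real^(1 option) \<Rightarrow> real^('n::finite option)"
  assumes G: "continuous_map X Emb G" and s: "continuous_map X euclideanreal s"
    and ax: "\<And>x. x \<in> topspace X \<Longrightarrow> G x \<in> axis_embeddings a" "\<And>x. x \<in> topspace X \<Longrightarrow> velocity (G x) = axis_vec a"
    and s01: "\<And>x. x \<in> topspace X \<Longrightarrow> 0 \<le> s x" "\<And>x. x \<in> topspace X \<Longrightarrow> s x \<le> 1"
  shows "continuous_map X Emb (\<lambda>x. straighten a (s x) (scale a (G x)) (G x))"
    and "\<And>x. x \<in> topspace X \<Longrightarrow> smooth_curve (straighten a (s x) (scale a (G x)) (G x) \<circ> circle_point)"
proof -
  let ?T = "prod_topology X (euclidean :: real topology)"
  define e where "e x = scale a (G x)" for x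
  have "continuous_map X (subtopology Emb {g. g pt_inf = pt_inf}) G"
    using G axis_embeddings_pt_inf[OF ax(1)] by (auto simp: continuous_map_in_subtopology)
  from continuous_map_compose[OF this continuous_map_scale]
  have ec: "continuous_map X euclideanreal e" by (simp add: o_def e_def[abs_def])
  have e: "e x > 0" "e x \<le> 1/32" if "x \<in> topspace X" for x
    using straighten_scale[OF ax(1)[OF that] ax(2)[OF that]] s01[OF that] unfolding e_def by auto
  \<comment> \<open>The cut-off vanishes for \<open>\<bar>sin t\<bar> \<ge> e x\<close>, so the blending formula stays valid up to twice that width.\<close>
  define R1 where "R1 = {p \<in> topspace ?T. cos (snd p) > 0} \<inter> {p \<in> topspace ?T. (2 * e (fst p)) * (2 * e (fst p)) - sin (snd p) * sin (snd p) > 0}"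
  define R2 where "R2 = {p \<in> topspace ?T. cos (snd p) < 1/2} \<union> {p \<in> topspace ?T. sin (snd p) * sin (snd p) - e (fst p) * e (fst p) > 0}"
  let ?W = "topspace X \<times> (UNIV :: real set)"
  have op: "openin ?T {p \<in> topspace ?T. f (fst p) (snd p) \<in> U}" if "joint_smooth X ?W f" "open U" for f and U :: "real set"
    using openin_continuous_map_preimage[OF joint_smooth_imp_continuous_whole[OF that(1)], of U] that(2) by simp
  have cs: "joint_smooth X ?W (\<lambda>_ t. cos t)" "joint_smooth X ?W (\<lambda>_ t. sin t)"
    by (rule joint_smooth_cos joint_smooth_sin, rule openin_whole, rule joint_smooth_id)+
  have O1: "openin ?T R1" unfolding R1_def
  proof (rule openin_Int)
    show "openin ?T {p \<in> topspace ?T. cos (snd p) > 0}" using op[OF cs(1), of "{0<..}"] by simp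
    have "joint_smooth X ?W (\<lambda>x t. (2 * e x) * (2 * e x) - sin t * sin t)"
      by (intro joint_smooth_diff joint_smooth_mult joint_smooth_const joint_smooth_param ec cs)
    from op[OF this, of "{0<..}"]
    show "openin ?T {p \<in> topspace ?T. (2 * e (fst p)) * (2 * e (fst p)) - sin (snd p) * sin (snd p) > 0}" by simp
  qed
  have O2: "openin ?T R2" unfolding R2_def
  proof (rule openin_Un)
    show "openin ?T {p \<in> topspace ?T. cos (snd p) < 1/2}" using op[OF cs(1), of "{..<1/2}"] by simp
    have "joint_smooth X ?W (\<lambda>x t. sin t * sin t - e x * e x)"
      by (intro joint_smooth_diff joint_smooth_mult joint_smooth_const joint_smooth_param ec cs)
    from op[OF this, of "{0<..}"]
    show "openin ?T {p \<in> topspace ?T. sin (snd p) * sin (snd p) - e (fst p) * e (fst p) > 0}" by simp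
  qed
  have R1: "x \<in> topspace X" "cos t > 0" "\<bar>sin t\<bar> < 2 * e x" if "(x, t) \<in> R1" for x t
    using that e(1)[of x] square_less_iff[of "2 * e x" "sin t"] by (auto simp: R1_def)
  have cover: "?W \<subseteq> R1 \<union> R2"
  proof
    fix p :: "'x \<times> real" assume "p \<in> ?W"
    then obtain x t where p: "p = (x, t)" "x \<in> topspace X" by auto
    show "p \<in> R1 \<union> R2"
    proof (cases "cos t \<ge> 1/2 \<and> \<not> sin t * sin t - e x * e x > 0")
      case True
      have "e x * e x > 0" using e[OF p(2)] by simp
      then have "sin t * sin t < (2 * e x) * (2 * e x)" using True by simp
      then show ?thesis using True p by (simp add: R1_def)
    next
      case False then show ?thesis using p by (auto simp: R2_def)
    qed
  qed
  note Gs = continuous_map_EmbD[OF G]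
  have bl: "joint_smooth X R1 (\<lambda>x t. blend a (s x) (e x) (G x) (circle_point t))"
  proof -
    have i: "joint_smooth X R1 (\<lambda>x t. sin t / e x)"
    proof (rule joint_smooth_divide[OF joint_smooth_subset[OF cs(2)] joint_smooth_param[OF ec]])
      show "R1 \<subseteq> ?W" by (auto simp: R1_def)
      show "e x \<noteq> 0" if "(x, t) \<in> R1" for x t using e(1)[OF R1(1)[OF that]] by simp
    qed
    have g: "joint_smooth X R1 (\<lambda>x t. G x (circle_point t))"
      by (rule joint_smooth_subset[OF Gs]) (auto simp: R1_def)
    have c: "joint_smooth X R1 (\<lambda>x t. great_circle a (circle_point t))"
      by (intro joint_smooth_linear[OF great_circle_linear] joint_smooth_circle_point O1 joint_smooth_id)
    have "joint_smooth X R1 (\<lambda>x t. G x (circle_point t) + (s x * bump (sin t / e x)) *\<^sub>R (great_circle a (circle_point t) - G x (circle_point t)))"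
      by (intro joint_smooth_add joint_smooth_scaleR joint_smooth_mult joint_smooth_param s joint_smooth_bump O1 i joint_smooth_diff g c)
    then show ?thesis by (simp add: blend_def)
  qed
  have fl: "joint_smooth X R1 (\<lambda>x t. flat (blend a (s x) (e x) (G x) (circle_point t)))"
    by (rule joint_smooth_linear[OF flat_linear bl])
  have small: "1 - flat (blend a (s x) (e x) (G x) (circle_point t)) \<bullet> flat (blend a (s x) (e x) (G x) (circle_point t)) > 0"
    "G x (circle_point t) $ None > 0" if "(x, t) \<in> R1" for x t
  proof -
    note r = R1[OF that]
    note cb = straighten_core_bounds[OF ax(1)[OF r(1)] ax(2)[OF r(1)] s01(1)[OF r(1)] s01(2)[OF r(1)], of "circle_point t"]
    have "norm (flat (blend a (s x) (e x) (G x) (circle_point t))) \<le> 8 * e x" using cb(1) r by (simp add: e_def)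
    then have "norm (flat (blend a (s x) (e x) (G x) (circle_point t))) \<le> 1/4" using e(2)[OF r(1)] by simp
    then have "(norm (flat (blend a (s x) (e x) (G x) (circle_point t))))\<^sup>2 \<le> (1/4)\<^sup>2" by (intro power_mono) auto
    then show "1 - flat (blend a (s x) (e x) (G x) (circle_point t)) \<bullet> flat (blend a (s x) (e x) (G x) (circle_point t)) > 0"
      unfolding power2_norm_eq_inner by (simp add: power_divide)
    show "G x (circle_point t) $ None > 0" using cb(2) r by (simp add: e_def)
  qed
  have h: "joint_smooth X R1 (\<lambda>x t. hemi (blend a (s x) (e x) (G x) (circle_point t)))"
    unfolding hemi_def power2_norm_eq_inner
    by (intro joint_smooth_add joint_smooth_scaleR joint_smooth_sqrt joint_smooth_diff joint_smooth_inner
        joint_smooth_const fl O1 small(1))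
  let ?F = "\<lambda>x t. straighten a (s x) (e x) (G x) (circle_point t)"
  have F1: "joint_smooth X R1 ?F"
  proof (rule joint_smooth_cong[OF O1 _ h])
    fix x t assume xt: "(x, t) \<in> R1"
    note r = R1[OF xt]
    show "hemi (blend a (s x) (e x) (G x) (circle_point t)) = ?F x t"
    proof (cases "\<bar>sin t\<bar> < e x")
      case True then show ?thesis using r by (simp add: straighten_def)
    next
      case False
      then have "bump (sin t / e x) = 0" using e(1)[OF r(1)] by (intro bump_0) (simp add: abs_div_pos[symmetric])
      then have "hemi (blend a (s x) (e x) (G x) (circle_point t)) = G x (circle_point t)"
        using hemi_eq[of "G x (circle_point t)"] small(2)[OF xt]
          circle_embeddingD(4)[OF axis_embeddings_circle[OF ax(1)[OF r(1)]], of "circle_point t"]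
        by (simp add: blend_def)
      then show ?thesis using False r by (simp add: straighten_def)
    qed
  qed
  have F2: "joint_smooth X R2 ?F"
  proof (rule joint_smooth_cong[OF O2])
    show "joint_smooth X R2 (\<lambda>x t. G x (circle_point t))"
      by (rule joint_smooth_subset[OF Gs]) (auto simp: R2_def)
    fix x t assume xt: "(x, t) \<in> R2"
    then have x: "x \<in> topspace X" by (auto simp: R2_def)
    have "\<not> (cos t > 0 \<and> \<bar>sin t\<bar> < e x)"
    proof
      assume h: "cos t > 0 \<and> \<bar>sin t\<bar> < e x"
      then have "sin t * sin t < e x * e x" using square_less_iff[OF e(1)[OF x]] by blast
      then have "cos t < 1/2" using xt by (auto simp: R2_def)
      then have "cos t * cos t < 1/2 * (1/2)" using h by (intro mult_strict_mono) auto
      moreover have "\<bar>sin t\<bar> < 1/2" using h e(2)[OF x] by linarith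
      then have "sin t * sin t < 1/2 * (1/2)" by (simp only: square_less_iff)
      ultimately show False using sin_cos_squared_add[of t] by (simp add: power2_eq_square)
    qed
    then show "G x (circle_point t) = ?F x t" by (auto simp: straighten_def)
  qed
  have sm: "joint_smooth X ?W ?F" by (rule joint_smooth_Un[OF O1 O2 F1 F2 cover])
  show sc: "smooth_curve (straighten a (s x) (scale a (G x)) (G x) \<circ> circle_point)" if x: "x \<in> topspace X" for x
    using joint_smooth_imp_Cinf(1)[OF sm x] by (simp add: o_def e_def)
  show "continuous_map X Emb (\<lambda>x. straighten a (s x) (scale a (G x)) (G x))"
  proof (rule continuous_map_EmbI)
    show "straighten a (s x) (scale a (G x)) (G x) \<in> circle_embeddings" if x: "x \<in> topspace X" for x
      by (rule straighten_mem(1)[OF ax(1)[OF x] ax(2)[OF x] s01(1)[OF x] s01(2)[OF x] sc[OF x]])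
  qed (use sm in \<open>simp add: e_def\<close>)
qed

lemma straighten_axis:
  assumes "g \<in> axis_embeddings a" "velocity g = axis_vec a" "0 \<le> s" "s \<le> 1"
  shows "straighten a s (scale a g) g \<in> axis_embeddings a" "velocity (straighten a s (scale a g) g) = axis_vec a"
proof -
  have "smooth_curve (straighten a s (scale a g) g \<circ> circle_point)"
    using straighten_continuous(2)[of "top_of_set {0::real}" "\<lambda>_. g" "\<lambda>_. s" a 0] assms axis_embeddings_circle[OF assms(1)]
    by simp
  then show "straighten a s (scale a g) g \<in> axis_embeddings a" "velocity (straighten a s (scale a g) g) = axis_vec a"
    using straighten_mem(2,3)[OF assms] by auto
qed

lemma straighten_0:
  assumes "g \<in> axis_embeddings a" "velocity g = axis_vec a"
  shows "straighten a 0 (scale a g) g = g"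
proof
  fix z
  have c: "g \<in> circle_embeddings" by (rule axis_embeddings_circle[OF assms(1)])
  show "straighten a 0 (scale a g) g z = g z"
  proof (cases "norm z = 1 \<and> z $ None > 0 \<and> \<bar>z $ Some 1\<bar> < scale a g")
    case True
    then have "g z $ None > 0"
      using straighten_core_bounds(2)[OF assms, of 0 z] straighten_scale(1)[OF assms, of 0] by simp
    then show ?thesis using True hemi_eq[of "g z"] circle_embeddingD(4)[OF c, of z] by (simp add: straighten_def blend_def)
  next
    case False
    then show ?thesis using circle_embeddingD(1)[OF c] by (auto simp: straighten_def extensional_def)
  qed
qed

text \<open>A standard embedding agrees with the great circle wherever blending takes place.\<close>
lemma straighten_standard:
  assumes "g \<in> standard_embeddings a" shows "straighten a s e g = g"
proof
  fix z
  have c: "g \<in> circle_embeddings" by (rule axis_embeddings_circle[OF standard_axis[OF assms]])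
  show "straighten a s e g z = g z"
  proof (cases "norm z = 1 \<and> z $ None > 0 \<and> \<bar>z $ Some 1\<bar> < e")
    case True
    then have "g z = great_circle a z" using assms by (simp add: standard_embeddings_def)
    then show ?thesis using True hemi_eq[of "great_circle a z"] by (simp add: straighten_def blend_def)
  next
    case False
    then show ?thesis using circle_embeddingD(1)[OF c] by (auto simp: straighten_def extensional_def)
  qed
qed

lemma straighten_1:
  assumes "norm z = 1" "z $ None > 0" "\<bar>z $ Some 1\<bar> \<le> e / 2" "e > 0"
  shows "straighten a 1 e g z = great_circle a z"
proof -
  have "\<bar>z $ Some 1 / e\<bar> \<le> 1/2" using assms by (simp add: field_simps)
  then have "bump (z $ Some 1 / e) = 1" by (rule bump_1)
  moreover have "\<bar>z $ Some 1\<bar> < e" using assms by linarith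
  ultimately show ?thesis using assms hemi_eq[of "great_circle a z"] by (simp add: straighten_def blend_def)
qed

section \<open>Deformation onto the compactified long knots\<close>

lemma SO_axis_great_circle: "B \<in> SO_axis a \<Longrightarrow> B *v great_circle a z = great_circle a z"
  using SO_axis_iff[of B a]
  by (simp add: great_circle_def matrix_vector_mult_scaleR matrix_vector_right_distrib)

lemma straighten_rotate:
  assumes "B \<in> SO_axis a"
  shows "straighten a s e (rotate_embedding B g) = rotate_embedding B (straighten a s e g)"
proof
  fix z
  have "norm z = 1 \<Longrightarrow> blend a s e (rotate_embedding B g) z = B *v blend a s e g z"
    by (simp add: blend_def rotate_embedding_def matrix_vector_right_distrib matrix_vector_mult_scaleR
        matrix_vector_mult_diff_distrib SO_axis_great_circle[OF assms])
  then show "straighten a s e (rotate_embedding B g) z = rotate_embedding B (straighten a s e g) z"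
    by (auto simp: straighten_def hemi_rotate[OF SO_axis_mid[OF assms]]) (auto simp: rotate_embedding_def straighten_def hemi_rotate[OF SO_axis_mid[OF assms]])
qed

lemma dilate_embedding_axis:
  assumes "g \<in> axis_embeddings a" "c > 0"
  shows "dilate_embedding (1 / c) c g \<in> axis_embeddings a"
  using dilate_embedding_pointed[OF axis_embeddings_pointed[OF assms(1)], of "1 / c" c] assms
  by (simp add: axis_embeddings_def)

text \<open>The great circle is invariant under conjugation with a dilation, so it is enough to be
  standard on the image of the hemisphere.\<close>
lemma dilate_embedding_standard:
  assumes "g \<in> axis_embeddings a" "c > 0"
    "\<And>z. norm z = 1 \<Longrightarrow> z $ None \<ge> 0 \<Longrightarrow> g (dilate c z) = great_circle a (dilate c z)"
  shows "dilate_embedding (1 / c) c g \<in> standard_embeddings a"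
  using dilate_embedding_axis[OF assms(1,2)] assms(2,3)
  by (simp add: standard_embeddings_def dilate_embedding_def dilate_great_circle dilate_inverse)

lemma dilate_None_nonneg:
  assumes "0 < c" "c \<le> 1" "norm z = 1" "z $ None \<ge> 0"
  shows "dilate c z $ None \<ge> 0" "c < 1 \<Longrightarrow> dilate c z $ None > 0" "dil_den c z \<ge> 1"
proof -
  have z: "z $ None \<le> 1" using sphere_None_bound[OF assms(3)] by simp
  have c2: "c\<^sup>2 * (1 - z $ None) \<le> 1 * (1 - z $ None)" using assms z by (intro mult_right_mono) (auto simp: power_le_one)
  have d: "dil_den c z > 0" by (rule dil_den_pos[OF assms(1,3)])
  show "dilate c z $ None \<ge> 0" using c2 assms d unfolding dilate_nth by (intro divide_nonneg_pos) auto
  show "dil_den c z \<ge> 1" unfolding dil_den_def using assms z mult_nonneg_nonneg[of "c\<^sup>2" "1 - z $ None"] by auto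
  assume "c < 1"
  then have "c\<^sup>2 < 1" using assms(1) by (simp add: power_less_one_iff)
  then have "(1 + z $ None) - c\<^sup>2 * (1 - z $ None) > 0"
  proof (cases "z $ None = 0")
    case False
    then show ?thesis using c2 assms(4) by simp
  qed simp
  then show "dilate c z $ None > 0" using d unfolding dilate_nth by (intro divide_pos_pos)
qed

text \<open>The end of the deformation. The straightened curve is standard on the arc where the bump
  equals \<open>1\<close>, that is where the sine of the angle is at most half the scale; dilating by
  a quarter of the scale maps the hemisphere into this arc.\<close>
definition regularize :: "'n::finite \<Rightarrow> (real^(1 option) \<Rightarrow> real^('n option)) \<Rightarrow> real^(1 option) \<Rightarrow> real^('n option)" where
  "regularize a g = (let u = unit_speed g; c = scale a u / 4 in dilate_embedding (1 / c) c (straighten a 1 (scale a u) u))"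

text \<open>The second and the third stage keep the standard embeddings and are equivariant because
  \<open>scale\<close> is invariant under rotations about the long axis.\<close>
lemma regularize:
  "homotopic_with (axis_compatible a) (Emb_axis a) (Emb_axis a) id (regularize a)"
  "g \<in> axis_embeddings a \<Longrightarrow> regularize a g \<in> standard_embeddings a"
proof -
  let ?X = "prod_topology (top_of_set {0..1::real}) (Emb_axis a)"
  note hu = homotopic_unit_speed(1)[of a]
  have uc: "continuous_map (Emb_axis a) (Emb_axis a) unit_speed" using homotopic_with_imp_continuous_maps[OF hu] by blast
  have ucompat: "axis_compatible a unit_speed" using homotopic_with_imp_property[OF hu] by blast
  have u: "unit_speed g \<in> axis_embeddings a" "velocity (unit_speed g) = axis_vec a" if "g \<in> axis_embeddings a" for g
    using continuous_map_image_subset_topspace[OF uc, unfolded topspace_Emb_axis] that homotopic_unit_speed(2)[OF that] by blast+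
  have us: "unit_speed g \<in> standard_embeddings a" if "g \<in> standard_embeddings a" for g
    using ucompat that by (simp add: axis_compatible_def)
  have ur: "unit_speed (rotate_embedding B g) = rotate_embedding B (unit_speed g)" if "B \<in> SO_axis a" "g \<in> axis_embeddings a" for B g
    using ucompat that by (simp add: axis_compatible_def)
  have sc: "scale a (unit_speed (rotate_embedding B g)) = scale a (unit_speed g)" if "B \<in> SO_axis a" "g \<in> axis_embeddings a" for B g
    unfolding ur[OF that] by (rule deviation_rotate(3)[OF that(1) u(1)[OF that(2)]])
  have e: "scale a (unit_speed g) > 0" "scale a (unit_speed g) \<le> 1/32" if "g \<in> axis_embeddings a" for g
    using straighten_scale(1,2)[OF u[OF that], of 0] by auto
  have U: "continuous_map ?X Emb (\<lambda>x. unit_speed (snd x))"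
    using continuous_map_into_fulltopology[OF continuous_map_compose[OF continuous_map_snd uc]] by (simp add: o_def)
  have f: "continuous_map ?X euclideanreal fst"
    by (rule continuous_map_into_fulltopology[OF continuous_map_fst])
  have "homotopic_with (axis_compatible a) (Emb_axis a) (Emb_axis a) unit_speed
     (\<lambda>g. straighten a 1 (scale a (unit_speed g)) (unit_speed g))"
  proof (rule homotopic_with_axisI[where h = "\<lambda>x. straighten a (fst x) (scale a (unit_speed (snd x))) (unit_speed (snd x))"])
    have "continuous_map ?X Emb (\<lambda>x. straighten a (fst x) (scale a (unit_speed (snd x))) (unit_speed (snd x)))"
      by (rule straighten_continuous(1)[OF U f]) (use u in auto)
    then show "continuous_map ?X (Emb_axis a) (\<lambda>x. straighten a (fst x) (scale a (unit_speed (snd x))) (unit_speed (snd x)))"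
      using straighten_axis(1)[OF u] by (auto simp: continuous_map_in_subtopology)
    show "axis_compatible a (\<lambda>g. straighten a (fst (s, g)) (scale a (unit_speed (snd (s, g)))) (unit_speed (snd (s, g))))" for s :: real
      unfolding axis_compatible_def fst_conv snd_conv
    proof (intro conjI ballI)
      fix g assume "g \<in> standard_embeddings a"
      then show "straighten a s (scale a (unit_speed g)) (unit_speed g) \<in> standard_embeddings a"
        using us straighten_standard[OF us] by simp
    next
      fix B g assume Bg: "B \<in> SO_axis a" "g \<in> axis_embeddings a"
      show "straighten a s (scale a (unit_speed (rotate_embedding B g))) (unit_speed (rotate_embedding B g)) =
          rotate_embedding B (straighten a s (scale a (unit_speed g)) (unit_speed g))"
        unfolding ur[OF Bg] deviation_rotate(3)[OF Bg(1) u(1)[OF Bg(2)]] straighten_rotate[OF Bg(1)] ..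
    qed
  qed (simp_all add: straighten_0[OF u])
  note h2 = homotopic_with_trans[OF hu this]
  let ?S = "\<lambda>g. straighten a 1 (scale a (unit_speed g)) (unit_speed g)"
  have Sc: "continuous_map (Emb_axis a) (Emb_axis a) ?S" and Scompat: "axis_compatible a ?S"
    using homotopic_with_imp_continuous_maps[OF h2] homotopic_with_imp_property[OF h2] by auto
  have S: "?S g \<in> axis_embeddings a" if "g \<in> axis_embeddings a" for g by (rule straighten_axis(1)[OF u[OF that]]) auto
  \<comment> \<open>The factor of the dilation moves linearly from \<open>1\<close> to a quarter of the scale; it stays positive and at most \<open>1\<close>, so that a hemisphere is mapped into itself.\<close>
  define c where "c x = (1 - fst x) + fst x * (scale a (unit_speed (snd x)) / 4)" for x :: "real \<times> _"
  have c: "0 < c (s, g)" "c (s, g) \<le> 1" if "0 \<le> s" "s \<le> 1" "g \<in> axis_embeddings a" for s g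
  proof -
    have "c (s, g) = 1 - s * (1 - scale a (unit_speed g) / 4)" by (simp add: c_def algebra_simps)
    moreover have "0 \<le> s * (1 - scale a (unit_speed g) / 4)" using that e(2)[OF that(3)] by (intro mult_nonneg_nonneg) auto
    moreover have "s * (1 - scale a (unit_speed g) / 4) \<le> 1 * (1 - scale a (unit_speed g) / 4)"
      using that e(2)[OF that(3)] by (intro mult_right_mono) auto
    ultimately show "0 < c (s, g)" "c (s, g) \<le> 1" using e(1)[OF that(3)] by auto
  qed
  have "continuous_map ?X (subtopology Emb {g. g pt_inf = pt_inf}) (\<lambda>x. unit_speed (snd x))"
    using U axis_embeddings_pt_inf[OF u(1)] by (auto simp: continuous_map_in_subtopology)
  from continuous_map_compose[OF this continuous_map_scale[of a]]
  have scc: "continuous_map ?X euclideanreal (\<lambda>x. scale a (unit_speed (snd x)))" by (simp add: o_def)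
  have cc: "continuous_map ?X euclideanreal c"
    unfolding c_def divide_inverse
    by (intro continuous_map_add continuous_map_diff continuous_map_real_mult f scc) auto
  have c1: "continuous_map ?X euclideanreal (\<lambda>x. inverse (c x))"
    by (intro continuous_map_real_inverse cc) (use c in force)
  have "homotopic_with (axis_compatible a) (Emb_axis a) (Emb_axis a) ?S (regularize a)"
  proof (rule homotopic_with_axisI[where h = "\<lambda>x. dilate_embedding (1 / c x) (c x) (?S (snd x))"])
    have SX: "continuous_map ?X Emb (\<lambda>x. ?S (snd x))"
      using continuous_map_into_fulltopology[OF continuous_map_compose[OF continuous_map_snd Sc]] by (simp add: o_def)
    have "continuous_map ?X Emb (\<lambda>x. dilate_embedding (inverse (c x)) (c x) (?S (snd x)))"
      by (rule dilate_embedding_continuous(1)[OF SX c1 cc]) (use c in auto)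
    then show "continuous_map ?X (Emb_axis a) (\<lambda>x. dilate_embedding (1 / c x) (c x) (?S (snd x)))"
      using dilate_embedding_axis[OF S c(1)] by (auto simp: continuous_map_in_subtopology inverse_eq_divide)
    show "dilate_embedding (1 / c (0, g)) (c (0, g)) (?S (snd (0::real, g))) = ?S g" if "g \<in> axis_embeddings a" for g
      using circle_embeddingD(1)[OF axis_embeddings_circle[OF S[OF that]]] by (simp add: c_def)
    show "dilate_embedding (1 / c (1, g)) (c (1, g)) (?S (snd (1::real, g))) = regularize a g" for g
      by (simp add: c_def regularize_def Let_def)
    show "axis_compatible a (\<lambda>g. dilate_embedding (1 / c (s, g)) (c (s, g)) (?S (snd (s, g))))" if s: "0 \<le> s" "s \<le> 1" for s
      unfolding axis_compatible_def snd_conv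
    proof (intro conjI ballI)
      fix g assume g: "g \<in> standard_embeddings a"
      then have Sg: "?S g \<in> standard_embeddings a" using Scompat by (simp add: axis_compatible_def)
      note cg = c[OF s standard_axis[OF g]]
      show "dilate_embedding (1 / c (s, g)) (c (s, g)) (?S g) \<in> standard_embeddings a"
      proof (rule dilate_embedding_standard[OF standard_axis[OF Sg] cg(1)])
        fix z :: "real^(1 option)" assume z: "norm z = 1" "z $ None \<ge> 0"
        show "?S g (dilate (c (s, g)) z) = great_circle a (dilate (c (s, g)) z)"
          using Sg dilate_norm[OF cg(1) z(1)] dilate_None_nonneg(1)[OF cg z] unfolding standard_embeddings_def by blast
      qed
    next
      fix B g assume B: "B \<in> SO_axis a" and g: "g \<in> axis_embeddings a"
      have "c (s, rotate_embedding B g) = c (s, g)" using sc[OF B g] by (simp add: c_def)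
      moreover have "?S (rotate_embedding B g) = rotate_embedding B (?S g)"
        using Scompat B g unfolding axis_compatible_def by blast
      ultimately show "dilate_embedding (1 / c (s, rotate_embedding B g)) (c (s, rotate_embedding B g)) (?S (rotate_embedding B g)) =
        rotate_embedding B (dilate_embedding (1 / c (s, g)) (c (s, g)) (?S g))"
        by (simp only: dilate_embedding_rotate[OF SO_axis_mid[OF B] c(1)[OF s g]])
    qed
  qed
  from homotopic_with_trans[OF h2 this]
  show "homotopic_with (axis_compatible a) (Emb_axis a) (Emb_axis a) id (regularize a)" .
  show "regularize a g \<in> standard_embeddings a" if g: "g \<in> axis_embeddings a"
    unfolding regularize_def Let_def
  proof (rule dilate_embedding_standard[OF S[OF g]])
    let ?c = "scale a (unit_speed g) / 4"
    show c0: "?c > 0" using e[OF g] by simp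
    have c1: "?c \<le> 1" "?c < 1" using e(2)[OF g] by auto
    fix z :: "real^(1 option)" assume z: "norm z = 1" "z $ None \<ge> 0"
    note d = dilate_None_nonneg[OF c0 c1(1) z]
    have "\<bar>z $ Some 1\<bar> \<le> 1" using component_le_norm_cart[of z "Some 1"] z by simp
    then have "2 * ?c * \<bar>z $ Some 1\<bar> \<le> 2 * ?c * dil_den ?c z"
      using d(3) c0 by (intro mult_left_mono) auto
    then have "\<bar>dilate ?c z $ Some 1\<bar> \<le> 2 * ?c"
      using d(3) c0 by (simp add: dilate_nth abs_mult divide_le_eq)
    then show "?S g (dilate ?c z) = great_circle a (dilate ?c z)"
      using d(2)[OF c1(2)] c0 z e[OF g] by (intro straighten_1) auto
  qed
qed

section \<open>The space of long knots\<close>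

lemma long_knotI:
  fixes f :: "real \<Rightarrow> real^'n::finite"
  assumes sm: "smooth_curve f" and im: "\<And>t. vector_derivative f (at t) \<noteq> 0" and inj: "inj f"
    and ax: "\<And>x. \<bar>x\<bar> \<ge> 1 \<Longrightarrow> f x = axis a x"
  shows "f \<in> long_knots a"
proof -
  have c: "continuous_on UNIV f" by (rule smooth_curve_continuous[OF sm])
  have "closed (f ` C)" if "closed C" for C
  proof -
    have l: "linear (axis a :: real \<Rightarrow> real^'n)" by (auto intro!: linearI simp: vec_eq_iff axis_def)
    have "inj (axis a :: real \<Rightarrow> real^'n)" by (auto intro!: injI simp: axis_eq_axis)
    then have "closed ((axis a :: real \<Rightarrow> real^'n) ` (C \<inter> {x. 1 \<le> \<bar>x\<bar>}))"
      using that by (intro closed_injective_linear_image l closed_Int closed_Collect_le continuous_intros)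
    moreover have "compact (f ` (C \<inter> {-1..1}))"
      using that by (intro compact_continuous_image continuous_on_subset[OF c] closed_Int_compact) auto
    moreover have "f ` C = f ` (C \<inter> {-1..1}) \<union> axis a ` (C \<inter> {x. 1 \<le> \<bar>x\<bar>})"
    proof -
      have "f ` (C \<inter> {x. 1 \<le> \<bar>x\<bar>}) = axis a ` (C \<inter> {x. 1 \<le> \<bar>x\<bar>})"
        by (rule image_cong) (use ax in auto)
      moreover have "C = (C \<inter> {-1..1}) \<union> (C \<inter> {x. 1 \<le> \<bar>x\<bar>})" by auto
      ultimately show ?thesis by (metis image_Un)
    qed
    ultimately show ?thesis by (simp add: closed_Un compact_imp_closed)
  qed
  then have "closed_map euclidean euclidean f" by (simp add: closed_map_def)
  then have "embedding_map euclidean euclidean f"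
    using c inj by (intro injective_closed_imp_embedding_map) auto
  then show ?thesis using assms by (simp add: long_knots_def)
qed

lemma long_knotD:
  assumes "f \<in> long_knots a"
  shows "smooth_curve f" "vector_derivative f (at t) \<noteq> 0" "inj f" "\<bar>x\<bar> \<ge> 1 \<Longrightarrow> f x = axis a x"
    "(f has_vector_derivative vector_derivative f (at t)) (at t)"
proof -
  show sm: "smooth_curve f" and "vector_derivative f (at t) \<noteq> 0" "\<bar>x\<bar> \<ge> 1 \<Longrightarrow> f x = axis a x"
    using assms by (auto simp: long_knots_def)
  show "inj f" using assms by (auto simp: long_knots_def embedding_map_def homeomorphic_eq_everything_map)
  have "nth_vderiv 0 f differentiable (at t)" using sm unfolding smooth_curve_def by blast
  then show "(f has_vector_derivative vector_derivative f (at t)) (at t)" by (simp add: vector_derivative_works)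
qed

lemma topspace_long_knots [simp]: "topspace (long_knot_space a) = long_knots a"
  by (simp add: long_knot_space_def)

text \<open>As for \<open>Emb\<close>, continuity into the long knots is joint smoothness of the
  family.\<close>
lemma continuous_map_long_knotsI:
  assumes "joint_smooth X (topspace X \<times> UNIV) F" "\<And>x. x \<in> topspace X \<Longrightarrow> F x \<in> long_knots a"
  shows "continuous_map X (long_knot_space a) F"
  using joint_smooth_imp_Cinf(2)[OF assms(1)] assms(2)
  by (auto simp: long_knot_space_def continuous_map_in_subtopology)

lemma continuous_map_long_knotsD:
  assumes "continuous_map X (long_knot_space a) F"
  shows "joint_smooth X (topspace X \<times> UNIV) F"
proof (rule Cinf_imp_joint_smooth)
  show "continuous_map X Cinf_topology F"
    using assms by (simp add: long_knot_space_def continuous_map_in_subtopology)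
  show "smooth_curve (F x)" if "x \<in> topspace X" for x
    using continuous_map_image_subset_topspace[OF assms] that long_knotD(1) by fastforce
qed

lemma fin_block_axis: "B \<in> SO_axis a \<Longrightarrow> fin_block B *v axis a x = axis a x"
  by (simp add: SO_axis_def)

lemma rotate_knot_mem:
  assumes B: "B \<in> SO_axis a" and f: "f \<in> long_knots a"
  shows "rotate_knot B f \<in> long_knots a"
proof (rule long_knotI)
  note fd = long_knotD[OF f]
  have d: "(rotate_knot B f has_vector_derivative fin_block B *v vector_derivative f (at t)) (at t)" for t
    unfolding rotate_knot_def
    by (rule bounded_linear.has_vector_derivative[OF matrix_vector_mul_bounded_linear fd(5)])
  have n: "norm (fin_block B *v v) = norm v" for v by (rule norm_fin_block[OF SO_axis_mid[OF B]])
  show "vector_derivative (rotate_knot B f) (at t) \<noteq> 0" for t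
    unfolding vector_derivative_at[OF d] using n[of "vector_derivative f (at t)"] fd(2)[of t] by force
  have "continuous_map (top_of_set {0::real}) (long_knot_space a) (\<lambda>_. f)" using f by simp
  then have "joint_smooth (top_of_set {0::real}) (topspace (top_of_set {0::real}) \<times> UNIV) (\<lambda>_ t. fin_block B *v f t)"
    by (intro joint_smooth_linear[OF matrix_vector_mul_bounded_linear] continuous_map_long_knotsD)
  from joint_smooth_imp_Cinf(1)[OF this, of 0]
  show "smooth_curve (rotate_knot B f)" by (simp add: rotate_knot_def)
  show "inj (rotate_knot B f)"
  proof (rule injI)
    fix x y assume "rotate_knot B f x = rotate_knot B f y"
    then have "norm (fin_block B *v (f x - f y)) = 0" by (simp add: rotate_knot_def matrix_vector_mult_diff_distrib)
    then show "x = y" unfolding n using fd(3) by (simp add: inj_eq)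
  qed
  show "rotate_knot B f x = axis a x" if "\<bar>x\<bar> \<ge> 1" for x
    using fd(4)[OF that] fin_block_axis[OF B] by (simp add: rotate_knot_def)
qed

lemma rotate_knot_continuous:
  "continuous_map (prod_topology (top_of_set (SO_axis a)) (long_knot_space a)) (long_knot_space a) (\<lambda>(B, f). rotate_knot B f)"
proof -
  let ?X = "prod_topology (top_of_set (SO_axis a)) (long_knot_space a)"
  have "linear (fin_block :: 'a succ_matrix \<Rightarrow> _)"
    by (auto intro!: linearI simp: fin_block_def vec_eq_iff)
  then have fb: "continuous_on UNIV (fin_block :: 'a succ_matrix \<Rightarrow> _)"
    by (rule linear_continuous_on[OF linear_conv_bounded_linear[THEN iffD1]])
  have "continuous_map ?X euclidean fst"
    by (rule continuous_map_into_fulltopology[OF continuous_map_fst])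
  then have 1: "continuous_map ?X euclidean (\<lambda>x. fin_block (fst x))"
    by (rule continuous_map_euclidean_unop[OF _ fb]) simp
  have "joint_smooth ?X (topspace ?X \<times> UNIV) (\<lambda>x t. fin_block (fst x) *v snd x t)"
    by (intro joint_smooth_bilinear[OF bounded_bilinear_matrix_vector] joint_smooth_param[OF 1]
        continuous_map_long_knotsD[OF continuous_map_snd])
  then have "continuous_map ?X (long_knot_space a) (\<lambda>x. rotate_knot (fst x) (snd x))"
    by (intro continuous_map_long_knotsI) (auto simp: rotate_knot_def[abs_def] intro: rotate_knot_mem[unfolded rotate_knot_def[abs_def]])
  then show ?thesis by (simp add: case_prod_unfold)
qed

lemma SO_axis_mult: "A \<in> SO_axis a \<Longrightarrow> B \<in> SO_axis a \<Longrightarrow> A ** B \<in> SO_axis a"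
  and SO_axis_transpose: "A \<in> SO_axis a \<Longrightarrow> transpose A \<in> SO_axis a"
  and SO_mid_mult: "A \<in> SO_mid \<Longrightarrow> B \<in> SO_mid \<Longrightarrow> A ** B \<in> SO_mid"
  and SO_mid_transpose: "A \<in> SO_mid \<Longrightarrow> transpose A \<in> SO_mid"
proof -
  have t: "transpose C *v v = v" if "C \<in> SO_succ" "C *v v = v" for C :: "'b::finite succ_matrix" and v
    using SO_succ_cancel(1)[OF that(1), of v] that(2) by simp
  show "A \<in> SO_axis a \<Longrightarrow> B \<in> SO_axis a \<Longrightarrow> A ** B \<in> SO_axis a"
    unfolding SO_axis_iff by (simp add: SO_succ_mult matrix_vector_mul_assoc[symmetric])
  show "A \<in> SO_axis a \<Longrightarrow> transpose A \<in> SO_axis a"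
    unfolding SO_axis_iff using t SO_succ_transpose by blast
  show "A \<in> SO_mid \<Longrightarrow> B \<in> SO_mid \<Longrightarrow> A ** B \<in> SO_mid" for A B :: "'a succ_matrix"
    by (simp add: SO_mid_def SO_succ_mult matrix_vector_mul_assoc[symmetric])
  show "A \<in> SO_mid \<Longrightarrow> transpose A \<in> SO_mid" for A :: "'a succ_matrix"
    unfolding SO_mid_def using t SO_succ_transpose by blast
qed

lemma fin_block_mult: "A \<in> SO_mid \<Longrightarrow> B \<in> SO_mid \<Longrightarrow> fin_block (A ** B) = fin_block A ** fin_block B"
  by (simp add: vec_eq_iff fin_block_def matrix_matrix_mult_def sum_option SO_mid_entries)

lemma rotate_knot_mult: "A \<in> SO_mid \<Longrightarrow> B \<in> SO_mid \<Longrightarrow> rotate_knot (A ** B) f = rotate_knot A (rotate_knot B f)"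
  by (simp add: rotate_knot_def fin_block_mult matrix_vector_mul_assoc)

lemma rotate_knot_1 [simp]: "rotate_knot (mat 1) f = f"
  by (simp add: rotate_knot_def fin_block_mat1)

lemma rotate_knot_cancel:
  assumes "B \<in> SO_mid"
  shows "rotate_knot (transpose B) (rotate_knot B f) = f" "rotate_knot B (rotate_knot (transpose B) f) = f"
  using rotate_knot_mult[OF SO_mid_transpose[OF assms] assms, of f] rotate_knot_mult[OF assms SO_mid_transpose[OF assms], of f]
    SO_succ_inverse[OF SO_mid_SO_succ[OF assms]] by simp_all

text \<open>Functions in the carrier of the permutation group are extensional, hence the restriction
  to \<open>long_knots a\<close>.\<close>
lemma rotate_knot_group_action:
  "group_action (SO_axis_group a) (long_knots a) (\<lambda>B. \<lambda>f \<in> long_knots a. rotate_knot B f)"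
proof -
  let ?G = "SO_axis_group a" and ?\<phi> = "\<lambda>B. \<lambda>f \<in> long_knots a. rotate_knot B f"
  have G: "group ?G"
  proof (rule groupI)
    show "\<exists>y\<in>carrier ?G. y \<otimes>\<^bsub>?G\<^esub> x = \<one>\<^bsub>?G\<^esub>" if "x \<in> carrier ?G" for x
      using that SO_axis_transpose[of x a] SO_succ_inverse(1)[OF SO_mid_SO_succ[OF SO_axis_mid[of x a]]]
      by (auto simp: SO_axis_group_def)
  qed (auto simp: SO_axis_group_def SO_axis_mult mat1_SO_axis matrix_mul_assoc)
  have bij: "?\<phi> B \<in> Bij (long_knots a)" if B: "B \<in> SO_axis a" for B
  proof -
    have "bij_betw (rotate_knot B) (long_knots a) (long_knots a)"
      by (rule bij_betw_byWitness[where f' = "rotate_knot (transpose B)"])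
        (use rotate_knot_cancel[OF SO_axis_mid[OF B]] rotate_knot_mem[OF B] rotate_knot_mem[OF SO_axis_transpose[OF B]] in auto)
    then show ?thesis by (simp add: Bij_def bij_betw_restrict_eq)
  qed
  have "?\<phi> (A ** B) = ?\<phi> A \<otimes>\<^bsub>BijGroup (long_knots a)\<^esub> ?\<phi> B" if "A \<in> SO_axis a" "B \<in> SO_axis a" for A B
    using bij[OF that(1)] bij[OF that(2)] rotate_knot_mem[OF that(2)]
    by (auto simp: BijGroup_def compose_def fun_eq_iff rotate_knot_mult[OF SO_axis_mid[OF that(1)] SO_axis_mid[OF that(2)]])
  then show ?thesis
    unfolding group_action_def group_hom_def group_hom_axioms_def
    using G bij group_BijGroup by (auto simp: hom_def SO_axis_group_def BijGroup_def)
qed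

section \<open>Stereographic projection\<close>

definition emb_finite :: "real^'d::finite \<Rightarrow> real^('d option)" where
  "emb_finite x = (\<chi> k. case k of None \<Rightarrow> 0 | Some i \<Rightarrow> x $ i)"

lemma emb_finite_nth [simp]: "emb_finite x $ None = 0" "emb_finite x $ Some i = x $ i"
  by (simp_all add: emb_finite_def)

lemma emb_finite_linear: "bounded_linear emb_finite"
  unfolding linear_conv_bounded_linear[symmetric]
  by (auto intro!: linearI simp: vec_eq_iff split_option_all)

lemma proj_finite_linear: "bounded_linear proj_finite"
  unfolding linear_conv_bounded_linear[symmetric]
  by (auto intro!: linearI simp: vec_eq_iff proj_finite_def)

text \<open>The componentwise definition in vector form, to which the closure properties of
  \<open>joint_smooth\<close> apply.\<close>
lemma inv_stereo_eq: "inv_stereo x = (1 / (x \<bullet> x + 1)) *\<^sub>R (2 *\<^sub>R emb_finite x + (x \<bullet> x - 1) *\<^sub>R pt_inf)"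
  by (simp add: vec_eq_iff split_option_all inv_stereo_def power2_norm_eq_inner)

lemma stereo_den_pos: "x \<bullet> x + 1 > (0 :: real)" for x :: "real^'d::finite"
  by (simp add: add_nonneg_pos)

lemma inv_stereo_norm [simp]: "norm (inv_stereo x) = 1"
proof -
  let ?q = "(norm x)\<^sup>2"
  have q: "?q + 1 > 0" by (simp add: add_nonneg_pos)
  have N: "inv_stereo x $ None = (?q - 1) / (?q + 1)" by (simp add: inv_stereo_def)
  have "proj_finite (inv_stereo x) = (2 / (?q + 1)) *\<^sub>R x"
    by (simp add: vec_eq_iff proj_finite_def inv_stereo_def)
  then have "(norm (inv_stereo x))\<^sup>2 = ((?q - 1) / (?q + 1))\<^sup>2 + (2 / (?q + 1))\<^sup>2 * ?q"
    using norm_option[of "inv_stereo x"] N by (simp add: power_mult_distrib power_divide)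
  also have "\<dots> = ((?q - 1)\<^sup>2 + 4 * ?q) / (?q + 1)\<^sup>2"
    by (simp add: power_divide add_divide_distrib power2_eq_square)
  also have "(?q - 1)\<^sup>2 + 4 * ?q = (?q + 1)\<^sup>2" by algebra
  finally have "(norm (inv_stereo x))\<^sup>2 = 1" using q by simp
  then show ?thesis by (metis norm_ge_zero one_power2 power2_eq_iff_nonneg zero_le_one)
qed

lemma sphere_None_1: "norm v = 1 \<Longrightarrow> v $ None = 1 \<longleftrightarrow> v = pt_inf" for v :: "real^('d::finite option)"
proof
  assume v: "norm v = 1" "v $ None = 1"
  then have "norm (proj_finite v) = 0" using norm_option[of v] by simp
  then have "proj_finite v = 0" by simp
  then show "v = pt_inf" using v by (simp add: vec_eq_iff split_option_all proj_finite_def)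
qed simp

lemma inv_stereo_ne [simp]: "inv_stereo x \<noteq> pt_inf"
proof
  assume "inv_stereo x = pt_inf"
  then have "inv_stereo x $ None = 1" by simp
  then have "((norm x)\<^sup>2 - 1) / ((norm x)\<^sup>2 + 1) = 1" by (simp add: inv_stereo_def)
  moreover have "(norm x)\<^sup>2 + 1 > 0" by (simp add: add_nonneg_pos)
  ultimately show False by (simp add: field_simps)
qed

lemma inv_stereo_stereo:
  fixes v :: "real^('d::finite option)"
  assumes "norm v = 1" "v \<noteq> pt_inf" shows "inv_stereo (stereo v) = v"
proof -
  let ?d = "1 - v $ None"
  have d: "?d > 0" using sphere_None_bound[OF assms(1)] sphere_None_1[OF assms(1)] assms(2) by (auto simp: less_le)
  have p: "(norm (proj_finite v))\<^sup>2 = (1 + v $ None) * ?d"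
    using norm_option[of v] assms by (simp add: power2_eq_square algebra_simps)
  have q: "(norm (stereo v))\<^sup>2 = (1 + v $ None) / ?d"
  proof -
    have "(norm (stereo v))\<^sup>2 = (norm (proj_finite v))\<^sup>2 / ?d\<^sup>2"
      by (simp add: stereo_def power_mult_distrib power_inverse divide_inverse mult.commute)
    also have "\<dots> = (1 + v $ None) / ?d" unfolding p using d by (simp add: power2_eq_square)
    finally show ?thesis .
  qed
  have q1: "(norm (stereo v))\<^sup>2 + 1 = 2 / ?d" "(norm (stereo v))\<^sup>2 - 1 = 2 * v $ None / ?d"
    unfolding q using d by (simp_all add: field_simps)
  have "inv_stereo (stereo v) $ k = v $ k" for k
  proof (cases k)
    case None
    then show ?thesis unfolding inv_stereo_def q1 using d by simp
  next
    case (Some i)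
    have "stereo v $ i = v $ Some i / ?d" by (simp add: stereo_def proj_finite_def divide_inverse mult.commute)
    then show ?thesis unfolding Some inv_stereo_def q1 using d by simp
  qed
  then show ?thesis by (simp add: vec_eq_iff)
qed

lemma stereo_great_circle: "stereo (great_circle a z) = axis a (stereo z $ 1)"
  by (simp add: stereo_def proj_finite_def vec_eq_iff great_circle_def axis_vec_nth axis_def)

lemma great_circle_ne: "z \<noteq> pt_inf \<Longrightarrow> great_circle a z \<noteq> pt_inf"
  using great_circle_inj[of a z pt_inf] by (auto simp: great_circle_def)

lemma stereo_abs_ge_1:
  fixes z :: "real^(1 option)"
  assumes "norm z = 1" "z \<noteq> pt_inf"
  shows "\<bar>stereo z $ 1\<bar> \<ge> 1 \<longleftrightarrow> z $ None \<ge> 0"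
proof -
  let ?d = "1 - z $ None"
  have d: "?d > 0" using sphere_None_bound[OF assms(1)] sphere_None_1[OF assms(1)] assms(2) by (auto simp: less_le)
  have s: "stereo z $ 1 = z $ Some 1 / ?d" by (simp add: stereo_def proj_finite_def divide_inverse mult.commute)
  have "(z $ Some 1)\<^sup>2 = 1 - (z $ None)\<^sup>2" using circle_norm[of z] assms by simp
  then have "(stereo z $ 1)\<^sup>2 = (1 + z $ None) * ?d / ?d\<^sup>2" unfolding s by (simp add: power_divide power2_eq_square algebra_simps)
  then have e: "(stereo z $ 1)\<^sup>2 = (1 + z $ None) / ?d" using d by (simp add: power2_eq_square)
  have "\<bar>stereo z $ 1\<bar> \<ge> 1 \<longleftrightarrow> 1\<^sup>2 \<le> (stereo z $ 1)\<^sup>2" using abs_le_square_iff[of 1 "stereo z $ 1"] by simp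
  also have "\<dots> \<longleftrightarrow> z $ None \<ge> 0" unfolding e using d by (simp add: field_simps)
  finally show ?thesis .
qed

lemma circle_point_stereo: "stereo (circle_point t) $ 1 = sin t / (1 - cos t)"
  by (simp add: stereo_def proj_finite_def divide_inverse mult.commute)

lemma joint_smooth_inv_stereo:
  assumes "joint_smooth X W u" shows "joint_smooth X W (\<lambda>x t. inv_stereo (u x t))"
  unfolding inv_stereo_eq
  by (intro joint_smooth_scaleR joint_smooth_divide joint_smooth_add joint_smooth_diff joint_smooth_inner
      joint_smooth_const joint_smooth_linear[OF emb_finite_linear] assms less_imp_neq[OF stereo_den_pos, symmetric])

lemma joint_smooth_stereo:
  assumes "joint_smooth X W u" "\<And>x t. (x, t) \<in> W \<Longrightarrow> u x t $ None \<noteq> 1"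
  shows "joint_smooth X W (\<lambda>x t. stereo (u x t))"
  unfolding stereo_def
  by (intro joint_smooth_scaleR joint_smooth_inverse joint_smooth_diff joint_smooth_const
      joint_smooth_linear[OF bounded_linear_vec_nth] joint_smooth_linear[OF proj_finite_linear] assms)
    (use assms(2) in auto)

text \<open>Used contrapositively: a chart with differentiable inverse cannot kill a nonzero
  velocity.\<close>
lemma has_vector_derivative_zero_compose:
  assumes "(u has_vector_derivative 0) (at t)" "(F has_derivative L) (at (u t))"
  shows "((\<lambda>s. F (u s)) has_vector_derivative 0) (at t)"
  using vector_derivative_diff_chain_within[of u 0 t UNIV F L] assms has_derivative_at_withinI[OF assms(2)]
    linear_0[OF has_derivative_linear[OF assms(2)]] by (simp add: o_def)

lemma stereo_differentiable:
  assumes "v $ None \<noteq> 1" shows "\<exists>L. (stereo has_derivative L) (at v)"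
proof -
  have n: "((\<lambda>v. v $ None) has_derivative (\<lambda>v. v $ None)) (at v)"
    by (rule bounded_linear_imp_has_derivative[OF bounded_linear_vec_nth])
  have p: "(proj_finite has_derivative proj_finite) (at v)"
    by (rule bounded_linear_imp_has_derivative[OF proj_finite_linear])
  have d: "1 - v $ None \<noteq> 0" using assms by simp
  have i: "((\<lambda>v. inverse (1 - v $ None)) has_derivative (\<lambda>h. - (inverse (1 - v $ None) * (0 - h $ None) * inverse (1 - v $ None)))) (at v)"
    by (rule Deriv.has_derivative_inverse[OF d has_derivative_diff[OF has_derivative_const n]])
  show ?thesis unfolding stereo_def[abs_def] using has_derivative_scaleR[OF i p] by blast
qed

lemma inv_stereo_differentiable: "\<exists>L. (inv_stereo has_derivative L) (at x)"
proof -
  have q: "((\<lambda>x. x \<bullet> x) has_derivative (\<lambda>h. x \<bullet> h + h \<bullet> x)) (at x)"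
    by (rule has_derivative_inner[OF has_derivative_ident has_derivative_ident])
  have p: "(emb_finite has_derivative emb_finite) (at x)"
    by (rule bounded_linear_imp_has_derivative[OF emb_finite_linear])
  show ?thesis unfolding inv_stereo_eq[abs_def]
    by (rule exI) (rule has_derivative_scaleR has_derivative_divide has_derivative_const has_derivative_add
      has_derivative_diff q p less_imp_neq[OF stereo_den_pos, symmetric])+
qed

section \<open>Compactifying long knots\<close>

lemma compactify_stereo:
  assumes "norm z = 1" "z \<noteq> pt_inf"
  shows "compactify f z = inv_stereo (f (stereo z $ 1))"
  using assms by (simp add: compactify_def)

lemma compactify_pt_inf [simp]: "compactify f pt_inf = pt_inf"
  by (simp add: compactify_def)

lemma compactify_great_circle:
  assumes f: "f \<in> long_knots a" and z: "norm z = 1" "z $ None \<ge> 0"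
  shows "compactify f z = great_circle a z"
proof (cases "z = pt_inf")
  case True then show ?thesis by (simp add: great_circle_def)
next
  case False
  have "\<bar>stereo z $ 1\<bar> \<ge> 1" using stereo_abs_ge_1[OF z(1) False] z by simp
  then have "compactify f z = inv_stereo (axis a (stereo z $ 1))"
    using compactify_stereo[OF z(1) False, of f] long_knotD(4)[OF f, of "stereo z $ 1"] by simp
  also have "\<dots> = great_circle a z"
    unfolding stereo_great_circle[symmetric] using z(1) great_circle_ne[OF False, of a] by (simp add: inv_stereo_stereo)
  finally show ?thesis .
qed

lemma great_circle_loop_derivative:
  "((\<lambda>t. great_circle a (circle_point t)) has_vector_derivative great_circle a (cos t *\<^sub>R axis_vec 1 - sin t *\<^sub>R pt_inf)) (at t)"
  "great_circle a (cos t *\<^sub>R axis_vec 1 - sin t *\<^sub>R pt_inf) \<noteq> 0"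
proof -
  show "((\<lambda>t. great_circle a (circle_point t)) has_vector_derivative great_circle a (cos t *\<^sub>R axis_vec 1 - sin t *\<^sub>R pt_inf)) (at t)"
    by (rule bounded_linear.has_vector_derivative[OF great_circle_linear circle_point_derivative])
  show "great_circle a (cos t *\<^sub>R axis_vec 1 - sin t *\<^sub>R pt_inf) \<noteq> 0"
  proof
    assume h: "great_circle a (cos t *\<^sub>R axis_vec 1 - sin t *\<^sub>R pt_inf) = 0"
    then have "norm (cos t *\<^sub>R axis_vec 1 - sin t *\<^sub>R pt_inf :: real^(1 option)) = 0"
      using great_circle_norm[of a "cos t *\<^sub>R axis_vec 1 - sin t *\<^sub>R pt_inf"] by simp
    then have "cos t *\<^sub>R axis_vec 1 - sin t *\<^sub>R pt_inf = (0 :: real^(1 option))" by simp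
    then have "cos t = 0" "sin t = 0" by (simp_all add: circle_eq_iff)
    then show False using sin_cos_squared_add[of t] by simp
  qed
qed

lemma circle_point_ne: "cos t \<noteq> 1 \<Longrightarrow> circle_point t \<noteq> pt_inf"
  by (auto dest: arg_cong[of _ _ "\<lambda>z. z $ None"])

text \<open>Near the base-point the compactified curve is the great circle, by the condition on long
  knots outside \<open>[-1, 1]\<close>; away from it the curve is the long knot read through
  stereographic charts. The two regions overlap.\<close>
lemma compactify_smooth:
  fixes F :: "'x \<Rightarrow> real \<Rightarrow> real^'n::finite"
  assumes F: "continuous_map X (long_knot_space a) F"
  shows "joint_smooth X (topspace X \<times> UNIV) (\<lambda>x t. compactify (F x) (circle_point t))"
proof -
  let ?T = "prod_topology X (euclidean :: real topology)" and ?W = "topspace X \<times> (UNIV :: real set)"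
  have Fm: "F x \<in> long_knots a" if "x \<in> topspace X" for x
    using continuous_map_image_subset_topspace[OF F] that by auto
  let ?R1 = "topspace X \<times> {t :: real. 0 < cos t}" and ?R2 = "topspace X \<times> {t :: real. cos t < 1}"
  have O: "openin ?T ?R1" "openin ?T ?R2"
    by (auto simp: openin_prod_Times_iff intro!: open_Collect_less continuous_intros)
  have "joint_smooth X ?R1 (\<lambda>x t. great_circle a (circle_point t))"
    by (intro joint_smooth_linear[OF great_circle_linear] joint_smooth_circle_point O joint_smooth_id)
  then have 1: "joint_smooth X ?R1 (\<lambda>x t. compactify (F x) (circle_point t))"
    by (rule joint_smooth_cong[OF O(1), rotated]) (use compactify_great_circle[OF Fm] in auto)
  have "joint_smooth X ?R2 (\<lambda>x t. sin t / (1 - cos t))"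
    by (intro joint_smooth_divide joint_smooth_sin joint_smooth_cos joint_smooth_diff joint_smooth_const joint_smooth_id O) auto
  from joint_smooth_compose[OF continuous_map_id this continuous_map_long_knotsD[OF F]]
  have "joint_smooth X ?R2 (\<lambda>x t. F x (sin t / (1 - cos t)))" by auto
  then have "joint_smooth X ?R2 (\<lambda>x t. inv_stereo (F x (sin t / (1 - cos t))))"
    by (rule joint_smooth_inv_stereo)
  then have 2: "joint_smooth X ?R2 (\<lambda>x t. compactify (F x) (circle_point t))"
  proof (rule joint_smooth_cong[OF O(2), rotated])
    fix x t assume "(x, t) \<in> ?R2"
    then have "circle_point t \<noteq> pt_inf" by (intro circle_point_ne) auto
    from compactify_stereo[OF circle_point_sphere this, of "F x"]
    show "inv_stereo (F x (sin t / (1 - cos t))) = compactify (F x) (circle_point t)"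
      by (simp only: circle_point_stereo)
  qed
  have "?W \<subseteq> ?R1 \<union> ?R2" by auto
  from joint_smooth_Un[OF O 1 2 this] show ?thesis .
qed

text \<open>Near the base-point the curve is a great circle; elsewhere immersivity and injectivity
  are transported through the stereographic charts.\<close>
lemma compactify_mem:
  assumes f: "f \<in> long_knots a"
  shows "compactify f \<in> circle_embeddings"
proof (rule circle_embeddingI)
  show "compactify f \<in> extensional unit_sphere" by (simp add: compactify_def)
  have "continuous_map (top_of_set {0::real}) (long_knot_space a) (\<lambda>_. f)" using f by simp
  from joint_smooth_imp_Cinf(1)[OF compactify_smooth[OF this], of 0]
  show sm: "smooth_curve (compactify f \<circ> circle_point)" by (simp add: o_def)
  have der: "((\<lambda>t. compactify f (circle_point t)) has_vector_derivative vector_derivative (\<lambda>t. compactify f (circle_point t)) (at t)) (at t)" for t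
  proof -
    have "nth_vderiv 0 (compactify f \<circ> circle_point) differentiable (at t)" using sm unfolding smooth_curve_def by blast
    then show ?thesis by (simp add: vector_derivative_works o_def)
  qed
  show n: "norm (compactify f z) = 1" if "norm z = 1" for z
    using that by (cases "z = pt_inf") (simp_all add: compactify_stereo)
  show "vector_derivative (compactify f \<circ> circle_point) (at t) \<noteq> 0" for t
  proof (cases "cos t > 0")
    case True
    have "open {t :: real. 0 < cos t}" by (intro open_Collect_less continuous_intros)
    then have "((\<lambda>t. compactify f (circle_point t)) has_vector_derivative great_circle a (cos t *\<^sub>R axis_vec 1 - sin t *\<^sub>R pt_inf)) (at t)"
      by (rule has_vector_derivative_transform_within_open[OF great_circle_loop_derivative(1)])
        (use True compactify_great_circle[OF f] in auto)
    then show ?thesis using great_circle_loop_derivative(2) by (simp add: vector_derivative_at o_def)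
  next
    case False
    then have c: "cos t \<noteq> 1" by auto
    show ?thesis
    proof
      assume 0: "vector_derivative (compactify f \<circ> circle_point) (at t) = 0"
      have d0: "((\<lambda>t. compactify f (circle_point t)) has_vector_derivative 0) (at t)"
        using der[of t] 0 by (simp add: o_def)
      have "compactify f (circle_point t) \<noteq> pt_inf"
        using compactify_stereo[OF circle_point_sphere circle_point_ne[OF c], of f] by simp
      then have "compactify f (circle_point t) $ None \<noteq> 1" using sphere_None_1[OF n[OF circle_point_sphere]] by simp
      then obtain L where "(stereo has_derivative L) (at (compactify f (circle_point t)))" using stereo_differentiable by blast
      from has_vector_derivative_zero_compose[OF d0 this]
      have "((\<lambda>t. f (sin t / (1 - cos t))) has_vector_derivative 0) (at t)"
      proof (rule has_vector_derivative_transform_within_open)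
        show "open {t :: real. cos t < 1}" by (intro open_Collect_less continuous_intros)
        show "t \<in> {t. cos t < 1}" using False by simp
        show "stereo (compactify f (circle_point s)) = f (sin s / (1 - cos s))" if "s \<in> {t. cos t < 1}" for s
          using that compactify_stereo[OF circle_point_sphere circle_point_ne[of s], of f]
          by (simp add: circle_point_stereo stereo_inv_stereo)
      qed
      moreover have "((\<lambda>t. sin t / (1 - cos t)) has_real_derivative (cos t * (1 - cos t) - sin t * sin t) / ((1 - cos t) * (1 - cos t))) (at t)"
        using c by (auto intro!: derivative_eq_intros)
      then have x: "((\<lambda>t. sin t / (1 - cos t)) has_vector_derivative (cos t * (1 - cos t) - sin t * sin t) / ((1 - cos t) * (1 - cos t))) (at t)"
        by (simp only: has_real_derivative_iff_has_vector_derivative)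
      from vector_diff_chain_at[OF x long_knotD(5)[OF f]]
      have "((\<lambda>t. f (sin t / (1 - cos t))) has_vector_derivative ((cos t * (1 - cos t) - sin t * sin t) / ((1 - cos t) * (1 - cos t))) *\<^sub>R
         vector_derivative f (at (sin t / (1 - cos t)))) (at t)" by (simp only: o_def)
      ultimately have "((cos t * (1 - cos t) - sin t * sin t) / ((1 - cos t) * (1 - cos t))) *\<^sub>R
         vector_derivative f (at (sin t / (1 - cos t))) = 0" using vector_derivative_unique_at by blast
      then have "cos t * (1 - cos t) - sin t * sin t = 0" using long_knotD(2)[OF f] c by simp
      then have "cos t - 1 = 0" using sin_cos_squared_add[of t] by (simp add: power2_eq_square algebra_simps)
      then show False using c by simp
    qed
  qed
  show "z = w" if zw: "norm z = 1" "norm w = 1" "compactify f z = compactify f w" for z w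
  proof (cases "z = pt_inf \<or> w = pt_inf")
    case True
    then show ?thesis using zw inv_stereo_ne[of "f (stereo z $ 1)"] inv_stereo_ne[of "f (stereo w $ 1)"]
      by (cases "z = pt_inf"; cases "w = pt_inf") (simp_all add: compactify_stereo)
  next
    case False
    then have "stereo (inv_stereo (f (stereo z $ 1))) = stereo (inv_stereo (f (stereo w $ 1)))"
      using zw compactify_stereo[of z f] compactify_stereo[of w f] by simp
    then have "stereo z $ 1 = stereo w $ 1" using long_knotD(3)[OF f] by (simp add: stereo_inv_stereo inj_eq)
    then have "stereo z = stereo w" by (simp add: vec_eq_iff)
    then have "inv_stereo (stereo z) = inv_stereo (stereo w)" by simp
    then show ?thesis using inv_stereo_stereo[of z] inv_stereo_stereo[of w] False zw by simp
  qed
qed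

lemma compactify_standard:
  assumes f: "f \<in> long_knots a" shows "compactify f \<in> standard_embeddings a"
proof -
  have "velocity (compactify f) = axis_vec a"
    by (rule velocity_great_circle[OF compactify_great_circle[OF f]])
  then show ?thesis
    using compactify_mem[OF f] compactify_great_circle[OF f]
    by (simp add: standard_embeddings_def axis_embeddings_def pointed_embeddings_def)
qed

lemma compactify_continuous:
  assumes "continuous_map X (long_knot_space a) F"
  shows "continuous_map X Emb (\<lambda>x. compactify (F x))"
proof (rule continuous_map_EmbI)
  show "compactify (F x) \<in> circle_embeddings" if "x \<in> topspace X" for x
    using continuous_map_image_subset_topspace[OF assms] that compactify_mem by fastforce
  show "joint_smooth X (topspace X \<times> UNIV) (\<lambda>x t. compactify (F x) (circle_point t))"
    by (rule compactify_smooth[OF assms])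
qed

text \<open>The inverse of compactification on \<open>standard_embeddings\<close>; here \<open>vec
  x\<close> is the real number \<open>x\<close> as an element of
  \<open>\<real>\<^sup>1\<close>.\<close>
definition uncompactify :: "(real^(1 option) \<Rightarrow> real^('n::finite option)) \<Rightarrow> real \<Rightarrow> real^'n" where
  "uncompactify g x = stereo (g (inv_stereo (vec x)))"

lemma inv_stereo_circle: "inv_stereo (vec x) = circle_point (pi - 2 * arctan x)"
proof -
  have p: "1 + x\<^sup>2 > 0" by (simp add: add_pos_nonneg)
  have c2: "cos (2 * arctan x) = (1 - x\<^sup>2) / (1 + x\<^sup>2)" and s2: "sin (2 * arctan x) = 2 * x / (1 + x\<^sup>2)"
    using p by (simp_all add: cos_double sin_double cos_arctan sin_arctan power_divide diff_divide_distrib)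
  have n: "(norm (vec x :: real^1))\<^sup>2 = x\<^sup>2" by (simp add: norm_vec_def L2_set_def)
  have "cos (pi - 2 * arctan x) = - ((1 - x\<^sup>2) / (1 + x\<^sup>2))" unfolding c2[symmetric] by (simp add: cos_diff)
  also have "\<dots> = (x\<^sup>2 - 1) / (x\<^sup>2 + 1)" using p by (simp add: field_simps)
  finally have c: "cos (pi - 2 * arctan x) = (x\<^sup>2 - 1) / (x\<^sup>2 + 1)" .
  have "sin (pi - 2 * arctan x) = 2 * x / (1 + x\<^sup>2)" unfolding s2[symmetric] by (simp add: sin_diff)
  then have s: "sin (pi - 2 * arctan x) = 2 * x / (x\<^sup>2 + 1)" by (simp only: add.commute)
  show ?thesis unfolding circle_eq_iff circle_point_nth c s by (simp add: inv_stereo_def n)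
qed

lemma stereo_inv_stereo_vec: "stereo (inv_stereo (vec x :: real^1)) $ 1 = x"
  by (simp add: stereo_inv_stereo)

lemma vec_stereo_1: "vec (stereo z $ 1) = stereo (z :: real^(1 option))"
  by (simp add: vec_eq_iff)

lemma uncompactify_ne:
  assumes g: "g \<in> pointed_embeddings"
  shows "g (inv_stereo (vec x)) \<noteq> pt_inf" "norm (g (inv_stereo (vec x))) = 1" "g (inv_stereo (vec x)) $ None \<noteq> 1"
proof -
  have c: "g \<in> circle_embeddings" "g pt_inf = pt_inf" using g by (auto simp: pointed_embeddings_def)
  show 1: "g (inv_stereo (vec x)) \<noteq> pt_inf"
    using circle_embeddingD(5)[OF c(1), of "inv_stereo (vec x)" pt_inf] c(2) by auto
  show 2: "norm (g (inv_stereo (vec x))) = 1" by (rule circle_embeddingD(4)[OF c(1)]) simp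
  show "g (inv_stereo (vec x)) $ None \<noteq> 1" using 1 sphere_None_1[OF 2] by simp
qed

lemma uncompactify_smooth:
  assumes G: "continuous_map X Emb G" and p: "\<And>x. x \<in> topspace X \<Longrightarrow> G x \<in> pointed_embeddings"
  shows "joint_smooth X (topspace X \<times> UNIV) (\<lambda>x t. uncompactify (G x) t)"
proof -
  have l: "joint_smooth X (topspace X \<times> UNIV) (\<lambda>x t. pi - 2 * arctan t)"
    by (intro joint_smooth_diff joint_smooth_mult joint_smooth_arctan joint_smooth_const joint_smooth_id openin_whole)
  have "joint_smooth X (topspace X \<times> UNIV) (\<lambda>x t. G (id x) (circle_point (pi - 2 * arctan t)))"
    by (rule joint_smooth_compose[OF continuous_map_id l continuous_map_EmbD[OF G]]) auto
  then have "joint_smooth X (topspace X \<times> UNIV) (\<lambda>x t. stereo (G x (circle_point (pi - 2 * arctan t))))"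
    by (intro joint_smooth_stereo) (use uncompactify_ne(3)[OF p] in \<open>auto simp: inv_stereo_circle\<close>)
  then show ?thesis by (simp add: uncompactify_def inv_stereo_circle)
qed

lemma uncompactify_mem:
  assumes g: "g \<in> standard_embeddings a"
  shows "uncompactify g \<in> long_knots a"
proof (rule long_knotI)
  have p: "g \<in> pointed_embeddings" and c: "g \<in> circle_embeddings"
    using axis_embeddings_pointed[OF standard_axis[OF g]] axis_embeddings_circle[OF standard_axis[OF g]] by auto
  note ne = uncompactify_ne[OF p]
  have "continuous_map (top_of_set {0::real}) Emb (\<lambda>_. g)" using c by simp
  from joint_smooth_imp_Cinf(1)[OF uncompactify_smooth[OF this p], of 0]
  show sm: "smooth_curve (uncompactify g)" by simp
  have iu: "inv_stereo (uncompactify g x) = g (inv_stereo (vec x))" for x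
    unfolding uncompactify_def by (rule inv_stereo_stereo[OF ne(2,1)])
  show "inj (uncompactify g)"
  proof (rule injI)
    fix x y assume "uncompactify g x = uncompactify g y"
    then have "g (inv_stereo (vec x)) = g (inv_stereo (vec y))" using iu[of x] iu[of y] by simp
    then have "inv_stereo (vec x :: real^1) = inv_stereo (vec y)" using circle_embeddingD(5)[OF c] by simp
    then have "stereo (inv_stereo (vec x :: real^1)) $ 1 = stereo (inv_stereo (vec y :: real^1)) $ 1" by simp
    then show "x = y" by (simp only: stereo_inv_stereo_vec)
  qed
  show "uncompactify g x = axis a x" if "\<bar>x\<bar> \<ge> 1" for x
  proof -
    have "inv_stereo (vec x :: real^1) $ None \<ge> 0"
      using stereo_abs_ge_1[of "inv_stereo (vec x)"] that by (simp add: stereo_inv_stereo)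
    then have "g (inv_stereo (vec x)) = great_circle a (inv_stereo (vec x))"
      using g by (simp add: standard_embeddings_def)
    then show ?thesis by (simp add: uncompactify_def stereo_great_circle stereo_inv_stereo)
  qed
  show "vector_derivative (uncompactify g) (at t) \<noteq> 0" for t
  proof
    assume 0: "vector_derivative (uncompactify g) (at t) = 0"
    have "nth_vderiv 0 (uncompactify g) differentiable (at t)" using sm unfolding smooth_curve_def by blast
    then have "(uncompactify g has_vector_derivative 0) (at t)" using 0 by (simp add: vector_derivative_works)
    moreover obtain L where "(inv_stereo has_derivative L) (at (uncompactify g t))" using inv_stereo_differentiable by blast
    ultimately have "((\<lambda>x. inv_stereo (uncompactify g x)) has_vector_derivative 0) (at t)"
      by (rule has_vector_derivative_zero_compose)
    then have d0: "((\<lambda>x. g (circle_point (pi - 2 * arctan x))) has_vector_derivative 0) (at t)"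
      by (simp add: iu inv_stereo_circle)
    have "1 + t\<^sup>2 > 0" by (simp add: add_pos_nonneg)
    then have ne: "1 + t\<^sup>2 \<noteq> 0" by simp
    have "((\<lambda>x. pi - 2 * arctan x) has_real_derivative 0 - 2 * inverse (1 + t\<^sup>2)) (at t)"
      by (intro DERIV_diff DERIV_const DERIV_cmult DERIV_arctan)
    then have x: "((\<lambda>x. pi - 2 * arctan x) has_vector_derivative - 2 * inverse (1 + t\<^sup>2)) (at t)"
      by (simp add: has_real_derivative_iff_has_vector_derivative)
    from vector_diff_chain_at[OF x loop_derivative[OF c]]
    have "((\<lambda>x. g (circle_point (pi - 2 * arctan x))) has_vector_derivative (- 2 * inverse (1 + t\<^sup>2)) *\<^sub>R
       vector_derivative (\<lambda>t. g (circle_point t)) (at (pi - 2 * arctan t))) (at t)" by (simp only: o_def)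
    from vector_derivative_unique_at[OF d0 this]
    show False using loop_immersed[OF c] ne by simp
  qed
qed

lemma uncompactify_continuous:
  assumes G: "continuous_map X Emb G" and p: "\<And>x. x \<in> topspace X \<Longrightarrow> G x \<in> standard_embeddings a"
  shows "continuous_map X (long_knot_space a) (\<lambda>x. uncompactify (G x))"
proof (rule continuous_map_long_knotsI)
  show "joint_smooth X (topspace X \<times> UNIV) (\<lambda>x. uncompactify (G x))"
    by (rule uncompactify_smooth[OF G]) (rule axis_embeddings_pointed[OF standard_axis[OF p]])
qed (use p uncompactify_mem in blast)

lemma uncompactify_compactify [simp]: "uncompactify (compactify f) = f"
  by (simp add: fun_eq_iff uncompactify_def compactify_stereo stereo_inv_stereo)

lemma compactify_uncompactify:
  assumes g: "g \<in> pointed_embeddings"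
  shows "compactify (uncompactify g) = g"
proof
  fix z :: "real^(1 option)"
  have c: "g \<in> circle_embeddings" "g pt_inf = pt_inf" using g by (auto simp: pointed_embeddings_def)
  consider "norm z \<noteq> 1" | "z = pt_inf" | "norm z = 1" "z \<noteq> pt_inf" by blast
  then show "compactify (uncompactify g) z = g z"
  proof cases
    case 1
    then show ?thesis using circle_embeddingD(1)[OF c(1)] by (simp add: compactify_def extensional_def)
  next
    case 2 then show ?thesis by (simp add: c)
  next
    case 3
    have v: "inv_stereo (vec (stereo z $ 1)) = z" unfolding vec_stereo_1 by (rule inv_stereo_stereo[OF 3])
    have "compactify (uncompactify g) z = inv_stereo (stereo (g z))"
      using compactify_stereo[OF 3, of "uncompactify g"] by (simp only: uncompactify_def v)
    also have "\<dots> = g z" using uncompactify_ne(1,2)[OF g, of "stereo z $ 1"] unfolding v by (intro inv_stereo_stereo)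
    finally show ?thesis .
  qed
qed

lemma uncompactify_rotate:
  assumes B: "B \<in> SO_axis a" and g: "g \<in> standard_embeddings a"
  shows "uncompactify (rotate_embedding B g) = rotate_knot B (uncompactify g)"
proof -
  have p: "g \<in> pointed_embeddings" by (rule axis_embeddings_pointed[OF standard_axis[OF g]])
  have "rotate_embedding B g = compactify (rotate_knot B (uncompactify g))"
    using compactify_rotate_knot[OF SO_axis_mid[OF B], of "uncompactify g"] compactify_uncompactify[OF p] by simp
  then show ?thesis by simp
qed

text \<open>The homotopy inverse of compactification on the embeddings along the long axis.\<close>
definition knot_of :: "'n::finite \<Rightarrow> (real^(1 option) \<Rightarrow> real^('n option)) \<Rightarrow> real \<Rightarrow> real^'n" where
  "knot_of a g = uncompactify (regularize a g)"

lemma knot_of_continuous: "continuous_map (Emb_axis a) (long_knot_space a) (knot_of a)"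
proof -
  have r: "continuous_map (Emb_axis a) Emb (regularize a)"
    using homotopic_with_imp_continuous_maps[OF regularize(1)] continuous_map_into_fulltopology by blast
  have "continuous_map (Emb_axis a) (long_knot_space a) (\<lambda>g. uncompactify (regularize a g))"
    by (rule uncompactify_continuous[OF r]) (use regularize(2)[of _ a] in simp)
  then show ?thesis by (simp add: knot_of_def[abs_def])
qed

lemma knot_of_rotate:
  assumes "B \<in> SO_axis a" "g \<in> axis_embeddings a"
  shows "knot_of a (rotate_embedding B g) = rotate_knot B (knot_of a g)"
proof -
  have "regularize a (rotate_embedding B g) = rotate_embedding B (regularize a g)"
    using homotopic_with_imp_property[OF regularize(1)[of a]] assms by (simp add: axis_compatible_def)
  then show ?thesis by (simp add: knot_of_def uncompactify_rotate[OF assms(1) regularize(2)[OF assms(2)]])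
qed

lemma compactify_knot_of: "g \<in> axis_embeddings a \<Longrightarrow> compactify (knot_of a g) = regularize a g"
  unfolding knot_of_def by (intro compactify_uncompactify axis_embeddings_pointed[OF standard_axis[OF regularize(2)]])

text \<open>The deformation given by \<open>regularize\<close> maps \<open>P\<close> into
  \<open>C\<close> and preserves \<open>C\<close>, so its restriction, transported through the
  homeomorphism between long knots and \<open>C\<close>, gives the homotopy on the side of the
  knots.\<close>
lemma compactify_homotopy_equivalence:
  "homotopy_equivalence (long_knot_space a) (Emb_axis a) compactify"
proof -
  let ?K = "long_knot_space a"
  have cc: "continuous_map ?K (Emb_axis a) compactify"
    using compactify_continuous[OF continuous_map_id[of ?K]] standard_axis[OF compactify_standard]
    by (auto simp: continuous_map_in_subtopology)
  have h: "homotopic_with (\<lambda>_. True) (Emb_axis a) (Emb_axis a) id (regularize a)"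
    by (rule homotopic_with_mono[OF regularize(1)]) auto
  have 1: "homotopic_with (\<lambda>_. True) (Emb_axis a) (Emb_axis a) (compactify \<circ> knot_of a) id"
  proof (rule homotopic_with_trans[OF homotopic_with_equal homotopic_with_symD[OF h]])
    show "continuous_map (Emb_axis a) (Emb_axis a) (compactify \<circ> knot_of a)"
      by (rule continuous_map_compose[OF knot_of_continuous cc])
  qed (auto intro: compactify_knot_of)
  obtain H where H: "continuous_map (prod_topology (top_of_set {0..1::real}) (Emb_axis a)) (Emb_axis a) H"
    "\<And>x. H (0, x) = x" "\<And>x. H (1, x) = regularize a x"
    "\<And>t. t \<in> {0..1} \<Longrightarrow> axis_compatible a (\<lambda>x. H (t, x))"
    using regularize(1)[of a] unfolding homotopic_with_def by (auto simp: id_def)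
  let ?X = "prod_topology (top_of_set {0..1::real}) ?K"
  have "continuous_map ?X (prod_topology (top_of_set {0..1::real}) (Emb_axis a)) (\<lambda>x. (fst x, compactify (snd x)))"
    using continuous_map_compose[OF continuous_map_snd cc, of "top_of_set {0..1::real}"]
    by (intro continuous_map_pairedI continuous_map_fst) (simp add: o_def)
  from continuous_map_into_fulltopology[OF continuous_map_compose[OF this H(1)]]
  have "continuous_map ?X Emb (\<lambda>x. H (fst x, compactify (snd x)))" by (simp add: o_def)
  then have "continuous_map ?X ?K (\<lambda>x. uncompactify (H (fst x, compactify (snd x))))"
    by (rule uncompactify_continuous) (use H(4) compactify_standard[of _ a] in \<open>auto simp: axis_compatible_def\<close>)
  then have 2: "homotopic_with (\<lambda>_. True) ?K ?K id (knot_of a \<circ> compactify)"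
    unfolding homotopic_with_def
    by (intro exI[of _ "\<lambda>x. uncompactify (H (fst x, compactify (snd x)))"]) (simp add: H(2,3) knot_of_def)
  show ?thesis unfolding homotopy_equivalence_def
    using cc knot_of_continuous 1 homotopic_with_symD[OF 2] by blast
qed

text \<open>For a pointed embedding the velocity is tangent to the sphere at \<open>pt_inf\<close>,
  so its coordinate \<open>None\<close> vanishes and its direction determines it up to a positive
  factor.\<close>
lemma Emb_axis_eq: "subtopology Emb_pt {g. direction g = axis a 1} = Emb_axis a"
proof -
  have "pointed_embeddings \<inter> {g. direction g = axis a 1} = axis_embeddings a"
  proof -
    have "direction g = axis a 1 \<longleftrightarrow> velocity g = norm (velocity g) *\<^sub>R axis_vec a" if g: "g \<in> pointed_embeddings" for g
    proof -
      have d: "direction g = sgn (proj_finite (velocity g))" by (simp add: direction_def velocity_def o_def)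
      have N: "velocity g $ None = 0" by (rule velocity_None[OF g])
      have n: "norm (proj_finite (velocity g)) = norm (velocity g)"
        using norm_option[of "velocity g"] N by simp
      have nz: "norm (velocity g) \<noteq> 0" using velocity_nonzero[of g] g by (simp add: pointed_embeddings_def)
      have dir: "direction g = proj_finite (velocity g) /\<^sub>R norm (velocity g)"
        unfolding d sgn_div_norm n ..
      have dr: "axis a 1 = proj_finite (velocity g) /\<^sub>R norm (velocity g) \<longleftrightarrow>
          norm (velocity g) *\<^sub>R axis a 1 = proj_finite (velocity g)"
        by (rule divideR_right[OF nz])
      have "direction g = axis a 1 \<longleftrightarrow> axis a 1 = proj_finite (velocity g) /\<^sub>R norm (velocity g)"
        unfolding dir by (rule eq_commute)
      also have "\<dots> \<longleftrightarrow> norm (velocity g) *\<^sub>R axis a 1 = proj_finite (velocity g)" by (rule dr)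
      also have "\<dots> \<longleftrightarrow> proj_finite (velocity g) = norm (velocity g) *\<^sub>R axis a 1" by (rule eq_commute)
      also have "\<dots> \<longleftrightarrow> velocity g = norm (velocity g) *\<^sub>R axis_vec a"
        by (simp add: vec_eq_iff split_option_all N proj_finite_def axis_vec_nth axis_def)
      finally show ?thesis .
    qed
    then show ?thesis by (auto simp: axis_embeddings_def)
  qed
  then show ?thesis by (simp add: Emb_pt_def subtopology_subtopology)
qed

section \<open>Rotations of the sphere and their local sections\<close>

text \<open>The reflection in the hyperplane orthogonal to \<open>w\<close>. Dividing by \<open>w
  \<bullet> w\<close> instead of normalizing \<open>w\<close> makes the entries rational in
  \<open>w\<close>.\<close>
definition reflection :: "real^'m::finite \<Rightarrow> real^'m^'m" where
  "reflection w = (\<chi> i j. (if i = j then 1 else 0) - 2 / (w \<bullet> w) * (w $ i * w $ j))"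

lemma reflection_mult: "reflection w *v x = x - (2 * (w \<bullet> x) / (w \<bullet> w)) *\<^sub>R w"
proof -
  have "(reflection w *v x) $ i = x $ i - 2 * (w \<bullet> x) / (w \<bullet> w) * w $ i" for i
  proof -
    have "(\<Sum>j\<in>UNIV. ((if i = j then 1 else 0) - 2 / (w \<bullet> w) * (w $ i * w $ j)) * x $ j) =
      (\<Sum>j\<in>UNIV. (if i = j then x $ j else 0)) - (\<Sum>j\<in>UNIV. 2 / (w \<bullet> w) * w $ i * (w $ j * x $ j))"
      unfolding sum_subtractf[symmetric] by (rule sum.cong) (auto simp: algebra_simps)
    also have "\<dots> = x $ i - 2 / (w \<bullet> w) * w $ i * (w \<bullet> x)"
      unfolding sum_distrib_left[symmetric] inner_vec_def[of w x] inner_real_def by simp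
    finally show ?thesis by (simp add: matrix_vector_mult_def reflection_def mult.commute)
  qed
  then show ?thesis by (simp add: vec_eq_iff)
qed

lemma reflection_involution:
  assumes "w \<noteq> 0" shows "reflection w *v (reflection w *v x) = x"
proof -
  have ww: "w \<bullet> w \<noteq> 0" using assms by simp
  have "w \<bullet> (reflection w *v x) = - (w \<bullet> x)" using ww by (simp add: reflection_mult inner_diff_right)
  then show ?thesis using ww by (simp add: reflection_mult[of w "reflection w *v x"]) (simp add: reflection_mult)
qed

lemma reflection_orthogonal: "w \<noteq> 0 \<Longrightarrow> orthogonal_matrix (reflection w)"
proof -
  assume w: "w \<noteq> 0"
  have t: "transpose (reflection w) = reflection w"
    by (simp add: transpose_def reflection_def vec_eq_iff mult.commute)
  have "reflection w ** reflection w = mat 1"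
    using reflection_involution[OF w] by (subst matrix_eq) (simp add: matrix_vector_mul_assoc[symmetric])
  then show ?thesis by (simp add: orthogonal_matrix_def t)
qed

lemma reflection_conjugate:
  assumes "orthogonal_matrix A" "w \<noteq> 0"
  shows "reflection (A *v w) = A ** reflection w ** transpose A"
proof -
  have A: "transpose A ** A = mat 1" "A ** transpose A = mat 1" using assms by (auto simp: orthogonal_matrix_def)
  have ot: "orthogonal_transformation ((*v) A)" using assms(1)
    by (simp add: orthogonal_transformation_matrix)
  have i: "(A *v x) \<bullet> (A *v y) = x \<bullet> y" for x y using ot by (simp add: orthogonal_transformation_def)
  show ?thesis
  proof (subst matrix_eq, intro allI)
    fix x
    define y where "y = transpose A *v x"
    have x: "x = A *v y" unfolding y_def matrix_vector_mul_assoc A by simp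
    have ty: "transpose A *v (A *v y) = y" unfolding matrix_vector_mul_assoc A by simp
    show "reflection (A *v w) *v x = A ** reflection w ** transpose A *v x"
      unfolding matrix_vector_mul_assoc[symmetric] unfolding x ty
      by (simp add: reflection_mult i matrix_vector_mult_diff_distrib matrix_vector_mult_scaleR)
  qed
qed

lemma reflection_scale: "c \<noteq> 0 \<Longrightarrow> reflection (c *\<^sub>R w) = reflection w"
  by (simp add: reflection_def vec_eq_iff field_simps)

text \<open>Any two nonzero vectors are related by an orthogonal matrix after scaling, so the two
  reflections are conjugate. Hence a product of two reflections has determinant \<open>1\<close>,
  without evaluating a determinant.\<close>
lemma det_reflection_eq:
  fixes v w :: "real^'m::finite"
  assumes "v \<noteq> 0" "w \<noteq> 0" shows "det (reflection v) = det (reflection w)"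
proof -
  have u: "norm (v /\<^sub>R norm v) = 1" "norm (w /\<^sub>R norm w) = 1" using assms by auto
  obtain f where f: "orthogonal_transformation f" "f (v /\<^sub>R norm v) = w /\<^sub>R norm w"
    using orthogonal_transformation_exists_1[OF u] by blast
  define A where "A = matrix f"
  have o: "orthogonal_matrix A" using f(1) by (simp add: A_def orthogonal_transformation_matrix)
  have Af: "A *v x = f x" for x using f(1) by (simp add: A_def orthogonal_transformation_matrix matrix_works)
  have d: "det A * det A = 1"
    using det_orthogonal_matrix[OF o] by auto
  have "reflection w = reflection (w /\<^sub>R norm w)" using reflection_scale[of "inverse (norm w)" w] assms by simp
  also have "\<dots> = A ** reflection (v /\<^sub>R norm v) ** transpose A"
    using reflection_conjugate[OF o, of "v /\<^sub>R norm v"] assms f(2) by (simp add: Af)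
  also have "reflection (v /\<^sub>R norm v) = reflection v" using reflection_scale[of "inverse (norm v)" v] assms by simp
  finally show ?thesis using d by (simp add: det_mul mult.commute mult.left_commute)
qed

text \<open>The first reflection sends \<open>u\<close> to \<open>-u\<close> and the second one
  sends \<open>-u\<close> to \<open>v\<close> when the two are unit vectors: the rotation in the plane
  of \<open>u\<close> and \<open>v\<close> that takes \<open>u\<close> to \<open>v\<close>. It depends
  continuously on \<open>v \<noteq> -u\<close>.\<close>
definition rot :: "real^'m::finite \<Rightarrow> real^'m \<Rightarrow> real^'m^'m" where
  "rot u v = reflection (u + v) ** reflection u"

lemma rot:
  assumes "norm u = 1" "norm v = 1" "u + v \<noteq> 0"
  shows "rotation_matrix (rot u v)" "rot u v *v u = v" "\<And>x. u \<bullet> x = 0 \<Longrightarrow> v \<bullet> x = 0 \<Longrightarrow> rot u v *v x = x"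
proof -
  have u0: "u \<noteq> 0" using assms by auto
  have "det (reflection u) * det (reflection u) = 1"
    using det_orthogonal_matrix[OF reflection_orthogonal[OF u0]] by auto
  then have "det (rot u v) = 1" by (simp add: rot_def det_mul det_reflection_eq[OF assms(3) u0])
  then show "rotation_matrix (rot u v)"
    using reflection_orthogonal[OF u0] reflection_orthogonal[OF assms(3)]
    by (simp add: rotation_matrix_def rot_def orthogonal_matrix_mul)
  have uu: "u \<bullet> u = 1" "v \<bullet> v = 1" using assms by (auto simp: dot_square_norm)
  have s: "(u + v) \<bullet> (u + v) = 2 * (1 + u \<bullet> v)" by (simp add: inner_add_left inner_add_right uu inner_commute)
  have nz: "1 + u \<bullet> v \<noteq> 0" using s assms(3) by (metis inner_eq_zero_iff mult_zero_right)
  have "reflection u *v u = - u" by (simp add: reflection_mult uu scaleR_2)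
  then have "rot u v *v u = reflection (u + v) *v (- u)" by (simp add: rot_def matrix_vector_mul_assoc[symmetric])
  also have "\<dots> = v"
  proof -
    have q: "2 * (- x) / (2 * x) = -1" if "x \<noteq> 0" for x :: real using that by simp
    have "(u + v) \<bullet> (- u) = - (1 + u \<bullet> v)" by (simp add: inner_add_left uu inner_commute[of v u])
    then have "2 * ((u + v) \<bullet> (- u)) / (2 * (1 + u \<bullet> v)) = -1" by (simp only: q[OF nz])
    then show ?thesis unfolding reflection_mult s by simp
  qed
  finally show "rot u v *v u = v" .
  show "rot u v *v x = x" if "u \<bullet> x = 0" "v \<bullet> x = 0" for x
    using that by (simp add: rot_def matrix_vector_mul_assoc[symmetric] reflection_mult inner_add_left)
qed

lemma matrix_entries_continuous:
  fixes f :: "'a::topological_space \<Rightarrow> real^'m::finite^'n::finite"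
  assumes "\<And>i j. continuous_on S (\<lambda>x. f x $ i $ j)" shows "continuous_on S f"
proof -
  have "continuous_on S (\<lambda>x. \<chi> i j. f x $ i $ j)" by (intro continuous_on_vec_lambda assms)
  then show ?thesis by simp
qed

lemma continuous_on_matrix_mult:
  fixes f :: "'a::topological_space \<Rightarrow> real^'m::finite^'n::finite" and g :: "'a \<Rightarrow> real^'k::finite^'m"
  assumes "continuous_on S f" "continuous_on S g" shows "continuous_on S (\<lambda>x. f x ** g x)"
  by (rule matrix_entries_continuous)
    (auto simp: matrix_matrix_mult_def intro!: continuous_intros assms)

lemma continuous_on_matrix_vector:
  fixes f :: "'a::topological_space \<Rightarrow> real^'m::finite^'n::finite"
  assumes "continuous_on S f" "continuous_on S g" shows "continuous_on S (\<lambda>x. f x *v g x)"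
  by (rule bounded_bilinear.continuous_on[OF bounded_bilinear_matrix_vector assms])

lemma continuous_on_transpose:
  fixes f :: "'a::topological_space \<Rightarrow> real^'m::finite^'n::finite"
  assumes "continuous_on S f" shows "continuous_on S (\<lambda>x. transpose (f x))"
  by (rule matrix_entries_continuous) (auto simp: transpose_def intro!: continuous_intros assms)

lemma continuous_on_reflection:
  assumes "continuous_on S w" "\<And>x. x \<in> S \<Longrightarrow> w x \<noteq> 0"
  shows "continuous_on S (\<lambda>x. reflection (w x))"
proof (rule matrix_entries_continuous)
  fix i j
  have "continuous_on S (\<lambda>x. (if i = j then 1 else 0) - 2 / (w x \<bullet> w x) * (w x $ i * w x $ j))"
    by (intro continuous_intros assms(1)) (use assms(2) in auto)
  then show "continuous_on S (\<lambda>x. reflection (w x) $ i $ j)" by (simp add: reflection_def)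
qed

lemma continuous_on_rot:
  assumes "continuous_on S u" "continuous_on S v" "\<And>x. x \<in> S \<Longrightarrow> u x \<noteq> 0" "\<And>x. x \<in> S \<Longrightarrow> u x + v x \<noteq> 0"
  shows "continuous_on S (\<lambda>x. rot (u x) (v x))"
  unfolding rot_def
  by (intro continuous_on_matrix_mult continuous_on_reflection continuous_on_add assms)

lemma rot_SO: "norm u = 1 \<Longrightarrow> norm v = 1 \<Longrightarrow> u + v \<noteq> 0 \<Longrightarrow> rot u v \<in> SO_succ"
  using rot(1) by (simp add: SO_succ_def)

lemma SO_succ_transitive:
  assumes "norm (b :: real^('n::finite option)) = 1"
  obtains A where "A \<in> SO_succ" "A *v pt_inf = b"
proof -
  have "CARD('n option) \<ge> 2" by (simp add: card_UNIV_option Suc_le_eq)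
  from rotation_matrix_exists_basis[OF this assms, of None] show ?thesis
    using that by (auto simp: SO_succ_def pt_inf_def)
qed

lemma SO_succ_inner: "A \<in> SO_succ \<Longrightarrow> (A *v x) \<bullet> (A *v y) = x \<bullet> y"
proof -
  assume "A \<in> SO_succ"
  then have "orthogonal_transformation ((*v) A)"
    by (simp add: SO_succ_def rotation_matrix_def orthogonal_transformation_matrix)
  then show ?thesis by (simp add: orthogonal_transformation_def)
qed

lemma frame_orthogonal [simp]: "pt_inf \<bullet> axis_vec a = 0" "axis_vec a \<bullet> pt_inf = 0"
  by (simp_all add: inner_pt_inf inner_commute[of "axis_vec a"])

text \<open>After moving \<open>pt_inf\<close> to \<open>v\<close>, a rotation fixing
  \<open>pt_inf\<close> has to move the long axis to a given unit vector orthogonal to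
  \<open>pt_inf\<close>. For the antipode of the long axis this takes a third direction, which exists
  because \<open>n \<ge> 2\<close>.\<close>
lemma SO_succ_frame_transitive:
  fixes v w :: "real^('n::finite option)"
  assumes "CARD('n) \<ge> 2" "norm v = 1" "norm w = 1" "v \<bullet> w = 0"
  obtains A where "A \<in> SO_succ" "A *v pt_inf = v" "A *v axis_vec a = w"
proof -
  obtain A0 where A0: "A0 \<in> SO_succ" "A0 *v pt_inf = v" using SO_succ_transitive[OF assms(2)] .
  define x where "x = transpose A0 *v w"
  have x: "A0 *v x = w" "norm x = 1" unfolding x_def using SO_succ_cancel(2)[OF A0(1)] SO_succ_norm[OF SO_succ_transpose[OF A0(1)]] assms by auto
  have xN: "pt_inf \<bullet> x = 0" using SO_succ_inner[OF A0(1), of pt_inf x] A0 x assms by simp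
  have "\<exists>B\<in>SO_succ. B *v pt_inf = pt_inf \<and> B *v axis_vec a = x"
  proof (cases "axis_vec a + x = 0")
    case False
    then show ?thesis using rot[of "axis_vec a" x] rot_SO[of "axis_vec a" x] x xN
      by (intro bexI[of _ "rot (axis_vec a) x"]) (auto simp: inner_commute[of x])
  next
    case True
    obtain i where i: "i \<noteq> a"
    proof -
      have "\<not> (\<forall>i. i = a)"
      proof
        assume "\<forall>i. i = a"
        then have "(UNIV :: 'n set) = {a}" by auto
        then have "CARD('n) = card {a}" by (simp only:)
        then show False using assms by simp
      qed
      then show ?thesis using that by blast
    qed
    have xe: "x = - axis_vec a" using True by (simp add: eq_neg_iff_add_eq_0 add.commute)
    have n1: "axis_vec a + axis_vec i \<noteq> 0"
    proof
      assume "axis_vec a + axis_vec i = 0"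
      then have "(axis_vec a + axis_vec i) $ Some a = 0" by simp
      then show False using i by (simp add: axis_vec_nth)
    qed
    have n2: "axis_vec i + x \<noteq> 0"
    proof
      assume "axis_vec i + x = 0"
      then have "(axis_vec i + x) $ Some a = 0" by simp
      then show False using i by (simp add: axis_vec_nth xe)
    qed
    let ?B = "rot (axis_vec i) x ** rot (axis_vec a) (axis_vec i)"
    have "?B \<in> SO_succ" using rot_SO[OF _ _ n1] rot_SO[OF _ x(2) n2] by (intro SO_succ_mult) auto
    moreover have "?B *v pt_inf = pt_inf" "?B *v axis_vec a = x"
      using rot(2,3)[OF _ _ n1] rot(2,3)[OF _ x(2) n2] xN
      by (simp_all add: matrix_vector_mul_assoc[symmetric] inner_commute[of x])
    ultimately show ?thesis by blast
  qed
  then obtain B where "B \<in> SO_succ" "B *v pt_inf = pt_inf" "B *v axis_vec a = x" by blast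
  then show ?thesis using A0 x by (intro that[of "A0 ** B"]) (auto simp: SO_succ_mult matrix_vector_mul_assoc[symmetric])
qed

lemma point_section:
  fixes b :: "real^('n::finite option)"
  assumes "norm b = 1"
  obtains W \<sigma> where "open W" "b \<in> W" "continuous_on W \<sigma>"
    "\<And>v. v \<in> W \<Longrightarrow> norm v = 1 \<Longrightarrow> \<sigma> v \<in> SO_succ \<and> \<sigma> v *v pt_inf = v"
proof -
  obtain A0 where A0: "A0 \<in> SO_succ" "A0 *v pt_inf = b" using SO_succ_transitive[OF assms] .
  show ?thesis
  proof (rule that[of "{v. b + v \<noteq> 0}" "\<lambda>v. rot b v ** A0"])
    show "open {v. b + v \<noteq> 0}" by (intro open_Collect_neq continuous_intros)
    have "b + b \<noteq> 0" using assms by (auto simp flip: scaleR_2)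
    then show "b \<in> {v. b + v \<noteq> 0}" by simp
    show "continuous_on {v. b + v \<noteq> 0} (\<lambda>v. rot b v ** A0)"
      by (intro continuous_on_matrix_mult continuous_on_rot continuous_intros) (use assms in auto)
    show "rot b v ** A0 \<in> SO_succ \<and> (rot b v ** A0) *v pt_inf = v" if "v \<in> {v. b + v \<noteq> 0}" "norm v = 1" for v
      using that rot_SO[OF assms, of v] rot(2)[OF assms, of v] A0 by (simp add: SO_succ_mult matrix_vector_mul_assoc[symmetric])
  qed
qed

text \<open>The first rotation moves \<open>b\<close> to \<open>v\<close>; the second one moves the
  image of \<open>c\<close> to \<open>w\<close> and fixes \<open>v\<close>, as \<open>v\<close> is
  orthogonal to both.\<close>
lemma frame_section:
  fixes A0 :: "'n::finite succ_matrix"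
  assumes A0: "A0 \<in> SO_succ"
  obtains W \<sigma> where "open W" "(A0 *v pt_inf, A0 *v axis_vec a) \<in> W" "continuous_on W \<sigma>"
    "\<And>v w. (v, w) \<in> W \<Longrightarrow> norm v = 1 \<Longrightarrow> norm w = 1 \<Longrightarrow> v \<bullet> w = 0 \<Longrightarrow>
       \<sigma> (v, w) \<in> SO_succ \<and> \<sigma> (v, w) *v pt_inf = v \<and> \<sigma> (v, w) *v axis_vec a = w"
proof -
  define b c where "b = A0 *v pt_inf" and "c = A0 *v axis_vec a"
  have bc: "norm b = 1" "norm c = 1" "b \<bullet> c = 0" using SO_succ_norm[OF A0] SO_succ_inner[OF A0] by (auto simp: b_def c_def)
  have b0: "b \<noteq> 0" "c \<noteq> 0" "b + b \<noteq> 0" "c + c \<noteq> 0" using bc by (auto simp flip: scaleR_2)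
  define W1 where "W1 = {v :: real^('n option). b + v \<noteq> 0} \<times> (UNIV :: (real^('n option)) set)"
  define f where "f = (\<lambda>p :: (real^('n option)) \<times> (real^('n option)). rot b (fst p) *v c + snd p)"
  have o1: "open W1" unfolding W1_def by (intro open_Times open_Collect_neq continuous_intros) auto
  have r1: "continuous_on W1 (\<lambda>p. rot b (fst p))"
    by (intro continuous_on_rot continuous_intros) (auto simp: W1_def b0)
  have cf: "continuous_on W1 f"
    unfolding f_def by (intro continuous_on_add continuous_on_matrix_vector r1 continuous_intros)
  define W where "W = W1 \<inter> f -` (- {0})"
  have oW: "open W" unfolding W_def by (rule continuous_open_preimage[OF cf o1]) auto
  have sub: "W \<subseteq> W1" by (auto simp: W_def)
  define \<sigma> where "\<sigma> = (\<lambda>p. rot (rot b (fst p) *v c) (snd p) ** (rot b (fst p) ** A0))"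
  have rbb: "rot b b *v b = b" "rot b b *v c = c" using rot(2,3)[OF bc(1) bc(1) b0(3)] bc by auto
  have inW: "(b, c) \<in> W" using b0 rbb by (auto simp: W_def W1_def f_def)
  show ?thesis
  proof (rule that[of W \<sigma>])
    show "open W" by (rule oW)
    show "(A0 *v pt_inf, A0 *v axis_vec a) \<in> W" using inW by (simp add: b_def c_def)
    have r: "continuous_on W (\<lambda>p. rot b (fst p))" by (rule continuous_on_subset[OF r1 sub])
    have nz: "rot b (fst p) *v c \<noteq> 0" "rot b (fst p) *v c + snd p \<noteq> 0" if "p \<in> W" for p
    proof -
      have "reflection w *v x \<noteq> 0" if "w \<noteq> 0" "x \<noteq> 0" for w x :: "real^('n option)"
        using reflection_involution[OF that(1), of x] that(2) by auto
      then show "rot b (fst p) *v c \<noteq> 0" using that b0 sub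
        by (auto simp: rot_def matrix_vector_mul_assoc[symmetric] W1_def)
      show "rot b (fst p) *v c + snd p \<noteq> 0" using that by (auto simp: W_def f_def)
    qed
    show "continuous_on W \<sigma>"
      unfolding \<sigma>_def
      by (intro continuous_on_matrix_mult continuous_on_rot continuous_on_matrix_vector r continuous_intros nz)
    fix v w assume vw: "(v, w) \<in> W" "norm v = 1" "norm w = 1" "v \<bullet> w = 0"
    have bv: "b + v \<noteq> 0" using vw(1) by (auto simp: W_def W1_def)
    let ?R = "rot b v"
    have R: "?R \<in> SO_succ" "?R *v b = v" using rot_SO[OF bc(1) vw(2) bv] rot(2)[OF bc(1) vw(2) bv] by auto
    have nRc: "norm (?R *v c) = 1" using SO_succ_norm[OF R(1)] bc by simp
    have oRc: "(?R *v c) \<bullet> v = 0" using SO_succ_inner[OF R(1), of c b] R(2) bc by (simp add: inner_commute)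
    have nz2: "?R *v c + w \<noteq> 0" using nz(2)[OF vw(1)] by simp
    note r2 = rot_SO[OF nRc vw(3) nz2] rot(2,3)[OF nRc vw(3) nz2]
    have s: "\<sigma> (v, w) = rot (?R *v c) w ** (?R ** A0)" by (simp add: \<sigma>_def)
    have "\<sigma> (v, w) *v pt_inf = v"
      unfolding s matrix_vector_mul_assoc[symmetric] b_def[symmetric] R(2) using r2(3)[OF oRc] vw(4) by (simp add: inner_commute)
    moreover have "\<sigma> (v, w) *v axis_vec a = w"
      unfolding s matrix_vector_mul_assoc[symmetric] c_def[symmetric] using r2(2) by simp
    ultimately show "\<sigma> (v, w) \<in> SO_succ \<and> \<sigma> (v, w) *v pt_inf = v \<and> \<sigma> (v, w) *v axis_vec a = w"
      using r2(1) R(1) A0 by (auto simp: s SO_succ_mult)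
  qed
qed

section \<open>Equivariant bundles\<close>

text \<open>Over an open set with a section \<open>\<sigma>\<close> of the orbit map of
  \<open>b0\<close>, the map \<open>(u, y) \<mapsto> act (\<sigma> u) (i y)\<close> is a
  trivialization; its inverse moves a point \<open>e\<close> back to the fibre over \<open>b0\<close>
  by the transpose of \<open>\<sigma> (p e)\<close>.\<close>
lemma equivariant_bundle:
  fixes H :: "(real^'m::finite^'m) set" and act :: "real^'m^'m \<Rightarrow> 'e \<Rightarrow> 'e" and actB :: "real^'m^'m \<Rightarrow> 'b \<Rightarrow> 'b"
  assumes act: "continuous_map (prod_topology (top_of_set H) E) E (\<lambda>(A, e). act A e)"
    and Ht: "\<And>A. A \<in> H \<Longrightarrow> transpose A \<in> H"
    and inv: "\<And>A e. A \<in> H \<Longrightarrow> e \<in> topspace E \<Longrightarrow> act (transpose A) (act A e) = e"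
    and p: "continuous_map E B p"
    and eq: "\<And>A e. A \<in> H \<Longrightarrow> e \<in> topspace E \<Longrightarrow> p (act A e) = actB A (p e)"
    and invB: "\<And>A b. A \<in> H \<Longrightarrow> b \<in> topspace B \<Longrightarrow> actB (transpose A) (actB A b) = b"
    and b0: "b0 \<in> topspace B"
    and sec: "\<And>b. b \<in> topspace B \<Longrightarrow> \<exists>U \<sigma>. openin B U \<and> b \<in> U \<and>
       continuous_map (subtopology B U) (top_of_set H) \<sigma> \<and> (\<forall>u\<in>U. actB (\<sigma> u) b0 = u)"
    and i: "homeomorphic_map F (subtopology E {e \<in> topspace E. p e = b0}) i"
  shows "bundle_sequence F i E p B b0"
proof -
  obtain j where ij: "homeomorphic_maps F (subtopology E {e \<in> topspace E. p e = b0}) i j"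
    using i homeomorphic_map_maps by blast
  have ic: "continuous_map F (subtopology E {e \<in> topspace E. p e = b0}) i"
    and jc: "continuous_map (subtopology E {e \<in> topspace E. p e = b0}) F j"
    and ji: "\<And>y. y \<in> topspace F \<Longrightarrow> j (i y) = y"
    and ij': "\<And>e. e \<in> topspace E \<Longrightarrow> p e = b0 \<Longrightarrow> i (j e) = e"
    using ij by (auto simp: homeomorphic_maps_def)
  have im: "i y \<in> topspace E" "p (i y) = b0" if "y \<in> topspace F" for y
    using continuous_map_image_subset_topspace[OF ic] that by auto
  have actm: "act A e \<in> topspace E" if "A \<in> H" "e \<in> topspace E" for A e
    using continuous_map_image_subset_topspace[OF act] that by force
  have inv': "act A (act (transpose A) e) = e" if "A \<in> H" "e \<in> topspace E" for A e
    using inv[OF Ht[OF that(1)] that(2)] by simp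
  have "\<exists>U h. openin B U \<and> b \<in> U \<and>
        homeomorphic_map (prod_topology (subtopology B U) F) (subtopology E {e \<in> topspace E. p e \<in> U}) h \<and>
        (\<forall>u \<in> U. \<forall>y \<in> topspace F. p (h (u, y)) = u)" if b: "b \<in> topspace B" for b
  proof -
    obtain U \<sigma> where U: "openin B U" "b \<in> U" and s: "continuous_map (subtopology B U) (top_of_set H) \<sigma>"
      and su: "\<And>u. u \<in> U \<Longrightarrow> actB (\<sigma> u) b0 = u" using sec[OF b] by blast
    have UB: "U \<subseteq> topspace B" by (rule openin_subset[OF U(1)])
    have sH: "\<sigma> u \<in> H" if "u \<in> U" for u
      using continuous_map_image_subset_topspace[OF s] that UB by auto
    let ?EU = "subtopology E {e \<in> topspace E. p e \<in> U}"
    define h where "h = (\<lambda>x. act (\<sigma> (fst x)) (i (snd x)))"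
    define k where "k = (\<lambda>e. (p e, j (act (transpose (\<sigma> (p e))) e)))"
    have ph: "p (h (u, y)) = u" if "u \<in> U" "y \<in> topspace F" for u y
      using eq[OF sH[OF that(1)] im(1)[OF that(2)]] im(2)[OF that(2)] su[OF that(1)] by (simp add: h_def)
    let ?X = "prod_topology (subtopology B U) F"
    have "continuous_map ?X (prod_topology (top_of_set H) E) (\<lambda>x. (\<sigma> (fst x), i (snd x)))"
      using continuous_map_compose[OF continuous_map_fst s, of F]
        continuous_map_compose[OF continuous_map_snd continuous_map_into_fulltopology[OF ic], of "subtopology B U"]
      by (intro continuous_map_pairedI) (simp_all add: o_def)
    from continuous_map_compose[OF this act] have "continuous_map ?X E h" by (simp add: h_def o_def)
    then have hc: "continuous_map ?X ?EU h"
      using ph actm[OF sH im(1)] by (auto simp: continuous_map_in_subtopology h_def)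
    have pe: "continuous_map ?EU (subtopology B U) p"
      using continuous_map_from_subtopology[OF p] by (auto simp: continuous_map_in_subtopology)
    have "continuous_map ?EU (top_of_set H) (\<lambda>e. \<sigma> (p e))"
      using continuous_map_compose[OF pe s] by (simp add: o_def)
    then have "continuous_map ?EU euclidean (\<lambda>e. transpose (\<sigma> (p e)))"
      using continuous_map_euclidean_unop[of ?EU "\<lambda>e. \<sigma> (p e)" UNIV transpose]
        continuous_on_transpose[OF continuous_on_id, of UNIV] by (auto simp: continuous_map_in_subtopology id_def)
    then have "continuous_map ?EU (top_of_set H) (\<lambda>e. transpose (\<sigma> (p e)))"
      using Ht[OF sH] by (auto simp: continuous_map_in_subtopology)
    then have "continuous_map ?EU (prod_topology (top_of_set H) E) (\<lambda>e. (transpose (\<sigma> (p e)), e))"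
      by (intro continuous_map_pairedI continuous_map_from_subtopology[OF continuous_map_id[unfolded id_def]])
    from continuous_map_compose[OF this act]
    have "continuous_map ?EU E (\<lambda>e. act (transpose (\<sigma> (p e))) e)" by (simp add: o_def)
    moreover have pb: "p (act (transpose (\<sigma> (p e))) e) = b0" if "e \<in> topspace E" "p e \<in> U" for e
      using eq[OF Ht[OF sH[OF that(2)]] that(1)] invB[OF sH[OF that(2)] b0] su[OF that(2)] by simp
    ultimately have "continuous_map ?EU (subtopology E {e \<in> topspace E. p e = b0}) (\<lambda>e. act (transpose (\<sigma> (p e))) e)"
      using actm[OF Ht[OF sH]] by (auto simp: continuous_map_in_subtopology)
    from continuous_map_compose[OF this jc]
    have kc: "continuous_map ?EU ?X k"
      unfolding k_def by (intro continuous_map_pairedI pe) (simp add: o_def)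
    have "homeomorphic_maps ?X ?EU h k"
      unfolding homeomorphic_maps_def
    proof (intro conjI ballI hc kc)
      fix x assume "x \<in> topspace ?X"
      then obtain u y where x: "x = (u, y)" "u \<in> U" "y \<in> topspace F" by auto
      have "act (transpose (\<sigma> u)) (h (u, y)) = i y" using inv[OF sH[OF x(2)] im(1)[OF x(3)]] by (simp add: h_def)
      then show "k (h x) = x" unfolding x(1) k_def ph[OF x(2,3)] using ji[OF x(3)] by simp
    next
      fix e assume "e \<in> topspace ?EU"
      then have e: "e \<in> topspace E" "p e \<in> U" by auto
      have "i (j (act (transpose (\<sigma> (p e))) e)) = act (transpose (\<sigma> (p e))) e"
        by (rule ij'[OF actm[OF Ht[OF sH[OF e(2)]] e(1)] pb[OF e]])
      then show "h (k e) = e" using inv'[OF sH[OF e(2)] e(1)] by (simp add: h_def k_def)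
    qed
    then have "homeomorphic_map ?X ?EU h" using homeomorphic_map_maps by blast
    then show ?thesis using U ph by blast
  qed
  then show ?thesis unfolding bundle_sequence_def fibre_bundle_def using p b0 i by blast
qed

lemma quotient_map_quotient_topology: "quotient_map X (quotient_topology X q) q"
proof -
  have t: "topspace (quotient_topology X q) = q ` topspace X"
  proof
    show "topspace (quotient_topology X q) \<subseteq> q ` topspace X"
      using openin_quotient_topology[of X q "topspace (quotient_topology X q)"] by simp
    have "{x \<in> topspace X. q x \<in> q ` topspace X} = topspace X" by auto
    then have "openin (quotient_topology X q) (q ` topspace X)" by (simp add: openin_quotient_topology)
    then show "q ` topspace X \<subseteq> topspace (quotient_topology X q)" by (rule openin_subset)
  qed
  show ?thesis unfolding quotient_map_def t
    by (auto simp: openin_quotient_topology)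
qed

lemma topspace_quotient_topology [simp]: "topspace (quotient_topology X q) = q ` topspace X"
  using quotient_map_quotient_topology[of X q] by (simp add: quotient_map_def)

text \<open>Orthogonal matrices have bounded columns, and the defining conditions are
  closed.\<close>
lemma SO_succ_compact: "compact (SO_succ :: 'n::finite succ_matrix set)"
proof -
  have 1: "closed {A :: 'n succ_matrix. transpose A ** A = mat 1}"
    and 2: "closed {A :: 'n succ_matrix. A ** transpose A = mat 1}"
    by (intro closed_Collect_eq continuous_on_matrix_mult continuous_on_transpose continuous_intros)+
  have 3: "closed {A :: 'n succ_matrix. det A = 1}"
    unfolding det_def by (intro closed_Collect_eq continuous_intros)
  have "SO_succ = {A :: 'n succ_matrix. transpose A ** A = mat 1} \<inter> {A. A ** transpose A = mat 1} \<inter> {A. det A = 1}"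
    by (auto simp: SO_succ_def rotation_matrix_def orthogonal_matrix_def)
  then have c: "closed (SO_succ :: 'n succ_matrix set)" using closed_Int[OF closed_Int[OF 1 2] 3] by (simp only:)
  have "norm A \<le> real (CARD('n option)) * real (CARD('n option))" if "A \<in> SO_succ" for A :: "'n succ_matrix"
  proof -
    have e: "\<bar>A $ i $ j\<bar> \<le> 1" for i j
    proof -
      have "(A *v axis j 1) $ i = A $ i $ j" by (simp add: matrix_vector_mult_basis column_def)
      then show ?thesis using component_le_norm_cart[of "A *v axis j 1" i] SO_succ_norm[OF that, of "axis j 1"]
        by (simp add: norm_axis_1)
    qed
    have r: "norm (A $ i) \<le> real (CARD('n option))" for i
    proof -
      have "norm (A $ i) \<le> (\<Sum>j\<in>UNIV. \<bar>A $ i $ j\<bar>)" by (rule norm_le_l1_cart)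
      also have "\<dots> \<le> (\<Sum>j\<in>(UNIV :: 'n option set). 1)" by (intro sum_mono e)
      finally show ?thesis by simp
    qed
    have "norm A \<le> (\<Sum>i\<in>UNIV. norm (A $ i))" unfolding norm_vec_def by (rule L2_set_le_sum) simp
    also have "\<dots> \<le> (\<Sum>i\<in>(UNIV :: 'n option set). real (CARD('n option)))" by (intro sum_mono r)
    finally show ?thesis by simp
  qed
  then have "bounded (SO_succ :: 'n succ_matrix set)" unfolding bounded_iff by blast
  then show ?thesis using c by (simp add: compact_eq_bounded_closed)
qed

lemma SO_mid_compact: "compact (SO_mid :: 'n::finite succ_matrix set)"
proof -
  have c: "closed {A :: 'n succ_matrix. A *v pt_inf = pt_inf}"
    by (intro closed_Collect_eq continuous_on_matrix_vector continuous_intros)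
  have "SO_mid = (SO_succ :: 'n succ_matrix set) \<inter> {A. A *v pt_inf = pt_inf}" by (auto simp: SO_mid_def)
  then show ?thesis using compact_Int_closed[OF SO_succ_compact c] by (simp only:)
qed

section \<open>Coset spaces\<close>

lemma quotient_topology_unique:
  assumes "quotient_map X Y q" shows "quotient_topology X q = Y"
  unfolding topology_eq openin_quotient_topology
proof
  fix U
  show "(U \<subseteq> q ` topspace X \<and> openin X {x \<in> topspace X. q x \<in> U}) = openin Y U"
    using assms[unfolded quotient_map_def] openin_subset[of Y U] by auto
qed

lemma quotient_topology_cong:
  assumes "\<And>x. x \<in> topspace X \<Longrightarrow> q x = q' x" shows "quotient_topology X q = quotient_topology X q'"
proof (rule quotient_topology_unique)
  show "quotient_map X (quotient_topology X q') q"
    using quotient_map_quotient_topology[of X q'] assms by (metis quotient_map_eq)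
qed

lemma coset_mult:
  assumes H: "H \<subseteq> SO_succ" "\<And>A B. A \<in> H \<Longrightarrow> B \<in> H \<Longrightarrow> A ** B \<in> H" "\<And>A. A \<in> H \<Longrightarrow> transpose A \<in> H" and B: "B \<in> H"
  shows "coset H (A ** B) = coset H A"
proof -
  have 1: "coset H (A ** B) \<subseteq> coset H A" if "B \<in> H" for A B
    using H(2)[OF that] by (auto simp: coset_def matrix_mul_assoc[symmetric])
  have "A = (A ** B) ** transpose B"
    using SO_succ_inverse(2)[of B] B H(1) by (auto simp: matrix_mul_assoc[symmetric])
  then have "coset H A \<subseteq> coset H (A ** B)" using 1[OF H(3)[OF B], of "A ** B"] by simp
  then show ?thesis using 1[OF B] by blast
qed

lemma coset_self: "mat 1 \<in> H \<Longrightarrow> A \<in> coset H A"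
  unfolding coset_def by (rule image_eqI[of _ _ "mat 1"]) auto

lemma mat1_SO_mid [simp]: "mat 1 \<in> SO_mid"
  by (simp add: SO_mid_def)

lemma SO_mid_subset: "SO_mid \<subseteq> SO_succ" and SO_axis_subset: "SO_axis a \<subseteq> SO_mid"
  by (auto simp: SO_mid_def SO_axis_def)

text \<open>\<open>SO_mid\<close> is the stabilizer of \<open>pt_inf\<close>.\<close>
lemma coset_mid_eq_iff:
  assumes "A \<in> SO_succ" "A' \<in> SO_succ"
  shows "coset SO_mid A = coset SO_mid A' \<longleftrightarrow> A *v pt_inf = A' *v pt_inf"
proof
  assume "coset SO_mid A = coset SO_mid A'"
  then have "A \<in> coset SO_mid A'" using coset_self[OF mat1_SO_mid, of A] by simp
  then show "A *v pt_inf = A' *v pt_inf"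
    by (auto simp: coset_def matrix_vector_mul_assoc[symmetric] SO_mid_pt_inf)
next
  assume e: "A *v pt_inf = A' *v pt_inf"
  let ?B = "transpose A' ** A"
  have "?B *v pt_inf = pt_inf" using SO_succ_cancel(1)[OF assms(2)] e by (simp only: matrix_vector_mul_assoc[symmetric])
  then have B: "?B \<in> SO_mid" using assms by (simp add: SO_mid_def SO_succ_mult SO_succ_transpose)
  have "A = A' ** ?B" using SO_succ_inverse(2)[OF assms(2)] by (simp add: matrix_mul_assoc)
  then show "coset SO_mid A = coset SO_mid A'"
    using coset_mult[OF SO_mid_subset SO_mid_mult SO_mid_transpose B, of A'] by simp
qed

text \<open>\<open>SO_axis a\<close> is the common stabilizer of \<open>pt_inf\<close> and the long
  axis, so its cosets are orthonormal pairs.\<close>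
lemma coset_axis_eq_iff:
  assumes "A \<in> SO_succ" "A' \<in> SO_succ"
  shows "coset (SO_axis a) A = coset (SO_axis a) A' \<longleftrightarrow> A *v pt_inf = A' *v pt_inf \<and> A *v axis_vec a = A' *v axis_vec a"
proof
  assume "coset (SO_axis a) A = coset (SO_axis a) A'"
  then have "A \<in> coset (SO_axis a) A'" using coset_self[OF mat1_SO_axis[of a], of A] by simp
  then show "A *v pt_inf = A' *v pt_inf \<and> A *v axis_vec a = A' *v axis_vec a"
    by (auto simp: coset_def matrix_vector_mul_assoc[symmetric] SO_axis_iff)
next
  assume e: "A *v pt_inf = A' *v pt_inf \<and> A *v axis_vec a = A' *v axis_vec a"
  let ?B = "transpose A' ** A"
  have "?B *v pt_inf = pt_inf" "?B *v axis_vec a = axis_vec a"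
    using SO_succ_cancel(1)[OF assms(2)] e by (simp_all only: matrix_vector_mul_assoc[symmetric])
  then have B: "?B \<in> SO_axis a" using assms by (simp add: SO_axis_iff SO_succ_mult SO_succ_transpose)
  have "A = A' ** ?B" using SO_succ_inverse(2)[OF assms(2)] by (simp add: matrix_mul_assoc)
  moreover have "SO_axis a \<subseteq> SO_succ" using SO_axis_subset SO_mid_subset by blast
  ultimately show "coset (SO_axis a) A = coset (SO_axis a) A'"
    using coset_mult[OF _ SO_axis_mult SO_axis_transpose B, of A'] by simp
qed

lemma induced_coset:
  assumes "mat 1 \<in> H" "\<And>B. B \<in> H \<Longrightarrow> f (A ** B) = f A"
  shows "induced f (coset H A) = f A"
  by (rule induced_eq[OF coset_self[OF assms(1)]]) (use assms(2) in \<open>auto simp: coset_def\<close>)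

lemma topspace_coset_space [simp]: "topspace (coset_space G H) = coset H ` G"
  by (simp add: coset_space_def)

lemma coset_quotient: "quotient_map (top_of_set G) (coset_space G H) (coset H)"
  unfolding coset_space_def by (rule quotient_map_quotient_topology)

lemma continuous_map_induced_coset:
  assumes "mat 1 \<in> H" "\<And>A B. A \<in> G \<Longrightarrow> B \<in> H \<Longrightarrow> f (A ** B) = f A" "continuous_on G f"
  shows "continuous_map (coset_space G H) euclidean (induced f)"
proof (rule continuous_compose_quotient_map[OF coset_quotient])
  have "continuous_map (top_of_set G) euclidean f" using assms(3) by simp
  then show "continuous_map (top_of_set G) euclidean (induced f \<circ> coset H)"
  proof (rule continuous_map_eq)
    fix A assume "A \<in> topspace (top_of_set G)"
    then show "f A = (induced f \<circ> coset H) A"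
      using induced_coset[OF assms(1), of f A] assms(2)[of A] by simp
  qed
qed

lemma compact_coset_space:
  assumes "compact G" shows "compact_space (coset_space G H)"
proof -
  have "compactin (coset_space G H) (coset H ` G)"
    by (rule image_compactin[OF _ quotient_imp_continuous_map[OF coset_quotient]]) (use assms in auto)
  then show ?thesis by (simp add: compact_space_def)
qed

lemma induced_mid_pt_inf: "induced (\<lambda>A. A *v pt_inf) (coset SO_mid A) = A *v pt_inf"
  by (rule induced_coset) (auto simp: matrix_vector_mul_assoc[symmetric] SO_mid_pt_inf)

text \<open>A continuous bijection from a compact space to a Hausdorff space.\<close>
lemma coset_mid_homeomorphic_sphere:
  "homeomorphic_map (coset_space SO_succ SO_mid) (top_of_set (unit_sphere :: (real^('n::finite option)) set)) (induced (\<lambda>A. A *v pt_inf))"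
proof (rule continuous_imp_homeomorphic_map)
  have "continuous_map (coset_space SO_succ SO_mid) euclidean (induced (\<lambda>A :: 'n succ_matrix. A *v pt_inf))"
    by (rule continuous_map_induced_coset)
      (auto simp: matrix_vector_mul_assoc[symmetric] SO_mid_pt_inf intro!: continuous_on_matrix_vector continuous_intros)
  then show "continuous_map (coset_space SO_succ SO_mid) (top_of_set unit_sphere) (induced (\<lambda>A :: 'n succ_matrix. A *v pt_inf))"
    by (auto simp: continuous_map_in_subtopology induced_mid_pt_inf SO_succ_norm)
  show "compact_space (coset_space (SO_succ :: 'n succ_matrix set) SO_mid)" by (rule compact_coset_space[OF SO_succ_compact])
  show "Hausdorff_space (top_of_set (unit_sphere :: (real^('n option)) set))" by (intro Hausdorff_space_subtopology Hausdorff_space_euclidean)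
  show "induced (\<lambda>A. A *v pt_inf) ` topspace (coset_space SO_succ SO_mid) = topspace (top_of_set (unit_sphere :: (real^('n option)) set))"
  proof -
    have "(\<lambda>A :: 'n succ_matrix. A *v pt_inf) ` SO_succ = unit_sphere"
    proof (intro equalityI subsetI)
      fix b :: "real^('n option)" assume "b \<in> unit_sphere"
      then obtain A where "A \<in> SO_succ" "A *v pt_inf = b" using SO_succ_transitive[of b] by auto
      then show "b \<in> (\<lambda>A. A *v pt_inf) ` SO_succ" by blast
    qed (auto simp: SO_succ_norm)
    then show ?thesis by (simp add: image_image induced_mid_pt_inf)
  qed
  show "inj_on (induced (\<lambda>A :: 'n succ_matrix. A *v pt_inf)) (topspace (coset_space SO_succ SO_mid))"
    by (auto simp: inj_on_def induced_mid_pt_inf coset_mid_eq_iff)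
qed

section \<open>Balanced products\<close>

text \<open>The balanced class of \<open>x\<close> written without reference to the group
  \<open>G\<close>: with \<open>A = (A B\<^sup>T) B\<close>, the pair \<open>(A, f)\<close> is related
  to \<open>(A B\<^sup>T, B f)\<close>. In this form the classes for \<open>SO(n)\<close> are
  literally classes for \<open>SO(n+1)\<close>.\<close>
definition orbit :: "'n::finite \<Rightarrow> 'n framed \<Rightarrow> 'n framed set" where
  "orbit a x = (\<lambda>B. (fst x ** transpose B, rotate_knot B (snd x))) ` SO_axis a"

text \<open>The two groups for which balanced products are formed; naming them together allows one
  proof for both.\<close>
definition frame_group :: "'n::finite succ_matrix set \<Rightarrow> bool" where
  "frame_group G \<longleftrightarrow> G = SO_mid \<or> G = SO_succ"

lemma frame_group:
  assumes "frame_group G"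
  shows "G \<subseteq> SO_succ" "SO_axis a \<subseteq> G" "\<And>A B. A \<in> G \<Longrightarrow> B \<in> G \<Longrightarrow> A ** B \<in> G" "\<And>A. A \<in> G \<Longrightarrow> transpose A \<in> G" "mat 1 \<in> G"
    "compact G"
proof -
  have "\<forall>G. frame_group G \<longrightarrow> G \<subseteq> SO_succ \<and> SO_axis a \<subseteq> G \<and> (\<forall>A\<in>G. \<forall>B\<in>G. A ** B \<in> G) \<and> (\<forall>A\<in>G. transpose A \<in> G) \<and> mat 1 \<in> G \<and> compact G"
    unfolding frame_group_def
    by (auto simp: SO_mid_mult SO_mid_transpose SO_succ_mult SO_succ_transpose SO_mid_compact SO_succ_compact
      dest: SO_axis_mid SO_mid_SO_succ)
  then show "G \<subseteq> SO_succ" "SO_axis a \<subseteq> G" "\<And>A B. A \<in> G \<Longrightarrow> B \<in> G \<Longrightarrow> A ** B \<in> G"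
    "\<And>A. A \<in> G \<Longrightarrow> transpose A \<in> G" "mat 1 \<in> G" "compact G" using assms by blast+
qed

lemma frame_group_cases [simp]: "frame_group SO_mid" "frame_group SO_succ"
  by (auto simp: frame_group_def)

lemma balanced_class_orbit:
  assumes G: "frame_group G" and A: "A \<in> G" and f: "f \<in> long_knots a"
  shows "balanced_class a G (A, f) = orbit a (A, f)"
proof (intro equalityI subsetI)
  fix y assume "y \<in> balanced_class a G (A, f)"
  then obtain A' B where y: "A = A' ** B" "y = (A', rotate_knot B f)" "B \<in> SO_axis a" "A' \<in> G"
    unfolding balanced_class_def balanced_rel_def by blast
  have "B ** transpose B = mat 1" using y(3) SO_axis_mid SO_mid_SO_succ SO_succ_inverse(2) by blast
  then have "A' = A ** transpose B" using y(1) by (simp add: matrix_mul_assoc[symmetric])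
  then show "y \<in> orbit a (A, f)" using y by (auto simp: orbit_def)
next
  fix y assume "y \<in> orbit a (A, f)"
  then obtain B where B: "B \<in> SO_axis a" "y = (A ** transpose B, rotate_knot B f)" by (auto simp: orbit_def)
  have "transpose B ** B = mat 1" using B(1) SO_axis_mid SO_mid_SO_succ SO_succ_inverse(1) by blast
  then have "A = (A ** transpose B) ** B" by (simp add: matrix_mul_assoc[symmetric])
  moreover have "A ** transpose B \<in> G" using frame_group(2,3)[OF G] A SO_axis_transpose[OF B(1)] by blast
  ultimately show "y \<in> balanced_class a G (A, f)"
    using B f unfolding balanced_class_def balanced_rel_def by blast
qed

lemma orbit_self: "x \<in> orbit a x"
  unfolding orbit_def by (rule image_eqI[of _ _ "mat 1"]) (auto simp: mat1_SO_axis)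

lemma orbit_shift:
  assumes B: "B \<in> SO_axis a"
  shows "orbit a (A ** B, f) = orbit a (A, rotate_knot B f)"
proof -
  have BB: "B ** transpose B = mat 1" "transpose B ** B = mat 1" using SO_succ_inverse[OF SO_mid_SO_succ[OF SO_axis_mid[OF B]]] by auto
  have m: "C \<in> SO_mid" if "C \<in> SO_axis a" for C using SO_axis_mid[OF that] .
  show ?thesis
  proof (intro equalityI subsetI)
    fix y assume "y \<in> orbit a (A ** B, f)"
    then obtain C where C: "C \<in> SO_axis a" "y = (A ** B ** transpose C, rotate_knot C f)" by (auto simp: orbit_def)
    have "y = (A ** transpose (C ** transpose B), rotate_knot (C ** transpose B) (rotate_knot B f))"
      using C B m SO_axis_transpose[OF B] rotate_knot_cancel(1)[OF m[OF B], of f]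
      by (simp add: matrix_transpose_mul matrix_mul_assoc rotate_knot_mult)
    then show "y \<in> orbit a (A, rotate_knot B f)"
      using SO_axis_mult[OF C(1) SO_axis_transpose[OF B]] by (auto simp: orbit_def)
  next
    fix y assume "y \<in> orbit a (A, rotate_knot B f)"
    then obtain C where C: "C \<in> SO_axis a" "y = (A ** transpose C, rotate_knot C (rotate_knot B f))" by (auto simp: orbit_def)
    have "A ** B ** transpose (C ** B) = A ** (B ** transpose B) ** transpose C"
      by (simp add: matrix_transpose_mul matrix_mul_assoc)
    then have "y = (A ** B ** transpose (C ** B), rotate_knot (C ** B) f)"
      using C B m by (simp add: BB rotate_knot_mult)
    then show "y \<in> orbit a (A ** B, f)" using SO_axis_mult[OF C(1) B] by (auto simp: orbit_def)
  qed
qed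

lemma induced_orbit:
  assumes "\<And>B. B \<in> SO_axis a \<Longrightarrow> h (A ** transpose B, rotate_knot B f) = h (A, f)"
  shows "induced h (orbit a (A, f)) = h (A, f)"
  by (rule induced_eq[OF orbit_self]) (use assms in \<open>auto simp: orbit_def\<close>)

lemma topspace_balanced: "frame_group G \<Longrightarrow> topspace (balanced_product a G) = orbit a ` (G \<times> long_knots a)"
  unfolding balanced_product_def topspace_quotient_topology
  by (rule image_cong) (auto simp: balanced_class_orbit)

lemma balanced_quotient:
  assumes "frame_group G"
  shows "quotient_map (prod_topology (top_of_set G) (long_knot_space a)) (balanced_product a G) (orbit a)"
proof -
  have "balanced_product a G = quotient_topology (prod_topology (top_of_set G) (long_knot_space a)) (orbit a)"
    unfolding balanced_product_def by (rule quotient_topology_cong) (auto simp: balanced_class_orbit[OF assms])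
  then show ?thesis using quotient_map_quotient_topology by metis
qed

lemma continuous_map_induced_balanced:
  assumes G: "frame_group G"
    and inv: "\<And>A f B. A \<in> G \<Longrightarrow> f \<in> long_knots a \<Longrightarrow> B \<in> SO_axis a \<Longrightarrow> h (A ** transpose B, rotate_knot B f) = h (A, f)"
    and h: "continuous_map (prod_topology (top_of_set G) (long_knot_space a)) Y h"
  shows "continuous_map (balanced_product a G) Y (induced h)"
proof (rule continuous_compose_quotient_map[OF balanced_quotient[OF G]])
  show "continuous_map (prod_topology (top_of_set G) (long_knot_space a)) Y (induced h \<circ> orbit a)"
  proof (rule continuous_map_eq[OF h])
    fix x assume "x \<in> topspace (prod_topology (top_of_set G) (long_knot_space a))"
    then have "h (fst x ** transpose B, rotate_knot B (snd x)) = h (fst x, snd x)" if "B \<in> SO_axis a" for B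
      using inv[of "fst x" "snd x" B] that by auto
    from induced_orbit[of a h "fst x" "snd x", OF this]
    show "h x = (induced h \<circ> orbit a) x" by simp
  qed
qed

definition translate :: "'n::finite succ_matrix \<Rightarrow> 'n framed set \<Rightarrow> 'n framed set" where
  "translate M C = (\<lambda>x. (M ** fst x, snd x)) ` C"

lemma translate_orbit: "translate M (orbit a (A, f)) = orbit a (M ** A, f)"
  by (simp add: translate_def orbit_def image_image matrix_mul_assoc)

lemma translate_inverse: "M \<in> SO_succ \<Longrightarrow> translate (transpose M) (translate M C) = C"
  by (simp add: translate_def image_image matrix_mul_assoc SO_succ_inverse)

lemma locally_compact_group: "frame_group G \<Longrightarrow> locally_compact_space (top_of_set G)"
  by (rule compact_imp_locally_compact_space) (simp add: compact_space_subtopology frame_group)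

text \<open>The product of a quotient map with a locally compact Hausdorff space is a quotient map,
  and the group is compact. So continuity can be checked before passing to classes.\<close>
lemma translate_continuous:
  assumes G: "frame_group G"
  shows "continuous_map (prod_topology (top_of_set G) (balanced_product a G)) (balanced_product a G) (\<lambda>(M, C). translate M C)"
proof -
  let ?P = "prod_topology (top_of_set G) (long_knot_space a)"
  have q: "quotient_map (prod_topology (top_of_set G) ?P) (prod_topology (top_of_set G) (balanced_product a G)) (\<lambda>(x, y). (x, orbit a y))"
    by (rule quotient_map_prod_right[OF locally_compact_group[OF G] _ balanced_quotient[OF G]])
      (auto intro: Hausdorff_space_subtopology)
  have f: "continuous_map (prod_topology (top_of_set G) ?P) euclidean fst"
    by (rule continuous_map_into_fulltopology[OF continuous_map_fst])
  have g: "continuous_map (prod_topology (top_of_set G) ?P) (top_of_set G) (\<lambda>x. fst (snd x))"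
    using continuous_map_compose[OF continuous_map_snd continuous_map_fst, of "top_of_set G" "top_of_set G" "long_knot_space a"] by (simp add: o_def)
  have "continuous_map (prod_topology (top_of_set G) ?P) euclidean (\<lambda>x. fst x ** fst (snd x))"
    by (rule continuous_map_euclidean_binop[where h = "(**)", OF f continuous_map_into_fulltopology[OF g]])
      (intro continuous_on_matrix_mult continuous_intros)
  then have 1: "continuous_map (prod_topology (top_of_set G) ?P) (top_of_set G) (\<lambda>x. fst x ** fst (snd x))"
    using frame_group(3)[OF G] by (auto simp: continuous_map_in_subtopology)
  have 2: "continuous_map (prod_topology (top_of_set G) ?P) (long_knot_space a) (\<lambda>x. snd (snd x))"
    using continuous_map_compose[OF continuous_map_snd continuous_map_snd, of "top_of_set G" "top_of_set G" "long_knot_space a"] by (simp add: o_def)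
  have "continuous_map (prod_topology (top_of_set G) ?P) ?P (\<lambda>x. (fst x ** fst (snd x), snd (snd x)))"
    by (rule continuous_map_pairedI[OF 1 2])
  from continuous_map_compose[OF this quotient_imp_continuous_map[OF balanced_quotient[OF G]]]
  have c: "continuous_map (prod_topology (top_of_set G) ?P) (balanced_product a G) (\<lambda>x. orbit a (fst x ** fst (snd x), snd (snd x)))"
    by (simp add: o_def)
  show ?thesis
    by (rule continuous_compose_quotient_map[OF q], rule continuous_map_eq[OF c]) (auto simp: translate_orbit)
qed

text \<open>The orthonormal pair to which \<open>[A, f]\<close> lies: since \<open>A\<close> is
  determined up to rotations about the long axis, the images of \<open>pt_inf\<close> and of the axis
  under \<open>A\<close> are well defined.\<close>
definition frame_of :: "'n::finite \<Rightarrow> 'n framed set \<Rightarrow> (real^('n option)) \<times> (real^('n option))" where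
  "frame_of a = induced (\<lambda>(A, f). (A *v pt_inf, A *v axis_vec a))"

lemma frame_of_orbit: "frame_of a (orbit a (A, f)) = (A *v pt_inf, A *v axis_vec a)"
proof -
  have "induced (\<lambda>(A, f). (A *v pt_inf, A *v axis_vec a)) (orbit a (A, f)) = (\<lambda>(A, f). (A *v pt_inf, A *v axis_vec a)) (A, f)"
  proof (rule induced_orbit)
    fix B assume "B \<in> SO_axis a"
    from SO_axis_transpose[OF this]
    show "(\<lambda>(A, f). (A *v pt_inf, A *v axis_vec a)) (A ** transpose B, rotate_knot B f) = (\<lambda>(A, f). (A *v pt_inf, A *v axis_vec a)) (A, f)"
      unfolding SO_axis_iff prod.case matrix_vector_mul_assoc[symmetric] by simp
  qed
  then show ?thesis by (simp add: frame_of_def)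
qed

lemma frame_of_continuous:
  assumes G: "frame_group G" shows "continuous_map (balanced_product a G) euclidean (frame_of a)"
  unfolding frame_of_def
proof (rule continuous_map_induced_balanced[OF G])
  show "(\<lambda>(A, f). (A *v pt_inf, A *v axis_vec a)) (A ** transpose B, rotate_knot B f) = (\<lambda>(A, f). (A *v pt_inf, A *v axis_vec a)) (A, f)"
    if "B \<in> SO_axis a" for A f B
    using SO_axis_transpose[OF that] unfolding SO_axis_iff prod.case matrix_vector_mul_assoc[symmetric] by simp
  let ?P = "prod_topology (top_of_set G) (long_knot_space a)"
  have f: "continuous_map ?P euclidean fst"
    by (rule continuous_map_into_fulltopology[OF continuous_map_fst])
  have "continuous_map ?P euclidean (\<lambda>x. (fst x *v pt_inf, fst x *v axis_vec a))"
    by (rule continuous_map_euclidean_unop[where S = UNIV and h = "\<lambda>A. (A *v pt_inf, A *v axis_vec a)", OF f])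
      (auto intro!: continuous_on_Pair continuous_on_matrix_vector continuous_intros)
  then show "continuous_map ?P euclidean (\<lambda>(A, f). (A *v pt_inf, A *v axis_vec a))" by (simp add: case_prod_unfold)
qed

lemma induced_coset_orbit:
  assumes "H = SO_mid \<or> H = SO_axis a"
  shows "induced (\<lambda>(A, f). coset H A) (orbit a (A, f)) = coset H A"
proof -
  have H: "H \<subseteq> SO_succ" "SO_axis a \<subseteq> H"
    using assms SO_mid_subset SO_axis_subset[of a] by auto
  have HH: "A ** B \<in> H" "transpose A \<in> H" if "A \<in> H" "B \<in> H" for A B
    using assms that SO_mid_mult SO_mid_transpose SO_axis_mult SO_axis_transpose by auto
  have "induced (\<lambda>(A, f). coset H A) (orbit a (A, f)) = (\<lambda>(A, f). coset H A) (A, f)"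
  proof (rule induced_orbit)
    fix B assume "B \<in> SO_axis a"
    then have "transpose B \<in> H" using H SO_axis_transpose by blast
    then show "(\<lambda>(A, f). coset H A) (A ** transpose B, rotate_knot B f) = (\<lambda>(A, f). coset H A) (A, f)"
      using coset_mult[OF H(1) HH(1) HH(2)] by simp
  qed
  then show ?thesis by simp
qed

lemma induced_coset_continuous:
  assumes "H = SO_mid \<or> H = SO_axis a" and G: "frame_group G"
  shows "continuous_map (balanced_product a G) (coset_space G H) (induced (\<lambda>(A, f). coset H A))"
proof (rule continuous_compose_quotient_map[OF balanced_quotient[OF G]])
  let ?P = "prod_topology (top_of_set G) (long_knot_space a)"
  have "continuous_map ?P (coset_space G H) (\<lambda>x. coset H (fst x))"
    using continuous_map_compose[OF continuous_map_fst quotient_imp_continuous_map[OF coset_quotient]] by (simp add: o_def)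
  then show "continuous_map ?P (coset_space G H) (induced (\<lambda>(A, f). coset H A) \<circ> orbit a)"
    by (rule continuous_map_eq) (use induced_coset_orbit[OF assms(1)] in auto)
qed

text \<open>A class over the standard pair is \<open>[A, f]\<close> with \<open>A\<close> a rotation
  about the axis, hence equal to \<open>[1, A f]\<close>. The inverse map \<open>[A, f] \<mapsto> A
  f\<close> is continuous because the quotient map stays one over the closed set of these
  classes.\<close>
lemma balanced_fibre:
  assumes G: "frame_group G"
  shows "homeomorphic_map (long_knot_space a)
     (subtopology (balanced_product a G) {e \<in> topspace (balanced_product a G). frame_of a e = (pt_inf, axis_vec a)})
     (\<lambda>f. balanced_class a G (mat 1, f))"
proof -
  let ?K = "long_knot_space a" and ?Q = "balanced_product a G"
  let ?V = "{e \<in> topspace ?Q. frame_of a e = (pt_inf, axis_vec a)}"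
  let ?P = "prod_topology (top_of_set G) ?K"
  have one: "mat 1 \<in> G" by (rule frame_group(5)[OF G])
  have bc: "balanced_class a G (mat 1, f) = orbit a (mat 1, f)" if "f \<in> long_knots a" for f
    by (rule balanced_class_orbit[OF G one that])
  have qc: "continuous_map ?P ?Q (orbit a)" by (rule quotient_imp_continuous_map[OF balanced_quotient[OF G]])
  have "continuous_map ?K ?P (\<lambda>f. (mat 1, f))"
    using one by (intro continuous_map_pairedI continuous_map_id[unfolded id_def]) auto
  from continuous_map_compose[OF this qc]
  have "continuous_map ?K ?Q (\<lambda>f. orbit a (mat 1, f))" by (simp add: o_def)
  then have "continuous_map ?K (subtopology ?Q ?V) (\<lambda>f. orbit a (mat 1, f))"
    using one by (auto simp: continuous_map_in_subtopology topspace_balanced[OF G] frame_of_orbit)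
  then have ic: "continuous_map ?K (subtopology ?Q ?V) (\<lambda>f. balanced_class a G (mat 1, f))"
    by (rule continuous_map_eq) (simp add: bc)
  have cl: "closedin ?Q ?V"
    using closedin_continuous_map_preimage[OF frame_of_continuous[OF G], of "{(pt_inf, axis_vec a)}"] by simp
  have U: "{x \<in> topspace ?P. orbit a x \<in> ?V} = SO_axis a \<times> long_knots a"
  proof -
    have "frame_of a (orbit a (A, f)) = (pt_inf, axis_vec a) \<longleftrightarrow> A \<in> SO_axis a" if "A \<in> G" for A f
      using that frame_group(1)[OF G] by (auto simp: frame_of_orbit SO_axis_iff)
    then show ?thesis using frame_group(2)[OF G, of a] by (auto simp: topspace_balanced[OF G])
  qed
  have q: "quotient_map (subtopology ?P (SO_axis a \<times> long_knots a)) (subtopology ?Q ?V) (orbit a)"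
    by (rule quotient_map_restriction[OF balanced_quotient[OF G] U]) (use cl in simp)
  have P: "subtopology ?P (SO_axis a \<times> long_knots a) = prod_topology (top_of_set (SO_axis a)) ?K"
    using frame_group(2)[OF G, of a] subtopology_topspace[of ?K]
    by (simp add: subtopology_Times subtopology_subtopology inf_absorb2)
  define j :: "'a framed set \<Rightarrow> real \<Rightarrow> real^'a" where "j = induced (\<lambda>(A, f). rotate_knot A f)"
  have jo: "j (orbit a (A, f)) = rotate_knot A f" if A: "A \<in> SO_axis a" for A f
  proof -
    have "induced (\<lambda>(A, f). rotate_knot A f) (orbit a (A, f)) = (\<lambda>(A, f). rotate_knot A f) (A, f)"
    proof (rule induced_orbit)
      fix B assume B: "B \<in> SO_axis a"
      note m = SO_axis_mid[OF A] SO_axis_mid[OF B]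
      show "(\<lambda>(A, f). rotate_knot A f) (A ** transpose B, rotate_knot B f) = (\<lambda>(A, f). rotate_knot A f) (A, f)"
        by (simp add: rotate_knot_mult[OF m(1) SO_mid_transpose[OF m(2)]] rotate_knot_cancel[OF m(2)])
    qed
    then show ?thesis by (simp add: j_def)
  qed
  have jc: "continuous_map (subtopology ?Q ?V) ?K j"
  proof (rule continuous_compose_quotient_map[OF q])
    show "continuous_map (subtopology ?P (SO_axis a \<times> long_knots a)) ?K (j \<circ> orbit a)"
      unfolding P by (rule continuous_map_eq[OF rotate_knot_continuous]) (auto simp: jo)
  qed
  have "homeomorphic_maps ?K (subtopology ?Q ?V) (\<lambda>f. balanced_class a G (mat 1, f)) j"
    unfolding homeomorphic_maps_def
  proof (intro conjI ballI ic jc)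
    show "j (balanced_class a G (mat 1, f)) = f" if "f \<in> topspace ?K" for f
      using that by (simp add: bc jo mat1_SO_axis)
    fix e assume "e \<in> topspace (subtopology ?Q ?V)"
    then obtain A f where e: "e = orbit a (A, f)" "A \<in> SO_axis a" "f \<in> long_knots a"
      using U by (auto simp: topspace_balanced[OF G])
    have "balanced_class a G (mat 1, rotate_knot A f) = orbit a (mat 1 ** A, f)"
      unfolding orbit_shift[OF e(2)] by (rule bc[OF rotate_knot_mem[OF e(2,3)]])
    then show "balanced_class a G (mat 1, j e) = e" by (simp add: e jo)
  qed
  then show ?thesis using homeomorphic_map_maps by blast
qed

text \<open>The condition on the frame is closed, and a quotient map restricts to a quotient map
  over a closed set; the two topologies are therefore quotients of the same space by the same
  map.\<close>
lemma balanced_mid_subtopology: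
  "subtopology (balanced_product a SO_succ) {e \<in> topspace (balanced_product a SO_succ). fst (frame_of a e) = pt_inf} = balanced_product a SO_mid"
proof -
  let ?K = "long_knot_space a" and ?Q = "balanced_product a SO_succ"
  let ?V = "{e \<in> topspace ?Q. fst (frame_of a e) = pt_inf}"
  let ?P = "prod_topology (top_of_set SO_succ) ?K"
  have "continuous_map ?Q euclidean (\<lambda>e. fst (frame_of a e))"
    by (rule continuous_map_euclidean_unop[where S = UNIV and h = fst, OF frame_of_continuous]) (auto intro: continuous_intros)
  from closedin_continuous_map_preimage[OF this, of "{pt_inf}"] have cl: "closedin ?Q ?V" by simp
  have U: "{x \<in> topspace ?P. orbit a x \<in> ?V} = SO_mid \<times> long_knots a"
    by (auto simp: topspace_balanced frame_of_orbit SO_mid_def)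
  have q: "quotient_map (subtopology ?P (SO_mid \<times> long_knots a)) (subtopology ?Q ?V) (orbit a)"
    by (rule quotient_map_restriction[OF balanced_quotient U]) (use cl in simp_all)
  have P: "subtopology ?P (SO_mid \<times> long_knots a) = prod_topology (top_of_set SO_mid) ?K"
    using subtopology_topspace[of ?K] by (simp add: subtopology_Times subtopology_subtopology inf_absorb2[OF SO_mid_subset])
  from quotient_topology_unique[OF q[unfolded P]] quotient_topology_unique[OF balanced_quotient[of SO_mid a]]
  show ?thesis by simp
qed

section \<open>The bundles over cosets and over the sphere\<close>

lemma rotate_embedding_1: "g \<in> extensional unit_sphere \<Longrightarrow> rotate_embedding (mat 1) g = g"
  by (auto simp: rotate_embedding_def fun_eq_iff extensional_def)

lemma rotate_embedding_inverse:
  assumes "A \<in> SO_succ" "g \<in> circle_embeddings"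
  shows "rotate_embedding (transpose A) (rotate_embedding A g) = g" "rotate_embedding A (rotate_embedding (transpose A) g) = g"
  using rotate_embedding_1[OF circle_embeddingD(1)[OF assms(2)]]
  by (simp_all add: rotate_embedding_mult[symmetric] SO_succ_inverse[OF assms(1)])

lemma continuous_map_eval: "continuous_map Emb euclidean (\<lambda>g. g pt_inf)"
proof -
  have s: "joint_smooth Emb (topspace Emb \<times> UNIV) (\<lambda>g t. g (circle_point t))"
    using continuous_map_EmbD[OF continuous_map_id[of Emb]] by simp
  have 1: "continuous_map Emb (prod_topology Emb euclidean) (\<lambda>g. (g, 0::real))"
    by (intro continuous_map_pairedI continuous_map_id[unfolded id_def]) auto
  show ?thesis using continuous_map_compose[OF 1 joint_smooth_imp_continuous_whole[OF s]] by (simp add: o_def)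
qed

text \<open>The form of \<open>point_section\<close> that \<open>equivariant_bundle\<close> asks
  for.\<close>
lemma sphere_sections:
  fixes b :: "real^('n::finite option)"
  assumes "norm b = 1"
  shows "\<exists>U \<sigma>. openin (top_of_set unit_sphere) U \<and> b \<in> U \<and>
     continuous_map (subtopology (top_of_set unit_sphere) U) (top_of_set SO_succ) \<sigma> \<and> (\<forall>u\<in>U. \<sigma> u *v pt_inf = u)"
proof -
  obtain W \<sigma> where W: "open W" "b \<in> W" "continuous_on W \<sigma>"
    "\<And>v. v \<in> W \<Longrightarrow> norm v = 1 \<Longrightarrow> \<sigma> v \<in> SO_succ \<and> \<sigma> v *v pt_inf = v" using point_section[OF assms] by blast
  have "continuous_map (subtopology (top_of_set unit_sphere) (unit_sphere \<inter> W)) (top_of_set SO_succ) \<sigma>"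
    using W(3,4) by (auto simp: subtopology_subtopology continuous_map_in_subtopology intro: continuous_on_subset)
  then show ?thesis using W assms by (intro exI[of _ "unit_sphere \<inter> W"] exI[of _ \<sigma>]) (auto intro: openin_open_Int)
qed

text \<open>\<open>SO(n+1)\<close> acts on embeddings by rotation, and evaluation at the base-point
  is equivariant.\<close>
lemma Emb_bundle:
  "bundle_sequence (Emb_pt :: (real^(1 option) \<Rightarrow> real^('n::finite option)) topology) id Emb (\<lambda>g. g pt_inf)
     (top_of_set unit_sphere) pt_inf"
proof (rule equivariant_bundle[where H = SO_succ and act = rotate_embedding and actB = "(*v)"])
  show "continuous_map (prod_topology (top_of_set SO_succ) Emb) Emb (\<lambda>(A, e). rotate_embedding A (e :: _ \<Rightarrow> real^('n option)))"
    by (rule rotate_embedding_continuous(1))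
  show "continuous_map Emb (top_of_set unit_sphere) (\<lambda>g :: _ \<Rightarrow> real^('n option). g pt_inf)"
    by (auto simp: continuous_map_in_subtopology continuous_map_eval circle_embeddingD(4))
  show "\<exists>U \<sigma>. openin (top_of_set unit_sphere) U \<and> b \<in> U \<and>
       continuous_map (subtopology (top_of_set unit_sphere) U) (top_of_set SO_succ) \<sigma> \<and> (\<forall>u\<in>U. \<sigma> u *v pt_inf = u)"
    if "b \<in> topspace (top_of_set unit_sphere)" for b :: "real^('n option)"
    using sphere_sections[of b] that by simp
  have "{e \<in> topspace Emb. e pt_inf = pt_inf} = (pointed_embeddings :: (_ \<Rightarrow> real^('n option)) set)"
    by (auto simp: pointed_embeddings_def)
  then show "homeomorphic_map (Emb_pt :: (_ \<Rightarrow> real^('n option)) topology) (subtopology Emb {e \<in> topspace Emb. e pt_inf = pt_inf}) id"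
    unfolding Emb_pt_def by (simp only: homeomorphic_map_id)
  show "rotate_embedding (transpose A) (rotate_embedding A e) = e" if "A \<in> SO_succ" "e \<in> topspace Emb"
    for A :: "'n succ_matrix" and e
    using that by (simp add: rotate_embedding_inverse)
  show "rotate_embedding A e pt_inf = A *v e pt_inf" for A :: "'n succ_matrix" and e by (simp add: rotate_embedding_def)
  show "transpose A *v (A *v b) = b" if "A \<in> SO_succ" for A :: "'n succ_matrix" and b by (rule SO_succ_cancel(1)[OF that])
qed (simp_all add: SO_succ_transpose)

definition coset_act :: "'n::finite succ_matrix \<Rightarrow> 'n succ_matrix set \<Rightarrow> 'n succ_matrix set" where
  "coset_act M C = (\<lambda>A. M ** A) ` C"

lemma coset_act_coset: "coset_act M (coset H A) = coset H (M ** A)"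
  by (simp add: coset_act_def coset_def image_image matrix_mul_assoc)

lemma coset_act_inverse: "M \<in> SO_succ \<Longrightarrow> coset_act (transpose M) (coset_act M C) = C"
  by (simp add: coset_act_def image_image matrix_mul_assoc SO_succ_inverse)

text \<open>Left translation makes the projection equivariant. The sections over the sphere are
  transported through the homeomorphism with the coset space.\<close>
lemma balanced_bundle_sphere:
  "bundle_sequence (balanced_product a SO_mid) id (balanced_product a SO_succ) (induced (\<lambda>(A, f). coset SO_mid A))
       (coset_space SO_succ SO_mid) (coset SO_mid (mat 1))"
proof (rule equivariant_bundle[where H = SO_succ and act = translate and actB = coset_act])
  let ?p = "induced (\<lambda>(A, f). coset SO_mid A)"
  show "continuous_map (prod_topology (top_of_set SO_succ) (balanced_product a SO_succ)) (balanced_product a SO_succ) (\<lambda>(A, e). translate A e)"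
    by (rule translate_continuous) simp
  show "continuous_map (balanced_product a SO_succ) (coset_space SO_succ SO_mid) ?p"
    by (rule induced_coset_continuous) auto
  show "?p (translate A e) = coset_act A (?p e)" if "A \<in> SO_succ" "e \<in> topspace (balanced_product a SO_succ)" for A e
    using that by (auto simp: topspace_balanced translate_orbit induced_coset_orbit coset_act_coset)
  show "\<exists>U \<sigma>. openin (coset_space SO_succ SO_mid) U \<and> b \<in> U \<and>
       continuous_map (subtopology (coset_space SO_succ SO_mid) U) (top_of_set SO_succ) \<sigma> \<and> (\<forall>u\<in>U. coset_act (\<sigma> u) (coset SO_mid (mat 1)) = u)"
    if b: "b \<in> topspace (coset_space SO_succ SO_mid)" for b :: "'a succ_matrix set"
  proof -
    \<comment> \<open>The coset is recovered from the image of \<open>pt_inf\<close>, so sections over the sphere are sections over the coset space.\<close>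
    let ?ev = "induced (\<lambda>A :: 'a succ_matrix. A *v pt_inf)"
    have ev: "continuous_map (coset_space SO_succ SO_mid) (top_of_set unit_sphere) ?ev"
      by (rule homeomorphic_imp_continuous_map[OF coset_mid_homeomorphic_sphere])
    have "norm (?ev b) = 1" using b by (auto simp: induced_mid_pt_inf SO_succ_norm)
    then obtain U \<sigma> where U: "openin (top_of_set unit_sphere) U" "?ev b \<in> U"
      "continuous_map (subtopology (top_of_set unit_sphere) U) (top_of_set SO_succ) \<sigma>" "\<forall>u\<in>U. \<sigma> u *v pt_inf = u"
      using sphere_sections by blast
    let ?V = "{C \<in> topspace (coset_space SO_succ SO_mid). ?ev C \<in> U}"
    have o: "openin (coset_space SO_succ SO_mid) ?V" by (rule openin_continuous_map_preimage[OF ev U(1)])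
    have "continuous_map (subtopology (coset_space SO_succ SO_mid) ?V) (subtopology (top_of_set unit_sphere) U) ?ev"
      using continuous_map_from_subtopology[OF ev] by (auto simp: continuous_map_in_subtopology)
    from continuous_map_compose[OF this U(3)]
    have c: "continuous_map (subtopology (coset_space SO_succ SO_mid) ?V) (top_of_set SO_succ) (\<lambda>C. \<sigma> (?ev C))" by (simp add: o_def)
    have "coset_act (\<sigma> (?ev C)) (coset SO_mid (mat 1)) = C" if C: "C \<in> ?V" for C
    proof -
      obtain A where A: "A \<in> SO_succ" "C = coset SO_mid A" using C by auto
      have "\<sigma> (?ev C) \<in> SO_succ" using continuous_map_image_subset_topspace[OF c] C by auto
      moreover have "\<sigma> (?ev C) *v pt_inf = A *v pt_inf" using U(4) C by (simp add: A induced_mid_pt_inf)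
      ultimately have "coset SO_mid (\<sigma> (?ev C)) = coset SO_mid A" using coset_mid_eq_iff A(1) by blast
      then show ?thesis by (simp add: coset_act_coset A(2))
    qed
    then show ?thesis using o c U(2) b by (intro exI[of _ ?V] exI[of _ "\<lambda>C. \<sigma> (?ev C)"]) simp
  qed
  have "{e \<in> topspace (balanced_product a SO_succ). ?p e = coset SO_mid (mat 1)} =
      {e \<in> topspace (balanced_product a SO_succ). fst (frame_of a e) = pt_inf}"
  proof (rule Collect_cong, rule conj_cong[OF refl])
    fix e assume "e \<in> topspace (balanced_product a SO_succ)"
    then obtain A f where e: "e = orbit a (A, f)" "A \<in> SO_succ" by (auto simp: topspace_balanced)
    have "?p e = coset SO_mid A" unfolding e(1) by (rule induced_coset_orbit) simp
    then show "(?p e = coset SO_mid (mat 1)) = (fst (frame_of a e) = pt_inf)"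
      using coset_mid_eq_iff[OF e(2) SO_succ_one] by (simp add: e(1) frame_of_orbit)
  qed
  then show "homeomorphic_map (balanced_product a SO_mid)
      (subtopology (balanced_product a SO_succ) {e \<in> topspace (balanced_product a SO_succ). ?p e = coset SO_mid (mat 1)}) id"
    by (simp only: balanced_mid_subtopology homeomorphic_map_id)
qed (auto simp: SO_succ_transpose translate_inverse coset_act_inverse)

text \<open>Pulls the local sections back along a map \<open>ev\<close> to orthonormal pairs; it
  serves for the coset spaces, for \<open>Emb\<close> and for the sphere of directions.\<close>
lemma frame_section_continuous:
  fixes ev :: "'b \<Rightarrow> (real^('n::finite option)) \<times> (real^('n option))"
  assumes ev: "continuous_map B euclidean ev"
    and on: "\<And>u. u \<in> topspace B \<Longrightarrow> norm (fst (ev u)) = 1 \<and> norm (snd (ev u)) = 1 \<and> fst (ev u) \<bullet> snd (ev u) = 0"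
    and b: "b \<in> topspace B" and A0: "A0 \<in> SO_succ" "ev b = (A0 *v pt_inf, A0 *v axis_vec a)"
  obtains U \<sigma> where "openin B U" "b \<in> U" "continuous_map (subtopology B U) (top_of_set SO_succ) \<sigma>"
    "\<And>u. u \<in> U \<Longrightarrow> \<sigma> u \<in> SO_succ \<and> \<sigma> u *v pt_inf = fst (ev u) \<and> \<sigma> u *v axis_vec a = snd (ev u)"
proof -
  obtain W s where W: "open W" "(A0 *v pt_inf, A0 *v axis_vec a) \<in> W" "continuous_on W s"
    "\<And>v w. (v, w) \<in> W \<Longrightarrow> norm v = 1 \<Longrightarrow> norm w = 1 \<Longrightarrow> v \<bullet> w = 0 \<Longrightarrow>
       s (v, w) \<in> SO_succ \<and> s (v, w) *v pt_inf = v \<and> s (v, w) *v axis_vec a = w"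
    using frame_section[OF A0(1), of a] by blast
  let ?U = "{u \<in> topspace B. ev u \<in> W}"
  have o: "openin B ?U" using openin_continuous_map_preimage[OF ev, of W] W(1) by simp
  have f: "s (ev u) \<in> SO_succ \<and> s (ev u) *v pt_inf = fst (ev u) \<and> s (ev u) *v axis_vec a = snd (ev u)" if u: "u \<in> ?U" for u
    using W(4)[of "fst (ev u)" "snd (ev u)"] on[of u] u by simp
  have c0: "continuous_map (subtopology B ?U) euclidean ev" by (rule continuous_map_from_subtopology[OF ev])
  have "continuous_map (subtopology B ?U) euclidean (\<lambda>u. s (ev u))"
    by (rule continuous_map_euclidean_unop[OF c0 W(3)]) auto
  then have "continuous_map (subtopology B ?U) (top_of_set SO_succ) (\<lambda>u. s (ev u))"
    using f by (auto simp: continuous_map_in_subtopology)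
  then show ?thesis using that[OF o _ _ f] b A0(2) W(2) by simp
qed

lemma coset_axis_frame:
  assumes G: "G \<subseteq> SO_succ"
  shows "continuous_map (coset_space G (SO_axis a)) euclidean (induced (\<lambda>A. (A *v pt_inf, A *v axis_vec a)))"
    "induced (\<lambda>A. (A *v pt_inf, A *v axis_vec a)) (coset (SO_axis a) A) = (A *v pt_inf, A *v axis_vec a)"
proof -
  have i: "(\<lambda>A. (A *v pt_inf, A *v axis_vec a)) (A ** B) = (\<lambda>A. (A *v pt_inf, A *v axis_vec a)) A" if "B \<in> SO_axis a" for A B
    using that by (simp add: matrix_vector_mul_assoc[symmetric] SO_axis_iff)
  show "continuous_map (coset_space G (SO_axis a)) euclidean (induced (\<lambda>A. (A *v pt_inf, A *v axis_vec a)))"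
    by (rule continuous_map_induced_coset[OF mat1_SO_axis], rule i)
      (auto intro!: continuous_on_Pair continuous_on_matrix_vector continuous_intros)
  show "induced (\<lambda>A. (A *v pt_inf, A *v axis_vec a)) (coset (SO_axis a) A) = (A *v pt_inf, A *v axis_vec a)"
    by (rule induced_coset[OF mat1_SO_axis, of a "\<lambda>A. (A *v pt_inf, A *v axis_vec a)"]) (rule i)
qed

text \<open>As for the sphere, with orthonormal pairs in place of points.\<close>
lemma balanced_bundle_frames:
  "bundle_sequence (long_knot_space a) (\<lambda>f. balanced_class a SO_succ (mat 1, f))
       (balanced_product a SO_succ) (induced (\<lambda>(A, f). coset (SO_axis a) A))
       (coset_space SO_succ (SO_axis a)) (coset (SO_axis a) (mat 1))"
proof (rule equivariant_bundle[where H = SO_succ and act = translate and actB = coset_act])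
  let ?p = "induced (\<lambda>(A, f). coset (SO_axis a) A)" and ?B = "coset_space SO_succ (SO_axis a)"
  show "continuous_map (prod_topology (top_of_set SO_succ) (balanced_product a SO_succ)) (balanced_product a SO_succ) (\<lambda>(A, e). translate A e)"
    by (rule translate_continuous) simp
  show "continuous_map (balanced_product a SO_succ) ?B ?p"
    by (rule induced_coset_continuous) auto
  show "?p (translate A e) = coset_act A (?p e)" if "A \<in> SO_succ" "e \<in> topspace (balanced_product a SO_succ)" for A e
    using that by (auto simp: topspace_balanced translate_orbit induced_coset_orbit coset_act_coset)
  show "\<exists>U \<sigma>. openin ?B U \<and> b \<in> U \<and>
       continuous_map (subtopology ?B U) (top_of_set SO_succ) \<sigma> \<and> (\<forall>u\<in>U. coset_act (\<sigma> u) (coset (SO_axis a) (mat 1)) = u)"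
    if b: "b \<in> topspace ?B" for b
  proof -
    let ?ev = "induced (\<lambda>A. (A *v pt_inf, A *v axis_vec a))"
    note ev = coset_axis_frame[of SO_succ a, OF subset_refl]
    obtain A0 where A0: "A0 \<in> SO_succ" "b = coset (SO_axis a) A0" using b by auto
    obtain U \<sigma> where U: "openin ?B U" "b \<in> U" "continuous_map (subtopology ?B U) (top_of_set SO_succ) \<sigma>"
      "\<And>u. u \<in> U \<Longrightarrow> \<sigma> u \<in> SO_succ \<and> \<sigma> u *v pt_inf = fst (?ev u) \<and> \<sigma> u *v axis_vec a = snd (?ev u)"
    proof (rule frame_section_continuous[OF ev(1) _ b A0(1)])
      show "norm (fst (?ev u)) = 1 \<and> norm (snd (?ev u)) = 1 \<and> fst (?ev u) \<bullet> snd (?ev u) = 0" if "u \<in> topspace ?B" for u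
        using that by (auto simp: ev(2) SO_succ_norm SO_succ_inner)
      show "?ev b = (A0 *v pt_inf, A0 *v axis_vec a)" by (simp add: A0 ev(2))
    qed blast
    have "coset_act (\<sigma> u) (coset (SO_axis a) (mat 1)) = u" if u: "u \<in> U" for u
    proof -
      obtain A where A: "A \<in> SO_succ" "u = coset (SO_axis a) A" using u openin_subset[OF U(1)] by auto
      have "coset (SO_axis a) (\<sigma> u) = coset (SO_axis a) A"
        using U(4)[OF u] coset_axis_eq_iff[of "\<sigma> u" A a] A(1) by (simp add: A(2) ev(2))
      then show ?thesis by (simp add: coset_act_coset A(2))
    qed
    then show ?thesis using U by blast
  qed
  have "{e \<in> topspace (balanced_product a SO_succ). ?p e = coset (SO_axis a) (mat 1)} =
      {e \<in> topspace (balanced_product a SO_succ). frame_of a e = (pt_inf, axis_vec a)}"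
  proof (rule Collect_cong, rule conj_cong[OF refl])
    fix e assume "e \<in> topspace (balanced_product a SO_succ)"
    then obtain A f where e: "e = orbit a (A, f)" "A \<in> SO_succ" by (auto simp: topspace_balanced)
    have "?p e = coset (SO_axis a) A" unfolding e(1) by (rule induced_coset_orbit) simp
    then show "(?p e = coset (SO_axis a) (mat 1)) = (frame_of a e = (pt_inf, axis_vec a))"
      using coset_axis_eq_iff[OF e(2) SO_succ_one, of a] by (simp add: e(1) frame_of_orbit)
  qed
  then show "homeomorphic_map (long_knot_space a)
      (subtopology (balanced_product a SO_succ) {e \<in> topspace (balanced_product a SO_succ). ?p e = coset (SO_axis a) (mat 1)})
      (\<lambda>f. balanced_class a SO_succ (mat 1, f))"
    using balanced_fibre[of SO_succ a] by simp
  show "coset (SO_axis a) (mat 1) \<in> topspace ?B" by (simp add: imageI)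
qed (simp_all add: SO_succ_transpose translate_inverse coset_act_inverse)

section \<open>The comparison map\<close>

definition frame_at :: "(real^(1 option) \<Rightarrow> real^('n::finite option)) \<Rightarrow> (real^('n option)) \<times> (real^('n option))" where
  "frame_at g = (g pt_inf, sgn (velocity g))"

definition framing :: "'n::finite \<Rightarrow> 'n succ_matrix \<Rightarrow> (real^(1 option) \<Rightarrow> real^('n option)) \<Rightarrow> bool" where
  "framing a A g \<longleftrightarrow> A \<in> SO_succ \<and> (A *v pt_inf, A *v axis_vec a) = frame_at g"

lemma frame_at_orthonormal:
  assumes "g \<in> circle_embeddings"
  shows "norm (fst (frame_at g)) = 1 \<and> norm (snd (frame_at g)) = 1 \<and> fst (frame_at g) \<bullet> snd (frame_at g) = 0"
proof (intro conjI)
  show "norm (fst (frame_at g)) = 1" using circle_embeddingD(4)[OF assms, of pt_inf] by (simp add: frame_at_def)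
  show "norm (snd (frame_at g)) = 1" using velocity_nonzero[OF assms] by (simp add: frame_at_def norm_sgn)
  show "fst (frame_at g) \<bullet> snd (frame_at g) = 0"
    using velocity_tangent[OF assms] by (simp add: frame_at_def sgn_div_norm)
qed

lemma frame_at_continuous: "continuous_map (Emb :: (_ \<Rightarrow> real^('n::finite option)) topology) euclidean frame_at"
proof -
  have "continuous_map (Emb :: (_ \<Rightarrow> real^('n option)) topology) euclidean (\<lambda>g. sgn (velocity g))"
  proof (rule continuous_map_euclidean_unop[OF continuous_map_velocity])
    show "continuous_on (-{0}) (sgn :: real^('n option) \<Rightarrow> _)" by (rule continuous_on_sgn[OF continuous_on_id]) simp
    show "velocity ` topspace (Emb :: (_ \<Rightarrow> real^('n option)) topology) \<subseteq> -{0}"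
      using velocity_nonzero by fastforce
  qed
  then have "continuous_map (Emb :: (_ \<Rightarrow> real^('n option)) topology) euclidean (\<lambda>g. (g pt_inf, sgn (velocity g)))"
    by (rule continuous_map_euclidean_binop[OF continuous_map_eval, where h = Pair]) simp
  then show ?thesis by (simp add: frame_at_def[abs_def])
qed

text \<open>Here \<open>n \<ge> 2\<close> enters: for \<open>n = 1\<close> no rotation reverses the
  long axis while fixing \<open>pt_inf\<close>.\<close>
lemma framing_exists:
  assumes "CARD('n::finite) \<ge> 2" "(g :: real^(1 option) \<Rightarrow> real^('n option)) \<in> circle_embeddings"
  shows "\<exists>A. framing a A g"
proof -
  note o = frame_at_orthonormal[OF assms(2)]
  obtain A where "A \<in> SO_succ" "A *v pt_inf = fst (frame_at g)" "A *v axis_vec a = snd (frame_at g)"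
    using SO_succ_frame_transitive[OF assms(1), of "fst (frame_at g)" "snd (frame_at g)" a] o by blast
  then show ?thesis unfolding framing_def by auto
qed

text \<open>Undoing a framing moves an embedding into \<open>P\<close>.\<close>
lemma framing_axis:
  assumes "framing a A g" "g \<in> circle_embeddings"
  shows "rotate_embedding (transpose A) g \<in> axis_embeddings a"
proof -
  have A: "A \<in> SO_succ" "A *v pt_inf = g pt_inf" "A *v axis_vec a = sgn (velocity g)"
    using assms(1) by (auto simp: framing_def frame_at_def)
  have At: "transpose A \<in> SO_succ" by (rule SO_succ_transpose[OF A(1)])
  have "velocity g = norm (velocity g) *\<^sub>R (A *v axis_vec a)" using velocity_nonzero[OF assms(2)] by (simp add: A sgn_div_norm)
  from arg_cong[OF this, of "(*v) (transpose A)"]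
  have "transpose A *v velocity g = norm (velocity g) *\<^sub>R (transpose A *v (A *v axis_vec a))"
    by (simp only: matrix_vector_mult_scaleR)
  then have v: "velocity (rotate_embedding (transpose A) g) = norm (velocity g) *\<^sub>R axis_vec a"
    using velocity_rotate[OF assms(2)] SO_succ_cancel(1)[OF A(1)] by simp
  have "transpose A *v g pt_inf = pt_inf" using SO_succ_cancel(1)[OF A(1), of pt_inf] A(2) by simp
  then have "rotate_embedding (transpose A) g pt_inf = pt_inf" by (simp only: rotate_embedding_def) simp
  then show ?thesis using v rotate_embedding_continuous(2)[OF At assms(2)]
    by (simp add: axis_embeddings_def pointed_embeddings_def)
qed

lemma framing_rotate:
  assumes A: "A \<in> SO_succ" and g: "g \<in> axis_embeddings a"
  shows "frame_at (rotate_embedding A g) = (A *v pt_inf, A *v axis_vec a)" "framing a A (rotate_embedding A g)"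
proof -
  have c: "g \<in> circle_embeddings" by (rule axis_embeddings_circle[OF g])
  have v: "velocity g = norm (velocity g) *\<^sub>R axis_vec a" using g by (simp add: axis_embeddings_def)
  have "velocity (rotate_embedding A g) = norm (velocity g) *\<^sub>R (A *v axis_vec a)"
    unfolding velocity_rotate[OF c] by (subst v) (simp add: matrix_vector_mult_scaleR)
  then have "sgn (velocity (rotate_embedding A g)) = A *v axis_vec a"
    using velocity_nonzero[OF c] by (simp add: sgn_div_norm SO_succ_norm[OF A])
  then show 1: "frame_at (rotate_embedding A g) = (A *v pt_inf, A *v axis_vec a)"
    by (simp add: frame_at_def) (simp add: rotate_embedding_def axis_embeddings_pt_inf[OF g])
  show "framing a A (rotate_embedding A g)" using A 1 by (simp add: framing_def)
qed

lemma framing_unique: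
  assumes "framing a A g" "framing a A' g"
  obtains B where "B \<in> SO_axis a" "A' = A ** B"
proof (rule that[of "transpose A ** A'"])
  have A: "A \<in> SO_succ" "A' \<in> SO_succ" "A' *v pt_inf = A *v pt_inf" "A' *v axis_vec a = A *v axis_vec a"
    using assms by (auto simp: framing_def frame_at_def)
  show "transpose A ** A' \<in> SO_axis a"
    unfolding SO_axis_iff matrix_vector_mul_assoc[symmetric] A(3,4)
    using A SO_succ_cancel(1)[OF A(1)] by (auto simp: SO_succ_mult SO_succ_transpose)
  show "A' = A ** (transpose A ** A')" by (simp add: matrix_mul_assoc SO_succ_inverse(2)[OF A(1)])
qed

text \<open>The choice does not depend continuously on \<open>g\<close>; it is used only in
  expressions whose value is the same for all framings.\<close>
definition some_framing :: "'n::finite \<Rightarrow> (real^(1 option) \<Rightarrow> real^('n option)) \<Rightarrow> 'n succ_matrix" where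
  "some_framing a g = (SOME A. framing a A g)"

text \<open>If an expression depends continuously on \<open>x\<close> and a framing, and its value
  is the same for all framings, then it depends continuously on \<open>x\<close>: framings can be
  chosen continuously near any given \<open>x\<close>.\<close>
lemma framing_descent:
  fixes F :: "'x \<Rightarrow> real^(1 option) \<Rightarrow> real^('n::finite option)" and a :: 'n
  assumes n: "CARD('n) \<ge> 2" and F: "continuous_map X Emb F"
    and \<Phi>: "continuous_map (subtopology (prod_topology (top_of_set SO_succ) X) {(A, x). framing a A (F x)}) Y \<Phi>"
    and \<phi>: "\<And>x A. x \<in> topspace X \<Longrightarrow> framing a A (F x) \<Longrightarrow> \<phi> x = \<Phi> (A, x)"
  shows "continuous_map X Y \<phi>"
proof -
  have Fm: "F x \<in> circle_embeddings" if "x \<in> topspace X" for x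
    using continuous_map_image_subset_topspace[OF F] that by auto
  have ev: "continuous_map X euclidean (\<lambda>x. frame_at (F x))"
    using continuous_map_compose[OF F frame_at_continuous] by (simp add: o_def)
  have "\<exists>U. openin X U \<and> b \<in> U \<and> continuous_map (subtopology X U) Y \<phi>" if b: "b \<in> topspace X" for b
  proof -
    obtain A0 where A0: "framing a A0 (F b)" using framing_exists[OF n Fm[OF b]] by blast
    then have "A0 \<in> SO_succ" "frame_at (F b) = (A0 *v pt_inf, A0 *v axis_vec a)" by (auto simp: framing_def)
    then obtain U \<sigma> where U: "openin X U" "b \<in> U" "continuous_map (subtopology X U) (top_of_set SO_succ) \<sigma>"
      "\<And>u. u \<in> U \<Longrightarrow> \<sigma> u \<in> SO_succ \<and> \<sigma> u *v pt_inf = fst (frame_at (F u)) \<and> \<sigma> u *v axis_vec a = snd (frame_at (F u))"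
      using frame_section_continuous[OF ev frame_at_orthonormal[OF Fm] b] by blast
    have fr: "framing a (\<sigma> u) (F u)" if "u \<in> U" for u using U(4)[OF that] by (simp add: framing_def)
    have "continuous_map (subtopology X U) (prod_topology (top_of_set SO_succ) X) (\<lambda>u. (\<sigma> u, u))"
      by (intro continuous_map_pairedI U(3) continuous_map_from_subtopology[OF continuous_map_id[unfolded id_def]])
    then have "continuous_map (subtopology X U) (subtopology (prod_topology (top_of_set SO_succ) X) {(A, x). framing a A (F x)}) (\<lambda>u. (\<sigma> u, u))"
      using fr by (auto simp: continuous_map_in_subtopology)
    from continuous_map_compose[OF this \<Phi>]
    have "continuous_map (subtopology X U) Y (\<lambda>u. \<Phi> (\<sigma> u, u))" by (simp add: o_def)
    then have "continuous_map (subtopology X U) Y \<phi>"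
    proof (rule continuous_map_eq)
      fix x assume "x \<in> topspace (subtopology X U)"
      then have "x \<in> topspace X" "x \<in> U" by auto
      from \<phi>[OF this(1) fr[OF this(2)]] show "\<Phi> (\<sigma> x, x) = \<phi> x" by (rule sym)
    qed
    then show ?thesis using U(1,2) by blast
  qed
  then have "\<forall>b\<in>topspace X. \<exists>U. openin X U \<and> b \<in> U \<and> continuous_map (subtopology X U) Y \<phi>" by blast
  from bchoice[OF this] obtain U where
    U: "\<forall>b\<in>topspace X. openin X (U b) \<and> b \<in> U b \<and> continuous_map (subtopology X (U b)) Y \<phi>" ..
  show ?thesis
    by (rule pasting_lemma[where I = "topspace X" and T = U and f = "\<lambda>_. \<phi>"]) (use U in auto)
qed

lemma theta_orbit:
  assumes "A \<in> SO_succ" "f \<in> long_knots a"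
  shows "theta (orbit a (A, f)) = rotate_embedding A (compactify f)"
  using theta_balanced_class[OF assms] balanced_class_orbit[OF _ assms] by simp

lemma theta_continuous: "continuous_map (balanced_product a SO_succ) Emb theta"
proof (rule continuous_compose_quotient_map[OF balanced_quotient])
  let ?P = "prod_topology (top_of_set SO_succ) (long_knot_space a)"
  have "continuous_map ?P (prod_topology (top_of_set SO_succ) Emb) (\<lambda>x. (fst x, compactify (snd x)))"
    by (intro continuous_map_pairedI continuous_map_fst compactify_continuous[where a = a] continuous_map_snd)
  from continuous_map_compose[OF this rotate_embedding_continuous(1)]
  have "continuous_map ?P Emb (\<lambda>x. rotate_embedding (fst x) (compactify (snd x)))" by (simp add: o_def)
  then show "continuous_map ?P Emb (theta \<circ> orbit a)"
    by (rule continuous_map_eq) (auto simp: theta_orbit)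
qed simp

lemma theta_frame: "e \<in> topspace (balanced_product a SO_succ) \<Longrightarrow> frame_at (theta e) = frame_of a e"
  using framing_rotate(1)[OF _ standard_axis[OF compactify_standard]]
  by (auto simp: topspace_balanced theta_orbit frame_of_orbit)

definition straightened_class :: "'n::finite \<Rightarrow> 'n succ_matrix \<Rightarrow> (real^(1 option) \<Rightarrow> real^('n option)) \<Rightarrow> 'n framed set" where
  "straightened_class a A g = orbit a (A, knot_of a (rotate_embedding (transpose A) g))"

text \<open>Two framings differ by a rotation about the axis, which can be moved across the bracket
  \<open>[A, f]\<close> since \<open>knot_of\<close> is equivariant.\<close>
lemma straightened_class_unique:
  assumes "framing a A g" "framing a A' g" "g \<in> circle_embeddings"
  shows "straightened_class a A' g = straightened_class a A g"
proof -
  obtain B where B: "B \<in> SO_axis a" "A' = A ** B" using framing_unique[OF assms(1,2)] .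
  let ?x = "rotate_embedding (transpose A) g"
  have x: "?x \<in> axis_embeddings a" by (rule framing_axis[OF assms(1,3)])
  have y: "rotate_embedding (transpose B) ?x \<in> axis_embeddings a" by (rule rotate_axis_embeddings[OF SO_axis_transpose[OF B(1)] x])
  have "rotate_embedding (transpose A') g = rotate_embedding (transpose B) ?x"
    by (simp add: B(2) matrix_transpose_mul rotate_embedding_mult)
  then have "straightened_class a A' g = orbit a (A, rotate_knot B (knot_of a (rotate_embedding (transpose B) ?x)))"
    by (simp add: straightened_class_def B(2) orbit_shift[OF B(1)])
  also have "rotate_knot B (knot_of a (rotate_embedding (transpose B) ?x)) = knot_of a (rotate_embedding B (rotate_embedding (transpose B) ?x))"
    by (rule knot_of_rotate[OF B(1) y, symmetric])
  also have "rotate_embedding B (rotate_embedding (transpose B) ?x) = ?x"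
    by (rule rotate_embedding_inverse(2)[OF SO_mid_SO_succ[OF SO_axis_mid[OF B(1)]] axis_embeddings_circle[OF x]])
  finally show ?thesis by (simp add: straightened_class_def)
qed

text \<open>The inverse \<open>h\<close> sends \<open>g\<close> to \<open>[A, knot_of a (A\<inverse>
  g)]\<close> for any framing \<open>A\<close>. Both homotopies apply the deformation \<open>H\<close>
  of \<open>P\<close> between \<open>A\<inverse>\<close> and \<open>A\<close>; \<open>H\<close> keeps
  the standard frame, so they stay over the identity of the frames.\<close>
lemma theta_fibre_homotopy_equivalence:
  fixes a :: "'n::finite"
  assumes n: "CARD('n) \<ge> 2"
  shows "fibre_homotopy_equivalence (balanced_product a SO_succ) (frame_of a) Emb frame_at theta"
proof -
  let ?Q = "balanced_product a SO_succ" and ?I = "top_of_set {0..1::real}"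
  obtain H where H: "continuous_map (prod_topology ?I (Emb_axis a)) (Emb_axis a) H"
    "\<And>x. H (0, x) = x" "\<And>x. H (1, x) = regularize a x"
    "\<And>t. t \<in> {0..1} \<Longrightarrow> axis_compatible a (\<lambda>x. H (t, x))"
    using regularize(1)[of a] unfolding homotopic_with_def by (auto simp: id_def)
  have Hm: "H (t, x) \<in> axis_embeddings a" if "t \<in> {0..1}" "x \<in> axis_embeddings a" for t x
    using continuous_map_image_subset_topspace[OF H(1)] that axis_embeddings_circle[OF that(2)] by force
  have Hs: "H (t, x) \<in> standard_embeddings a" if "t \<in> {0..1}" "x \<in> standard_embeddings a" for t x
    using H(4)[OF that(1)] that(2) by (simp add: axis_compatible_def)
  have Hr: "H (t, rotate_embedding B x) = rotate_embedding B (H (t, x))" if "t \<in> {0..1}" "B \<in> SO_axis a" "x \<in> axis_embeddings a" for t B x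
    using H(4)[OF that(1)] that(2,3) by (simp add: axis_compatible_def)
  define h where "h g = straightened_class a (some_framing a g) g" for g
  have some: "framing a (some_framing a g) g" if "g \<in> circle_embeddings" for g
    unfolding some_framing_def by (rule someI_ex[OF framing_exists[OF n that]])
  have h: "h g = straightened_class a A g" if "g \<in> circle_embeddings" "framing a A g" for g A
    unfolding h_def by (rule straightened_class_unique[OF that(2) some[OF that(1)] that(1)])
  have unrot: "continuous_map (subtopology (prod_topology (top_of_set SO_succ) X) {(A, x). framing a A (F x)}) (Emb_axis a)
      (\<lambda>(A, x). rotate_embedding (transpose A) (F x))" if F: "continuous_map X Emb F" for X :: "'y topology" and F
  proof -
    let ?S = "subtopology (prod_topology (top_of_set SO_succ) X) {(A, x). framing a A (F x)}"
    have f: "continuous_map ?S euclidean fst"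
      by (rule continuous_map_from_subtopology[OF continuous_map_into_fulltopology[OF continuous_map_fst]])
    have "continuous_map ?S euclidean (\<lambda>x. transpose (fst x))"
      by (rule continuous_map_euclidean_unop[where S = UNIV and h = transpose, OF f]) (auto intro: continuous_on_transpose continuous_intros)
    then have 1: "continuous_map ?S (top_of_set SO_succ) (\<lambda>x. transpose (fst x))"
      using SO_succ_transpose by (auto simp: continuous_map_in_subtopology)
    have 2: "continuous_map ?S Emb (\<lambda>x. F (snd x))"
      using continuous_map_from_subtopology[OF continuous_map_compose[OF continuous_map_snd F]] by (simp add: o_def)
    have "continuous_map ?S (prod_topology (top_of_set SO_succ) Emb) (\<lambda>x. (transpose (fst x), F (snd x)))"
      by (rule continuous_map_pairedI[OF 1 2])
    from continuous_map_compose[OF this rotate_embedding_continuous(1)]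
    have "continuous_map ?S Emb (\<lambda>x. rotate_embedding (transpose (fst x)) (F (snd x)))" by (simp add: o_def)
    moreover have "F x \<in> circle_embeddings" if "x \<in> topspace X" for x
      using continuous_map_image_subset_topspace[OF F] that by auto
    ultimately have "continuous_map ?S (Emb_axis a) (\<lambda>x. rotate_embedding (transpose (fst x)) (F (snd x)))"
      by (auto simp: continuous_map_in_subtopology intro!: framing_axis)
    then show ?thesis by (simp add: case_prod_unfold)
  qed
  have fstc: "continuous_map (subtopology (prod_topology (top_of_set SO_succ) X) S) (top_of_set SO_succ) fst" for X :: "'y topology" and S
    by (rule continuous_map_from_subtopology[OF continuous_map_fst])
  have hc: "continuous_map Emb ?Q h"
  proof (rule framing_descent[OF n continuous_map_id[unfolded id_def]])
    let ?S = "subtopology (prod_topology (top_of_set SO_succ) Emb) {(A, x). framing a A x}"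
    have "continuous_map ?S (long_knot_space a) (\<lambda>x. knot_of a (rotate_embedding (transpose (fst x)) (snd x)))"
      using continuous_map_compose[OF unrot[OF continuous_map_id[unfolded id_def]] knot_of_continuous]
      by (simp add: o_def case_prod_unfold)
    from continuous_map_compose[OF continuous_map_pairedI[OF fstc this] quotient_imp_continuous_map[OF balanced_quotient]]
    show "continuous_map ?S ?Q (\<lambda>x. straightened_class a (fst x) (snd x))"
      by (simp add: o_def straightened_class_def)
    show "h x = (\<lambda>x. straightened_class a (fst x) (snd x)) (A, x)" if "x \<in> topspace Emb" "framing a A x" for x A
      using h that by simp
  qed
  have km: "knot_of a g \<in> long_knots a" if "g \<in> axis_embeddings a" for g
    unfolding knot_of_def by (rule uncompactify_mem[OF regularize(2)[OF that]])
  have hf: "frame_of a (h g) = frame_at g" if "g \<in> circle_embeddings" for g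
    using some[OF that] by (simp add: h_def straightened_class_def frame_of_orbit framing_def)
  define HE where "HE = (\<lambda>x. rotate_embedding (some_framing a (snd x)) (H (fst x, rotate_embedding (transpose (some_framing a (snd x))) (snd x))))"
  have HE: "HE (t, g) = rotate_embedding A (H (t, rotate_embedding (transpose A) g))"
    if t: "t \<in> {0..1}" and g: "g \<in> circle_embeddings" and A: "framing a A g" for t g A
  proof -
    obtain B where B: "B \<in> SO_axis a" "some_framing a g = A ** B" using framing_unique[OF A some[OF g]] .
    have x: "rotate_embedding (transpose A) g \<in> axis_embeddings a" by (rule framing_axis[OF A g])
    have "rotate_embedding (transpose (A ** B)) g = rotate_embedding (transpose B) (rotate_embedding (transpose A) g)"
      by (simp add: matrix_transpose_mul rotate_embedding_mult)
    then have "HE (t, g) = rotate_embedding A (rotate_embedding B (rotate_embedding (transpose B) (H (t, rotate_embedding (transpose A) g))))"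
      by (simp add: HE_def B(2) Hr[OF t SO_axis_transpose[OF B(1)] x] rotate_embedding_mult)
    also have "rotate_embedding B (rotate_embedding (transpose B) (H (t, rotate_embedding (transpose A) g))) = H (t, rotate_embedding (transpose A) g)"
      by (rule rotate_embedding_inverse(2)[OF SO_mid_SO_succ[OF SO_axis_mid[OF B(1)]] axis_embeddings_circle[OF Hm[OF t x]]])
    finally show ?thesis .
  qed
  \<comment> \<open>Each stage is independent of the framing, so its continuity can be checked with a framing as an additional variable.\<close>
  have HEc: "continuous_map (prod_topology ?I Emb) Emb HE"
  proof (rule framing_descent[OF n continuous_map_snd])
    let ?X = "prod_topology ?I (Emb :: (_ \<Rightarrow> real^('n option)) topology)"
    let ?S = "subtopology (prod_topology (top_of_set SO_succ) ?X) {(A, x). framing a A (snd x)}"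
    have 1: "continuous_map ?S (Emb_axis a) (\<lambda>x. rotate_embedding (transpose (fst x)) (snd (snd x)))"
      using unrot[OF continuous_map_snd[of ?I Emb]] by (simp add: case_prod_unfold)
    have 2: "continuous_map ?S ?I (\<lambda>x. fst (snd x))"
      using continuous_map_from_subtopology[OF continuous_map_compose[OF continuous_map_snd continuous_map_fst]] by (simp add: o_def)
    from continuous_map_into_fulltopology[OF continuous_map_compose[OF continuous_map_pairedI[OF 2 1] H(1)]]
    have "continuous_map ?S Emb (\<lambda>x. H (fst (snd x), rotate_embedding (transpose (fst x)) (snd (snd x))))" by (simp add: o_def)
    from continuous_map_compose[OF continuous_map_pairedI[OF fstc this] rotate_embedding_continuous(1)]
    show "continuous_map ?S Emb (\<lambda>x. rotate_embedding (fst x) (H (fst (snd x), rotate_embedding (transpose (fst x)) (snd (snd x)))))"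
      by (simp add: o_def)
    show "HE x = (\<lambda>x. rotate_embedding (fst x) (H (fst (snd x), rotate_embedding (transpose (fst x)) (snd (snd x))))) (A, x)"
      if "x \<in> topspace ?X" "framing a A (snd x)" for x A
      using that HE[of "fst x" "snd x" A] by auto
  qed
  have hE: "homotopic_with (\<lambda>k. \<forall>y\<in>topspace Emb. frame_at (k y) = frame_at y) Emb Emb id (theta \<circ> h)"
  proof (rule iffD2[OF homotopic_with], simp, intro exI[of _ HE] conjI ballI)
    show "continuous_map (prod_topology ?I Emb) Emb HE" by (rule HEc)
  next
    fix g :: "_ \<Rightarrow> real^('n option)" assume "g \<in> topspace Emb"
    then have g: "g \<in> circle_embeddings" by simp
    let ?A = "some_framing a g"
    have A: "framing a ?A g" "?A \<in> SO_succ" using some[OF g] by (auto simp: framing_def)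
    have x: "rotate_embedding (transpose ?A) g \<in> axis_embeddings a" by (rule framing_axis[OF A(1) g])
    show "HE (0, g) = id g" using HE[OF _ g A(1), of 0] rotate_embedding_inverse(2)[OF A(2) g] by (simp add: H(2))
    show "HE (1, g) = (theta \<circ> h) g"
      using HE[OF _ g A(1), of 1] theta_orbit[OF A(2) km[OF x]] compactify_knot_of[OF x]
      by (simp add: H(3) h_def straightened_class_def)
    show "frame_at (HE (t, g)) = frame_at g" if t: "t \<in> {0..1}" for t
      using framing_rotate(1)[OF A(2) Hm[OF t x]] A(1) by (simp add: HE[OF t g A(1)] framing_def)
  qed
  define hq where "hq t = (\<lambda>x :: 'n framed. orbit a (fst x, uncompactify (H (t, compactify (snd x)))))" for t
  have hqi: "induced (hq t) (orbit a (A, f)) = orbit a (A, uncompactify (H (t, compactify f)))"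
    if t: "t \<in> {0..1}" and f: "f \<in> long_knots a" for t A f
  proof -
    have "induced (hq t) (orbit a (A, f)) = hq t (A, f)"
    proof (rule induced_orbit)
      fix B assume B: "B \<in> SO_axis a"
      have s: "compactify f \<in> standard_embeddings a" by (rule compactify_standard[OF f])
      have "uncompactify (H (t, compactify (rotate_knot B f))) = rotate_knot B (uncompactify (H (t, compactify f)))"
        by (simp add: compactify_rotate_knot[OF SO_axis_mid[OF B]] Hr[OF t B standard_axis[OF s]] uncompactify_rotate[OF B Hs[OF t s]])
      then have "hq t (A ** transpose B, rotate_knot B f) = orbit a ((A ** transpose B) ** B, uncompactify (H (t, compactify f)))"
        by (simp add: hq_def orbit_shift[OF B])
      then show "hq t (A ** transpose B, rotate_knot B f) = hq t (A, f)"
        using SO_succ_inverse(1)[OF SO_mid_SO_succ[OF SO_axis_mid[OF B]]] by (simp add: hq_def matrix_mul_assoc[symmetric])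
    qed
    then show ?thesis by (simp add: hq_def)
  qed
  let ?P = "prod_topology (top_of_set SO_succ) (long_knot_space a)"
  \<comment> \<open>The unit interval is compact, so its product with the quotient map is again a quotient map.\<close>
  have q: "quotient_map (prod_topology ?I ?P) (prod_topology ?I ?Q) (\<lambda>(x, y). (x, orbit a y))"
    by (rule quotient_map_prod_right[OF _ _ balanced_quotient])
      (auto intro: Hausdorff_space_subtopology compact_imp_locally_compact_space simp: compact_space_subtopology)
  have HQc: "continuous_map (prod_topology ?I ?Q) ?Q (\<lambda>x. induced (hq (fst x)) (snd x))"
  proof (rule continuous_compose_quotient_map[OF q])
    have 1: "continuous_map (prod_topology ?I ?P) (top_of_set SO_succ) (\<lambda>x. fst (snd x))"
      using continuous_map_compose[OF continuous_map_snd continuous_map_fst] by (simp add: o_def)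
    have 2: "continuous_map (prod_topology ?I ?P) (long_knot_space a) (\<lambda>x. snd (snd x))"
      using continuous_map_compose[OF continuous_map_snd continuous_map_snd] by (simp add: o_def)
    have 3: "continuous_map (prod_topology ?I ?P) (Emb_axis a) (\<lambda>x. compactify (snd (snd x)))"
      using compactify_continuous[OF 2] standard_axis[OF compactify_standard] by (auto simp: continuous_map_in_subtopology)
    from continuous_map_into_fulltopology[OF continuous_map_compose[OF continuous_map_pairedI[OF continuous_map_fst 3] H(1)]]
    have "continuous_map (prod_topology ?I ?P) Emb (\<lambda>x. H (fst x, compactify (snd (snd x))))" by (simp add: o_def)
    then have 4: "continuous_map (prod_topology ?I ?P) (long_knot_space a) (\<lambda>x. uncompactify (H (fst x, compactify (snd (snd x)))))"
      by (rule uncompactify_continuous) (use Hs compactify_standard[of _ a] in auto)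
    from continuous_map_compose[OF continuous_map_pairedI[OF 1 4] quotient_imp_continuous_map[OF balanced_quotient]]
    have "continuous_map (prod_topology ?I ?P) ?Q (\<lambda>x. orbit a (fst (snd x), uncompactify (H (fst x, compactify (snd (snd x))))))"
      by (simp add: o_def)
    then show "continuous_map (prod_topology ?I ?P) ?Q ((\<lambda>x. induced (hq (fst x)) (snd x)) \<circ> (\<lambda>(x, y). (x, orbit a y)))"
      by (rule continuous_map_eq) (auto simp: hqi)
  qed
  have hQ: "homotopic_with (\<lambda>k. \<forall>y\<in>topspace ?Q. frame_of a (k y) = frame_of a y) ?Q ?Q id (h \<circ> theta)"
  proof (rule iffD2[OF homotopic_with], simp, intro exI[of _ "\<lambda>x. induced (hq (fst x)) (snd x)"] conjI ballI)
    show "continuous_map (prod_topology ?I ?Q) ?Q (\<lambda>x. induced (hq (fst x)) (snd x))" by (rule HQc)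
  next
    fix e assume "e \<in> topspace ?Q"
    then obtain A f where e: "e = orbit a (A, f)" "A \<in> SO_succ" "f \<in> long_knots a" by (auto simp: topspace_balanced)
    have s: "compactify f \<in> axis_embeddings a" by (rule standard_axis[OF compactify_standard[OF e(3)]])
    show "induced (hq (fst (0::real, e))) (snd (0::real, e)) = id e" using hqi[OF _ e(3), of 0 A] by (simp add: e(1) H(2))
    have th: "theta e = rotate_embedding A (compactify f)" using theta_orbit[OF e(2,3)] e(1) by simp
    have "h (theta e) = straightened_class a A (theta e)"
      unfolding th by (rule h[OF rotate_embedding_continuous(2)[OF e(2) axis_embeddings_circle[OF s]] framing_rotate(2)[OF e(2) s]])
    also have "\<dots> = orbit a (A, knot_of a (compactify f))"
      unfolding th straightened_class_def rotate_embedding_inverse(1)[OF e(2) axis_embeddings_circle[OF s]] ..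
    finally show "induced (hq (fst (1::real, e))) (snd (1::real, e)) = (h \<circ> theta) e"
      using hqi[OF _ e(3), of 1 A] by (simp add: e(1) H(3) knot_of_def)
    show "frame_of a (induced (hq (fst (t, e))) (snd (t, e))) = frame_of a e" if "t \<in> {0..1}" for t
      using hqi[OF that e(3), of A] by (simp add: e(1) frame_of_orbit)
  qed
  show ?thesis unfolding fibre_homotopy_equivalence_def
    using theta_continuous theta_frame hc hf homotopic_with_symD[OF hE] homotopic_with_symD[OF hQ] by auto
qed

section \<open>Restricting to the pointed embeddings\<close>

text \<open>A map that commutes with \<open>p\<close> also commutes with every function of
  \<open>p\<close>.\<close>
lemma fibre_homotopy_equivalence_project:
  assumes f: "fibre_homotopy_equivalence X p Y q f"
    and p': "\<And>x. x \<in> topspace X \<Longrightarrow> p' x = r (p x)" and q': "\<And>y. y \<in> topspace Y \<Longrightarrow> q' y = r (q y)"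
  shows "fibre_homotopy_equivalence X p' Y q' f"
proof -
  obtain g where c: "continuous_map X Y f" "\<forall>x \<in> topspace X. q (f x) = p x"
    and g: "continuous_map Y X g" "\<forall>y \<in> topspace Y. p (g y) = q y"
    and 1: "homotopic_with (\<lambda>h. \<forall>x \<in> topspace X. p (h x) = p x) X X (g \<circ> f) id"
    and 2: "homotopic_with (\<lambda>h. \<forall>y \<in> topspace Y. q (h y) = q y) Y Y (f \<circ> g) id"
    using f unfolding fibre_homotopy_equivalence_def by blast
  have "homotopic_with (\<lambda>h. \<forall>x \<in> topspace X. p' (h x) = p' x) X X (g \<circ> f) id"
  proof (rule homotopic_with_mono[OF 1], intro ballI)
    show "p' (h x) = p' x" if "continuous_map X X h" "\<forall>x \<in> topspace X. p (h x) = p x" "x \<in> topspace X" for h x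
      using that(2,3) continuous_map_image_subset_topspace[OF that(1)] p' by (auto simp: image_subset_iff)
  qed
  moreover have "homotopic_with (\<lambda>h. \<forall>y \<in> topspace Y. q' (h y) = q' y) Y Y (f \<circ> g) id"
  proof (rule homotopic_with_mono[OF 2], intro ballI)
    show "q' (h x) = q' x" if "continuous_map Y Y h" "\<forall>x \<in> topspace Y. q (h x) = q x" "x \<in> topspace Y" for h x
      using that(2,3) continuous_map_image_subset_topspace[OF that(1)] q' by (auto simp: image_subset_iff)
  qed
  moreover have "f x \<in> topspace Y" if "x \<in> topspace X" for x using continuous_map_image_subset_topspace[OF c(1)] that by auto
  moreover have "g y \<in> topspace X" if "y \<in> topspace Y" for y using continuous_map_image_subset_topspace[OF g(1)] that by auto
  ultimately show ?thesis unfolding fibre_homotopy_equivalence_def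
    using c g p' q' by auto
qed

text \<open>A homotopy over the base preserves the part of the total space over
  \<open>S\<close>.\<close>
lemma homotopic_over_restrict:
  assumes k: "homotopic_with (\<lambda>h. \<forall>x \<in> topspace X. p (h x) = p x) X X k id"
    and V: "V = {x \<in> topspace X. p x \<in> S}"
  shows "homotopic_with (\<lambda>h. \<forall>x \<in> topspace (subtopology X V). p (h x) = p x) (subtopology X V) (subtopology X V) k id"
proof -
  let ?I = "top_of_set {0..1::real}"
  obtain H where H: "continuous_map (prod_topology ?I X) X H" "\<And>x. H (0, x) = k x" "\<And>x. H (1, x) = x"
    "\<And>t. t \<in> {0..1} \<Longrightarrow> \<forall>x \<in> topspace X. p (H (t, x)) = p x"
    using k unfolding homotopic_with_def by (auto simp: id_def)
  have c: "continuous_map (prod_topology ?I (subtopology X V)) X H"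
    using continuous_map_from_subtopology[OF H(1), of "UNIV \<times> V"]
    by (simp only: subtopology_Times subtopology_UNIV)
  have m: "H (t, x) \<in> V" if "t \<in> {0..1}" "x \<in> V" for t x
    using H(4)[OF that(1)] that continuous_map_image_subset_topspace[OF H(1)] by (auto simp: V image_subset_iff)
  show ?thesis unfolding homotopic_with_def
  proof (intro exI[of _ H] conjI allI ballI)
    show "continuous_map (prod_topology ?I (subtopology X V)) (subtopology X V) H"
      using c m by (auto simp: continuous_map_in_subtopology)
    show "p (H (t, x)) = p x" if "t \<in> {0..1}" "x \<in> topspace (subtopology X V)" for t x
      using H(4)[OF that(1)] that(2) by simp
  qed (simp_all add: H)
qed

lemma fibre_homotopy_equivalence_restrict:
  assumes f: "fibre_homotopy_equivalence X p Y q f"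
  shows "fibre_homotopy_equivalence (subtopology X {x \<in> topspace X. p x \<in> S}) p (subtopology Y {y \<in> topspace Y. q y \<in> S}) q f"
proof -
  obtain g where c: "continuous_map X Y f" "\<forall>x \<in> topspace X. q (f x) = p x"
    and g: "continuous_map Y X g" "\<forall>y \<in> topspace Y. p (g y) = q y"
    and 1: "homotopic_with (\<lambda>h. \<forall>x \<in> topspace X. p (h x) = p x) X X (g \<circ> f) id"
    and 2: "homotopic_with (\<lambda>h. \<forall>y \<in> topspace Y. q (h y) = q y) Y Y (f \<circ> g) id"
    using f unfolding fibre_homotopy_equivalence_def by blast
  let ?X = "subtopology X {x \<in> topspace X. p x \<in> S}" and ?Y = "subtopology Y {y \<in> topspace Y. q y \<in> S}"
  have "continuous_map ?X ?Y f"
    using continuous_map_from_subtopology[OF c(1)] c(2) continuous_map_image_subset_topspace[OF c(1)]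
    by (auto simp: continuous_map_in_subtopology image_subset_iff)
  moreover have "continuous_map ?Y ?X g"
    using continuous_map_from_subtopology[OF g(1)] g(2) continuous_map_image_subset_topspace[OF g(1)]
    by (auto simp: continuous_map_in_subtopology image_subset_iff)
  ultimately show ?thesis unfolding fibre_homotopy_equivalence_def
    using c(2) g(2) homotopic_over_restrict[OF 1 refl, of S] homotopic_over_restrict[OF 2 refl, of S]
    by (intro conjI exI[of _ g]) (assumption | simp)+
qed

lemma fibre_homotopy_equivalence_imp:
  assumes "fibre_homotopy_equivalence X p Y q f"
  shows "homotopy_equivalence X Y f"
proof -
  obtain g where "continuous_map X Y f" "continuous_map Y X g"
    and 1: "homotopic_with (\<lambda>h. \<forall>x \<in> topspace X. p (h x) = p x) X X (g \<circ> f) id"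
    and 2: "homotopic_with (\<lambda>h. \<forall>y \<in> topspace Y. q (h y) = q y) Y Y (f \<circ> g) id"
    using assms unfolding fibre_homotopy_equivalence_def by blast
  then show ?thesis unfolding homotopy_equivalence_def
    using homotopic_with_mono[OF 1, where Q = "\<lambda>_. True"] homotopic_with_mono[OF 2, where Q = "\<lambda>_. True"] by blast
qed

lemma Emb_pt_restrict: "subtopology Emb {g \<in> topspace Emb. frame_at g \<in> {x. fst x = pt_inf}} = Emb_pt"
  unfolding Emb_pt_def by (rule arg_cong[where f = "subtopology Emb"]) (auto simp: frame_at_def pointed_embeddings_def)

lemma balanced_mid_restrict:
  "subtopology (balanced_product a SO_succ) {e \<in> topspace (balanced_product a SO_succ). frame_of a e \<in> {x. fst x = pt_inf}} = balanced_product a SO_mid"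
  using balanced_mid_subtopology[of a] by simp

lemma topspace_balanced_mid:
  assumes "e \<in> topspace (balanced_product a SO_mid)"
  shows "e \<in> topspace (balanced_product a SO_succ)" "fst (frame_of a e) = pt_inf"
  using assms unfolding balanced_mid_subtopology[symmetric] by auto

lemma theta_continuous_mid: "continuous_map (balanced_product a SO_mid) Emb_pt theta"
proof -
  have "continuous_map (balanced_product a SO_mid) Emb theta"
    unfolding balanced_mid_subtopology[symmetric] by (rule continuous_map_from_subtopology[OF theta_continuous])
  moreover have "theta e \<in> pointed_embeddings" if e: "e \<in> topspace (balanced_product a SO_mid)" for e
  proof -
    have "theta e \<in> circle_embeddings"
      using continuous_map_image_subset_topspace[OF theta_continuous] topspace_balanced_mid(1)[OF e] by (auto simp: image_subset_iff)
    moreover have "theta e pt_inf = pt_inf"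
      using arg_cong[OF theta_frame[OF topspace_balanced_mid(1)[OF e]], of fst] topspace_balanced_mid(2)[OF e] by (simp add: frame_at_def)
    ultimately show ?thesis by (simp add: pointed_embeddings_def)
  qed
  ultimately show ?thesis unfolding Emb_pt_def by (auto simp: continuous_map_in_subtopology)
qed

lemma theta_fibre_homotopy_equivalence_mid:
  fixes a :: "'n::finite"
  assumes n: "CARD('n) \<ge> 2"
  shows "fibre_homotopy_equivalence (balanced_product a SO_mid) (frame_of a) Emb_pt frame_at theta"
  using fibre_homotopy_equivalence_restrict[OF theta_fibre_homotopy_equivalence[OF n, of a], of "{x. fst x = pt_inf}"]
  by (simp only: Emb_pt_restrict balanced_mid_restrict)

lemma theta_bundle_morphism:
  fixes a :: "'n::finite"
  shows "bundle_morphism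
       (balanced_product a SO_mid) id
       (balanced_product a SO_succ) (induced (\<lambda>(A, f). coset SO_mid A))
       (coset_space SO_succ SO_mid)
       Emb_pt id
       Emb (\<lambda>g. g pt_inf)
       (top_of_set unit_sphere)
       theta theta (induced (\<lambda>A. A *v pt_inf))"
  unfolding bundle_morphism_def
proof (intro conjI ballI)
  show "continuous_map (balanced_product a SO_mid) Emb_pt theta" by (rule theta_continuous_mid)
  show "continuous_map (balanced_product a SO_succ) Emb theta" by (rule theta_continuous)
  show "continuous_map (coset_space SO_succ SO_mid) (top_of_set unit_sphere) (induced (\<lambda>A :: 'n succ_matrix. A *v pt_inf))"
    by (rule homeomorphic_imp_continuous_map[OF coset_mid_homeomorphic_sphere])
  show "theta e pt_inf = induced (\<lambda>A. A *v pt_inf) (induced (\<lambda>(A, f). coset SO_mid A) e)"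
    if e: "e \<in> topspace (balanced_product a SO_succ)" for e
  proof -
    obtain A f where A: "e = orbit a (A, f)" using e by (auto simp: topspace_balanced)
    have "theta e pt_inf = fst (frame_at (theta e))" by (simp add: frame_at_def)
    also have "\<dots> = A *v pt_inf" by (simp add: theta_frame[OF e]) (simp add: A frame_of_orbit)
    finally show ?thesis by (simp add: A induced_coset_orbit induced_mid_pt_inf)
  qed
qed simp

section \<open>Directions at the base-point\<close>

lemma proj_emb_finite [simp]: "proj_finite (emb_finite x) = x"
  by (simp add: proj_finite_def vec_eq_iff)

lemma norm_emb_finite [simp]: "norm (emb_finite x) = norm x"
  using norm_option[of "emb_finite x"] by simp

lemma emb_finite_axis: "emb_finite (axis a 1) = axis_vec a"
  by (simp add: vec_eq_iff split_option_all axis_def axis_vec_def)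

lemma inner_pt_inf_emb_finite: "pt_inf \<bullet> emb_finite x = 0"
  by (simp add: inner_pt_inf)

lemma SO_mid_emb_finite:
  assumes "A \<in> SO_mid" shows "A *v emb_finite x = emb_finite (fin_block A *v x)"
  using SO_mid_mult_nth[OF assms, of "emb_finite x"] by (simp add: vec_eq_iff split_option_all)

lemma emb_finite_inject: "emb_finite x = emb_finite y \<longleftrightarrow> x = y"
  by (metis proj_emb_finite)

lemma SO_mid_inverse_block:
  assumes "A \<in> SO_mid" shows "fin_block (transpose A) *v (fin_block A *v x) = x"
proof -
  have t: "transpose A \<in> SO_mid" using frame_group(4)[OF frame_group_cases(1)] assms by blast
  have "emb_finite (fin_block (transpose A) *v (fin_block A *v x)) = transpose A *v (A *v emb_finite x)"
    by (simp only: SO_mid_emb_finite[OF t] SO_mid_emb_finite[OF assms])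
  also have "\<dots> = emb_finite x" by (rule SO_succ_cancel(1)) (use assms SO_mid_subset in auto)
  finally show ?thesis by (simp only: emb_finite_inject)
qed

text \<open>For rotations fixing \<open>pt_inf\<close> the orthonormal pair amounts to one unit
  vector in \<open>\<real>\<^sup>n\<close>, the direction of the image of the axis.\<close>
lemma SO_mid_frame:
  assumes "A \<in> SO_mid" shows "(A *v pt_inf, A *v axis_vec a) = (pt_inf, emb_finite (fin_block A *v axis a 1))"
  using assms by (simp add: SO_mid_emb_finite emb_finite_axis[symmetric]) (simp add: SO_mid_def)

lemma direction_sections:
  fixes a :: "'n::finite" and b :: "real^'n"
  assumes n: "CARD('n) \<ge> 2" and b: "norm b = 1"
  shows "\<exists>U \<sigma>. openin (top_of_set unit_sphere) U \<and> b \<in> U \<and>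
     continuous_map (subtopology (top_of_set unit_sphere) U) (top_of_set SO_mid) \<sigma> \<and> (\<forall>u\<in>U. fin_block (\<sigma> u) *v axis a 1 = u)"
proof -
  obtain A0 where A0: "A0 \<in> SO_succ" "A0 *v pt_inf = pt_inf" "A0 *v axis_vec a = emb_finite b"
    using SO_succ_frame_transitive[OF n, of pt_inf "emb_finite b" a] b by (auto simp: inner_pt_inf_emb_finite)
  let ?S = "top_of_set (unit_sphere :: (real^'n) set)"
  have ev: "continuous_map ?S euclidean (\<lambda>w. (pt_inf, emb_finite w))"
    by (simp add: continuous_on_Pair bounded_linear.continuous_on[OF emb_finite_linear])
  obtain U \<sigma> where U: "openin ?S U" "b \<in> U" "continuous_map (subtopology ?S U) (top_of_set SO_succ) \<sigma>"
    "\<And>u. u \<in> U \<Longrightarrow> \<sigma> u \<in> SO_succ \<and> \<sigma> u *v pt_inf = fst (pt_inf :: real^('n option), emb_finite u) \<and> \<sigma> u *v axis_vec a = snd (pt_inf :: real^('n option), emb_finite u)"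
  proof (rule frame_section_continuous[OF ev _ _ A0(1)])
    show "norm (fst (pt_inf :: real^('n option), emb_finite u)) = 1 \<and> norm (snd (pt_inf :: real^('n option), emb_finite u)) = 1 \<and>
        fst (pt_inf, emb_finite u) \<bullet> snd (pt_inf :: real^('n option), emb_finite u) = 0" if "u \<in> topspace ?S" for u
      using that by (simp add: inner_pt_inf_emb_finite)
    show "b \<in> topspace ?S" using b by simp
    show "(pt_inf, emb_finite b) = (A0 *v pt_inf, A0 *v axis_vec a)" by (simp add: A0)
  qed blast
  have m: "\<sigma> u \<in> SO_mid" if "u \<in> U" for u using U(4)[OF that] by (simp add: SO_mid_def)
  have "fin_block (\<sigma> u) *v axis a 1 = u" if "u \<in> U" for u
    using SO_mid_frame[OF m[OF that], of a] U(4)[OF that] by (simp add: emb_finite_inject)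
  moreover have "continuous_map (subtopology ?S U) (top_of_set SO_mid) \<sigma>"
    using U(3) m by (auto simp: continuous_map_in_subtopology)
  ultimately show ?thesis using U(1,2) by blast
qed

text \<open>The instance of \<open>equivariant_bundle\<close> in which \<open>SO(n)\<close> acts on
  the sphere of directions in \<open>\<real>\<^sup>n\<close>.\<close>
lemma direction_bundle:
  fixes a :: "'n::finite" and act :: "'n succ_matrix \<Rightarrow> 'e \<Rightarrow> 'e"
  assumes n: "CARD('n) \<ge> 2"
    and act: "continuous_map (prod_topology (top_of_set SO_mid) E) E (\<lambda>(A, e). act A e)"
    and inv: "\<And>A e. A \<in> SO_mid \<Longrightarrow> e \<in> topspace E \<Longrightarrow> act (transpose A) (act A e) = e"
    and p: "continuous_map E (top_of_set unit_sphere) p"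
    and eq: "\<And>A e. A \<in> SO_mid \<Longrightarrow> e \<in> topspace E \<Longrightarrow> p (act A e) = fin_block A *v p e"
    and i: "homeomorphic_map F (subtopology E {e \<in> topspace E. p e = axis a 1}) i"
  shows "bundle_sequence F i E p (top_of_set unit_sphere) (axis a 1)"
proof (rule equivariant_bundle[OF act _ inv p eq _ _ _ i])
  show "transpose A \<in> SO_mid" if "A \<in> SO_mid" for A :: "'n succ_matrix"
    using frame_group(4)[OF frame_group_cases(1)] that by blast
  show "fin_block (transpose A) *v (fin_block A *v b) = b" if "A \<in> SO_mid" for A :: "'n succ_matrix" and b
    by (rule SO_mid_inverse_block[OF that])
  show "axis a 1 \<in> topspace (top_of_set unit_sphere)" by (simp add: norm_axis_1)
  show "\<exists>U \<sigma>. openin (top_of_set unit_sphere) U \<and> b \<in> U \<and>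
     continuous_map (subtopology (top_of_set unit_sphere) U) (top_of_set SO_mid) \<sigma> \<and> (\<forall>u\<in>U. fin_block (\<sigma> u) *v axis a 1 = u)"
    if "b \<in> topspace (top_of_set unit_sphere)" for b :: "real^'n"
    using direction_sections[OF n, of b a] that by simp
qed

lemma fin_block_mult_vector:
  assumes "A \<in> SO_mid" "B \<in> SO_mid" shows "fin_block (A ** B) *v x = fin_block A *v (fin_block B *v x)"
  by (simp add: fin_block_mult[OF assms] matrix_vector_mul_assoc)

lemma fin_block_axis_proj: "A \<in> SO_mid \<Longrightarrow> fin_block A *v axis a 1 = proj_finite (A *v axis_vec a)"
  by (simp add: emb_finite_axis[symmetric] SO_mid_emb_finite)

lemma SO_axis_iff_fin_block: "A \<in> SO_axis a \<longleftrightarrow> A \<in> SO_mid \<and> fin_block A *v axis a 1 = axis a 1"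
proof -
  have "A *v axis_vec a = axis_vec a \<longleftrightarrow> fin_block A *v axis a 1 = axis a 1" if "A \<in> SO_mid"
    using SO_mid_emb_finite[OF that, of "axis a 1"] emb_finite_inject[of _ "axis a 1"] by (simp add: emb_finite_axis)
  then show ?thesis by (auto simp: SO_axis_iff SO_mid_def)
qed

lemma continuous_on_fin_block_axis: "continuous_on S (\<lambda>A :: 'n::finite succ_matrix. fin_block A *v axis a 1)"
proof -
  have "(\<lambda>A :: 'n succ_matrix. fin_block A *v axis a 1) = (\<lambda>A. \<chi> i. A $ Some i $ Some a)"
    by (simp add: fun_eq_iff vec_eq_iff matrix_vector_mult_basis column_def fin_block_def)
  then show ?thesis by (simp only:) (intro continuous_intros)
qed

lemma norm_fin_block_axis: "A \<in> SO_mid \<Longrightarrow> norm (fin_block A *v axis a 1) = 1"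
  by (simp add: norm_fin_block norm_axis_1)

lemma rotation_bundle:
  fixes a :: "'n::finite"
  assumes n: "CARD('n) \<ge> 2"
  shows "bundle_sequence (top_of_set (SO_axis a)) id (top_of_set SO_mid) (\<lambda>A. fin_block A *v axis a 1)
          (top_of_set unit_sphere) (axis a 1)"
proof (rule direction_bundle[OF n, where act = "(**)"])
  have "continuous_map (prod_topology (top_of_set SO_mid) (top_of_set (SO_mid :: 'n succ_matrix set))) euclidean (\<lambda>(A, B). A ** B)"
    by (simp add: case_prod_unfold continuous_on_matrix_mult continuous_on_fst continuous_on_snd continuous_on_id flip: subtopology_Times)
  then show "continuous_map (prod_topology (top_of_set SO_mid) (top_of_set (SO_mid :: 'n succ_matrix set))) (top_of_set SO_mid) (\<lambda>(A, B). A ** B)"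
    using frame_group(3)[OF frame_group_cases(1)] by (auto simp: continuous_map_in_subtopology)
  show "transpose A ** (A ** B) = B" if "A \<in> SO_mid" for A B :: "'n succ_matrix"
    using SO_succ_inverse(1)[of A] that SO_mid_subset by (auto simp: matrix_mul_assoc)
  show "continuous_map (top_of_set SO_mid) (top_of_set unit_sphere) (\<lambda>A :: 'n succ_matrix. fin_block A *v axis a 1)"
    by (auto simp: continuous_map_in_subtopology norm_fin_block_axis continuous_on_fin_block_axis)
  show "fin_block (A ** B) *v axis a 1 = fin_block A *v (fin_block B *v axis a 1)"
    if "A \<in> SO_mid" "B \<in> topspace (top_of_set SO_mid)" for A B :: "'n succ_matrix"
    using that by (simp add: fin_block_mult_vector)
  have "{A \<in> topspace (top_of_set SO_mid). fin_block A *v axis a 1 = axis a 1} = SO_axis a"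
    by (auto simp: SO_axis_iff_fin_block)
  moreover have "SO_mid \<inter> SO_axis a = SO_axis a" by (auto simp: SO_axis_iff_fin_block)
  ultimately show "homeomorphic_map (top_of_set (SO_axis a))
      (subtopology (top_of_set SO_mid) {A \<in> topspace (top_of_set SO_mid). fin_block A *v axis a 1 = axis a 1}) id"
    by (simp only: subtopology_subtopology homeomorphic_map_id)
qed

lemma induced_fin_block:
  assumes "A \<in> SO_mid" shows "induced (\<lambda>A. fin_block A *v axis a 1) (coset (SO_axis a) A) = fin_block A *v axis a 1"
  by (rule induced_coset[OF mat1_SO_axis, of a "\<lambda>A. fin_block A *v axis a 1"])
    (use assms in \<open>simp add: fin_block_mult_vector SO_axis_iff_fin_block\<close>)

text \<open>Again a continuous bijection from a compact space to a Hausdorff space; transitivity is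
  that on orthonormal pairs which start with \<open>pt_inf\<close>.\<close>
lemma coset_axis_homeomorphic_sphere:
  fixes a :: "'n::finite"
  assumes n: "CARD('n) \<ge> 2"
  shows "homeomorphic_map (coset_space SO_mid (SO_axis a)) (top_of_set unit_sphere) (induced (\<lambda>A. fin_block A *v axis a 1))"
proof (rule continuous_imp_homeomorphic_map)
  have "continuous_map (coset_space SO_mid (SO_axis a)) euclidean (induced (\<lambda>A. fin_block A *v axis a 1))"
    by (rule continuous_map_induced_coset[OF mat1_SO_axis _ continuous_on_fin_block_axis])
      (simp add: fin_block_mult_vector SO_axis_iff_fin_block)
  then show "continuous_map (coset_space SO_mid (SO_axis a)) (top_of_set unit_sphere) (induced (\<lambda>A. fin_block A *v axis a 1))"
    by (auto simp: continuous_map_in_subtopology induced_fin_block norm_fin_block_axis)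
  show "compact_space (coset_space SO_mid (SO_axis a))" by (rule compact_coset_space[OF SO_mid_compact])
  show "Hausdorff_space (top_of_set (unit_sphere :: (real^'n) set))" by (intro Hausdorff_space_subtopology Hausdorff_space_euclidean)
  have "b \<in> (\<lambda>A. fin_block A *v axis a 1) ` SO_mid" if b: "norm b = 1" for b :: "real^'n"
  proof -
    obtain A where A: "A \<in> SO_succ" "A *v pt_inf = pt_inf" "A *v axis_vec a = emb_finite b"
      using SO_succ_frame_transitive[OF n, of pt_inf "emb_finite b" a] b by (auto simp: inner_pt_inf_emb_finite)
    then have "A \<in> SO_mid" by (simp add: SO_mid_def)
    moreover from this have "fin_block A *v axis a 1 = b" by (simp add: fin_block_axis_proj A)
    ultimately show ?thesis by blast
  qed
  then have "(\<lambda>A. fin_block A *v axis a 1) ` SO_mid = unit_sphere" by (auto simp: norm_fin_block_axis)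
  moreover have "induced (\<lambda>A. fin_block A *v axis a 1) ` topspace (coset_space SO_mid (SO_axis a)) = (\<lambda>A. fin_block A *v axis a 1) ` SO_mid"
    by (simp add: image_image induced_fin_block)
  ultimately show "induced (\<lambda>A. fin_block A *v axis a 1) ` topspace (coset_space SO_mid (SO_axis a)) = topspace (top_of_set unit_sphere)"
    by simp
  have "inj_on (induced (\<lambda>A. fin_block A *v axis a 1)) (coset (SO_axis a) ` SO_mid)"
  proof (rule inj_onI, elim imageE)
    fix C C' A A'
    assume *: "induced (\<lambda>A. fin_block A *v axis a 1) C = induced (\<lambda>A. fin_block A *v axis a 1) C'"
      "C = coset (SO_axis a) A" "A \<in> SO_mid" "C' = coset (SO_axis a) A'" "A' \<in> SO_mid"
    then have "fin_block A *v axis a 1 = fin_block A' *v axis a 1" by (simp add: induced_fin_block)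
    then have "(A *v pt_inf, A *v axis_vec a) = (A' *v pt_inf, A' *v axis_vec a)"
      by (simp only: SO_mid_frame[OF *(3)] SO_mid_frame[OF *(5)])
    then show "C = C'" using coset_axis_eq_iff[of A A' a] * SO_mid_subset by auto
  qed
  then show "inj_on (induced (\<lambda>A. fin_block A *v axis a 1)) (topspace (coset_space SO_mid (SO_axis a)))" by simp
qed

text \<open>The projection to the sphere of directions is read off from the frame.\<close>
lemma balanced_direction:
  assumes "e \<in> topspace (balanced_product a SO_mid)"
  shows "(induced (\<lambda>A. fin_block A *v axis a 1) \<circ> induced (\<lambda>(A, f). coset (SO_axis a) A)) e = proj_finite (snd (frame_of a e))"
    "frame_of a e = (pt_inf, emb_finite (proj_finite (snd (frame_of a e))))" "norm (proj_finite (snd (frame_of a e))) = 1"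
proof -
  obtain A f where A: "e = orbit a (A, f)" "A \<in> SO_mid" using assms by (auto simp: topspace_balanced)
  have f: "frame_of a e = (pt_inf, emb_finite (fin_block A *v axis a 1))"
    using SO_mid_frame[OF A(2), of a] by (simp add: A(1) frame_of_orbit)
  then show "(induced (\<lambda>A. fin_block A *v axis a 1) \<circ> induced (\<lambda>(A, f). coset (SO_axis a) A)) e = proj_finite (snd (frame_of a e))"
    by (simp add: A(1) induced_coset_orbit induced_fin_block[OF A(2)])
  show "frame_of a e = (pt_inf, emb_finite (proj_finite (snd (frame_of a e))))" "norm (proj_finite (snd (frame_of a e))) = 1"
    using f by (simp_all add: norm_fin_block_axis[OF A(2)])
qed

lemma balanced_direction_bundle:
  fixes a :: "'n::finite"
  assumes n: "CARD('n) \<ge> 2"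
  defines "P \<equiv> induced (\<lambda>A. fin_block A *v axis a 1) \<circ> induced (\<lambda>(A, f). coset (SO_axis a) A)"
  shows "bundle_sequence (long_knot_space a) (\<lambda>f. balanced_class a SO_mid (mat 1, f)) (balanced_product a SO_mid) P
          (top_of_set unit_sphere) (axis a 1)"
proof (rule direction_bundle[OF n, where act = translate])
  let ?Q = "balanced_product a SO_mid"
  note P = balanced_direction[of _ a, folded P_def]
  show "continuous_map (prod_topology (top_of_set SO_mid) ?Q) ?Q (\<lambda>(A, e). translate A e)"
    by (rule translate_continuous) simp
  show "translate (transpose A) (translate A e) = e" if "A \<in> SO_mid" for A e
    by (rule translate_inverse) (use that SO_mid_subset in auto)
  have "continuous_map ?Q euclidean (\<lambda>e. snd (frame_of a e))"
    by (rule continuous_map_euclidean_unop[where S = UNIV and h = snd, OF frame_of_continuous]) (auto intro: continuous_intros)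
  from continuous_map_euclidean_unop[where S = UNIV and h = proj_finite, OF this bounded_linear.continuous_on[OF proj_finite_linear continuous_on_id]]
  have "continuous_map ?Q euclidean (\<lambda>e. proj_finite (snd (frame_of a e)))" by simp
  then have "continuous_map ?Q (top_of_set unit_sphere) (\<lambda>e. proj_finite (snd (frame_of a e)))"
    by (auto simp: continuous_map_in_subtopology P(3))
  then show "continuous_map ?Q (top_of_set unit_sphere) P"
    by (rule continuous_map_eq) (simp add: P(1))
  show "P (translate A e) = fin_block A *v P e" if A: "A \<in> SO_mid" and e: "e \<in> topspace ?Q" for A e
  proof -
    obtain A' f where A': "e = orbit a (A', f)" "A' \<in> SO_mid" using e by (auto simp: topspace_balanced)
    have c: "A ** A' \<in> SO_mid" using frame_group(3)[OF frame_group_cases(1)] A A'(2) by blast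
    show ?thesis by (simp add: P_def A'(1) translate_orbit induced_coset_orbit induced_fin_block[OF c] induced_fin_block[OF A'(2)] fin_block_mult_vector[OF A A'(2)])
  qed
  have "(P e = axis a 1) = (frame_of a e = (pt_inf, axis_vec a))" if e: "e \<in> topspace ?Q" for e
    using P(1)[OF e] P(2)[OF e] by (metis emb_finite_axis emb_finite_inject prod.inject)
  then have "{e \<in> topspace ?Q. P e = axis a 1} = {e \<in> topspace ?Q. frame_of a e = (pt_inf, axis_vec a)}" by blast
  then show "homeomorphic_map (long_knot_space a) (subtopology ?Q {e \<in> topspace ?Q. P e = axis a 1}) (\<lambda>f. balanced_class a SO_mid (mat 1, f))"
    using balanced_fibre[of SO_mid a] by simp
qed

text \<open>The velocity of a pointed embedding has vanishing coordinate \<open>None\<close>, so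
  normalizing commutes with dropping that coordinate.\<close>
lemma pointed_velocity:
  assumes "g \<in> pointed_embeddings" shows "direction g = proj_finite (snd (frame_at g))" "norm (direction g) = 1"
proof -
  interpret bounded_linear "proj_finite :: real^('a option) \<Rightarrow> real^'a" by (rule proj_finite_linear)
  have n: "norm (proj_finite (velocity g)) = norm (velocity g)"
    using norm_option[of "velocity g"] velocity_None[OF assms] by simp
  have "direction g = sgn (proj_finite (velocity g))" by (simp add: direction_def velocity_def o_def)
  then show "direction g = proj_finite (snd (frame_at g))" by (simp add: frame_at_def sgn_div_norm n scaleR)
  show "norm (direction g) = 1"
    using velocity_nonzero[of g] assms n by (simp add: direction_def velocity_def o_def norm_sgn pointed_embeddings_def) (metis norm_eq_zero)
qed

lemma topspace_Emb_pt [simp]: "topspace Emb_pt = pointed_embeddings"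
  by (auto simp: Emb_pt_def pointed_embeddings_def)

lemma Emb_direction_bundle:
  fixes a :: "'n::finite"
  assumes n: "CARD('n) \<ge> 2"
  shows "bundle_sequence (subtopology Emb_pt {g. direction g = axis a 1}) id (Emb_pt :: (real^(1 option) \<Rightarrow> real^('n option)) topology) direction
          (top_of_set unit_sphere) (axis a 1)"
proof (rule direction_bundle[OF n, where act = rotate_embedding])
  let ?E = "Emb_pt :: (real^(1 option) \<Rightarrow> real^('n option)) topology"
  have r: "rotate_embedding A g \<in> pointed_embeddings" if "A \<in> SO_mid" "g \<in> pointed_embeddings" for A :: "'n succ_matrix" and g
    using that rotate_embedding_continuous(2)[of A g] by (auto simp: pointed_embeddings_def SO_mid_def rotate_embedding_def)
  have "continuous_map (prod_topology (top_of_set SO_mid) ?E) Emb (\<lambda>(A, g). rotate_embedding A g)"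
  proof -
    have "prod_topology (top_of_set (SO_mid :: 'n succ_matrix set)) ?E = subtopology (prod_topology (top_of_set SO_succ) Emb) (SO_mid \<times> pointed_embeddings)"
      by (simp only: Emb_pt_def subtopology_Times subtopology_subtopology Int_absorb1[OF SO_mid_subset])
    then show ?thesis by (simp only: continuous_map_from_subtopology[OF rotate_embedding_continuous(1)])
  qed
  then show "continuous_map (prod_topology (top_of_set SO_mid) ?E) ?E (\<lambda>(A, g). rotate_embedding A g)"
    using r by (subst (2) Emb_pt_def) (auto simp: continuous_map_in_subtopology)
  show "rotate_embedding (transpose A) (rotate_embedding A g) = g" if "A \<in> SO_mid" "g \<in> topspace ?E" for A g
    using rotate_embedding_inverse(1)[of A g] that SO_mid_subset by (auto simp: pointed_embeddings_def)
  have "continuous_map ?E euclidean frame_at"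
    unfolding Emb_pt_def by (rule continuous_map_from_subtopology[OF frame_at_continuous])
  from continuous_map_euclidean_unop[where S = UNIV and h = snd, OF this continuous_on_snd[OF continuous_on_id] subset_UNIV]
  have "continuous_map ?E euclidean (\<lambda>g. snd (frame_at g))" .
  from continuous_map_euclidean_unop[where S = UNIV and h = proj_finite, OF this bounded_linear.continuous_on[OF proj_finite_linear continuous_on_id]]
  have "continuous_map ?E euclidean (\<lambda>g. proj_finite (snd (frame_at g)))" by simp
  then have "continuous_map ?E (top_of_set unit_sphere) (\<lambda>g. proj_finite (snd (frame_at g)))"
    by (auto simp: continuous_map_in_subtopology pointed_velocity(1)[symmetric] pointed_velocity(2))
  then show "continuous_map ?E (top_of_set unit_sphere) direction"
    by (rule continuous_map_eq) (simp add: pointed_velocity(1))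
  show "direction (rotate_embedding A g) = fin_block A *v direction g" if A: "A \<in> SO_mid" and g: "g \<in> topspace ?E" for A g
  proof -
    have c: "g \<in> circle_embeddings" using g by (simp add: pointed_embeddings_def)
    have s: "snd (frame_at (rotate_embedding A g)) = A *v snd (frame_at g)"
      using SO_succ_norm[of A] A SO_mid_subset
      by (auto simp: frame_at_def velocity_rotate[OF c] sgn_div_norm matrix_vector_mult_scaleR)
    show ?thesis using g r[OF A, of g]
      by (simp add: pointed_velocity(1) s) (simp add: SO_mid_mult_nth[OF A] vec_eq_iff proj_finite_def[of "A *v _"])
  qed
  have eq: "{g \<in> topspace ?E. direction g = axis a 1} = topspace ?E \<inter> {g. direction g = axis a 1}" by blast
  show "homeomorphic_map (subtopology ?E {g. direction g = axis a 1}) (subtopology ?E {g \<in> topspace ?E. direction g = axis a 1}) id"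
    by (simp only: eq subtopology_restrict homeomorphic_map_id)
qed

text \<open>Both projections are functions of the frame.\<close>
lemma theta_direction:
  fixes a :: "'n::finite"
  assumes n: "CARD('n) \<ge> 2"
  shows "fibre_homotopy_equivalence (balanced_product a SO_mid)
          (induced (\<lambda>A. fin_block A *v axis a 1) \<circ> induced (\<lambda>(A, f). coset (SO_axis a) A)) Emb_pt direction theta"
  by (rule fibre_homotopy_equivalence_project[OF theta_fibre_homotopy_equivalence_mid[OF n, of a], where r = "\<lambda>x. proj_finite (snd x)"])
    (simp_all only: balanced_direction(1) pointed_velocity(1) topspace_Emb_pt)

section \<open>Left translations of the three-sphere\<close>

text \<open>The product of quaternions, with \<open>None\<close> the real part and \<open>i\<close>,
  \<open>j\<close>, \<open>k\<close> the imaginary units.\<close>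
definition quaternion_product :: "'n::finite \<Rightarrow> 'n \<Rightarrow> 'n \<Rightarrow> real^('n option) \<Rightarrow> real^('n option) \<Rightarrow> real^('n option)" where
  "quaternion_product i j k v x = (\<chi> m.
     if m = None then v $ None * x $ None - v $ Some i * x $ Some i - v $ Some j * x $ Some j - v $ Some k * x $ Some k
     else if m = Some i then v $ None * x $ Some i + v $ Some i * x $ None + v $ Some j * x $ Some k - v $ Some k * x $ Some j
     else if m = Some j then v $ None * x $ Some j - v $ Some i * x $ Some k + v $ Some j * x $ None + v $ Some k * x $ Some i
     else v $ None * x $ Some k + v $ Some i * x $ Some j - v $ Some j * x $ Some i + v $ Some k * x $ None)"

text \<open>Left multiplication by a unit quaternion is orthogonal because the norm is
  multiplicative, and it sends \<open>pt_inf = 1\<close> to \<open>v\<close>. Its determinant is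
  \<open>\<plusminus>1\<close>, continuous on the connected sphere, and \<open>1\<close> at the unit
  element.\<close>
lemma quaternion_left_translation:
  assumes c: "CARD('n::finite) = 3"
  obtains L :: "real^('n::finite option) \<Rightarrow> 'n::finite succ_matrix" where
    "continuous_on unit_sphere L" "\<And>v. norm v = 1 \<Longrightarrow> L v \<in> SO_succ" "\<And>v. L v *v pt_inf = v"
proof -
  obtain i j k :: 'n where u: "UNIV = {i, j, k}" "i \<noteq> j" "i \<noteq> k" "j \<noteq> k"
    using c card_3_iff[of "UNIV :: 'n set"] by metis
  let ?q = "quaternion_product i j k"
  define L where "L v = matrix (?q v)" for v
  have nth: "?q v x $ None = v $ None * x $ None - v $ Some i * x $ Some i - v $ Some j * x $ Some j - v $ Some k * x $ Some k"
    "?q v x $ Some i = v $ None * x $ Some i + v $ Some i * x $ None + v $ Some j * x $ Some k - v $ Some k * x $ Some j"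
    "?q v x $ Some j = v $ None * x $ Some j - v $ Some i * x $ Some k + v $ Some j * x $ None + v $ Some k * x $ Some i"
    "?q v x $ Some k = v $ None * x $ Some k + v $ Some i * x $ Some j - v $ Some j * x $ Some i + v $ Some k * x $ None" for v x
    using u(2-4) by (simp_all add: quaternion_product_def)
  have eqI: "x = y" if "x $ None = y $ None" "x $ Some i = y $ Some i" "x $ Some j = y $ Some j" "x $ Some k = y $ Some k" for x y :: "real^('n option)"
  proof -
    have l: "l \<in> {i, j, k}" for l unfolding u(1)[symmetric] by (rule UNIV_I)
    have "x $ Some l = y $ Some l" for l using l[of l] that(2-4) by auto
    then show ?thesis using that(1) by (simp add: vec_eq_iff split_option_all)
  qed
  have inner: "x \<bullet> y = x $ None * y $ None + x $ Some i * y $ Some i + x $ Some j * y $ Some j + x $ Some k * y $ Some k" for x y :: "real^('n option)"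
    unfolding inner_vec_def sum_option u(1) using u(2-4) by simp
  have lin: "linear (?q v)" for v
    by (rule linearI) (rule eqI; simp add: nth algebra_simps)+
  have lin': "linear (\<lambda>v. ?q v x)" for x
    by (rule linearI) (rule eqI; simp add: nth algebra_simps)+
  have mv: "L v *v x = ?q v x" for v x using lin by (simp add: L_def matrix_works linear_matrix_vector_mul_eq)
  have base: "L v *v pt_inf = v" for v
    unfolding mv by (rule eqI) (simp_all add: nth pt_inf_def axis_def)
  have len: "?q v x \<bullet> ?q v x = (v \<bullet> v) * (x \<bullet> x)" for v x
    unfolding inner nth by algebra
  have orth: "orthogonal_matrix (L v)" if "norm v = 1" for v
  proof -
    have "v \<bullet> v = 1" using that by (simp add: norm_eq_1)
    then have "norm (?q v x) = norm x" for x by (simp add: norm_eq_sqrt_inner len)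
    then have "orthogonal_transformation (?q v)" using lin by (simp add: orthogonal_transformation)
    then show ?thesis by (simp add: L_def orthogonal_transformation_matrix)
  qed
  have cont: "continuous_on S L" for S
  proof (rule matrix_entries_continuous)
    fix l m
    have "continuous_on S (\<lambda>v. ?q v (axis m 1) $ l)"
      by (rule continuous_on_component[OF linear_continuous_on[OF iffD1[OF linear_conv_bounded_linear lin']]])
    then show "continuous_on S (\<lambda>v. L v $ l $ m)" by (simp add: L_def matrix_def)
  qed
  have "L pt_inf *v x = x" for x
    unfolding mv by (rule eqI) (simp_all add: nth pt_inf_def axis_def)
  then have one: "L pt_inf = mat 1" by (simp add: matrix_eq)
  have "connected (unit_sphere :: (real^('n option)) set)" by (rule connected_sphere) (simp add: c)
  moreover have "continuous_on UNIV (det :: 'n succ_matrix \<Rightarrow> real)"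
    unfolding det_def by (intro continuous_intros)
  then have "continuous_on unit_sphere (\<lambda>v. det (L v))"
    by (rule continuous_on_compose2[OF _ cont]) simp
  ultimately have con: "connected ((\<lambda>v. det (L v)) ` unit_sphere)"
    by (rule connected_continuous_image[rotated])
  have pm: "det (L v) = 1 \<or> det (L v) = -1" if "norm v = 1" for v by (rule det_orthogonal_matrix[OF orth[OF that]])
  have det: "det (L v) = 1" if v: "norm v = 1" for v
  proof (rule ccontr)
    assume "det (L v) \<noteq> 1"
    then have "-1 \<in> (\<lambda>v. det (L v)) ` unit_sphere" using pm[OF v] v by (auto intro!: image_eqI[of _ _ v])
    moreover have "1 \<in> (\<lambda>v. det (L v)) ` unit_sphere" by (rule image_eqI[of _ _ pt_inf]) (simp_all add: one)
    ultimately have "0 \<in> (\<lambda>v. det (L v)) ` unit_sphere" using connectedD_interval[OF con, of "-1" 1 0] by simp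
    then show False using pm by force
  qed
  show ?thesis using that[OF cont] orth det base by (simp add: SO_succ_def rotation_matrix_def)
qed

text \<open>Rotating \<open>g\<close> back by the left translation that belongs to its value at the
  base-point yields a pointed embedding, and the value records how to undo this.\<close>
lemma Emb_product_sphere:
  assumes c: "CARD('n::finite) = 3"
  shows "(Emb :: (real^(1 option) \<Rightarrow> real^('n::finite option)) topology) homeomorphic_space
          prod_topology (top_of_set (unit_sphere :: (real^('n::finite option)) set)) (Emb_pt :: (real^(1 option) \<Rightarrow> real^('n::finite option)) topology)"
proof -
  obtain L :: "real^('n option) \<Rightarrow> 'n succ_matrix" where
    L: "continuous_on unit_sphere L" "\<And>v. norm v = 1 \<Longrightarrow> L v \<in> SO_succ" "\<And>v. L v *v pt_inf = v"
    using quaternion_left_translation[OF c] by blast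
  let ?E = "Emb :: (real^(1 option) \<Rightarrow> real^('n option)) topology"
  let ?P = "Emb_pt :: (real^(1 option) \<Rightarrow> real^('n option)) topology"
  let ?S = "top_of_set (unit_sphere :: (real^('n option)) set)"
  have Lc: "continuous_map ?S (top_of_set SO_succ) L" using L(1,2) by (auto simp: continuous_map_in_subtopology)
  have Lt: "continuous_map ?S (top_of_set SO_succ) (\<lambda>v. transpose (L v))"
    using L(1,2) by (auto simp: continuous_map_in_subtopology SO_succ_transpose intro: continuous_on_transpose)
  have n1: "norm (g pt_inf) = 1" if "g \<in> circle_embeddings" for g :: "_ \<Rightarrow> real^('n option)"
    using circle_embeddingD(4)[OF that, of pt_inf] by simp
  have ev: "continuous_map ?E ?S (\<lambda>g. g pt_inf)"
    by (auto simp: continuous_map_in_subtopology continuous_map_eval n1)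
  let ?f = "\<lambda>g :: _ \<Rightarrow> real^('n option). (g pt_inf, rotate_embedding (transpose (L (g pt_inf))) g)"
  let ?g = "\<lambda>(v, h). rotate_embedding (L v) h"
  have "continuous_map ?E (top_of_set SO_succ) (\<lambda>g. transpose (L (g pt_inf)))"
    using continuous_map_compose[OF ev Lt] by (simp add: o_def)
  from continuous_map_compose[OF continuous_map_pairedI[OF this continuous_map_id[unfolded id_def]] rotate_embedding_continuous(1)]
  have "continuous_map ?E ?E (\<lambda>g. rotate_embedding (transpose (L (g pt_inf))) g)" by (simp add: o_def)
  moreover have "rotate_embedding (transpose (L (g pt_inf))) g \<in> pointed_embeddings" if g: "g \<in> circle_embeddings" for g
  proof -
    have "transpose (L (g pt_inf)) *v g pt_inf = pt_inf"
      using SO_succ_cancel(1)[OF L(2)[OF n1[OF g]], of pt_inf] by (simp only: L(3))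
    then have "rotate_embedding (transpose (L (g pt_inf))) g pt_inf = pt_inf" by (simp only: rotate_embedding_def) simp
    then show ?thesis using rotate_embedding_continuous(2)[OF SO_succ_transpose[OF L(2)[OF n1[OF g]]] g] by (simp add: pointed_embeddings_def)
  qed
  ultimately have "continuous_map ?E ?P (\<lambda>g. rotate_embedding (transpose (L (g pt_inf))) g)"
    by (auto simp: Emb_pt_def continuous_map_in_subtopology)
  then have f: "continuous_map ?E (prod_topology ?S ?P) ?f" by (rule continuous_map_pairedI[OF ev])
  have P: "continuous_map ?P ?E (\<lambda>g. g)" unfolding Emb_pt_def by (rule continuous_map_from_subtopology[OF continuous_map_id[unfolded id_def]])
  have 1: "continuous_map (prod_topology ?S ?P) (top_of_set SO_succ) (\<lambda>x. L (fst x))"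
    using continuous_map_compose[OF continuous_map_fst Lc] by (simp add: o_def)
  have 2: "continuous_map (prod_topology ?S ?P) ?E (\<lambda>x. snd x)"
    using continuous_map_compose[OF continuous_map_snd P] by (simp add: o_def)
  have g: "continuous_map (prod_topology ?S ?P) ?E ?g"
    using continuous_map_compose[OF continuous_map_pairedI[OF 1 2] rotate_embedding_continuous(1)]
    by (simp add: o_def case_prod_unfold)
  have "homeomorphic_maps ?E (prod_topology ?S ?P) ?f ?g"
    unfolding homeomorphic_maps_def
  proof (intro conjI f g ballI)
    show "?g (?f g) = g" if "g \<in> topspace ?E" for g
      using rotate_embedding_inverse(2)[OF L(2)[OF n1], of g] that by simp
    fix x assume "x \<in> topspace (prod_topology ?S ?P)"
    then obtain v h where x: "x = (v, h)" "norm v = 1" "h \<in> pointed_embeddings" by auto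
    then have h: "h \<in> circle_embeddings" "h pt_inf = pt_inf" by (auto simp: pointed_embeddings_def)
    have "rotate_embedding (L v) h pt_inf = v" by (simp add: rotate_embedding_def h L(3))
    then show "?f (?g x) = x" using rotate_embedding_inverse(1)[OF L(2)[OF x(2)] h(1)] by (simp add: x(1))
  qed
  then show ?thesis unfolding homeomorphic_space_def by blast
qed

section \<open>The comparison of bundles\<close>

theorem proposition1p4:
  fixes a :: "'n::finite"
  shows
    "group_action (SO_axis_group a) (long_knots a) (\<lambda>B. \<lambda>f \<in> long_knots a. rotate_knot B f) \<and>
     continuous_map (prod_topology (top_of_set (SO_axis a)) (long_knot_space a))
       (long_knot_space a) (\<lambda>(B, f). rotate_knot B f) \<and>
     bundle_sequence
       (balanced_product a SO_mid) id
       (balanced_product a SO_succ) (induced (\<lambda>(A, f). coset SO_mid A))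
       (coset_space SO_succ SO_mid) (coset SO_mid (mat 1)) \<and>
     bundle_sequence
       (Emb_pt :: (real^(1 option) \<Rightarrow> real^('n option)) topology) id
       Emb (\<lambda>g. g pt_inf)
       (top_of_set unit_sphere) pt_inf \<and>
     bundle_morphism
       (balanced_product a SO_mid) id
       (balanced_product a SO_succ) (induced (\<lambda>(A, f). coset SO_mid A))
       (coset_space SO_succ SO_mid)
       Emb_pt id
       Emb (\<lambda>g. g pt_inf)
       (top_of_set unit_sphere)
       theta theta (induced (\<lambda>A. A *v pt_inf)) \<and>
     homeomorphic_map (coset_space SO_succ SO_mid)
       (top_of_set (unit_sphere :: (real^('n option)) set)) (induced (\<lambda>A. A *v pt_inf)) \<and>
     (CARD('n) \<ge> 2 \<longrightarrow>
        homotopy_equivalence (balanced_product a SO_mid) Emb_pt theta \<and>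
        homotopy_equivalence (balanced_product a SO_succ) Emb theta) \<and>
     bundle_sequence
       (long_knot_space a) (\<lambda>f. balanced_class a SO_succ (mat 1, f))
       (balanced_product a SO_succ) (induced (\<lambda>(A, f). coset (SO_axis a) A))
       (coset_space SO_succ (SO_axis a)) (coset (SO_axis a) (mat 1)) \<and>
     (CARD('n) = 3 \<longrightarrow>
        (Emb :: (real^(1 option) \<Rightarrow> real^('n option)) topology) homeomorphic_space
          prod_topology (top_of_set (unit_sphere :: (real^('n option)) set))
            (Emb_pt :: (real^(1 option) \<Rightarrow> real^('n option)) topology) \<and>
        bundle_sequence
          (top_of_set (SO_axis a)) id
          (top_of_set SO_mid) (\<lambda>A. fin_block A *v axis a 1)
          (top_of_set unit_sphere) (axis a 1) \<and>
        homeomorphic_map (coset_space SO_mid (SO_axis a))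
          (top_of_set unit_sphere) (induced (\<lambda>A. fin_block A *v axis a 1)) \<and>
        bundle_sequence
          (long_knot_space a) (\<lambda>f. balanced_class a SO_mid (mat 1, f))
          (balanced_product a SO_mid)
          (induced (\<lambda>A. fin_block A *v axis a 1) \<circ> induced (\<lambda>(A, f). coset (SO_axis a) A))
          (top_of_set unit_sphere) (axis a 1) \<and>
        bundle_sequence
          (subtopology Emb_pt {g. direction g = axis a 1}) id
          (Emb_pt :: (real^(1 option) \<Rightarrow> real^('n option)) topology) direction
          (top_of_set unit_sphere) (axis a 1) \<and>
        homotopy_equivalence
          (long_knot_space a) (subtopology Emb_pt {g. direction g = axis a 1}) compactify \<and>
        fibre_homotopy_equivalence
          (balanced_product a SO_mid)
          (induced (\<lambda>A. fin_block A *v axis a 1) \<circ> induced (\<lambda>(A, f). coset (SO_axis a) A))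
          Emb_pt direction theta)"
proof -
  have two: "CARD('n) \<ge> 2" if "CARD('n) = 3" using that by simp
  show ?thesis
    by (intro conjI impI,
        rule rotate_knot_group_action, rule rotate_knot_continuous,
        rule balanced_bundle_sphere, rule Emb_bundle,
        rule theta_bundle_morphism, rule coset_mid_homeomorphic_sphere,
        erule fibre_homotopy_equivalence_imp[OF theta_fibre_homotopy_equivalence_mid],
        erule fibre_homotopy_equivalence_imp[OF theta_fibre_homotopy_equivalence],
        rule balanced_bundle_frames,
        erule Emb_product_sphere, erule rotation_bundle[OF two],
        erule coset_axis_homeomorphic_sphere[OF two], erule balanced_direction_bundle[OF two],
        erule Emb_direction_bundle[OF two],
        subst Emb_axis_eq, rule compactify_homotopy_equivalence,
        erule theta_direction[OF two])
qed

end
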